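(* Let $G$ be a connected complex reductive algebraic group with $\mathfrak{g}=\operatorname{Lie}(G)$, let $e\in\mathfrak{g}$ be a nilpotent element, $(e,h,f)$ an $\mathfrak{sl}_2$-triple in $\mathfrak g$, and $\mathfrak{g}_f$ the centraliser of $f$ in $\mathfrak{g}$. Equip $\mathbb{C}[e+\mathfrak{g}_f]$ with its natural Poisson structure inherited from $\mathfrak{g}\cong\mathfrak{g}^*$ via Hamiltonian reduction. Then the annihilators of simple Poisson $\mathbb{C}[e+\mathfrak{g}_f]$-modules lie in natural one-to-one correspondence with the connected components of the sets $(G\cdot x)\cap(e+\mathfrak{g}_f)$, where $x\in e+\mathfrak{g}_f$.
   Context: $G\cdot x$ denotes the orbit of $x$ under the adjoint action. The Poisson structure on the slice is the following. Fix a nondegenerate $G$-invariant symmetric bilinear form $\kappa$ on $\mathfrak{g}$, identifying $\mathfrak{g}\cong\mathfrak{g}^*$, so that $\mathbb{C}[\mathfrak{g}]\cong S(\mathfrak{g})$ has the Lie–Poisson bracket; set $\chi=\kappa(e,\cdot)$. Let $\mathfrak{g}=\bigoplus_i\mathfrak{g}(i)$ be the $\operatorname{ad}(h)$-eigenspace grading, $\mathfrak{l}\subseteq\mathfrak{g}(-1)$ a Lagrangian subspace for the symplectic form $(x,y)\mapsto\chi([x,y])$, and $\mathfrak{m}=\mathfrak{l}\oplus\bigoplus_{i\le-2}\mathfrak{g}(i)$. Restriction of functions to $e+\mathfrak{g}_f$ gives an isomorphism $\big(S(\mathfrak{g})/S(\mathfrak{g})\{x-\chi(x):x\in\mathfrak{m}\}\big)^{\operatorname{ad}\mathfrak{m}}\cong\mathbb{C}[e+\mathfrak{g}_f]$,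 and the Poisson bracket on $\mathbb{C}[e+\mathfrak{g}_f]$ is the one induced from the Lie–Poisson bracket through this isomorphism (the classical finite $W$-algebra). For a complex Poisson algebra $Z$, a Poisson $Z$-module is a $Z$-module $M$ with a linear map $\nabla:Z\to\operatorname{End}_{\mathbb{C}}(M)$ such that for all $x,y,a\in Z$, $m\in M$: (i) $\nabla(xy)m=x\nabla(y)m+y\nabla(x)m$; (ii) $\{x,a\}m=[\nabla(x),a]m$; (iii) $\nabla(\{x,y\})m=[\nabla(x),\nabla(y)]m$. It is simple if it is non-zero and has no proper non-zero $\nabla(Z)$-stable $Z$-submodule. The annihilator of $M$ is $\{z\in Z:zM=0\}$. *)

theory Defs
  imports
    "HOL-Analysis.Analysis"
    "HOL-Algebra.Coset"
    "HOL-Algebra.Ideal"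
    "HOL-Algebra.Module"
begin

section \<open>Complex matrices\<close>

type_synonym 'n cmat = "complex^'n^'n"

definition cscale :: "complex \<Rightarrow> 'n::finite cmat \<Rightarrow> 'n cmat" (infixr \<open>*\<^sub>C\<close> 75)
  where "c *\<^sub>C A = map_matrix ((*) c) A"

global_interpretation cmat: vector_space "cscale :: complex \<Rightarrow> 'n::finite cmat \<Rightarrow> 'n cmat"
  by unfold_locales (simp_all add: cscale_def vec_eq_iff algebra_simps)

definition lie_bracket :: "'n::finite cmat \<Rightarrow> 'n cmat \<Rightarrow> 'n cmat"
  where "lie_bracket A B = A ** B - B ** A"

text \<open>The power \<open>A ^ k\<close> on \<^typ>\<open>'n cmat\<close> is entrywise, hence the iterated \<open>(**)\<close>.\<close>

definition nilpotent_mat :: "'n::finite cmat \<Rightarrow> bool"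
  where "nilpotent_mat A \<longleftrightarrow> (\<exists>k. (((**) A) ^^ k) (mat 1) = 0)"

section \<open>Zariski topology\<close>

inductive_set mat_poly :: "('n::finite cmat \<Rightarrow> complex) set" where
  const: "(\<lambda>A. c) \<in> mat_poly"
| coord: "(\<lambda>A. A $ i $ j) \<in> mat_poly"
| add: "p \<in> mat_poly \<Longrightarrow> q \<in> mat_poly \<Longrightarrow> (\<lambda>A. p A + q A) \<in> mat_poly"
| mult: "p \<in> mat_poly \<Longrightarrow> q \<in> mat_poly \<Longrightarrow> (\<lambda>A. p A * q A) \<in> mat_poly"

definition zariski :: "'n::finite cmat topology"
  where "zariski = topology_generated_by {{A. p A \<noteq> 0} | p. p \<in> mat_poly}"

section \<open>Linear algebraic groups\<close>

definition GL :: "'n::finite cmat monoid"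
  where "GL = \<lparr>carrier = {A. invertible A}, mult = (**), one = mat 1\<rparr>"

definition linear_algebraic_group :: "'n::finite cmat set \<Rightarrow> bool"
  where "linear_algebraic_group G \<longleftrightarrow>
    subgroup G GL \<and> closedin (subtopology zariski (carrier GL)) G"

text \<open>Reductive: the unipotent radical, that is, the largest connected normal unipotent closed
  subgroup, is trivial.\<close>

definition reductive_group :: "'n::finite cmat set \<Rightarrow> bool"
  where "reductive_group G \<longleftrightarrow> linear_algebraic_group G \<and>
    (\<forall>U. linear_algebraic_group U \<and> normal U (GL\<lparr>carrier := G\<rparr>) \<and> connectedin zariski U \<and>
         (\<forall>u\<in>U. nilpotent_mat (u - mat 1)) \<longrightarrow> U = {mat 1})"

text \<open>The Lie algebra is the Zariski tangent space at the identity.\<close>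

definition Lie :: "'n::finite cmat set \<Rightarrow> 'n cmat set"
  where "Lie G = {X. \<forall>p\<in>mat_poly. (\<forall>A\<in>G. p A = 0) \<longrightarrow>
    ((\<lambda>t. p (mat 1 + t *\<^sub>C X)) has_field_derivative 0) (at 0)}"

definition Ad :: "'n::finite cmat \<Rightarrow> 'n cmat \<Rightarrow> 'n cmat"
  where "Ad A X = A ** X ** matrix_inv A"

definition adjoint_orbit :: "'n::finite cmat set \<Rightarrow> 'n cmat \<Rightarrow> 'n cmat set"
  where "adjoint_orbit G X = (\<lambda>A. Ad A X) ` G"

definition nondeg_invariant_form ::
  "'n::finite cmat set \<Rightarrow> ('n cmat \<Rightarrow> 'n cmat \<Rightarrow> complex) \<Rightarrow> bool"
  where "nondeg_invariant_form G \<kappa> \<longleftrightarrow>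
    (\<forall>x\<in>Lie G. \<forall>y\<in>Lie G. \<kappa> x y = \<kappa> y x) \<and>
    (\<forall>x\<in>Lie G. \<forall>y\<in>Lie G. \<forall>z\<in>Lie G. \<kappa> (x + y) z = \<kappa> x z + \<kappa> y z) \<and>
    (\<forall>c. \<forall>x\<in>Lie G. \<forall>y\<in>Lie G. \<kappa> (c *\<^sub>C x) y = c * \<kappa> x y) \<and>
    (\<forall>x\<in>Lie G. (\<forall>y\<in>Lie G. \<kappa> x y = 0) \<longrightarrow> x = 0) \<and>
    (\<forall>A\<in>G. \<forall>x\<in>Lie G. \<forall>y\<in>Lie G. \<kappa> (Ad A x) (Ad A y) = \<kappa> x y)"

definition sl2_triple :: "'n::finite cmat set \<Rightarrow> 'n cmat \<Rightarrow> 'n cmat \<Rightarrow> 'n cmat \<Rightarrow> bool"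
  where "sl2_triple \<gg> e h f \<longleftrightarrow> e \<in> \<gg> \<and> h \<in> \<gg> \<and> f \<in> \<gg> \<and>
    lie_bracket h e = 2 *\<^sub>C e \<and> lie_bracket h f = (- 2) *\<^sub>C f \<and> lie_bracket e f = h"

section \<open>Poisson algebras and Poisson modules\<close>

record 'a poisson_ring = "'a ring" +
  scalar :: "complex \<Rightarrow> 'a"
  pbracket :: "'a \<Rightarrow> 'a \<Rightarrow> 'a"

locale poisson_algebra = cring Z for Z :: "('a, 'b) poisson_ring_scheme" (structure) +
  assumes scalar_closed: "scalar Z c \<in> carrier Z"
    and scalar_add: "scalar Z (c + d) = scalar Z c \<oplus> scalar Z d"
    and scalar_mult: "scalar Z (c * d) = scalar Z c \<otimes> scalar Z d"
    and scalar_one: "scalar Z 1 = \<one>"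
    and pbracket_closed:
      "\<lbrakk>x \<in> carrier Z; y \<in> carrier Z\<rbrakk> \<Longrightarrow> pbracket Z x y \<in> carrier Z"
    and pbracket_skew:
      "\<lbrakk>x \<in> carrier Z; y \<in> carrier Z\<rbrakk> \<Longrightarrow> pbracket Z y x = \<ominus> pbracket Z x y"
    and pbracket_add:
      "\<lbrakk>x \<in> carrier Z; y \<in> carrier Z; z \<in> carrier Z\<rbrakk> \<Longrightarrow>
       pbracket Z x (y \<oplus> z) = pbracket Z x y \<oplus> pbracket Z x z"
    and pbracket_scalar:
      "\<lbrakk>x \<in> carrier Z; y \<in> carrier Z\<rbrakk> \<Longrightarrow>
       pbracket Z x (scalar Z c \<otimes> y) = scalar Z c \<otimes> pbracket Z x y"
    and pbracket_jacobi:
      "\<lbrakk>x \<in> carrier Z; y \<in> carrier Z; z \<in> carrier Z\<rbrakk> \<Longrightarrow>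
       pbracket Z x (pbracket Z y z) \<oplus> pbracket Z y (pbracket Z z x)
         \<oplus> pbracket Z z (pbracket Z x y) = \<zero>"
    and pbracket_leibniz:
      "\<lbrakk>x \<in> carrier Z; y \<in> carrier Z; z \<in> carrier Z\<rbrakk> \<Longrightarrow>
       pbracket Z x (y \<otimes> z) = pbracket Z x y \<otimes> z \<oplus> y \<otimes> pbracket Z x z"

text \<open>\<open>\<nabla>\<close> is a \<open>\<complex>\<close>-linear map from \<open>Z\<close> to \<open>End\<^sub>\<complex> M\<close>, the scalars acting on \<open>M\<close> through \<open>Z\<close>.\<close>

locale poisson_module = poisson_algebra Z + Module.module Z M
  for Z :: "('a, 'b) poisson_ring_scheme"
    and M :: "('a, 'm, 'c) module_scheme" +
  fixes nabla :: "'a \<Rightarrow> 'm \<Rightarrow> 'm"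
  assumes nabla_closed:
      "\<lbrakk>x \<in> carrier Z; m \<in> carrier M\<rbrakk> \<Longrightarrow> nabla x m \<in> carrier M"
    and nabla_add_right:
      "\<lbrakk>x \<in> carrier Z; m \<in> carrier M; n \<in> carrier M\<rbrakk> \<Longrightarrow>
       nabla x (m \<oplus>\<^bsub>M\<^esub> n) = nabla x m \<oplus>\<^bsub>M\<^esub> nabla x n"
    and nabla_scalar_right:
      "\<lbrakk>x \<in> carrier Z; m \<in> carrier M\<rbrakk> \<Longrightarrow>
       nabla x (scalar Z c \<odot>\<^bsub>M\<^esub> m) = scalar Z c \<odot>\<^bsub>M\<^esub> nabla x m"
    and nabla_add_left:
      "\<lbrakk>x \<in> carrier Z; y \<in> carrier Z; m \<in> carrier M\<rbrakk> \<Longrightarrow>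
       nabla (x \<oplus>\<^bsub>Z\<^esub> y) m = nabla x m \<oplus>\<^bsub>M\<^esub> nabla y m"
    and nabla_scalar_left:
      "\<lbrakk>x \<in> carrier Z; m \<in> carrier M\<rbrakk> \<Longrightarrow>
       nabla (scalar Z c \<otimes>\<^bsub>Z\<^esub> x) m = scalar Z c \<odot>\<^bsub>M\<^esub> nabla x m"
    and nabla_mult:
      "\<lbrakk>x \<in> carrier Z; y \<in> carrier Z; m \<in> carrier M\<rbrakk> \<Longrightarrow>
       nabla (x \<otimes>\<^bsub>Z\<^esub> y) m = x \<odot>\<^bsub>M\<^esub> nabla y m \<oplus>\<^bsub>M\<^esub> y \<odot>\<^bsub>M\<^esub> nabla x m"
    and nabla_smult:
      "\<lbrakk>x \<in> carrier Z; a \<in> carrier Z; m \<in> carrier M\<rbrakk> \<Longrightarrow>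
       pbracket Z x a \<odot>\<^bsub>M\<^esub> m = nabla x (a \<odot>\<^bsub>M\<^esub> m) \<ominus>\<^bsub>M\<^esub> a \<odot>\<^bsub>M\<^esub> nabla x m"
    and nabla_pbracket:
      "\<lbrakk>x \<in> carrier Z; y \<in> carrier Z; m \<in> carrier M\<rbrakk> \<Longrightarrow>
       nabla (pbracket Z x y) m = nabla x (nabla y m) \<ominus>\<^bsub>M\<^esub> nabla y (nabla x m)"

locale simple_poisson_module = poisson_module +
  assumes nonzero: "carrier M \<noteq> {\<zero>\<^bsub>M\<^esub>}"
    and simple:
      "\<lbrakk>submodule N Z M; \<And>x m. x \<in> carrier Z \<Longrightarrow> m \<in> N \<Longrightarrow> nabla x m \<in> N\<rbrakk> \<Longrightarrow>
       N = {\<zero>\<^bsub>M\<^esub>} \<or> N = carrier M"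

definition annihilator :: "('a, 'b) ring_scheme \<Rightarrow> ('a, 'm, 'c) module_scheme \<Rightarrow> 'a set"
  where "annihilator Z M = {z \<in> carrier Z. \<forall>m\<in>carrier M. z \<odot>\<^bsub>M\<^esub> m = \<zero>\<^bsub>M\<^esub>}"

text \<open>The modules range over all those whose underlying set is contained in the type \<open>'m\<close>.\<close>

definition simple_poisson_annihilators ::
  "'m itself \<Rightarrow> ('a, 'b) poisson_ring_scheme \<Rightarrow> 'a set set"
  where "simple_poisson_annihilators _ Z =
    {annihilator Z M | (M :: ('a, 'm) module) nabla. simple_poisson_module Z M nabla}"

section \<open>The Slodowy slice and its Poisson algebra\<close>

text \<open>The coordinate ring of a closed set \<open>X\<close>, as the ring of restrictions to \<open>X\<close> of polynomial
  functions, together with a given bracket.\<close>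

definition coord_algebra :: "'n::finite cmat set \<Rightarrow>
    (('n cmat \<Rightarrow> complex) \<Rightarrow> ('n cmat \<Rightarrow> complex) \<Rightarrow> ('n cmat \<Rightarrow> complex)) \<Rightarrow>
    ('n cmat \<Rightarrow> complex) poisson_ring"
  where "coord_algebra X br =
    \<lparr>carrier = (\<lambda>p. restrict p X) ` mat_poly,
     mult = (\<lambda>\<phi> \<psi>. restrict (\<lambda>\<xi>. \<phi> \<xi> * \<psi> \<xi>) X),
     one = restrict (\<lambda>\<xi>. 1) X,
     zero = restrict (\<lambda>\<xi>. 0) X,
     add = (\<lambda>\<phi> \<psi>. restrict (\<lambda>\<xi>. \<phi> \<xi> + \<psi> \<xi>) X),
     scalar = (\<lambda>c. restrict (\<lambda>\<xi>. c) X),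
     pbracket = br\<rparr>"

text \<open>The gradient of \<open>F\<close> at \<open>\<xi>\<close> is the differential \<open>dF\<^sub>\<xi> \<in> \<gg>\<^sup>*\<close>, transported to \<open>\<gg>\<close> by \<open>\<kappa>\<close>.\<close>

definition gradient :: "'n::finite cmat set \<Rightarrow> ('n cmat \<Rightarrow> 'n cmat \<Rightarrow> complex) \<Rightarrow>
    ('n cmat \<Rightarrow> complex) \<Rightarrow> 'n cmat \<Rightarrow> 'n cmat"
  where "gradient \<gg> \<kappa> F \<xi> = (THE v. v \<in> \<gg> \<and>
    (\<forall>y\<in>\<gg>. ((\<lambda>t. F (\<xi> + t *\<^sub>C y)) has_field_derivative \<kappa> v y) (at 0)))"

text \<open>An element \<open>x \<in> \<gg> \<subseteq> S(\<gg>)\<close>, viewed as a function on \<open>\<gg>\<close>.\<close>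

definition linear_fun :: "'n::finite cmat set \<Rightarrow> ('n cmat \<Rightarrow> 'n cmat \<Rightarrow> complex) \<Rightarrow>
    'n cmat \<Rightarrow> 'n cmat \<Rightarrow> complex"
  where "linear_fun \<gg> \<kappa> x = restrict (\<kappa> x) \<gg>"

text \<open>The algebra \<open>\<complex>[\<gg>] \<cong> S(\<gg>)\<close> with its Lie--Poisson bracket. As \<open>linear_fun \<gg> \<kappa> x\<close> has constant
  gradient \<open>x\<close>, the bracket of the functions of \<open>x\<close> and \<open>y\<close> is the function of
  \<open>lie_bracket x y\<close>.\<close>

definition lie_poisson_algebra :: "'n::finite cmat set \<Rightarrow> ('n cmat \<Rightarrow> 'n cmat \<Rightarrow> complex) \<Rightarrow>
    ('n cmat \<Rightarrow> complex) poisson_ring"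
  where "lie_poisson_algebra \<gg> \<kappa> = coord_algebra \<gg>
    (\<lambda>F H. restrict (\<lambda>\<xi>. \<kappa> \<xi> (lie_bracket (gradient \<gg> \<kappa> F \<xi>) (gradient \<gg> \<kappa> H \<xi>))) \<gg>)"

definition ad_eigenspace :: "'n::finite cmat set \<Rightarrow> 'n cmat \<Rightarrow> int \<Rightarrow> 'n cmat set"
  where "ad_eigenspace \<gg> h i = {x \<in> \<gg>. lie_bracket h x = of_int i *\<^sub>C x}"

definition lagrangian :: "'n::finite cmat set \<Rightarrow> ('n cmat \<Rightarrow> 'n cmat \<Rightarrow> complex) \<Rightarrow>
    'n cmat \<Rightarrow> 'n cmat \<Rightarrow> 'n cmat set \<Rightarrow> bool"
  where "lagrangian \<gg> \<kappa> e h \<ll> \<longleftrightarrow> cmat.subspace \<ll> \<and>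
    \<ll> = {x \<in> ad_eigenspace \<gg> h (- 1). \<forall>y\<in>\<ll>. \<kappa> e (lie_bracket x y) = 0}"

definition premet :: "'n::finite cmat set \<Rightarrow> 'n cmat \<Rightarrow> 'n cmat set \<Rightarrow> 'n cmat set"
  where "premet \<gg> h \<ll> = cmat.span (\<ll> \<union> (\<Union>i\<in>{..- 2}. ad_eigenspace \<gg> h i))"

text \<open>The ideal of \<open>S(\<gg>)\<close> generated by \<open>x - \<chi>(x)\<close> for \<open>x \<in> \<mm>\<close>, where \<open>\<chi> = \<kappa>(e, _)\<close>.\<close>

definition shift_ideal :: "'n::finite cmat set \<Rightarrow> ('n cmat \<Rightarrow> 'n cmat \<Rightarrow> complex) \<Rightarrow>
    'n cmat \<Rightarrow> 'n cmat set \<Rightarrow> ('n cmat \<Rightarrow> complex) set"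
  where "shift_ideal \<gg> \<kappa> e \<mm> = genideal (lie_poisson_algebra \<gg> \<kappa>)
    {restrict (\<lambda>\<xi>. linear_fun \<gg> \<kappa> x \<xi> - \<kappa> e x) \<gg> | x. x \<in> \<mm>}"

text \<open>The representatives in \<open>S(\<gg>)\<close> of the \<open>ad \<mm>\<close>-invariants of the quotient by that ideal.\<close>

definition invariant_lifts :: "'n::finite cmat set \<Rightarrow> ('n cmat \<Rightarrow> 'n cmat \<Rightarrow> complex) \<Rightarrow>
    'n cmat \<Rightarrow> 'n cmat set \<Rightarrow> ('n cmat \<Rightarrow> complex) set"
  where "invariant_lifts \<gg> \<kappa> e \<mm> = {F \<in> carrier (lie_poisson_algebra \<gg> \<kappa>).
    \<forall>x\<in>\<mm>. pbracket (lie_poisson_algebra \<gg> \<kappa>) (linear_fun \<gg> \<kappa> x) F \<in> shift_ideal \<gg> \<kappa> e \<mm>}"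

definition slodowy_slice :: "'n::finite cmat set \<Rightarrow> 'n cmat \<Rightarrow> 'n cmat \<Rightarrow> 'n cmat set"
  where "slodowy_slice \<gg> e f = (\<lambda>y. e + y) ` {y \<in> \<gg>. lie_bracket f y = 0}"

text \<open>Restriction to the slice identifies the \<open>ad \<mm>\<close>-invariants with the coordinate ring of the
  slice. The bracket of \<open>\<phi>\<close> and \<open>\<psi>\<close> is the restriction of the bracket of any invariant
  representatives \<open>F\<close> and \<open>H\<close> restricting to them; it does not depend on the choice of these.\<close>

definition slice_algebra :: "'n::finite cmat set \<Rightarrow> ('n cmat \<Rightarrow> 'n cmat \<Rightarrow> complex) \<Rightarrow>
    'n cmat \<Rightarrow> 'n cmat \<Rightarrow> 'n cmat \<Rightarrow> 'n cmat set \<Rightarrow> ('n cmat \<Rightarrow> complex) poisson_ring"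
  where "slice_algebra \<gg> \<kappa> e h f \<ll> =
    (let S = slodowy_slice \<gg> e f; L = invariant_lifts \<gg> \<kappa> e (premet \<gg> h \<ll>) in
     coord_algebra S (\<lambda>\<phi> \<psi>. THE \<theta>. \<exists>F\<in>L. \<exists>H\<in>L. restrict F S = \<phi> \<and> restrict H S = \<psi> \<and>
       \<theta> = restrict (pbracket (lie_poisson_algebra \<gg> \<kappa>) F H) S))"

definition vanishing_ideal :: "('p \<Rightarrow> complex, 'b) ring_scheme \<Rightarrow> 'p set \<Rightarrow> ('p \<Rightarrow> complex) set"
  where "vanishing_ideal Z C = {\<phi> \<in> carrier Z. \<forall>x\<in>C. \<phi> x = 0}"

end

(* Every symplectic leaf of the slice is a component of an orbit slice, and its ideal is the largest
  Poisson ideal J y inside the maximal ideal of any of its points y. The four ingredients are as follows.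

  (1) Since ad e is injective on m with values transversal to the centraliser of f, the vector fields
  [m, .] on e + m^perp have coordinates dual to them; truncated exponential series in these coordinates
  extend every function on the slice to an m-invariant one. Hence Hamiltonian vector fields on the slice
  are polynomial, and at y they span the intersection of [g, y] with the centraliser of f, which is the
  tangent space of the orbit slice.

  (2) If vector fields span the tangent space of an ideal I at y, then an Euler type argument and
  Krull's intersection theorem show that the largest stable ideal inside the maximal ideal at y agrees
  with I near y. So the points with the same J y form open, closed and irreducible subsets of an orbit
  slice: they are its connected components.

  (3) The distributions supported at y that are generated by the evaluation at y form a simple Poisson
  module with annihilator J y.

  (4) A simple Poisson module has a prime annihilator P, and, having countable dimension, the constants
  of the fraction field of its quotient are complex numbers by Schur's lemma. Differential operators
  then separate functions modulo P, which leaves countably many conditions on a point y of V(P) for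
  J y = P; since the complex numbers are uncountable, such a point exists. *)

theory Submission
 imports Defs "HOL-Library.Function_Algebras" "HOL-Computational_Algebra.Polynomial"
  "HOL-Computational_Algebra.Fundamental_Theorem_Algebra"
begin

section \<open>Subrings, ideals, Noetherian rings\<close>

text \<open>Two devices carry what is usually drawn from algebraic geometry. Points and tangent
  vectors are lifted through finitely generated extensions, one generator at a time
  (\<open>point_extension\<close>), with countably many elements kept nonzero on the way. This one
  statement serves as a Nullstellensatz with countably many inequations. For the orbit map it
  replaces openness of orbits in their closures and generic smoothness: an orbit contains every
  point of its closure off countably many proper hypersurfaces, and its tangent spaces are [g, y].
  The leaf argument in (2) is also run on the group itself, with right-invariant fields, to turn
  connectedness of G into primality of its ideal; primality of orbit ideals follows. All ideals live
  in the polynomial ring of the whole matrix space. Functions vanishing on the slice lie in every J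
  y with y on the slice, as Hamiltonian fields are tangent to it, so ideals of the slice algebra are
  recovered by restriction. The type 'm must hold the modules of distributions. A distribution is
  determined by its values on countably many polynomials, so an injection of the complex numbers
  gives enough room.\<close>

definition is_subring :: "'a::comm_ring_1 set => bool" where
 "is_subring R \<longleftrightarrow> 1 \<in> R & (ALL x:R. ALL y:R. x + y \<in> R & x * y \<in> R & - x \<in> R)"

lemma is_subring_UNIV [simp]: "is_subring UNIV"
 by (simp add: is_subring_def)

context
 fixes R :: "'a::comm_ring_1 set"
 assumes R: "is_subring R"
begin

lemma subring_add: "x \<in> R ==> y \<in> R ==> x + y \<in> R"
 and subring_mult: "x \<in> R ==> y \<in> R ==> x * y \<in> R"
 and subring_uminus: "x \<in> R ==> - x \<in> R"
 and subring_1: "1 \<in> R"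
 using R by (auto simp: is_subring_def)

lemma subring_0: "0 \<in> R"
 using subring_add[OF subring_1 subring_uminus[OF subring_1]] by simp

lemma subring_diff: "x \<in> R ==> y \<in> R ==> x - y \<in> R"
 using subring_add[OF _ subring_uminus] by fastforce

lemma subring_sum: "(!!i. i \<in> S ==> f i \<in> R) ==> sum f S \<in> R"
 by (induction S rule: infinite_finite_induct) (auto simp: subring_0 subring_add)

lemma subring_power: "x \<in> R ==> x ^ n \<in> R"
 by (induction n) (auto simp: subring_1 subring_mult)

lemma subring_of_nat: "of_nat n \<in> R"
 by (induction n) (auto simp: subring_0 subring_add subring_1)

end

lemmas subring_intros = subring_add subring_mult subring_uminus subring_1 subring_0 subring_diff
 subring_sum subring_power subring_of_nat

definition ideal_in :: "'a::comm_ring_1 set => 'a set => bool" where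
 "ideal_in R I \<longleftrightarrow> I \<subseteq> R & 0 \<in> I & (ALL x:I. ALL y:I. x + y \<in> I) & (ALL r:R. ALL x:I. r * x \<in> I)"

lemma ideal_in_sub: "ideal_in R I ==> x \<in> I ==> x \<in> R"
 and ideal_in_0: "ideal_in R I ==> 0 \<in> I"
 and ideal_in_add: "ideal_in R I ==> x \<in> I ==> y \<in> I ==> x + y \<in> I"
 and ideal_in_mult: "ideal_in R I ==> r \<in> R ==> x \<in> I ==> r * x \<in> I"
 by (auto simp: ideal_in_def)

lemma ideal_in_mult2: "ideal_in R I ==> r \<in> R ==> x \<in> I ==> x * r \<in> I"
 by (metis ideal_in_mult mult.commute)

lemma ideal_in_uminus: "is_subring R ==> ideal_in R I ==> x \<in> I ==> - x \<in> I"
 by (metis ideal_in_mult mult_minus1 subring_1 subring_uminus)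

lemma ideal_in_diff: "is_subring R ==> ideal_in R I ==> x \<in> I ==> y \<in> I ==> x - y \<in> I"
 using ideal_in_add[OF _ _ ideal_in_uminus] by fastforce

lemma ideal_in_sum: "ideal_in R I ==> (!!i. i \<in> S ==> f i \<in> I) ==> sum f S \<in> I"
 by (induction S rule: infinite_finite_induct) (auto simp: ideal_in_0 ideal_in_add)

inductive_set gen :: "'a::comm_ring_1 set => 'a set => 'a set" for R X where
 gen_0: "0 \<in> gen R X"
| gen_step: "r \<in> R ==> x \<in> X ==> y \<in> gen R X ==> r * x + y \<in> gen R X"

lemma gen_add: "x \<in> gen R X ==> y \<in> gen R X ==> x + y \<in> gen R X"
 by (induction rule: gen.induct) (auto simp: add.assoc intro: gen_step)

lemma gen_mult:
 assumes "is_subring R" "r \<in> R" "x \<in> gen R X" shows "r * x \<in> gen R X"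
 using assms(3,1,2)
proof (induction rule: gen.induct)
 case (gen_step s x y)
 have "(r * s) * x + r * y \<in> gen R X"
  using gen_step by (intro gen.gen_step) (auto simp: subring_mult)
 then show ?case by (simp add: algebra_simps)
qed (auto intro: gen_0)

lemma gen_incl: "is_subring R ==> x \<in> X ==> x \<in> gen R X"
 using gen_step[OF subring_1 _ gen_0, of R x X] by simp

lemma gen_sub: "X \<subseteq> I ==> ideal_in R I ==> gen R X \<subseteq> I"
proof
 fix x assume "X \<subseteq> I" "ideal_in R I" "x \<in> gen R X"
 then show "x \<in> I"
  by (induction rule: gen.induct[OF \<open>x \<in> gen R X\<close>]) (auto simp: ideal_in_0 ideal_in_add ideal_in_mult subset_iff)
qed

lemma ideal_gen: "is_subring R ==> X \<subseteq> R ==> ideal_in R (gen R X)"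
proof -
 assume R: "is_subring R" and X: "X \<subseteq> R"
 have "ideal_in R R" using R by (auto simp: ideal_in_def subring_intros)
 from gen_sub[OF X this] show ?thesis
  using R by (auto simp: ideal_in_def gen_0 gen_add gen_mult)
qed

lemma gen_mono: "X \<subseteq> Y ==> gen R X \<subseteq> gen R Y"
proof
 fix x assume XY: "X \<subseteq> Y" assume "x \<in> gen R X"
 then show "x \<in> gen R Y" by induction (use XY in \<open>auto intro: gen.intros\<close>)
qed

definition noetherian :: "'a::comm_ring_1 set => bool" where
 "noetherian R \<longleftrightarrow> (ALL I. ideal_in R I --> (EX F. finite F & F \<subseteq> I & I = gen R F))"

lemma noetherianD:
 assumes "noetherian R" "ideal_in R I"
 obtains F where "finite F" "F \<subseteq> I" "I = gen R F"
 using assms by (auto simp: noetherian_def)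

lemma finite_subset_Un_mono:
 assumes "finite F" "F \<subseteq> (\<Union>n. S n)" "mono (S :: nat => 'a set)"
 shows "EX N. F \<subseteq> S N"
 using assms
proof (induction F)
 case (insert x F)
 then obtain N M where "F \<subseteq> S N" "x \<in> S M" by auto
 then have "insert x F \<subseteq> S (max N M)"
  using monoD[OF insert.prems(2), of N "max N M"] monoD[OF insert.prems(2), of M "max N M"] by auto
 then show ?case by blast
qed auto

lemma ideal_Un_mono:
 assumes "!!n. ideal_in R (S n)" "mono (S :: nat => 'a::comm_ring_1 set)"
 shows "ideal_in R (\<Union>n. S n)"
proof -
 have "x + y \<in> (\<Union>n. S n)" if "x \<in> S n" "y \<in> S m" for x y n m
  using that monoD[OF assms(2), of n "max n m"] monoD[OF assms(2), of m "max n m"]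
  ideal_in_add[OF assms(1), of x "max n m" y] by auto
 with assms(1) show ?thesis by (fastforce simp: ideal_in_def)
qed

text \<open>The ideals generated by the initial segments form an increasing chain. A finite
  generating set of their union lies in one of them, so the chain is stationary from there on.
  Krull's theorem applies this to the Rees algebra.\<close>

lemma noetherian_chain:
 assumes N: "noetherian R" and R: "is_subring R" and x: "!!k. x k \<in> R"
 shows "EX n. x n \<in> gen R (x ` {..<n::nat})"
proof -
 let ?S = "%n. gen R (x ` {..<n})"
 have m: "mono ?S" by (intro monoI gen_mono image_mono) auto
 have I: "ideal_in R (\<Union>n. ?S n)"
  by (intro ideal_Un_mono m ideal_gen R) (use x in auto)
 obtain F where F: "finite F" "F \<subseteq> (\<Union>n. ?S n)" "(\<Union>n. ?S n) = gen R F"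
  using noetherianD[OF N I] by blast
 obtain n where n: "F \<subseteq> ?S n" using finite_subset_Un_mono[OF F(1,2) m] by blast
 have "gen R F \<subseteq> ?S n" by (intro gen_sub n ideal_gen R) (use x in auto)
 moreover have "x n \<in> ?S (Suc n)" by (intro gen_incl R) auto
 ultimately show ?thesis using F(3) by blast
qed

section \<open>Adjoining an element\<close>

abbreviation pover :: "'a::comm_ring_1 set => 'a poly => bool" where
 "pover A p \<equiv> (ALL i. coeff p i \<in> A)"

context
 fixes A :: "'a::comm_ring_1 set"
 assumes A: "is_subring A"
begin

lemma pover_0: "pover A 0" and pover_add: "pover A p ==> pover A q ==> pover A (p + q)"
 and pover_diff: "pover A p ==> pover A q ==> pover A (p - q)"
 and pover_smult: "a \<in> A ==> pover A q ==> pover A (Polynomial.smult a q)"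
 and pover_uminus: "pover A p ==> pover A (- p)"
 using A by (auto intro: subring_intros)

lemma pover_monom: "a \<in> A ==> pover A (monom a n)"
 using A by (auto intro: subring_intros)

lemma pover_pCons: "a \<in> A ==> pover A p ==> pover A (pCons a p)"
 using A by (auto simp: coeff_pCons split: nat.splits)

lemma pover_1: "pover A 1"
 using pover_pCons[OF subring_1[OF A] pover_0] unfolding one_pCons by blast

lemma pover_mult: "pover A p ==> pover A q ==> pover A (p * q)"
 using A by (auto simp: coeff_mult intro!: subring_sum subring_mult)

end

lemmas pover_intros = pover_0 pover_add pover_diff pover_smult pover_uminus pover_monom pover_pCons
 pover_1 pover_mult

definition adj :: "'a::comm_ring_1 set => 'a => 'a set" where
 "adj A u = {poly p u | p. pover A p}"

lemma adjI: "pover A p ==> poly p u \<in> adj A u"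
 by (auto simp: adj_def)

lemma adjE: assumes "x \<in> adj A u" obtains p where "pover A p" "x = poly p u"
 using assms by (auto simp: adj_def)

lemma adj_subring: assumes "is_subring A" shows "is_subring (adj A u)"
proof -
 have "1 \<in> adj A u" using adjI[OF pover_1[OF assms], of u] by simp
 moreover have "x + y \<in> adj A u & x * y \<in> adj A u & - x \<in> adj A u"
  if xy: "x \<in> adj A u" "y \<in> adj A u" for x y
 proof -
  obtain p q where pq: "pover A p" "pover A q" "x = poly p u" "y = poly q u"
  using xy by (auto elim!: adjE)
  show ?thesis
  using adjI[OF pover_add[OF assms pq(1,2)], of u] adjI[OF pover_mult[OF assms pq(1,2)], of u]
  adjI[OF pover_uminus[OF assms pq(1)], of u] pq by simp
 qed
 ultimately show ?thesis by (auto simp: is_subring_def)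
qed

lemma adj_base: assumes "is_subring A" "a \<in> A" shows "a \<in> adj A u"
 using adjI[OF pover_pCons[OF assms pover_0[OF assms(1)]], of u] by simp

lemma adj_self: assumes "is_subring A" shows "u \<in> adj A u"
 using adjI[OF pover_monom[OF assms subring_1[OF assms], of 1], of u] by (simp add: poly_monom)

lemma adj_least: assumes "is_subring B" "A \<subseteq> B" "u \<in> B" shows "adj A u \<subseteq> B"
proof
 fix x assume "x \<in> adj A u"
 then obtain p where p: "pover A p" "x = poly p u" by (blast elim: adjE)
 have "coeff p i * u ^ i \<in> B" for i
  using p(1) assms(2,3) by (intro subring_mult[OF assms(1)] subring_power[OF assms(1)]) auto
 then show "x \<in> B" unfolding p(2) poly_altdef by (intro subring_sum[OF assms(1)])
qed

text \<open>Hilbert's basis theorem: an ideal is generated by polynomials whose leading coefficients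
 generate the ideals of leading coefficients in the degrees up to stabilisation.\<close>

lemma noetherian_adj:
 assumes N: "noetherian A" and A: "is_subring A"
 shows "noetherian (adj A u)"
 unfolding noetherian_def
proof (intro allI impI)
 fix I assume I: "ideal_in (adj A u) I"
 note B = adj_subring[OF A, of u]
 \<comment> \<open>A value at \<open>u\<close> does not determine its polynomial, so leading
   coefficients are taken over all representatives \<open>p\<close>; \<open>n\<close> is only a
   degree bound, which makes \<open>L n\<close> closed under sums.\<close>
 define L where "L n = {coeff p n | p. pover A p & (\<forall>i>n. coeff p i = 0) & poly p u \<in> I}" for n
 have LI: "ideal_in A (L n)" for n
 proof -
  have "0 \<in> L n" unfolding L_def using pover_0[OF A] ideal_in_0[OF I]
  by (intro CollectI exI[of _ 0]) auto
  moreover have "x + y \<in> L n" if xy: "x \<in> L n" "y \<in> L n" for x y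
  proof -
  obtain p where p: "pover A p" "\<forall>i>n. coeff p i = 0" "poly p u \<in> I" "x = coeff p n"
  using xy(1) unfolding L_def by blast
  obtain q where q: "pover A q" "\<forall>i>n. coeff q i = 0" "poly q u \<in> I" "y = coeff q n"
  using xy(2) unfolding L_def by blast
  show ?thesis unfolding L_def using pover_add[OF A p(1) q(1)] ideal_in_add[OF I p(3) q(3)] p q
  by (intro CollectI exI[of _ "p + q"]) auto
  qed
  moreover have "r * x \<in> L n" if xr: "x \<in> L n" "r \<in> A" for x r
  proof -
  obtain p where p: "pover A p" "\<forall>i>n. coeff p i = 0" "poly p u \<in> I" "x = coeff p n"
  using xr(1) unfolding L_def by blast
  show ?thesis unfolding L_def
  using pover_smult[OF A xr(2) p(1)] ideal_in_mult[OF I adj_base[OF A xr(2)] p(3)] p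
  by (intro CollectI exI[of _ "Polynomial.smult r p"]) auto
  qed
  ultimately show ?thesis by (auto simp: ideal_in_def L_def)
 qed
 have shift: "pover A (monom 1 k * p)" "\<forall>i>n+k. coeff (monom 1 k * p) i = 0"
  "poly (monom 1 k * p) u \<in> I" "coeff (monom 1 k * p) (n + k) = coeff p n"
  if p: "pover A p" "\<forall>i>n. coeff p i = 0" "poly p u \<in> I" for p n k
  using pover_mult[OF A pover_monom[OF A subring_1[OF A]] p(1)] p
  ideal_in_mult[OF I subring_power[OF B adj_self[OF A]] p(3)]
  by (auto simp: coeff_monom_mult poly_monom)
 have mono: "mono L"
 proof (intro monoI subsetI)
  fix n m x assume nm: "n \<le> m" and "x \<in> L n"
  then obtain p where p: "pover A p" "\<forall>i>n. coeff p i = 0" "poly p u \<in> I" "x = coeff p n"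
  by (auto simp: L_def)
  have "n + (m - n) = m" using nm by simp
  then show "x \<in> L m" unfolding L_def using shift[OF p(1-3), of "m - n"] p(4)
  by (intro CollectI exI[of _ "monom 1 (m - n) * p"]) auto
 qed
 obtain F0 where F0: "finite F0" "F0 \<subseteq> (\<Union>n. L n)" "(\<Union>n. L n) = gen A F0"
  using noetherianD[OF N ideal_Un_mono[OF LI mono]] by blast
 obtain M where M: "F0 \<subseteq> L M" using finite_subset_Un_mono[OF F0(1,2) mono] by blast
 have stab: "L n \<subseteq> L M" for n using gen_sub[OF M LI] F0(3) by blast
 have "ALL n. EX F. finite F & F \<subseteq> L n & L n = gen A F" using noetherianD[OF N LI] by metis
 then obtain F where F: "!!n. finite (F n)" "!!n. F n \<subseteq> L n" "!!n. L n = gen A (F n)" by metis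
 have "ALL n a. EX p. a \<in> F n --> pover A p & (\<forall>i>n. coeff p i = 0) & poly p u \<in> I & coeff p n = a"
  using F(2) unfolding L_def by blast
 then obtain P where P: "!!n a. a \<in> F n ==> pover A (P n a) & (\<forall>i>n. coeff (P n a) i = 0) &
  poly (P n a) u \<in> I & coeff (P n a) n = a" by metis
 \<comment> \<open>Degrees beyond \<open>M\<close> get no generators of their own:
   \<open>L n\<close> is contained in \<open>L M\<close>, and multiplying by powers of
   \<open>u\<close> raises the degree.\<close>
 define X where "X = (\<Union>n\<in>{..M}. (%a. poly (P n a) u) ` F n)"
 have X: "finite X" "X \<subseteq> I" unfolding X_def using F(1) P by auto
 have lead: "EX q. pover A q & (\<forall>i>n. coeff q i = 0) & coeff q n = a & poly q u \<in> gen (adj A u) X"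
  if "a \<in> gen A (F (min n M))" for a n
  using that
 proof induction
  case gen_0
  then show ?case using pover_0[OF A] by (intro exI[of _ 0]) (auto intro: gen.gen_0)
 next
  case (gen_step r x y)
  then obtain q where q: "pover A q" "\<forall>i>n. coeff q i = 0" "coeff q n = y"
  "poly q u \<in> gen (adj A u) X" by blast
  let ?m = "min n M"
  let ?p = "P ?m x"
  have p: "pover A ?p" "\<forall>i>?m. coeff ?p i = 0" "poly ?p u \<in> I" "coeff ?p ?m = x"
  using P[OF gen_step(2)] by auto
  have mn: "?m + (n - ?m) = n" by simp
  note s = shift[OF p(1-3), of "n - ?m", unfolded mn]
  have "poly ?p u \<in> X" unfolding X_def using gen_step(2) by auto
  then have "poly (Polynomial.smult r (monom 1 (n - ?m) * ?p)) u \<in> gen (adj A u) X"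
  using gen_mult[OF B subring_mult[OF B adj_base[OF A gen_step(1)] subring_power[OF B adj_self[OF A]]]
  gen_incl[OF B], of _ X "n - ?m"]
  by (simp add: poly_monom mult.assoc)
  then show ?case
  using q s p(4) pover_add[OF A pover_smult[OF A gen_step(1) s(1)] q(1)]
  by (intro exI[of _ "Polynomial.smult r (monom 1 (n - ?m) * ?p) + q"]) (auto intro: gen_add)
 qed
 \<comment> \<open>Induction on a strict degree bound: subtracting the polynomial supplied by
   \<open>lead\<close> cancels the top coefficient and keeps the value in \<open>I\<close>.\<close>
 have main: "poly p u \<in> gen (adj A u) X"
  if "pover A p" "\<forall>i\<ge>n. coeff p i = 0" "poly p u \<in> I" for p n
  using that
 proof (induction n arbitrary: p)
  case 0
  then have "p = 0" by (simp add: poly_eq_iff)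
  then show ?case by (simp add: gen_0)
 next
  case (Suc n)
  then have "coeff p n \<in> L n" unfolding L_def by (auto simp: Suc_le_eq)
  then have "coeff p n \<in> gen A (F (min n M))"
  using F(3) stab[of n] monoD[OF mono, of M n] by (cases "n \<le> M") (auto simp: min_def)
  then obtain q where q: "pover A q" "\<forall>i>n. coeff q i = 0" "coeff q n = coeff p n"
  "poly q u \<in> gen (adj A u) X" using lead by blast
  have qI: "poly q u \<in> I" using gen_sub[OF X(2) I] q(4) by blast
  have "poly (p - q) u \<in> gen (adj A u) X"
  proof (rule Suc.IH)
  show "pover A (p - q)" by (rule pover_diff[OF A Suc.prems(1) q(1)])
  show "\<forall>i\<ge>n. coeff (p - q) i = 0"
  proof (intro allI impI)
  fix i assume "n \<le> i"
  then show "coeff (p - q) i = 0" using q Suc.prems(2) by (cases "i = n") auto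
  qed
  show "poly (p - q) u \<in> I" using ideal_in_diff[OF B I Suc.prems(3) qI] by simp
  qed
  from gen_add[OF this q(4)] show ?case by simp
 qed
 have "I = gen (adj A u) X"
 proof
  show "gen (adj A u) X \<subseteq> I" by (rule gen_sub[OF X(2) I])
  show "I \<subseteq> gen (adj A u) X"
  proof
  fix x assume x: "x \<in> I"
  then obtain p where p: "pover A p" "x = poly p u" using ideal_in_sub[OF I] by (blast elim: adjE)
  show "x \<in> gen (adj A u) X"
  using main[OF p(1), of "Suc (degree p)"] p x by (simp add: coeff_eq_0 Suc_le_eq)
  qed
 qed
 with X show "EX F. finite F & F \<subseteq> I & I = gen (adj A u) F" by blast
qed

fun adjs :: "'a::comm_ring_1 set => 'a list => 'a set" where
 "adjs A [] = A"
| "adjs A (u # us) = adj (adjs A us) u"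

lemma adjs_subring: "is_subring A ==> is_subring (adjs A us)"
 by (induction us) (auto intro: adj_subring)

lemma adjs_base: "is_subring A ==> a \<in> A ==> a \<in> adjs A us"
 by (induction us) (auto intro: adj_base adjs_subring)

lemma adjs_self: "is_subring A ==> u \<in> set us ==> u \<in> adjs A us"
 by (induction us) (auto intro: adj_base adj_self adjs_subring)

lemma adjs_least: "is_subring B ==> A \<subseteq> B ==> set us \<subseteq> B ==> adjs A us \<subseteq> B"
 by (induction us) (auto dest: adj_least)

lemma noetherian_adjs: "noetherian A ==> is_subring A ==> noetherian (adjs A us)"
 by (induction us) (auto intro: noetherian_adj adjs_subring)

section \<open>Krull's intersection theorem\<close>

text \<open>\<open>mpow m k a\<close> says that \<open>a\<close> lies in the k-th power of the ideal
  \<open>m\<close>, the zeroth power being the whole ring. The inductive form makes products,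
  derivations and Euler's formula accessible to rule induction.\<close>

inductive mpow :: "'a::comm_ring_1 set => nat => 'a => bool" for m where
 mpow_0: "mpow m 0 a"
| mpow_Suc: "a \<in> m ==> mpow m k b ==> mpow m (Suc k) (a * b)"
| mpow_zero: "mpow m k 0"
| mpow_add: "mpow m k a ==> mpow m k b ==> mpow m k (a + b)"

lemma mpow_scale: "mpow m k b ==> mpow m k (r * b)"
proof (induction rule: mpow.induct)
 case (mpow_Suc a k b)
 then show ?case using mpow.mpow_Suc[of a m k "r * b"] by (simp add: mult.left_commute)
qed (auto simp: distrib_left intro: mpow.intros)

lemma mpow_mult: "mpow m i a ==> mpow m j b ==> mpow m (i + j) (a * b)"
proof (induction rule: mpow.induct)
 case (mpow_Suc a k c)
 then show ?case using mpow.mpow_Suc[of a m "k + j" "c * b"] by (simp add: mult.assoc)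
qed (auto simp: distrib_right mpow_scale intro: mpow.intros)

lemma mpow_Suc_ideal:
 assumes "ideal_in UNIV m" shows "mpow m (Suc k) a ==> a \<in> m"
 by (induction "Suc k" a rule: mpow.induct) (auto intro: ideal_in_0[OF assms] ideal_in_add[OF assms] ideal_in_mult2[OF assms])

lemma mpow_sum: "(!!i. i \<in> S ==> mpow m k (f i)) ==> mpow m k (sum f S)"
 by (induction S rule: infinite_finite_induct) (auto intro: mpow.intros)

lemma mpow_uminus: "mpow m k a ==> mpow m k (- a)"
 using mpow_scale[of m k a "-1"] by simp

text \<open>The Rees algebra lives inside the polynomial ring, so its base ring has to be a subring
  there: the constant polynomials, to which the Noetherian property is transported.\<close>

lemma noetherian_const_polys:
 assumes "noetherian (UNIV :: 'a::comm_ring_1 set)"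
 shows "noetherian (range (%r::'a. [:r:]))" and "is_subring (range (%r::'a. [:r:]))"
proof -
 let ?c = "%r::'a. [:r:]"
 show sub: "is_subring (range ?c)"
  by (auto simp: is_subring_def one_pCons)
 show "noetherian (range ?c)"
  unfolding noetherian_def
 proof (intro allI impI)
  fix I assume I: "ideal_in (range ?c) I"
  have "ideal_in UNIV {r. ?c r \<in> I}"
  unfolding ideal_in_def
  proof (intro conjI ballI CollectI; (elim CollectE)?)
  show "?c 0 \<in> I" using ideal_in_0[OF I] by simp
  show "?c (x + y) \<in> I" if "?c x \<in> I" "?c y \<in> I" for x y
  using ideal_in_add[OF I that] by simp
  show "?c (r * x) \<in> I" if "?c x \<in> I" for r x
  using ideal_in_mult[OF I _ that, of "?c r"] by (simp add: mult.commute)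
  qed auto
  then obtain F where F: "finite F" "F \<subseteq> {r. ?c r \<in> I}" "{r. ?c r \<in> I} = gen UNIV F"
  using noetherianD[OF assms] by blast
  have "?c r \<in> gen (range ?c) (?c ` F)" if "r \<in> gen UNIV F" for r
  using that
  proof induction
  case (gen_step r x y)
  then have "[:r:] * [:x:] + [:y:] \<in> gen (range ?c) (?c ` F)" by (intro gen.gen_step) auto
  then show ?case by (simp add: mult.commute)
  qed (simp add: gen.gen_0)
  then have "I \<subseteq> gen (range ?c) (?c ` F)" using ideal_in_sub[OF I] F(3) by blast
  moreover have "gen (range ?c) (?c ` F) \<subseteq> I" by (rule gen_sub[OF _ I]) (use F in auto)
  ultimately show "EX F. finite F & F \<subseteq> I & I = gen (range ?c) F"
  using F(1,2) by (intro exI[of _ "?c ` F"]) auto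
 qed
qed

text \<open>The Rees algebra of \<open>m\<close> is Noetherian. If \<open>c k \<in> m\<^sup>k\<close> represents \<open>\<phi>\<close> modulo \<open>I\<close>, then
 \<open>c n T\<^sup>n\<close> is in the ideal generated by the \<open>c k T\<^sup>k\<close> with \<open>k < n\<close> for some \<open>n\<close>, and
 comparing coefficients of \<open>T\<^sup>n\<close> expresses \<open>\<phi>\<close> as an \<open>m\<close>-multiple of itself.\<close>

lemma krull_intersection:
 fixes m I :: "'a::comm_ring_1 set"
 assumes N: "noetherian (UNIV :: 'a set)" and m: "ideal_in UNIV m" and I: "ideal_in UNIV I"
  and \<phi>: "!!k. EX c. mpow m k c & \<phi> - c \<in> I"
 shows "EX a:m. (1 - a) * \<phi> \<in> I"
proof -
 obtain F where F: "finite F" "F \<subseteq> m" "m = gen UNIV F" using noetherianD[OF N m] by blast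
 obtain fs where fs: "set fs = F" using F(1) finite_list by blast
 define C where "C = range (%r::'a. [:r:])"
 note C = noetherian_const_polys[OF N, folded C_def]
 \<comment> \<open>\<open>R\<close> is the Rees algebra, and \<open>?B\<close> below is generated
   over the constants by the monomials \<open>a T\<close> with \<open>a\<close> in a finite
   generating set of \<open>m\<close>. The two are equal, which makes \<open>R\<close>
   Noetherian.\<close>
 define R where "R = {p. ALL j. mpow m j (coeff p j)}"
 have R: "is_subring R"
  unfolding is_subring_def R_def
 proof (intro conjI ballI; (intro CollectI allI)?)
  fix j show "mpow m j (coeff 1 j)"
  by (cases j) (simp_all add: coeff_1 mpow_0 mpow_zero)
 next
  fix x y :: "'a poly" and j
  assume "x \<in> {p. ALL j. mpow m j (coeff p j)}" "y \<in> {p. ALL j. mpow m j (coeff p j)}"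
  then have x: "!!j. mpow m j (coeff x j)" and y: "!!j. mpow m j (coeff y j)" by auto
  show "mpow m j (coeff (x + y) j)" using x y by (simp add: mpow_add)
  show "mpow m j (coeff (- x) j)" using x by (simp add: mpow_uminus)
  show "mpow m j (coeff (x * y) j)"
  unfolding coeff_mult
  proof (rule mpow_sum)
  fix i assume "i \<in> {..j}"
  then show "mpow m j (coeff x i * coeff y (j - i))"
  using mpow_mult[OF x[of i] y[of "j - i"]] by simp
  qed
 qed
 let ?B = "adjs C (map (%a. monom a 1) fs)"
 note B = adjs_subring[OF C(2), of "map (%a. monom a 1) fs"]
 have CB: "[:r:] \<in> ?B" for r by (rule adjs_base[OF C(2)]) (simp add: C_def)
 have 1: "monom a 1 \<in> ?B" if "a \<in> gen UNIV F" for a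
  using that
 proof induction
  case (gen_step r x y)
  have "monom x 1 \<in> ?B" by (rule adjs_self[OF C(2)]) (use fs gen_step in auto)
  then have "[:r:] * monom x 1 + monom y 1 \<in> ?B" by (intro subring_intros[OF B] CB gen_step.IH)
  then show ?case by (simp add: add_monom smult_monom)
 qed (use subring_0[OF B] in auto)
 have 2: "monom a k \<in> ?B" if "mpow m k a" for a k
  using that
 proof induction
  case (mpow_Suc a k b)
  then have "monom a 1 * monom b k \<in> ?B" using 1 F(3) by (intro subring_mult[OF B]) auto
  then show ?case by (simp add: mult_monom)
 next
  case (mpow_0 a) then show ?case using CB[of a] by (simp add: monom_0)
 next
  case (mpow_zero k) then show ?case using subring_0[OF B] by (simp only: monom_eq_0)
 next
  case (mpow_add k a b) then show ?case using subring_add[OF B] by (simp only: add_monom[symmetric])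
 qed
 have "R \<subseteq> ?B"
 proof
  fix p assume "p \<in> R"
  then have "(\<Sum>i\<le>degree p. monom (coeff p i) i) \<in> ?B"
  by (intro subring_sum[OF B] 2) (auto simp: R_def)
  then show "p \<in> ?B" by (simp add: poly_as_sum_of_monoms)
 qed
 have m1: "mpow m (Suc 0) a" if "a \<in> m" for a
  using mpow_Suc[OF that mpow_0[of m 1]] by simp
 then have "monom a 1 \<in> R" if "a \<in> m" for a
  unfolding R_def
 proof (intro CollectI allI)
  fix j show "mpow m j (coeff (monom a 1) j)"
  using m1[OF that] mpow_zero[of m j] by (cases "j = 1") auto
 qed
 moreover have "[:r:] \<in> R" for r
  by (auto simp: R_def coeff_pCons split: nat.splits intro: mpow_0 mpow_zero)
 ultimately have "?B \<subseteq> R"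
  using F(2) fs by (intro adjs_least[OF R]) (auto simp: C_def)
 with \<open>R \<subseteq> ?B\<close> have NR: "noetherian R" using noetherian_adjs[OF C] by (metis subset_antisym)
 obtain c where c: "!!k. mpow m k (c k)" "!!k. \<phi> - c k \<in> I" using \<phi> by metis
 define x where "x k = monom (c k) k" for k
 have xR: "x k \<in> R" for k using c(1) by (auto simp: R_def x_def intro: mpow_zero)
 obtain n where n: "x n \<in> gen R (x ` {..<n})" using noetherian_chain[of R x, OF NR R xR] by blast
 \<comment> \<open>A multiplier from the Rees algebra contributes its coefficient of degree
   \<open>n - k\<close> against \<open>c k\<close>, so the coefficients of the combination lie in
   positive powers of \<open>m\<close>.\<close>
 have "EX d. (\<forall>k<n. mpow m (n - k) (d k)) & coeff y n = (\<Sum>k<n. d k * c k)"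
  if "y \<in> gen R (x ` {..<n})" for y
  using that
 proof induction
  case gen_0
  show ?case by (intro exI[of _ "%_. 0"]) (auto intro: mpow_zero)
 next
  case (gen_step r z y)
  then obtain d where d: "\<forall>k<n. mpow m (n - k) (d k)" "coeff y n = (\<Sum>k<n. d k * c k)" by blast
  obtain k where k: "k < n" "z = x k" using gen_step by auto
  let ?e = "%j. if j = k then coeff r (n - k) else 0"
  have "coeff (r * z) n = coeff (monom (c k) k * r) n"
  using k by (simp add: x_def mult.commute)
  also have "\<dots> = coeff r (n - k) * c k"
  using k coeff_monom_mult[of "c k" k r n] by (simp only: mult.commute[of "c k"]) simp
  also have "\<dots> = (\<Sum>j<n. if j = k then coeff r (n - k) * c k else 0)"
  using k(1) by (simp add: sum.delta)
  also have "\<dots> = (\<Sum>j<n. ?e j * c j)" by (intro sum.cong) auto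
  finally have "coeff (r * z + y) n = (\<Sum>j<n. (?e j + d j) * c j)"
  by (simp add: d(2) distrib_right sum.distrib)
  moreover have "\<forall>j<n. mpow m (n - j) (?e j + d j)"
  proof (intro allI impI)
  fix j assume "j < n"
  have r: "mpow m i (coeff r i)" for i using gen_step(1) unfolding R_def by blast
  have "mpow m (n - j) (?e j)"
  proof (cases "j = k")
  case True
  then show ?thesis using r[of "n - k"] by (simp only: if_True refl)
  next
  case False
  then show ?thesis using mpow_zero[of m "n - j"] by (simp only: if_False)
  qed
  moreover have "mpow m (n - j) (d j)" using d(1) \<open>j < n\<close> by blast
  ultimately show "mpow m (n - j) (?e j + d j)" by (rule mpow_add)
  qed
  ultimately show ?case by (intro exI[of _ "%j. ?e j + d j"] conjI)
 qed
 from this[OF n] obtain d where d: "\<forall>k<n. mpow m (n - k) (d k)" "c n = (\<Sum>k<n. d k * c k)"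
  by (auto simp: x_def)
 let ?a = "\<Sum>k<n. d k"
 have "d k \<in> m" if "k < n" for k
  using d(1) that mpow_Suc_ideal[OF m, of "n - Suc k"] by (simp add: Suc_diff_Suc)
 then have "?a \<in> m" by (intro ideal_in_sum[OF m]) auto
 \<comment> \<open>Modulo \<open>I\<close> every \<open>c k\<close> equals \<phi>, so the relation
   for \<open>c n\<close> reads \<phi> = \<open>?a\<close> * \<phi>.\<close>
 moreover have "(1 - ?a) * \<phi> = (\<phi> - c n) + (\<Sum>k<n. d k * (- (\<phi> - c k)))"
 proof -
  have "(\<Sum>k<n. d k * (- (\<phi> - c k))) = (\<Sum>k<n. d k * c k) - (\<Sum>k<n. d k * \<phi>)"
  by (simp add: right_diff_distrib sum_subtractf)
  then show ?thesis by (simp add: d(2) left_diff_distrib flip: sum_distrib_right)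
 qed
 then have "(1 - ?a) * \<phi> \<in> I"
  using ideal_in_add[OF I c(2)[of n] ideal_in_sum[OF I, of "{..<n}" "%k. d k * (- (\<phi> - c k))"]]
  ideal_in_mult[OF I UNIV_I ideal_in_uminus[OF is_subring_UNIV I c(2)]] by simp
 ultimately show ?thesis by blast
qed

section \<open>Primes, derivations and their cores\<close>

definition prime_in :: "'a::comm_ring_1 set => 'a set => bool" where
 "prime_in B P \<longleftrightarrow> ideal_in B P & 1 \<notin> P & (ALL x:B. ALL y:B. x * y \<in> P --> x \<in> P | y \<in> P)"

lemma prime_inD: "prime_in B P ==> x \<in> B ==> y \<in> B ==> x * y \<in> P ==> x \<in> P | y \<in> P"
 and prime_in_ideal: "prime_in B P ==> ideal_in B P"
 and prime_in_1: "prime_in B P ==> 1 \<notin> P"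
 by (auto simp: prime_in_def)

lemma prime_in_power:
 assumes "prime_in B P" "is_subring B" "x \<in> B" "x ^ n \<in> P" shows "x \<in> P"
 using assms(4)
proof (induction n)
 case 0 then show ?case using prime_in_1[OF assms(1)] by simp
next
 case (Suc n)
 then show ?case using prime_inD[OF assms(1,3) subring_power[OF assms(2,3)], of n] by auto
qed

definition derivation :: "('a::comm_ring_1 => 'a) => bool" where
 "derivation d \<longleftrightarrow> (ALL x y. d (x + y) = d x + d y) & (ALL x y. d (x * y) = d x * y + x * d y)"

lemma derivation_add: "derivation d ==> d (x + y) = d x + d y"
 and derivation_mult: "derivation d ==> d (x * y) = d x * y + x * d y"
 by (auto simp: derivation_def)

lemma derivation_0: "derivation d ==> d 0 = 0"
 using derivation_add[of d 0 0] by simp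

lemma derivation_uminus: "derivation d ==> d (- x) = - d x"
 using derivation_add[of d x "- x"] derivation_0[of d] by (simp add: add_eq_0_iff)

lemma derivation_diff: "derivation d ==> d (x - y) = d x - d y"
 using derivation_add[of d x "- y"] derivation_uminus[of d y] by simp

lemma derivation_sum: "derivation d ==> d (sum f S) = (\<Sum>i\<in>S. d (f i))"
 by (induction S rule: infinite_finite_induct) (auto simp: derivation_0 derivation_add)

lemma derivation_funpow_add: "derivation d ==> (d ^^ k) (x + y) = (d ^^ k) x + (d ^^ k) y"
 by (induction k) (auto simp: derivation_add)

primrec wd :: "('a => 'a) list => 'a => 'a" where
 "wd [] a = a"
| "wd (d # ds) a = d (wd ds a)"

lemma wd_append: "wd (us @ vs) a = wd us (wd vs a)"
 by (induction us) auto

text \<open>This is the largest subset of \<open>Q\<close> stable under \<Delta>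
  (\<open>core_closed\<close>, \<open>core_greatest\<close>). For Hamiltonian derivations and a
  maximal ideal it is the Poisson core.\<close>

definition core :: "('a => 'a) set => 'a set => 'a set" where
 "core \<Delta> Q = {a. ALL ds. set ds \<subseteq> \<Delta> --> wd ds a \<in> Q}"

definition core1 :: "('a => 'a) => 'a set => 'a set" where
 "core1 d Q = {a. ALL k. (d ^^ k) a \<in> Q}"

lemma core1_sub: "core1 d Q \<subseteq> Q"
proof
 fix a assume "a \<in> core1 d Q"
 then have "(d ^^ 0) a \<in> Q" unfolding core1_def by blast
 then show "a \<in> Q" by simp
qed

lemma core1_mono: "Q \<subseteq> Q' ==> core1 d Q \<subseteq> core1 d Q'"
 by (auto simp: core1_def)

abbreviation char0 :: "'a::comm_ring_1 set => bool" where
 "char0 Q \<equiv> (\<forall>n>0. of_nat n \<notin> Q)"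

text \<open>If \<open>k\<close> and \<open>l\<close> are minimal with \<open>d\<^sup>k x \<notin> Q\<close> and \<open>d\<^sup>l y \<notin> Q\<close>, then modulo \<open>Q\<close> the element
 \<open>d\<^sup>k\<^sup>+\<^sup>l (x y)\<close> is a positive multiple of \<open>d\<^sup>k x * d\<^sup>l y\<close>.\<close>

lemma prime_core1:
 assumes P: "prime_in UNIV Q" and c: "char0 Q" and d: "derivation d"
 shows "prime_in UNIV (core1 d Q)"
proof -
 note I = prime_in_ideal[OF P]
 have D0: "(d ^^ k) 0 = 0" for k by (induction k) (auto simp: derivation_0[OF d])
 have mult: "(d ^^ s) ((d ^^ i) r * (d ^^ j) x) \<in> Q" if "x \<in> core1 d Q" for s i j r x
 proof (induction s arbitrary: i j)
  case 0
  show ?case using that ideal_in_mult[OF I] by (simp add: core1_def)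
 next
  case (Suc s)
  have "(d ^^ Suc s) ((d ^^ i) r * (d ^^ j) x)
  = (d ^^ s) ((d ^^ Suc i) r * (d ^^ j) x) + (d ^^ s) ((d ^^ i) r * (d ^^ Suc j) x)"
  by (simp only: funpow_Suc_right o_def derivation_mult[OF d] derivation_funpow_add[OF d])
  (simp add: funpow_swap1)
  then show ?case using Suc.IH[of "Suc i" j] Suc.IH[of i "Suc j"] ideal_in_add[OF I] by simp
 qed
 have ideal: "ideal_in UNIV (core1 d Q)"
  unfolding ideal_in_def
 proof (intro conjI ballI)
  show "0 \<in> core1 d Q" by (auto simp: core1_def D0 ideal_in_0[OF I])
  show "x + y \<in> core1 d Q" if "x \<in> core1 d Q" "y \<in> core1 d Q" for x y
  using that by (auto simp: core1_def derivation_funpow_add[OF d] ideal_in_add[OF I])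
  show "r * x \<in> core1 d Q" if "x \<in> core1 d Q" for r x
  using mult[OF that, of _ 0 r 0] by (simp add: core1_def)
 qed auto
 have "x * y \<notin> core1 d Q" if x: "x \<notin> core1 d Q" and y: "y \<notin> core1 d Q" for x y
 proof
  assume xy: "x * y \<in> core1 d Q"
  obtain k where k: "(d ^^ k) x \<notin> Q" "!!i. i < k ==> (d ^^ i) x \<in> Q"
  using x exists_least_iff[of "%k. (d ^^ k) x \<notin> Q"] by (auto simp: core1_def)
  obtain l where l: "(d ^^ l) y \<notin> Q" "!!i. i < l ==> (d ^^ i) y \<in> Q"
  using y exists_least_iff[of "%k. (d ^^ k) y \<notin> Q"] by (auto simp: core1_def)
  \<comment> \<open>Here \<open>c\<close> counts the ways of distributing the \<open>s\<close>
    remaining derivatives so that \<open>x\<close> receives \<open>k\<close> and \<open>y\<close>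
    receives \<open>l\<close> of them in total. Only positivity matters, since \<open>char0\<close>
    then keeps \<open>c\<close> outside \<open>Q\<close>.\<close>
  have "\<exists>c::nat. (d ^^ s) ((d ^^ i) x * (d ^^ j) y) - of_nat c * ((d ^^ k) x * (d ^^ l) y) \<in> Q
  & (i \<le> k & j \<le> l --> c > 0)" if "i + j + s = k + l" for s i j
  using that
  proof (induction s arbitrary: i j)
  case 0
  show ?case
  proof (cases "i = k")
  case True
  then show ?thesis using 0 ideal_in_0[OF I] by (intro exI[of _ 1]) auto
  next
  case False
  then have "i < k | j < l" "~ (i \<le> k & j \<le> l)" using 0 by auto
  then show ?thesis using k(2)[of i] l(2)[of j] ideal_in_mult[OF I] ideal_in_mult2[OF I]
  by (intro exI[of _ 0]) auto
  qed
  next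
  case (Suc s)
  obtain c1 c2 :: nat where c1: "(d ^^ s) ((d ^^ Suc i) x * (d ^^ j) y) - of_nat c1 * ((d ^^ k) x * (d ^^ l) y) \<in> Q"
  "Suc i \<le> k & j \<le> l --> c1 > 0"
  and c2: "(d ^^ s) ((d ^^ i) x * (d ^^ Suc j) y) - of_nat c2 * ((d ^^ k) x * (d ^^ l) y) \<in> Q"
  "i \<le> k & Suc j \<le> l --> c2 > 0"
  using Suc.IH[of "Suc i" j] Suc.IH[of i "Suc j"] Suc.prems by auto
  have "(d ^^ Suc s) ((d ^^ i) x * (d ^^ j) y)
  = (d ^^ s) ((d ^^ Suc i) x * (d ^^ j) y) + (d ^^ s) ((d ^^ i) x * (d ^^ Suc j) y)"
  by (simp only: funpow_Suc_right o_def derivation_mult[OF d] derivation_funpow_add[OF d])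
  (simp add: funpow_swap1)
  then have "(d ^^ Suc s) ((d ^^ i) x * (d ^^ j) y) - of_nat (c1 + c2) * ((d ^^ k) x * (d ^^ l) y) \<in> Q"
  using ideal_in_add[OF I c1(1) c2(1)] by (simp add: algebra_simps)
  moreover have "i \<le> k & j \<le> l --> c1 + c2 > 0"
  proof
  assume "i \<le> k & j \<le> l"
  then have "Suc i \<le> k | Suc j \<le> l" using Suc.prems by linarith
  then show "c1 + c2 > 0" using c1(2) c2(2) \<open>i \<le> k & j \<le> l\<close> by auto
  qed
  ultimately show ?case by blast
  qed
  from this[of 0 0 "k + l"] obtain c :: nat where
  c': "(d ^^ (k + l)) (x * y) - of_nat c * ((d ^^ k) x * (d ^^ l) y) \<in> Q" "c > 0" by auto
  have "(d ^^ (k + l)) (x * y) \<in> Q" using xy unfolding core1_def by blast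
  from ideal_in_diff[OF is_subring_UNIV I this c'(1)]
  have "of_nat c * ((d ^^ k) x * (d ^^ l) y) \<in> Q" by simp
  then show False using prime_inD[OF P UNIV_I UNIV_I] k(1) l(1) c c'(2) by metis
 qed
 moreover have "1 \<notin> core1 d Q" using core1_sub[of d Q] prime_in_1[OF P] by blast
 ultimately show ?thesis using ideal unfolding prime_in_def by blast
qed

text \<open>Taking the core for one derivation at a time preserves primality at each step, which is
  not visible for \<open>core\<close> itself; \<open>core\<close> is recovered as the intersection
  over all words.\<close>

primrec cores :: "'a set => ('a => 'a) list => 'a set" where
 "cores Q [] = Q"
| "cores Q (d # ds) = cores (core1 d Q) ds"

lemma cores_append: "cores Q (us @ vs) = cores (cores Q us) vs"
 by (induction us arbitrary: Q) auto

lemma cores_mono: "Q \<subseteq> Q' ==> cores Q ds \<subseteq> cores Q' ds"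
proof (induction ds arbitrary: Q Q')
 case (Cons d ds)
 show ?case using Cons.IH[OF core1_mono[OF Cons.prems]] by simp
qed simp

lemma cores_sub: "cores Q ds \<subseteq> Q"
proof (induction ds arbitrary: Q)
 case (Cons d ds)
 show ?case using subset_trans[OF Cons.IH[of "core1 d Q"] core1_sub] by simp
qed simp

lemma cores_wd: "a \<in> cores Q ds ==> wd ds a \<in> Q"
proof (induction ds arbitrary: Q)
 case (Cons d ds)
 then have "wd ds a \<in> core1 d Q" by simp
 then have "(d ^^ 1) (wd ds a) \<in> Q" unfolding core1_def by blast
 then show ?case by simp
qed simp

text \<open>A block of \<open>k\<close> equal letters in a word realises the k-th power of a
  derivation that \<open>core1\<close> asks for.\<close>

lemma core_cores: "a \<in> core \<Delta> Q ==> set ds \<subseteq> \<Delta> ==> a \<in> cores Q ds"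
proof (induction ds arbitrary: Q)
 case Nil
 then have "wd [] a \<in> Q" unfolding core_def by (metis (mono_tags) empty_set empty_subsetI mem_Collect_eq)
 then show ?case by simp
next
 case (Cons d ds)
 have "(d ^^ k) (wd es a) \<in> Q" if "set es \<subseteq> \<Delta>" for k es
 proof -
  have "set (replicate k d @ es) \<subseteq> \<Delta>" using Cons.prems(2) that by auto
  then have "wd (replicate k d @ es) a \<in> Q" using Cons.prems(1) unfolding core_def by blast
  moreover have "wd (replicate k d) b = (d ^^ k) b" for b by (induction k) auto
  ultimately show ?thesis by (simp add: wd_append)
 qed
 then have "a \<in> core \<Delta> (core1 d Q)" by (auto simp: core_def core1_def)
 then show ?case using Cons by simp
qed

lemma core_alt: "core \<Delta> Q = (\<Inter>ds\<in>{ds. set ds \<subseteq> \<Delta>}. cores Q ds)"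
proof
 show "core \<Delta> Q \<subseteq> (\<Inter>ds\<in>{ds. set ds \<subseteq> \<Delta>}. cores Q ds)" using core_cores by fast
 show "(\<Inter>ds\<in>{ds. set ds \<subseteq> \<Delta>}. cores Q ds) \<subseteq> core \<Delta> Q"
 proof
  fix a assume "a \<in> (\<Inter>ds\<in>{ds. set ds \<subseteq> \<Delta>}. cores Q ds)"
  then have "a \<in> cores Q ds" if "set ds \<subseteq> \<Delta>" for ds using that by simp
  then show "a \<in> core \<Delta> Q" unfolding core_def by (intro CollectI allI impI cores_wd)
 qed
qed

lemma prime_cores:
 assumes "prime_in UNIV Q" "char0 Q" "ALL d:set ds. derivation d"
 shows "prime_in UNIV (cores Q ds)"
 using assms
proof (induction ds arbitrary: Q)
 case (Cons d ds)
 have "char0 (core1 d Q)" using Cons.prems(2) core1_sub[of d Q] by blast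
 then show ?case using Cons prime_core1[of Q d] by simp
qed simp

text \<open>By \<open>core_alt\<close> the core is the intersection of the primes
  \<open>cores Q ds\<close>. The family is directed downwards, because the prime of
  \<open>us @ vs\<close> lies in those of \<open>us\<close> and of \<open>vs\<close>, and the
  intersection of such a family of primes is prime.\<close>

lemma prime_core:
 assumes "prime_in UNIV Q" "char0 Q" "ALL d:\<Delta>. derivation d"
 shows "prime_in UNIV (core \<Delta> Q)"
proof -
 have pr: "prime_in UNIV (cores Q ds)" if "set ds \<subseteq> \<Delta>" for ds
  using prime_cores[OF assms(1,2)] assms(3) that by blast
 have "ideal_in UNIV (core \<Delta> Q)"
  using prime_in_ideal[OF pr] by (simp add: core_alt ideal_in_def)
 moreover have "1 \<notin> core \<Delta> Q"
  using prime_in_1[OF assms(1)] core_cores[of 1 \<Delta> Q "[]"] by auto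
 moreover have "x * y \<notin> core \<Delta> Q" if xy: "x \<notin> core \<Delta> Q" "y \<notin> core \<Delta> Q" for x y
 proof -
  obtain us vs where u: "set us \<subseteq> \<Delta>" "x \<notin> cores Q us" and v: "set vs \<subseteq> \<Delta>" "y \<notin> cores Q vs"
  using xy by (auto simp: core_alt)
  have s: "cores Q (us @ vs) \<subseteq> cores Q us" "cores Q (us @ vs) \<subseteq> cores Q vs"
  unfolding cores_append by (rule cores_sub, rule cores_mono[OF cores_sub])
  have uv: "set (us @ vs) \<subseteq> \<Delta>" using u v by auto
  have "x * y \<notin> cores Q (us @ vs)"
  using prime_inD[OF pr[OF uv] UNIV_I UNIV_I] s u(2) v(2) by blast
  then show ?thesis using uv unfolding core_alt by blast
 qed
 ultimately show ?thesis by (auto simp: prime_in_def)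
qed

lemma core_sub: "core \<Delta> Q \<subseteq> Q"
 using core_cores[of _ \<Delta> Q "[]"] by auto

lemma core_closed: "a \<in> core \<Delta> Q ==> d \<in> \<Delta> ==> d a \<in> core \<Delta> Q"
 unfolding core_def
proof (intro CollectI allI impI)
 fix ds assume "a \<in> {a. ALL ds. set ds \<subseteq> \<Delta> --> wd ds a \<in> Q}" "d \<in> \<Delta>" "set ds \<subseteq> \<Delta>"
 then have "wd (ds @ [d]) a \<in> Q" by auto
 then show "wd ds (d a) \<in> Q" by (simp add: wd_append)
qed

lemma core_greatest:
 assumes "I \<subseteq> Q" "!!d a. d \<in> \<Delta> ==> a \<in> I ==> d a \<in> I" shows "I \<subseteq> core \<Delta> Q"
proof -
 have "wd ds a \<in> I" if "a \<in> I" "set ds \<subseteq> \<Delta>" for a ds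
  using that by (induction ds) (auto intro: assms(2))
 then show ?thesis using assms(1) by (auto simp: core_def)
qed

section \<open>Extension of points and tangent vectors\<close>

text \<open>A complex point of \<open>A\<close> modulo \<open>A \<inter> P\<close>;
  \<open>is_der\<close> below is a tangent vector at that point. The set \<open>P\<close> may sit in
  a larger ring, so that it can stay fixed while \<open>A\<close> grows.\<close>

definition is_hom :: "'a::comm_ring_1 set => 'a set => ('a => complex) => bool" where
 "is_hom A P \<phi> \<longleftrightarrow> \<phi> 1 = 1 & (ALL x:A. ALL y:A. \<phi> (x + y) = \<phi> x + \<phi> y & \<phi> (x * y) = \<phi> x * \<phi> y)
  & (ALL x:A \<inter> P. \<phi> x = 0)"

definition is_der :: "'a::comm_ring_1 set => 'a set => ('a => complex) => ('a => complex) => bool" where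
 "is_der A P \<phi> d \<longleftrightarrow> (ALL x:A. ALL y:A. d (x + y) = d x + d y & d (x * y) = \<phi> x * d y + d x * \<phi> y)
  & (ALL x:A \<inter> P. d x = 0)"

text \<open>Every step costs one factor of the leading coefficient of \<open>r\<close> in place of a
  division by it. The degree bound on the quotient is part of the claim because
  \<open>bezout\<close> argues with it.\<close>

lemma pseudo_division:
 fixes r :: "'a::comm_ring_1 poly"
 assumes A: "is_subring A" and r: "pover A r" "\<forall>i>m. coeff r i = 0"
 shows "pover A q ==> \<forall>i>n. coeff q i = 0 ==> m \<le> n ==>
  EX k s t. pover A s & pover A t & Polynomial.smult (coeff r m ^ k) q = r * s + t &
  (\<forall>i\<ge>m. coeff t i = 0) & (\<forall>i>n-m. coeff s i = 0)"
proof (induction "n - m" arbitrary: n q)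
 case 0
 let ?c = "coeff r m"
 have nm: "n = m" using 0 by simp
 let ?t = "Polynomial.smult ?c q - r * [:coeff q m:]"
 have "pover A ?t" using A r(1) 0(2) by (intro pover_intros) auto
 moreover have "\<forall>i\<ge>m. coeff ?t i = 0"
 proof (intro allI impI)
  fix i assume "m \<le> i"
  then show "coeff ?t i = 0" using r(2) 0(3) nm by (cases "i = m") auto
 qed
 moreover have "pover A [:coeff q m:]" using 0(2) by (intro pover_intros A) auto
 moreover have "\<forall>i>n-m. coeff [:coeff q m:] i = 0" using nm by (auto simp: coeff_pCons split: nat.splits)
 ultimately show ?case
  by (intro exI[of _ "1::nat"] exI[of _ "[:coeff q m:]"] exI[of _ ?t] conjI) simp_all
next
 case (Suc d)
 let ?c = "coeff r m"
 obtain n' where n': "n = Suc n'" "d = n' - m" "m \<le> n'" using Suc by (cases n) auto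
 let ?M = "monom (coeff q n) (n - m)"
 let ?q = "Polynomial.smult ?c q - r * ?M"
 have M: "pover A ?M" using Suc.prems(1) by (intro pover_intros A) auto
 have q': "pover A ?q" using A r(1) Suc.prems(1) M by (intro pover_intros) auto
 have cM: "coeff (r * ?M) i = (if n - m \<le> i then coeff r (i - (n - m)) * coeff q n else 0)" for i
  by (simp only: mult.commute[of r] coeff_monom_mult) (auto simp: mult.commute)
 have "\<forall>i>n'. coeff ?q i = 0"
 proof (intro allI impI)
  fix i assume i: "n' < i"
  show "coeff ?q i = 0"
  proof (cases "i = n")
  case True
  then show ?thesis using Suc.prems(3) by (simp add: cM)
  next
  case False
  then have "n < i" using i n' by simp
  then show ?thesis using Suc.prems(2,3) r(2) by (simp add: cM)
  qed
 qed
 from Suc.hyps(1)[OF n'(2) q' this n'(3)] obtain k s t where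
  st: "pover A s" "pover A t" "Polynomial.smult (?c ^ k) ?q = r * s + t" "\<forall>i\<ge>m. coeff t i = 0"
  "\<forall>i>n'-m. coeff s i = 0" by blast
 let ?s = "s + Polynomial.smult (?c ^ k) ?M"
 have "Polynomial.smult (?c ^ Suc k) q = Polynomial.smult (?c ^ k) ?q + Polynomial.smult (?c ^ k) (r * ?M)"
  by (simp add: smult_diff_right mult.commute)
 also have "\<dots> = r * ?s + t" by (simp add: st(3) algebra_simps)
 finally have "Polynomial.smult (?c ^ Suc k) q = r * ?s + t" .
 moreover have "pover A ?s"
  by (intro pover_add[OF A] pover_smult[OF A] subring_power[OF A] st M) (use r(1) in auto)
 moreover have "\<forall>i>n-m. coeff ?s i = 0" using st(5) n' by auto
 ultimately show ?case using st(2,4) by blast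
qed

context
 fixes A P :: "'a::comm_ring_1 set" and \<phi> :: "'a => complex"
 assumes A: "is_subring A" and P0: "0 \<in> P" and hom: "is_hom A P \<phi>"
begin

lemma hom_0: "\<phi> 0 = 0"
 using hom P0 subring_0[OF A] by (auto simp: is_hom_def)

lemma hom_add: "x \<in> A ==> y \<in> A ==> \<phi> (x + y) = \<phi> x + \<phi> y"
 and hom_mult: "x \<in> A ==> y \<in> A ==> \<phi> (x * y) = \<phi> x * \<phi> y"
 and hom_1: "\<phi> 1 = 1"
 using hom by (auto simp: is_hom_def)

lemma hom_uminus: "x \<in> A ==> \<phi> (- x) = - \<phi> x"
 using hom_add[of x "- x"] hom_0 subring_uminus[OF A, of x] by (simp add: add_eq_0_iff)

lemma hom_diff: "x \<in> A ==> y \<in> A ==> \<phi> (x - y) = \<phi> x - \<phi> y"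
 using hom_add[of x "- y"] hom_uminus[of y] subring_uminus[OF A, of y] by simp

lemma hom_sum: "(!!i. i \<in> S ==> f i \<in> A) ==> \<phi> (sum f S) = (\<Sum>i\<in>S. \<phi> (f i))"
proof (induction S rule: infinite_finite_induct)
 case (insert x F)
 then have "f x \<in> A" "sum f F \<in> A" using subring_sum[OF A, of F f] by auto
 then show ?case using insert by (simp add: hom_add)
qed (auto simp: hom_0)

lemma hom_power: "x \<in> A ==> \<phi> (x ^ n) = \<phi> x ^ n"
 by (induction n) (auto simp: hom_1 hom_mult subring_power[OF A])

lemma coeff_map_hom: "coeff (map_poly \<phi> p) i = \<phi> (coeff p i)"
 by (simp add: coeff_map_poly hom_0)

lemma map_hom_add: "pover A p ==> pover A q ==> map_poly \<phi> (p + q) = map_poly \<phi> p + map_poly \<phi> q"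
 and map_hom_diff: "pover A p ==> pover A q ==> map_poly \<phi> (p - q) = map_poly \<phi> p - map_poly \<phi> q"
 by (auto simp: poly_eq_iff coeff_map_hom hom_add hom_diff)

lemma map_hom_mult: "pover A p ==> pover A q ==> map_poly \<phi> (p * q) = map_poly \<phi> p * map_poly \<phi> q"
 by (auto simp: poly_eq_iff coeff_map_hom coeff_mult hom_sum hom_mult subring_mult[OF A])

lemma map_hom_const: "map_poly \<phi> [:a:] = [:\<phi> a:]"
 by (auto simp: poly_eq_iff coeff_map_hom coeff_pCons hom_0 split: nat.splits)

text \<open>The extension sends \<open>u\<close> to \<open>c\<close>. It is well defined once
  \<open>c\<close> satisfies all relations of \<open>u\<close> modulo \<open>P\<close>, since two
  polynomials with the same value at \<open>u\<close> differ by such a relation.\<close>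

lemma hom_extend:
 assumes c: "!!q. pover A q ==> poly q u \<in> P ==> poly (map_poly \<phi> q) c = 0"
 obtains \<psi> where "is_hom (adj A u) P \<psi>" "!!q. pover A q ==> \<psi> (poly q u) = poly (map_poly \<phi> q) c"
  "!!x. x \<in> A ==> \<psi> x = \<phi> x"
proof -
 define \<psi> where "\<psi> x = poly (map_poly \<phi> (SOME q. pover A q & poly q u = x)) c" for x
 have \<psi>: "\<psi> (poly q u) = poly (map_poly \<phi> q) c" if q: "pover A q" for q
 proof -
  let ?r = "SOME r. pover A r & poly r u = poly q u"
  have r: "pover A ?r" "poly ?r u = poly q u" using someI[of "%r. pover A r & poly r u = poly q u" q] q by auto
  have "poly (map_poly \<phi> (?r - q)) c = 0"
  by (rule c) (use pover_diff[OF A r(1) q] r(2) P0 in auto)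
  then show ?thesis unfolding \<psi>_def using map_hom_diff[OF r(1) q] by simp
 qed
 have 1: "\<psi> x = \<phi> x" if "x \<in> A" for x
  using \<psi>[OF pover_pCons[OF A that pover_0[OF A]]] by (simp add: map_hom_const)
 have "is_hom (adj A u) P \<psi>"
  unfolding is_hom_def
 proof (intro conjI ballI)
  show "\<psi> 1 = 1" using 1[OF subring_1[OF A]] hom_1 by simp
  fix x y assume "x \<in> adj A u" "y \<in> adj A u"
  then obtain p q where "pover A p" "x = poly p u" "pover A q" "y = poly q u" by (auto elim!: adjE)
  then show "\<psi> (x + y) = \<psi> x + \<psi> y" "\<psi> (x * y) = \<psi> x * \<psi> y"
  using \<psi>[OF pover_add[OF A, of p q]] \<psi>[OF pover_mult[OF A, of p q]]
  by (simp_all add: \<psi> map_hom_add map_hom_mult)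
 next
  fix x assume "x \<in> adj A u \<inter> P"
  then show "\<psi> x = 0" using \<psi> c by (auto elim!: adjE)
 qed
 with \<psi> 1 that show ?thesis by blast
qed

context
 fixes d :: "'a => complex"
 assumes der: "is_der A P \<phi> d"
begin

lemma der_0: "d 0 = 0"
 using der P0 subring_0[OF A] by (auto simp: is_der_def)

lemma der_add: "x \<in> A ==> y \<in> A ==> d (x + y) = d x + d y"
 and der_mult: "x \<in> A ==> y \<in> A ==> d (x * y) = \<phi> x * d y + d x * \<phi> y"
 using der by (auto simp: is_der_def)

lemma der_uminus: "x \<in> A ==> d (- x) = - d x"
 using der_add[of x "- x"] der_0 subring_uminus[OF A, of x] by (simp add: add_eq_0_iff)

lemma der_diff: "x \<in> A ==> y \<in> A ==> d (x - y) = d x - d y"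
 using der_add[of x "- y"] der_uminus[of y] subring_uminus[OF A, of y] by simp

lemma der_sum: "(!!i. i \<in> S ==> f i \<in> A) ==> d (sum f S) = (\<Sum>i\<in>S. d (f i))"
proof (induction S rule: infinite_finite_induct)
 case (insert x F)
 then have "f x \<in> A" "sum f F \<in> A" using subring_sum[OF A, of F f] by auto
 then show ?case using insert by (simp add: der_add)
qed (auto simp: der_0)

lemma coeff_map_der: "coeff (map_poly d p) i = d (coeff p i)"
 by (simp add: coeff_map_poly der_0)

lemma map_der_add: "pover A p ==> pover A q ==> map_poly d (p + q) = map_poly d p + map_poly d q"
 and map_der_diff: "pover A p ==> pover A q ==> map_poly d (p - q) = map_poly d p - map_poly d q"
 by (auto simp: poly_eq_iff coeff_map_der der_add der_diff)

lemma map_der_mult: "pover A p ==> pover A q ==>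
  map_poly d (p * q) = map_poly \<phi> p * map_poly d q + map_poly d p * map_poly \<phi> q"
 by (auto simp: poly_eq_iff coeff_map_hom coeff_map_der coeff_mult der_sum der_mult subring_mult[OF A] sum.distrib)

lemma map_der_const: "map_poly d [:a:] = [:d a:]"
 by (auto simp: poly_eq_iff coeff_map_der coeff_pCons der_0 split: nat.splits)

text \<open>Derivative of the value of \<open>q\<close> when its coefficients move by
  \<open>d\<close> and the point \<open>c\<close> moves with velocity \<open>v\<close>.\<close>

definition ext_der :: "complex => complex => 'a poly => complex" where
 "ext_der c v q = poly (map_poly d q) c + poly (pderiv (map_poly \<phi> q)) c * v"

lemma ext_der_add: "pover A p ==> pover A q ==> ext_der c v (p + q) = ext_der c v p + ext_der c v q"
 and ext_der_diff: "pover A p ==> pover A q ==> ext_der c v (p - q) = ext_der c v p - ext_der c v q"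
 by (simp_all add: ext_der_def map_der_add map_der_diff map_hom_add map_hom_diff pderiv_add pderiv_diff algebra_simps)

lemma ext_der_mult: "pover A p ==> pover A q ==> ext_der c v (p * q) =
  poly (map_poly \<phi> p) c * ext_der c v q + ext_der c v p * poly (map_poly \<phi> q) c"
 by (simp add: ext_der_def map_der_mult map_hom_mult pderiv_mult algebra_simps)

lemma der_extend:
 assumes \<psi>: "!!q. pover A q ==> \<psi> (poly q u) = poly (map_poly \<phi> q) c"
  and v: "!!q. pover A q ==> poly q u \<in> P ==> ext_der c v q = 0"
 shows "EX d'. is_der (adj A u) P \<psi> d' & (ALL x:A. d' x = d x)"
proof -
 define d' where "d' x = ext_der c v (SOME q. pover A q & poly q u = x)" for x
 have d': "d' (poly q u) = ext_der c v q" if q: "pover A q" for q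
 proof -
  let ?r = "SOME r. pover A r & poly r u = poly q u"
  have r: "pover A ?r" "poly ?r u = poly q u" using someI[of "%r. pover A r & poly r u = poly q u" q] q by auto
  have "ext_der c v (?r - q) = 0"
  by (rule v) (use pover_diff[OF A r(1) q] r(2) P0 in auto)
  then show ?thesis unfolding d'_def using ext_der_diff[OF r(1) q] by simp
 qed
 have 1: "d' x = d x" if "x \<in> A" for x
  using d'[OF pover_pCons[OF A that pover_0[OF A]]] by (simp add: map_der_const map_hom_const ext_der_def)
 have "is_der (adj A u) P \<psi> d'"
  unfolding is_der_def
 proof (intro conjI ballI)
  fix x y assume "x \<in> adj A u" "y \<in> adj A u"
  then obtain p q where "pover A p" "x = poly p u" "pover A q" "y = poly q u" by (auto elim!: adjE)
  then show "d' (x + y) = d' x + d' y" "d' (x * y) = \<psi> x * d' y + d' x * \<psi> y"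
  using d'[OF pover_add[OF A, of p q]] d'[OF pover_mult[OF A, of p q]]
  by (simp_all add: d' \<psi> ext_der_add ext_der_mult)
 next
  fix x assume "x \<in> adj A u \<inter> P"
  then show "d' x = 0" using d' v by (auto elim!: adjE)
 qed
 with 1 show ?thesis by blast
qed

end
end

text \<open>Geometrically, \<psi> lies over \<phi> and the differential of the projection at \<psi>
  is onto the tangent space at \<phi>.\<close>

definition extends_from :: "'a::comm_ring_1 set => 'a set => 'a set => ('a => complex) => ('a => complex) => bool" where
 "extends_from A B P \<phi> \<psi> \<longleftrightarrow> is_hom B P \<psi> & (ALL x:A. \<psi> x = \<phi> x) &
  (ALL d. is_der A P \<phi> d --> (EX d'. is_der B P \<psi> d' & (ALL x:A. d' x = d x)))"

lemma extends_from_trans: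
 assumes "extends_from A B P \<phi> \<psi>" "extends_from B C P \<psi> \<omega>" "A \<subseteq> B"
 shows "extends_from A C P \<phi> \<omega>"
 using assms unfolding extends_from_def by (metis (no_types, lifting) subsetD)

section \<open>Adjoining one transcendental element\<close>

lemma avoid_roots:
 fixes Q :: "nat => complex poly"
 assumes "!!n. Q n ~= 0"
 shows "EX c. ALL n. poly (Q n) c ~= 0"
proof -
 have "countable (\<Union>n. {c. poly (Q n) c = 0})"
  using poly_roots_finite[OF assms] by (intro countable_UN) (auto intro: countable_finite)
 then have "(\<Union>n. {c. poly (Q n) c = 0}) ~= UNIV" using uncountable_UNIV_complex by metis
 then show ?thesis by blast
qed

text \<open>The value of \<open>u\<close> is free, and countably many nonzero polynomials leave a
  complex number that is a root of none. The element \<open>a n\<close> is a coefficient outside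
  \<open>P\<close> of \<open>b n\<close>, written as a polynomial in \<open>u\<close>; if it does
  not vanish at \<phi>, that polynomial stays nonzero after specialisation. Tangent vectors are
  lifted with velocity 0.\<close>

lemma extension_step_transcendental:
 fixes A P :: "'a::comm_ring_1 set"
 assumes A: "is_subring A" and P: "prime_in (adj A u) P"
  and tr: "!!q. pover A q ==> poly q u \<in> P ==> ALL i. coeff q i \<in> P"
  and b: "!!n::nat. b n \<in> adj A u - P"
 shows "EX a. (\<forall>n::nat. a n \<in> A - P) & (ALL \<phi>. is_hom A P \<phi> --> (ALL n. \<phi> (a n) ~= 0) -->
  (EX \<psi>. extends_from A (adj A u) P \<phi> \<psi> & (ALL n. \<psi> (b n) ~= 0)))"
proof -
 note I = prime_in_ideal[OF P] and B = adj_subring[OF A, of u]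
 have P0: "0 \<in> P" by (rule ideal_in_0[OF I])
 have "EX q. pover A q & b n = poly q u" for n using b[of n] unfolding adj_def by blast
 then obtain q where q: "!!n. pover A (q n)" "!!n. b n = poly (q n) u" by metis
 have "EX k. coeff (q n) k \<notin> P" for n
 proof (rule ccontr)
  assume "\<nexists>k. coeff (q n) k \<notin> P"
  then have "(\<Sum>i\<le>degree (q n). coeff (q n) i * u ^ i) \<in> P"
  using subring_power[OF B adj_self[OF A]] by (intro ideal_in_sum[OF I] ideal_in_mult2[OF I]) auto
  then show False using b[of n] q(2)[of n] by (simp add: poly_altdef)
 qed
 then obtain k where k: "!!n. coeff (q n) (k n) \<notin> P" by metis
 show ?thesis
 proof (intro exI[of _ "%n. coeff (q n) (k n)"] conjI allI impI)
  show "coeff (q n) (k n) \<in> A - P" for n using q k by auto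
  fix \<phi> assume hom: "is_hom A P \<phi>" and nz: "ALL n. \<phi> (coeff (q n) (k n)) ~= 0"
  have "map_poly \<phi> (q n) ~= 0" for n
  using nz coeff_map_hom[OF A P0 hom, of "q n" "k n"] by (metis coeff_0)
  then obtain c where c: "!!n. poly (map_poly \<phi> (q n)) c ~= 0"
  using avoid_roots[of "%n. map_poly \<phi> (q n)"] by blast
  have z: "map_poly \<phi> p = 0" if "pover A p" "poly p u \<in> P" for p
  using tr[OF that] that(1) hom by (auto simp: poly_eq_iff coeff_map_hom[OF A P0 hom] is_hom_def)
  obtain \<psi> where \<psi>: "is_hom (adj A u) P \<psi>" "!!q. pover A q ==> \<psi> (poly q u) = poly (map_poly \<phi> q) c"
  "!!x. x \<in> A ==> \<psi> x = \<phi> x"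
  using hom_extend[OF A P0 hom, of u c] z by auto
  have "EX d'. is_der (adj A u) P \<psi> d' & (ALL x:A. d' x = d x)" if der: "is_der A P \<phi> d" for d
  proof (rule der_extend[OF A P0 hom der \<psi>(2), where v = 0])
  fix p assume p: "pover A p" "poly p u \<in> P"
  have "map_poly d p = 0"
  using tr[OF p] p(1) der by (auto simp: poly_eq_iff coeff_map_der[OF A P0 hom der] is_der_def)
  then show "ext_der \<phi> d c 0 p = 0" by (simp add: ext_der_def[OF A P0 hom der])
  qed auto
  then show "EX \<psi>. extends_from A (adj A u) P \<phi> \<psi> & (ALL n. \<psi> (b n) ~= 0)"
  using \<psi> c q by (intro exI[of _ \<psi>]) (auto simp: extends_from_def)
 qed
qed

section \<open>Adjoining one algebraic element\<close>

lemma poly_coeffs_in_ideal: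
 assumes "is_subring B" "ideal_in B P" "u \<in> B" "ALL i. coeff q i \<in> P" shows "poly q u \<in> P"
 unfolding poly_altdef using assms
 by (intro ideal_in_sum[OF assms(2)] ideal_in_mult2[OF assms(2)] subring_power[OF assms(1)]) auto

text \<open>Cutting off the top terms with coefficients in \<open>P\<close> changes the value at
  \<open>u\<close> only by an element of \<open>P\<close>.\<close>

lemma trim_poly:
 assumes A: "is_subring A" and B: "is_subring B" "ideal_in B P" "u \<in> B"
  and q: "pover A q" "\<forall>i>n. coeff q i = 0" "~ (ALL i. coeff q i \<in> P)"
 shows "EX k p. k \<le> n & pover A p & (\<forall>i>k. coeff p i = 0) & coeff p k \<notin> P & poly q u - poly p u \<in> P"
proof -
 have P0: "0 \<in> P" by (rule ideal_in_0[OF B(2)])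
 define k where "k = Max {i. coeff q i \<notin> P}"
 have sub: "{i. coeff q i \<notin> P} \<subseteq> {..n}"
 proof
  fix i assume "i \<in> {i. coeff q i \<notin> P}"
  then show "i \<in> {..n}" using q(2) P0 by (cases "i \<le> n") auto
 qed
 have fin: "finite {i. coeff q i \<notin> P}" using sub finite_subset by blast
 have k: "coeff q k \<notin> P" using Max_in[OF fin] q(3) unfolding k_def by auto
 have k2: "coeff q i \<in> P" if "i > k" for i using Max_ge[OF fin, of i] that unfolding k_def by auto
 let ?p = "poly_cutoff (Suc k) q"
 have c: "coeff ?p i = (if i \<le> k then coeff q i else 0)" for i by (auto simp: coeff_poly_cutoff less_Suc_eq_le)
 have "poly (q - ?p) u \<in> P"
  by (rule poly_coeffs_in_ideal[OF B]) (use k2 P0 in \<open>auto simp: c\<close>)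
 then show ?thesis
  using k sub c q(1) subring_0[OF A] by (intro exI[of _ k] exI[of _ ?p]) auto
qed

text \<open>\<open>p\<close> plays the part of the minimal polynomial of \<open>u\<close> over the
  fraction field of \<open>A\<close> modulo \<open>A \<inter> P\<close>: a relation of least degree
  among those whose leading coefficient survives modulo \<open>P\<close>.\<close>

locale algebraic_step =
 fixes A P :: "'a::comm_ring_1 set" and u :: 'a and n :: nat and p :: "'a poly"
 assumes A: "is_subring A" and P: "prime_in (adj A u) P" and ch: "char0 P"
  and p: "pover A p" "\<forall>i>n. coeff p i = 0" "coeff p n \<notin> P" "poly p u \<in> P"
  and least: "!!q k. k < n ==> pover A q ==> \<forall>i>k. coeff q i = 0 ==> poly q u \<in> P ==> coeff q k \<in> P"
begin

lemmas I = prime_in_ideal[OF P]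
lemmas B = adj_subring[OF A, of u]
lemmas P0 = ideal_in_0[OF I]

lemma uB: "u \<in> adj A u" by (rule adj_self[OF A])

lemma AB: "a \<in> A ==> a \<in> adj A u" by (rule adj_base[OF A])

lemma polyB: "pover A q ==> poly q u \<in> adj A u" by (rule adjI)

lemma minimal: assumes "pover A q" "\<forall>i\<ge>n. coeff q i = 0" "poly q u \<in> P" shows "ALL i. coeff q i \<in> P"
proof (cases "n = 0")
 case True
 then show ?thesis using assms(2) P0 by simp
next
 case False
 show ?thesis
 proof (rule ccontr)
  assume "~ (ALL i. coeff q i \<in> P)"
  moreover have "\<forall>i>n-1. coeff q i = 0" using assms(2) by auto
  ultimately obtain k r where r: "k \<le> n - 1" "pover A r" "\<forall>i>k. coeff r i = 0" "coeff r k \<notin> P"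
  "poly q u - poly r u \<in> P" using trim_poly[OF A B I uB assms(1)] by metis
  have "poly r u \<in> P" using ideal_in_diff[OF B I assms(3) r(5)] by simp
  moreover have "k < n" using r(1) False by simp
  ultimately show False using least[OF _ r(2,3)] r(4) by blast
 qed
qed

lemma n_pos: "n > 0"
proof (rule ccontr)
 assume "~ n > 0"
 then have "p = [:coeff p 0:]" using p(2) by (auto simp: poly_eq_iff coeff_pCons split: nat.splits)
 then have "poly p u = coeff p 0" by (metis mult_zero_right poly_0 poly_pCons add.right_neutral)
 then show False using p \<open>~ n > 0\<close> by simp
qed

lemma prime_mult: "x \<in> adj A u ==> y \<in> adj A u ==> x \<notin> P ==> y \<notin> P ==> x * y \<notin> P"
 using prime_inD[OF P] by blast

lemma power_notin: "x \<in> adj A u ==> x \<notin> P ==> x ^ k \<notin> P"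
 using prime_in_power[OF P B] by blast

text \<open>A nonzero element of the algebraic extension has a nonzero multiple in the base. Among
  the multiples of \<open>b\<close> modulo \<open>P\<close> that are values r(u) outside
  \<open>P\<close>, one takes \<open>r\<close> of least degree; pseudo-division of \<open>p\<close>
  by \<open>r\<close> leaves a remainder with value in \<open>P\<close>, and the minimality of
  \<open>p\<close> then forces \<open>r\<close> to be constant.\<close>

lemma bezout:
 assumes b: "b \<in> adj A u" "b \<notin> P"
 shows "EX a s. a \<in> A & a \<notin> P & pover A s & a - poly s u * b \<in> P"
proof -
 define C where "C m r s \<longleftrightarrow> pover A r & pover A s & (\<forall>i>m. coeff r i = 0) & poly r u \<notin> P
  & poly r u - poly s u * b \<in> P" for m r s
 obtain q where q: "pover A q" "b = poly q u" using b(1) by (blast elim: adjE)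
 have "C (degree q) q 1" using q b P0 pover_1[OF A] by (auto simp: C_def coeff_eq_0)
 then have "EX m. EX r s. C m r s" by blast
 then obtain m where m: "EX r s. C m r s" "!!m'. m' < m ==> ~ (EX r s. C m' r s)"
  using exists_least_iff[of "%m. EX r s. C m r s"] by blast
 then obtain r s where C: "C m r s" by blast
 then have r: "pover A r" "\<forall>i>m. coeff r i = 0" "poly r u \<notin> P" and s: "pover A s"
  and rs: "poly r u - poly s u * b \<in> P" by (auto simp: C_def)
 show ?thesis
 proof (cases "m = 0")
  case True
  then have "r = [:coeff r 0:]" using r(2) by (auto simp: poly_eq_iff coeff_pCons split: nat.splits)
  then have "poly r u = coeff r 0" by (metis mult_zero_right poly_0 poly_pCons add.right_neutral)
  then show ?thesis using r s rs by metis
 next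
  case False
  have lc: "coeff r m \<notin> P"
  proof
  assume l: "coeff r m \<in> P"
  let ?r = "r - monom (coeff r m) m"
  have "poly (monom (coeff r m) m) u \<in> P"
  unfolding poly_monom by (intro ideal_in_mult2[OF I] l subring_power[OF B uB])
  then have 1: "poly ?r u - poly r u \<in> P"
  using ideal_in_uminus[OF B I] by simp
  have "poly ?r u \<notin> P" using ideal_in_diff[OF B I _ 1] r(3) by force
  moreover have "poly ?r u - poly s u * b \<in> P" using ideal_in_add[OF I 1 rs] by (simp add: algebra_simps)
  moreover have "\<forall>i>m-1. coeff ?r i = 0"
  proof (intro allI impI)
  fix i assume "m - 1 < i"
  then show "coeff ?r i = 0" using r(2) by (cases "i = m") auto
  qed
  moreover have "pover A ?r" using r(1) by (intro pover_intros A) auto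
  ultimately have "C (m - 1) ?r s" using s by (simp add: C_def)
  then show False using m(2)[of "m - 1"] False by auto
  qed
  have mn: "m < n"
  proof (rule ccontr)
  assume "~ m < n"
  then obtain k s' t where st: "pover A s'" "pover A t" "Polynomial.smult (coeff p n ^ k) r = p * s' + t"
  "\<forall>i\<ge>n. coeff t i = 0" using pseudo_division[OF A p(1,2) r(1,2)] by auto
  have e: "poly t u = coeff p n ^ k * poly r u - poly p u * poly s' u"
  using arg_cong[OF st(3), of "%q. poly q u"] by simp
  have ps: "poly p u * poly s' u \<in> P" by (intro ideal_in_mult2[OF I] p polyB st)
  have a: "coeff p n ^ k \<in> adj A u" by (intro AB subring_power[OF A]) (use p in auto)
  have "coeff p n ^ k * poly r u \<notin> P"
  by (intro prime_mult a polyB r power_notin AB) (use p in auto)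
  then have "poly t u \<notin> P" using ideal_in_add[OF I _ ps] unfolding e by force
  moreover have "poly t u - poly (Polynomial.smult (coeff p n ^ k) s) u * b
  = coeff p n ^ k * (poly r u - poly s u * b) - poly p u * poly s' u"
  unfolding e by (simp add: algebra_simps)
  then have "poly t u - poly (Polynomial.smult (coeff p n ^ k) s) u * b \<in> P"
  using ideal_in_diff[OF B I ideal_in_mult[OF I a rs] ps] by simp
  moreover have "pover A (Polynomial.smult (coeff p n ^ k) s)"
  by (intro pover_smult[OF A] subring_power[OF A] s) (use p in auto)
  moreover have "\<forall>i>n-1. coeff t i = 0" using st(4) by auto
  ultimately have "C (n - 1) t (Polynomial.smult (coeff p n ^ k) s)" using st(2) by (simp add: C_def)
  then show False using m(2)[of "n - 1"] \<open>~ m < n\<close> n_pos by auto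
  qed
  obtain k s' t where st: "pover A s'" "pover A t" "Polynomial.smult (coeff r m ^ k) p = r * s' + t"
  "\<forall>i\<ge>m. coeff t i = 0" "\<forall>i>n-m. coeff s' i = 0"
  using pseudo_division[OF A r(1,2) p(1,2)] mn by auto
  have e: "poly t u = coeff r m ^ k * poly p u - poly r u * poly s' u"
  using arg_cong[OF st(3), of "%q. poly q u"] by simp
  have pP: "coeff r m ^ k * poly p u \<in> P"
  by (intro ideal_in_mult[OF I] p AB subring_power[OF A]) (use r in auto)
  \<comment> \<open>Otherwise the value of the remainder \<open>t\<close> would be a multiple of
    \<open>b\<close> belonging to a smaller degree.\<close>
  have tP: "poly t u \<in> P"
  proof (rule ccontr)
  assume t: "poly t u \<notin> P"
  have "poly t u - poly (- (s * s')) u * b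
  = coeff r m ^ k * poly p u - poly s' u * (poly r u - poly s u * b)"
  unfolding e by (simp add: algebra_simps)
  then have "poly t u - poly (- (s * s')) u * b \<in> P"
  using ideal_in_diff[OF B I pP ideal_in_mult[OF I polyB[OF st(1)] rs]] by simp
  moreover have "pover A (- (s * s'))" by (intro pover_uminus[OF A] pover_mult[OF A] s st)
  moreover have "\<forall>i>m-1. coeff t i = 0" using st(4) by auto
  ultimately have "C (m - 1) t (- (s * s'))" using st(2) t by (simp add: C_def)
  then show False using m(2)[of "m - 1"] False by auto
  qed
  have "poly r u * poly s' u \<in> P" using ideal_in_diff[OF B I pP tP] e by simp
  then have "poly s' u \<in> P" using prime_mult[OF polyB[OF r(1)] polyB[OF st(1)]] r(3) by blast
  then have s'P: "ALL i. coeff s' i \<in> P" using minimal[OF st(1)] st(5) False n_pos by auto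
  \<comment> \<open>All coefficients of the quotient are in \<open>P\<close>, so comparing
    coefficients of degree \<open>n\<close> puts a product of elements outside \<open>P\<close> into
    \<open>P\<close>.\<close>
  have "coeff r m ^ k * coeff p n = coeff (r * s') n"
  using arg_cong[OF st(3), of "%q. coeff q n"] st(4) mn by simp
  also have "\<dots> \<in> P" unfolding coeff_mult
  by (intro ideal_in_sum[OF I] ideal_in_mult[OF I] AB) (use r s'P in auto)
  finally have "coeff r m ^ k * coeff p n \<in> P" .
  moreover have "coeff r m ^ k * coeff p n \<notin> P"
  by (intro prime_mult power_notin AB subring_power[OF A] lc p) (use r p in auto)
  ultimately show ?thesis by blast
 qed
qed

lemma step:
 assumes b: "!!i::nat. b i \<in> adj A u - P"
 shows "EX a. (\<forall>i::nat. a i \<in> A - P) & (ALL \<phi>. is_hom A P \<phi> --> (ALL i. \<phi> (a i) ~= 0) -->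
  (EX \<psi>. extends_from A (adj A u) P \<phi> \<psi> & (ALL i. \<psi> (b i) ~= 0)))"
proof -
 \<comment> \<open>The derivative of \<open>p\<close>. Its value at \<open>u\<close> is outside
   \<open>P\<close> by minimality and characteristic zero, so a generic root of the specialised
   polynomial is simple.\<close>
 define q0 where "q0 = (\<Sum>i<n. monom (of_nat (Suc i) * coeff p (Suc i)) i)"
 have cq0: "coeff q0 i = of_nat (Suc i) * coeff p (Suc i)" for i
  using p(2) by (cases "i < n") (auto simp: q0_def coeff_sum coeff_monom if_distrib sum.delta simp del: of_nat_Suc cong: if_cong)
 have q0A: "pover A q0" unfolding cq0 using p(1) subring_mult[OF A subring_of_nat[OF A]] by blast
 have q0P: "poly q0 u \<notin> P"
 proof
  assume "poly q0 u \<in> P"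
  then have "ALL i. coeff q0 i \<in> P" using minimal[OF q0A] p(2) by (auto simp: cq0)
  then have "coeff q0 (n - 1) \<in> P" by blast
  then have "of_nat n * coeff p n \<in> P" using n_pos by (simp add: cq0)
  moreover have "of_nat n * coeff p n \<notin> P"
  using ch n_pos p by (intro prime_mult AB subring_of_nat[OF A]) auto
  ultimately show False by blast
 qed
 \<comment> \<open>The derivative joins the elements to be kept nonzero. In the same way the leading
   coefficient of \<open>p\<close> joins the list \<open>a\<close> below, so that specialisation
   does not lower the degree.\<close>
 define b' where "b' i = (case i of 0 => poly q0 u | Suc j => b j)" for i
 have "b' i \<in> adj A u & b' i \<notin> P" for i
  using b q0P polyB[OF q0A] by (auto simp: b'_def split: nat.splits)
 then have "ALL i. EX a s. a \<in> A & a \<notin> P & pover A s & a - poly s u * b' i \<in> P" using bezout by blast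
 then obtain a' s where a': "!!i. a' i \<in> A" "!!i. a' i \<notin> P" "!!i. pover A (s i)"
  "!!i. a' i - poly (s i) u * b' i \<in> P" by metis
 define a where "a i = (case i of 0 => coeff p n | Suc j => a' j)" for i
 have aA: "a i \<in> A - P" for i using a' p by (auto simp: a_def split: nat.splits)
 have "EX \<psi>. extends_from A (adj A u) P \<phi> \<psi> & (ALL i. \<psi> (b i) ~= 0)"
  if hom: "is_hom A P \<phi>" and nz: "ALL i. \<phi> (a i) ~= 0" for \<phi>
 proof -
  note cm = coeff_map_hom[OF A P0 hom]
  have a0: "\<phi> (coeff p n) ~= 0" using nz[rule_format, of 0] by (simp add: a_def)
  have a1: "\<phi> (a' i) ~= 0" for i using nz[rule_format, of "Suc i"] by (simp add: a_def)
  have "n \<le> degree (map_poly \<phi> p)" by (rule le_degree) (simp add: cm a0)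
  then have "~ constant (poly (map_poly \<phi> p))" using n_pos by (simp add: constant_degree)
  then obtain c where c: "poly (map_poly \<phi> p) c = 0" using fundamental_theorem_of_algebra by blast
  \<comment> \<open>Up to a power of the leading coefficient, every relation of \<open>u\<close>
    modulo \<open>P\<close> is a multiple of \<open>p\<close> plus a polynomial with coefficients in
    \<open>P\<close>. Hence the conditions on the root and on the velocity reduce to those for
    \<open>p\<close>.\<close>
  have red: "EX k s t. pover A s & pover A t & [:coeff p n ^ k:] * q = p * s + t & (ALL i. coeff t i \<in> P)"
  if q: "pover A q" "poly q u \<in> P" for q
  proof -
  obtain k s t where st: "pover A s" "pover A t" "Polynomial.smult (coeff p n ^ k) q = p * s + t"
  "\<forall>i\<ge>n. coeff t i = 0"
  using pseudo_division[OF A p(1,2) q(1), of "max n (degree q)"] by (auto simp: coeff_eq_0)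
  have "poly t u = coeff p n ^ k * poly q u - poly p u * poly s u"
  using arg_cong[OF st(3), of "%q. poly q u"] by simp
  moreover have "coeff p n ^ k * poly q u \<in> P"
  by (intro ideal_in_mult[OF I] q AB subring_power[OF A]) (use p in auto)
  ultimately have "poly t u \<in> P"
  using ideal_in_diff[OF B I _ ideal_in_mult2[OF I polyB[OF st(1)] p(4)]] by simp
  then have "ALL i. coeff t i \<in> P" using minimal[OF st(2,4)] by blast
  with st show ?thesis by auto
  qed
  have k0: "pover A [:coeff p n ^ k:]" for k
  by (intro pover_pCons[OF A] pover_0[OF A] subring_power[OF A]) (use p in auto)
  have z: "poly (map_poly \<phi> q) c = 0" if q: "pover A q" "poly q u \<in> P" for q
  proof -
  obtain k s t where st: "pover A s" "pover A t" "[:coeff p n ^ k:] * q = p * s + t" "ALL i. coeff t i \<in> P"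
  using red[OF q] by blast
  have "map_poly \<phi> t = 0" using st(2,4) hom by (auto simp: poly_eq_iff cm is_hom_def)
  then have "[:\<phi> (coeff p n ^ k):] * map_poly \<phi> q = map_poly \<phi> p * map_poly \<phi> s"
  using arg_cong[OF st(3), of "map_poly \<phi>"]
  by (simp only: map_hom_mult[OF A P0 hom k0 q(1)] map_hom_mult[OF A P0 hom p(1) st(1)]
  map_hom_add[OF A P0 hom pover_mult[OF A p(1) st(1)] st(2)] map_hom_const[OF A P0 hom]) simp
  from arg_cong[OF this, of "%q. poly q c"] c have "\<phi> (coeff p n ^ k) * poly (map_poly \<phi> q) c = 0" by simp
  then show ?thesis using a0 p(1) by (simp add: hom_power[OF A P0 hom])
  qed
  obtain \<psi> where \<psi>: "is_hom (adj A u) P \<psi>" "!!q. pover A q ==> \<psi> (poly q u) = poly (map_poly \<phi> q) c"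
  "!!x. x \<in> A ==> \<psi> x = \<phi> x" using hom_extend[OF A P0 hom z] by auto
  have nzb: "\<psi> (b' i) ~= 0" for i
  proof
  assume z: "\<psi> (b' i) = 0"
  have bB: "b' i \<in> adj A u" using b polyB[OF q0A] by (auto simp: b'_def split: nat.splits)
  have sB: "poly (s i) u * b' i \<in> adj A u" by (intro subring_mult[OF B] polyB a' bB)
  have "\<psi> (a' i - poly (s i) u * b' i) = 0"
  using \<psi>(1) a'(4)[of i] subring_diff[OF B AB[OF a'(1)[of i]] sB] by (auto simp: is_hom_def)
  then have "\<psi> (a' i) = \<psi> (poly (s i) u) * \<psi> (b' i)"
  using hom_diff[OF B P0 \<psi>(1) AB[OF a'(1)[of i]] sB] hom_mult[OF B P0 \<psi>(1) polyB[OF a'(3)[of i]] bB] by simp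
  then show False using a1[of i] z \<psi>(3)[OF a'(1)[of i]] by simp
  qed
  have "pderiv (map_poly \<phi> p) = map_poly \<phi> q0"
  proof (rule poly_eqI)
  fix i
  have on: "\<phi> (of_nat k) = of_nat k" for k
  by (induction k) (use hom_0[OF A P0 hom] hom_1[OF A P0 hom] hom_add[OF A P0 hom subring_1[OF A] subring_of_nat[OF A]] in auto)
  have "\<phi> (of_nat (Suc i) * coeff p (Suc i)) = of_nat (Suc i) * \<phi> (coeff p (Suc i))"
  using hom_mult[OF A P0 hom subring_of_nat[OF A, of "Suc i"], of "coeff p (Suc i)"] p(1) on by metis
  then show "coeff (pderiv (map_poly \<phi> p)) i = coeff (map_poly \<phi> q0) i"
  by (simp only: coeff_pderiv cm cq0)
  qed
  then have nz0: "poly (pderiv (map_poly \<phi> p)) c ~= 0"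
  using nzb[of 0] \<psi>(2)[OF q0A] by (simp add: b'_def)
  have "EX d'. is_der (adj A u) P \<psi> d' & (ALL x:A. d' x = d x)" if der: "is_der A P \<phi> d" for d
  \<comment> \<open>The velocity comes from implicit differentiation of \<open>p\<close> at its
    simple root \<open>c\<close>.\<close>
  proof (rule der_extend[OF A P0 hom der \<psi>(2),
  where v = "- poly (map_poly d p) c / poly (pderiv (map_poly \<phi> p)) c"])
  let ?v = "- poly (map_poly d p) c / poly (pderiv (map_poly \<phi> p)) c"
  note ed = ext_der_def[OF A P0 hom der]
  have p0: "ext_der \<phi> d c ?v p = 0" using nz0 by (simp add: ed)
  fix q assume q: "pover A q" "poly q u \<in> P"
  obtain k s t where st: "pover A s" "pover A t" "[:coeff p n ^ k:] * q = p * s + t" "ALL i. coeff t i \<in> P"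
  using red[OF q] by blast
  have "map_poly \<phi> t = 0" using st(2,4) hom by (auto simp: poly_eq_iff cm is_hom_def)
  moreover have "map_poly d t = 0"
  using st(2,4) der by (auto simp: poly_eq_iff coeff_map_der[OF A P0 hom der] is_der_def)
  ultimately have t0: "ext_der \<phi> d c ?v t = 0" by (simp add: ed)
  have "ext_der \<phi> d c ?v ([:coeff p n ^ k:] * q) = ext_der \<phi> d c ?v (p * s + t)" using st(3) by simp
  then have "\<phi> (coeff p n ^ k) * ext_der \<phi> d c ?v q = 0"
  using p0 t0 c z[OF q]
  by (simp only: ext_der_mult[OF A P0 hom der k0 q(1)]
  ext_der_add[OF A P0 hom der pover_mult[OF A p(1) st(1)] st(2)]
  ext_der_mult[OF A P0 hom der p(1) st(1)] map_hom_const[OF A P0 hom]) simp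
  then show "ext_der \<phi> d c ?v q = 0" using a0 p(1) by (simp add: hom_power[OF A P0 hom])
  qed auto
  then have "extends_from A (adj A u) P \<phi> \<psi>" using \<psi> by (auto simp: extends_from_def)
  moreover have "\<psi> (b i) ~= 0" for i using nzb[of "Suc i"] by (simp add: b'_def)
  ultimately show ?thesis by blast
 qed
 with aA show ?thesis by blast
qed

end

lemma extension_step:
 fixes A P :: "'a::comm_ring_1 set"
 assumes A: "is_subring A" and P: "prime_in (adj A u) P" and ch: "char0 P"
  and b: "!!n::nat. b n \<in> adj A u - P"
 shows "EX a. (\<forall>n::nat. a n \<in> A - P) & (ALL \<phi>. is_hom A P \<phi> --> (ALL n. \<phi> (a n) ~= 0) -->
  (EX \<psi>. extends_from A (adj A u) P \<phi> \<psi> & (ALL n. \<psi> (b n) ~= 0)))"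
proof (cases "ALL q. pover A q --> poly q u \<in> P --> (ALL i. coeff q i \<in> P)")
 case True
 then show ?thesis by (intro extension_step_transcendental[OF A P] b) blast
next
 case False
 define C where "C n \<longleftrightarrow> (EX p. pover A p & (\<forall>i>n. coeff p i = 0) & coeff p n \<notin> P & poly p u \<in> P)" for n
 note I = prime_in_ideal[OF P] and B = adj_subring[OF A, of u]
 obtain q where q: "pover A q" "poly q u \<in> P" "~ (ALL i. coeff q i \<in> P)" using False by blast
 obtain k p where kp: "pover A p" "\<forall>i>k. coeff p i = 0" "coeff p k \<notin> P" "poly q u - poly p u \<in> P"
  using trim_poly[OF A B I adj_self[OF A] q(1) _ q(3), of "degree q"] by (auto simp: coeff_eq_0)
 have "poly p u \<in> P" using ideal_in_diff[OF B I q(2) kp(4)] by simp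
 then have "C k" using kp by (auto simp: C_def)
 then obtain n where n: "C n" "!!m. m < n ==> ~ C m" using exists_least_iff[of C] by blast
 then obtain p where p: "pover A p" "\<forall>i>n. coeff p i = 0" "coeff p n \<notin> P" "poly p u \<in> P" by (auto simp: C_def)
 interpret algebraic_step A P u n p
  using A P ch p n(2) unfolding algebraic_step_def C_def by blast
 show ?thesis by (rule step[OF b])
qed

text \<open>A point of the base off countably many hypersurfaces lifts, with all its tangent
  vectors, to a point at which the given countable family is nonzero. Induction along the generators
  works because each step trades a countable family for a countable family in the smaller
  ring.\<close>

theorem point_extension:
 fixes A P :: "'a::comm_ring_1 set"
 assumes A: "is_subring A" and "prime_in (adjs A us) P" and "char0 P"
  and "!!n::nat. b n \<in> adjs A us - P"
 shows "EX a. (\<forall>n::nat. a n \<in> A - P) & (ALL \<phi>. is_hom A P \<phi> --> (ALL n. \<phi> (a n) ~= 0) -->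
  (EX \<psi>. extends_from A (adjs A us) P \<phi> \<psi> & (ALL n. \<psi> (b n) ~= 0)))"
 using assms(2-4)
proof (induction us arbitrary: b P)
 case Nil
 then show ?case by (intro exI[of _ b]) (auto simp: extends_from_def)
next
 case (Cons u us)
 let ?B = "adjs A us"
 have B: "is_subring ?B" by (rule adjs_subring[OF A])
 have BC: "?B \<subseteq> adjs A (u # us)" using adj_base[OF B] by auto
 have AB: "A \<subseteq> ?B" using adjs_base[OF A] by blast
 have "EX a. (\<forall>n::nat. a n \<in> ?B - P) & (ALL \<phi>. is_hom ?B P \<phi> --> (ALL n. \<phi> (a n) ~= 0) -->
  (EX \<psi>. extends_from ?B (adj ?B u) P \<phi> \<psi> & (ALL n. \<psi> (b n) ~= 0)))"
  using Cons.prems by (intro extension_step[OF B]) auto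
 then obtain a where aa: "(\<forall>n::nat. a n \<in> ?B - P) & (ALL \<phi>. is_hom ?B P \<phi> --> (ALL n. \<phi> (a n) ~= 0) -->
  (EX \<psi>. extends_from ?B (adj ?B u) P \<phi> \<psi> & (ALL n. \<psi> (b n) ~= 0)))" ..
 note a = conjunct1[OF aa] and ext = conjunct2[OF aa]
 \<comment> \<open>The induction hypothesis speaks of a prime of the smaller ring, hence the
   intersection; the facts \<open>e\<close> show that points and tangent vectors do not notice the
   difference.\<close>
 have h1: "prime_in ?B (P \<inter> ?B)"
  using Cons.prems(1) BC B by (auto simp: prime_in_def ideal_in_def subset_iff subring_0 subring_add subring_mult)
 have h2: "char0 (P \<inter> ?B)" using Cons.prems(2) by blast
 have h3: "a n \<in> ?B - P \<inter> ?B" for n using a by blast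
 have "EX a'. (\<forall>n::nat. a' n \<in> A - P \<inter> ?B) & (ALL \<phi>. is_hom A (P \<inter> ?B) \<phi> --> (ALL n. \<phi> (a' n) ~= 0) -->
  (EX \<psi>. extends_from A ?B (P \<inter> ?B) \<phi> \<psi> & (ALL n. \<psi> (a n) ~= 0)))"
  by (rule Cons.IH[OF h1 h2 h3])
 then obtain a' where aa': "(\<forall>n::nat. a' n \<in> A - P \<inter> ?B) & (ALL \<phi>. is_hom A (P \<inter> ?B) \<phi> --> (ALL n. \<phi> (a' n) ~= 0) -->
  (EX \<psi>. extends_from A ?B (P \<inter> ?B) \<phi> \<psi> & (ALL n. \<psi> (a n) ~= 0)))" ..
 note a' = conjunct1[OF aa'] and ext' = conjunct2[OF aa']
 have ABP: "A \<inter> (P \<inter> ?B) = A \<inter> P" "?B \<inter> (P \<inter> ?B) = ?B \<inter> P" using AB by auto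
 have e: "is_hom A (P \<inter> ?B) \<phi> \<longleftrightarrow> is_hom A P \<phi>"
  "extends_from A ?B (P \<inter> ?B) \<phi> \<psi> \<longleftrightarrow> extends_from A ?B P \<phi> \<psi>" for \<phi> \<psi>
  by (simp_all only: extends_from_def is_hom_def is_der_def ABP)
 have "EX \<psi>. extends_from A (adjs A (u # us)) P \<phi> \<psi> & (ALL n. \<psi> (b n) ~= 0)"
  if "is_hom A P \<phi>" "ALL n. \<phi> (a' n) ~= 0" for \<phi>
 proof -
  have "is_hom A (P \<inter> ?B) \<phi>" using that e by blast
  then have "EX \<psi>. extends_from A ?B (P \<inter> ?B) \<phi> \<psi> & (ALL n. \<psi> (a n) ~= 0)"
  using mp[OF mp[OF spec[OF ext', of \<phi>]]] that(2) by simp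
  then obtain \<psi> where "extends_from A ?B (P \<inter> ?B) \<phi> \<psi> & (ALL n. \<psi> (a n) ~= 0)" ..
  then have \<psi>: "extends_from A ?B P \<phi> \<psi>" "ALL n. \<psi> (a n) ~= 0" using e by auto
  have "is_hom ?B P \<psi>" using \<psi>(1) by (simp add: extends_from_def)
  from mp[OF mp[OF spec[OF ext, of \<psi>] this] \<psi>(2)]
  obtain \<omega> where "extends_from ?B (adj ?B u) P \<psi> \<omega> & (ALL n. \<omega> (b n) ~= 0)" ..
  then have w: "extends_from ?B (adj ?B u) P \<psi> \<omega>" "ALL n. \<omega> (b n) ~= 0" by auto
  have "extends_from A (adjs A (u # us)) P \<phi> \<omega>"
  using extends_from_trans[OF \<psi>(1) w(1) AB] by simp
  then show ?thesis using w(2) by (intro exI[of _ \<omega>] conjI)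
 qed
 moreover have "a' n \<in> A - P" for n using a' AB by blast
 ultimately show ?case by (intro exI[of _ a'] conjI allI impI) auto
qed

section \<open>The algebra of polynomial functions on matrices\<close>

text \<open>A type of its own makes the polynomial functions an instance of
  \<open>comm_ring_1\<close>, to which the results on ideals and derivations apply.\<close>

typedef (overloaded) 'n pol = "mat_poly :: ('n::finite cmat => complex) set"
 morphisms ev Pol
 using mat_poly.const by blast

setup_lifting type_definition_pol

instantiation pol :: (finite) comm_ring_1
begin

lift_definition zero_pol :: "'a pol" is "%_. 0" by (rule mat_poly.const)
lift_definition one_pol :: "'a pol" is "%_. 1" by (rule mat_poly.const)
lift_definition plus_pol :: "'a pol => 'a pol => 'a pol" is "%p q A. p A + q A" by (rule mat_poly.add)
lift_definition times_pol :: "'a pol => 'a pol => 'a pol" is "%p q A. p A * q A" by (rule mat_poly.mult)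
lift_definition uminus_pol :: "'a pol => 'a pol" is "%p A. (-1) * p A"
 by (intro mat_poly.mult mat_poly.const)
lift_definition minus_pol :: "'a pol => 'a pol => 'a pol" is "%p q A. p A + (-1) * q A"
 by (intro mat_poly.add mat_poly.mult mat_poly.const)

instance
 by standard (transfer, force simp: algebra_simps fun_eq_iff)+

end

lift_definition Cst :: "complex => 'n::finite pol" is "%c A. c" by (rule mat_poly.const)
lift_definition Var :: "'n => 'n => 'n::finite pol" is "%i j A. A $ i $ j" by (rule mat_poly.coord)

lemma ev_simps [simp]:
 "ev 0 x = 0" "ev 1 x = 1" "ev (p + q) x = ev p x + ev q x" "ev (p * q) x = ev p x * ev q x"
 "ev (- p) x = - ev p x" "ev (p - q) x = ev p x - ev q x" "ev (Cst c) x = c" "ev (Var i j) x = x $ i $ j"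
 by (transfer, simp)+

lemma ev_sum [simp]: "ev (sum f S) x = (\<Sum>i\<in>S. ev (f i) x)"
 by (induction S rule: infinite_finite_induct) auto

lemma ev_prod [simp]: "ev (prod f S) x = (\<Prod>i\<in>S. ev (f i) x)"
 by (induction S rule: infinite_finite_induct) auto

lemma ev_power [simp]: "ev (p ^ n) x = ev p x ^ n"
 by (induction n) auto

lemma ev_of_nat [simp]: "ev (of_nat n) x = of_nat n"
 by (induction n) auto

lemma pol_eqI: "(!!x. ev p x = ev q x) ==> p = q"
 by (metis ev_inject ext)

lemma range_ev: "range ev = mat_poly"
 by (metis type_definition.Rep_range type_definition_pol)

lemma mat_poly_ev: "p \<in> mat_poly ==> EX q. p = ev q"
 using range_ev by blast

lemma ev_mat_poly [simp]: "ev p \<in> mat_poly"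
 by (rule ev)

lemma pol_induct [case_names Cst Var add mult]:
 assumes "!!c. P (Cst c)" "!!i j. P (Var i j)" "!!p q. P p ==> P q ==> P (p + q)"
  "!!p q. P p ==> P q ==> P (p * q)"
 shows "P p"
proof -
 have "ALL q. ev q = f --> P q" if "f \<in> mat_poly" for f
  using that
 proof (induction rule: mat_poly.induct)
  case (const c)
  then show ?case using assms(1)[of c] by (metis ev_simps(7) pol_eqI)
 next
  case (coord i j)
  then show ?case using assms(2)[of i j] by (metis ev_simps(8) pol_eqI)
 next
  case (add f g)
  obtain p where p: "f = ev p" using mat_poly_ev[OF add.hyps(1)] ..
  obtain q where q: "g = ev q" using mat_poly_ev[OF add.hyps(2)] ..
  note pq = p q
  have "r = p + q" if "ev r = (%A. f A + g A)" for r by (rule pol_eqI) (simp add: that pq)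
  then show ?case using add.IH(1)[rule_format, OF p[symmetric]] add.IH(2)[rule_format, OF q[symmetric]] assms(3)[of p q] by blast
 next
  case (mult f g)
  obtain p where p: "f = ev p" using mat_poly_ev[OF mult.hyps(1)] ..
  obtain q where q: "g = ev q" using mat_poly_ev[OF mult.hyps(2)] ..
  note pq = p q
  have "r = p * q" if "ev r = (%A. f A * g A)" for r by (rule pol_eqI) (simp add: that pq)
  then show ?case using mult.IH(1)[rule_format, OF p[symmetric]] mult.IH(2)[rule_format, OF q[symmetric]] assms(4)[of p q] by blast
 qed
 from this[OF ev_mat_poly[of p]] show ?thesis by blast
qed

lemma Cst_simps: "Cst (a + b) = Cst a + Cst b" "Cst (a * b) = Cst a * Cst b" "Cst 0 = 0" "Cst 1 = 1"
 "Cst (- a) = - Cst a"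
 by (auto intro!: pol_eqI)

lemma is_subring_Cst: "is_subring (range Cst)"
 by (auto simp: is_subring_def simp flip: Cst_simps)

lemma noetherian_Cst: "noetherian (range (Cst :: complex => 'n::finite pol))"
 unfolding noetherian_def
proof (intro allI impI)
 fix I :: "'n pol set" assume I: "ideal_in (range Cst) I"
 show "EX F. finite F & F \<subseteq> I & I = gen (range Cst) F"
 proof (cases "I = {0}")
  case True
  have "gen (range Cst) {} = {0 :: 'n pol}"
  using gen.cases gen.gen_0 by (metis (no_types, opaque_lifting) empty_iff subset_antisym subset_iff singletonD singletonI)
  with True show ?thesis by (intro exI[of _ "{}"]) auto
 next
  case False
  then obtain x where x: "x \<in> I" "x ~= 0" using ideal_in_0[OF I] by blast
  then obtain c where c: "x = Cst c" using ideal_in_sub[OF I] by blast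
  have c0: "c ~= 0" using x c Cst_simps(3) by metis
  have "I \<subseteq> gen (range Cst) {x}"
  proof
  fix y assume "y \<in> I"
  then obtain d where d: "y = Cst d" using ideal_in_sub[OF I] by blast
  have "Cst (d / c) * x + 0 \<in> gen (range Cst) {x}" by (intro gen.intros) auto
  moreover have "Cst (d / c) * x + 0 = y" using c0 by (simp add: c d flip: Cst_simps(2))
  ultimately show "y \<in> gen (range Cst) {x}" by simp
  qed
  moreover have "gen (range Cst) {x} \<subseteq> I" by (rule gen_sub[OF _ I]) (use x in auto)
  ultimately show ?thesis using x by (intro exI[of _ "{x}"]) auto
 qed
qed

lemma finite_generation: "EX us. adjs (range Cst) us = (UNIV :: 'n::finite pol set)"
proof -
 obtain us :: "'n pol list" where us: "set us = (%(i, j). Var i j) ` UNIV"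
  using finite_list[of "(%(i, j). Var i j) ` (UNIV :: ('n \<times> 'n) set)"] by auto
 let ?B = "adjs (range Cst) us"
 note B = adjs_subring[OF is_subring_Cst, of us]
 have "p \<in> ?B" for p
 proof (induction p rule: pol_induct)
  case (Cst c) then show ?case by (rule adjs_base[OF is_subring_Cst]) simp
 next
  case (Var i j)
  have "Var i j \<in> set us" unfolding us by (rule image_eqI[of _ _ "(i, j)"]) auto
  then show ?case by (rule adjs_self[OF is_subring_Cst])
 qed (auto intro: subring_add[OF B] subring_mult[OF B])
 then show ?thesis by blast
qed

lemma noetherian_pol: "noetherian (UNIV :: 'n::finite pol set)"
 using finite_generation noetherian_adjs[OF noetherian_Cst is_subring_Cst] by metis

section \<open>Directional derivatives\<close>

definition dirD :: "'n::finite pol => 'n cmat => 'n cmat => complex" where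
 "dirD p x v = deriv (%t. ev p (x + t *\<^sub>C v)) 0"

definition has_dd :: "('n::finite cmat => 'm::finite cmat) => 'n cmat => 'n cmat => 'm cmat => bool" where
 "has_dd f x v w \<longleftrightarrow> (ALL i j. ((%t. f (x + t *\<^sub>C v) $ i $ j) has_field_derivative w $ i $ j) (at 0))"

lemma cscale_nth [simp]: "(c *\<^sub>C A) $ i $ j = c * A $ i $ j"
 by (simp add: cscale_def)

lemma cscale_0_left [simp]: "0 *\<^sub>C A = 0"
 by (simp add: vec_eq_iff)

lemma has_dd_id: "has_dd (%x. x) x v v"
 by (auto simp: has_dd_def intro!: derivative_eq_intros)

lemma dirD_has: "((%t. ev p (x + t *\<^sub>C v)) has_field_derivative dirD p x v) (at 0)"
proof -
 have "EX d. ((%t. ev p (x + t *\<^sub>C v)) has_field_derivative d) (at 0)"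
 proof (induction p rule: pol_induct)
  case (Cst c) show ?case by (intro exI[of _ 0]) auto
 next
  case (Var i j) show ?case by (intro exI[of _ "v $ i $ j"]) (auto intro!: derivative_eq_intros)
 next
  case (add p q)
  then obtain d e where "((%t. ev p (x + t *\<^sub>C v)) has_field_derivative d) (at 0)"
  "((%t. ev q (x + t *\<^sub>C v)) has_field_derivative e) (at 0)" by (elim exE)
  from DERIV_add[OF this] show ?case by (auto intro: exI[of _ "d + e"])
 next
  case (mult p q)
  then obtain d e where "((%t. ev p (x + t *\<^sub>C v)) has_field_derivative d) (at 0)"
  "((%t. ev q (x + t *\<^sub>C v)) has_field_derivative e) (at 0)" by (elim exE)
  from DERIV_mult[OF this] show ?case unfolding ev_simps by (rule exI)
 qed
 then show ?thesis by (auto simp: dirD_def DERIV_deriv_iff_has_field_derivative)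
qed

lemma dirD_eqI: "((%t. ev p (x + t *\<^sub>C v)) has_field_derivative d) (at 0) ==> dirD p x v = d"
 using DERIV_unique dirD_has by blast

lemma dirD_simps [simp]:
 "dirD (Cst c) x v = 0" "dirD (Var i j) x v = v $ i $ j"
 "dirD (p + q) x v = dirD p x v + dirD q x v" "dirD (- p) x v = - dirD p x v"
 "dirD (p - q) x v = dirD p x v - dirD q x v"
 "dirD (p * q) x v = dirD p x v * ev q x + ev p x * dirD q x v"
 by (rule dirD_eqI; (rule DERIV_cong, (auto intro!: derivative_intros dirD_has; fail), simp))+

lemma dirD_chain:
 assumes "has_dd f x v w"
 shows "((%t. ev p (f (x + t *\<^sub>C v))) has_field_derivative dirD p (f x) w) (at 0)"
proof (induction p rule: pol_induct)
 case (Var i j) show ?case using assms by (simp add: has_dd_def)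
next
 case (add p q) then show ?case by (auto intro: DERIV_add)
next
 case (mult p q) from DERIV_mult[OF this] show ?case by (simp add: mult.commute)
qed auto

lemma dirD_0 [simp]: "dirD 0 x v = 0"
 using dirD_simps(1)[of 0] by (simp only: Cst_simps)

lemma dirD_1 [simp]: "dirD 1 x v = 0"
 using dirD_simps(1)[of 1] by (simp only: Cst_simps)

lemma dirD_sum: "dirD (sum f S) x v = (\<Sum>i\<in>S. dirD (f i) x v)"
 by (induction S rule: infinite_finite_induct) auto

lemma dirD_linear: "dirD p x (a *\<^sub>C v + b *\<^sub>C w) = a * dirD p x v + b * dirD p x w"
 by (induction p rule: pol_induct) (auto simp: algebra_simps)

lemma dirD_add: "dirD p x (v + w) = dirD p x v + dirD p x w"
 and dirD_scale: "dirD p x (a *\<^sub>C v) = a * dirD p x v"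
 using dirD_linear[of p x 1 v 1 w] dirD_linear[of p x a v 0 0] by auto

lemma dirD_zero_right [simp]: "dirD p x 0 = 0"
 using dirD_scale[of p x 0 0] by simp

lemma dirD_sum_right: "dirD p x (sum f S) = (\<Sum>i\<in>S. dirD p x (f i))"
 by (induction S rule: infinite_finite_induct) (auto simp: dirD_add)

lemma dirD_uminus: "dirD p x (- v) = - dirD p x v"
 using dirD_scale[of p x "-1" v] by simp

lemma dirD_diff: "dirD p x (v - w) = dirD p x v - dirD p x w"
 using dirD_add[of p x v "- w"] dirD_uminus[of p x w] by simp

section \<open>Polynomial maps and vector fields\<close>

definition pfun :: "('n::finite cmat => complex) => bool" where "pfun f \<longleftrightarrow> (EX p. ev p = f)"

definition pmap :: "('n::finite cmat => 'm::finite cmat) => bool" where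
 "pmap f \<longleftrightarrow> (ALL i j. pfun (%x. f x $ i $ j))"

lemma pfun_ev [simp]: "pfun (ev p)" by (auto simp: pfun_def)

lemma pfun_iff: "pfun f \<longleftrightarrow> f \<in> mat_poly"
 by (metis pfun_def ev_mat_poly mat_poly_ev)

lemma pfun_intros [simp, intro]:
 "pfun (%x. c)" "pfun (%x. x $ i $ j)" "pfun f ==> pfun g ==> pfun (%x. f x + g x)"
 "pfun f ==> pfun g ==> pfun (%x. f x * g x)"
 by (auto simp: pfun_iff intro: mat_poly.intros)

lemma pfun_uminus [simp, intro]: "pfun f ==> pfun (%x. - f x)"
 using pfun_intros(4)[OF pfun_intros(1)[of "-1"]] by simp

lemma pfun_diff [simp, intro]: "pfun f ==> pfun g ==> pfun (%x. f x - g x)"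
 using pfun_intros(3)[of f "%x. - g x"] by simp

lemma pfun_sum [intro]: "(!!i. i \<in> S ==> pfun (f i)) ==> pfun (%x. \<Sum>i\<in>S. f i x)"
 by (induction S rule: infinite_finite_induct) auto

lemma pfun_prod [intro]: "(!!i. i \<in> S ==> pfun (f i)) ==> pfun (%x. \<Prod>i\<in>S. f i x)"
 by (induction S rule: infinite_finite_induct) auto

lemma pfun_compose: assumes "pmap f" shows "pfun (%x. ev p (f x))"
proof (induction p rule: pol_induct)
 case (Var i j) then show ?case using assms by (simp add: pmap_def)
qed auto

lemma pfun_compose': "pmap f ==> pfun g ==> pfun (%x. g (f x))"
 using pfun_compose by (auto simp: pfun_def)

lemma pmap_const [simp, intro]: "pmap (%x. c)" and pmap_id [simp, intro]: "pmap (%x. x)"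
 by (auto simp: pmap_def)

lemma pmap_add [intro]: "pmap f ==> pmap g ==> pmap (%x. f x + g x)"
 and pmap_diff [intro]: "pmap f ==> pmap g ==> pmap (%x. f x - g x)"
 and pmap_uminus [intro]: "pmap f ==> pmap (%x. - f x)"
 and pmap_scale [intro]: "pfun a ==> pmap f ==> pmap (%x. a x *\<^sub>C f x)"
 by (auto simp: pmap_def)

lemma pmap_mult [intro]: "pmap f ==> pmap g ==> pmap (%x. f x ** g x)"
 by (auto simp: pmap_def matrix_matrix_mult_def)

lemma pmap_bracket [intro]: "pmap f ==> pmap g ==> pmap (%x. lie_bracket (f x) (g x))"
 unfolding lie_bracket_def by (intro pmap_diff pmap_mult)

lemma pmap_sum [intro]: "(!!i. i \<in> S ==> pmap (f i)) ==> pmap (%x. \<Sum>i\<in>S. f i x)"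
 by (induction S rule: infinite_finite_induct) auto

definition pcomp :: "'m::finite pol => ('n::finite cmat => 'm cmat) => 'n pol" where
 "pcomp p f = (SOME q. ev q = (%x. ev p (f x)))"

lemma ev_pcomp: "pmap f ==> ev (pcomp p f) x = ev p (f x)"
 using someI_ex[of "%q. ev q = (%x. ev p (f x))"] pfun_compose[of f p] by (simp add: pcomp_def pfun_def)

lemma dirD_pcomp: "pmap f ==> has_dd f x v w ==> dirD (pcomp p f) x v = dirD p (f x) w"
 by (rule dirD_eqI) (simp add: ev_pcomp dirD_chain)

lemma pmap_has_dd: assumes "pmap f" shows "EX w. has_dd f x v w"
proof -
 have "ALL i j. EX p. ev p = (%x. f x $ i $ j)" using assms by (auto simp: pmap_def pfun_def)
 then obtain p where p: "!!i j. ev (p i j) = (%x. f x $ i $ j)" by metis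
 have "has_dd f x v (\<chi> i j. dirD (p i j) x v)"
  unfolding has_dd_def using dirD_has[of "p _ _" x v] by (simp add: p)
 then show ?thesis by blast
qed

lemma has_dd_unique: "has_dd f x v w ==> has_dd f x v w' ==> w = w'"
 unfolding has_dd_def vec_eq_iff using DERIV_unique by blast

text \<open>The derivation given by the vector field \<open>w\<close>. The choice is unique because
  \<open>ev\<close> is injective, and possible when \<open>w\<close> is polynomial.\<close>

definition vf :: "('n::finite cmat => 'n cmat) => 'n pol => 'n pol" where
 "vf w p = (SOME q. ev q = (%x. dirD p x (w x)))"

lemma pfun_dirD: assumes "pmap w" shows "pfun (%x. dirD p x (w x))"
proof (induction p rule: pol_induct)
 case (Var i j) then show ?case using assms by (simp add: pmap_def)
qed auto

lemma ev_vf: "pmap w ==> ev (vf w p) x = dirD p x (w x)"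
 using someI_ex[of "%q. ev q = (%x. dirD p x (w x))"] pfun_dirD[of w p] by (simp add: vf_def pfun_def)

lemma derivation_vf: "pmap w ==> derivation (vf w)"
 unfolding derivation_def by (auto intro!: pol_eqI simp: ev_vf)

section \<open>Linear algebra of matrices\<close>

definition pairing :: "'n::finite cmat => 'n cmat => complex" where
 "pairing a v = (\<Sum>i\<in>UNIV. \<Sum>j\<in>UNIV. a $ i $ j * v $ i $ j)"

definition unit_mat :: "'n::finite => 'n => 'n cmat" where
 "unit_mat i j = (\<chi> k l. if k = i & l = j then 1 else 0)"

lemma unit_mat_nth: "unit_mat i j $ k $ l = (if k = i & l = j then 1 else 0)"
 by (simp add: unit_mat_def)

lemma sum_nth2: "sum f S $ i $ j = (\<Sum>x\<in>S. f x $ i $ j)"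
 by (simp add: sum_component)

lemma unit_mat_expand: "v = (\<Sum>(i, j)\<in>UNIV. (v $ i $ j) *\<^sub>C unit_mat i j)"
proof -
 have "(\<Sum>(i, j)\<in>UNIV. (v $ i $ j) *\<^sub>C unit_mat i j) $ k $ l = v $ k $ l" for k l
 proof -
  have "(\<Sum>(i, j)\<in>UNIV. (v $ i $ j) *\<^sub>C unit_mat i j) $ k $ l
  = (\<Sum>x\<in>UNIV. if x = (k, l) then v $ k $ l else 0)"
  unfolding sum_nth2 by (intro sum.cong) (auto simp: unit_mat_nth split: if_splits)
  then show ?thesis by (simp add: sum.delta)
 qed
 then show ?thesis by (simp add: vec_eq_iff)
qed

global_interpretation fcm: finite_dimensional_vector_space
 "cscale :: complex => 'n::finite cmat => 'n cmat" "range (%(i, j). unit_mat i j)"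
proof
 show "finite (range (%(i, j). unit_mat i j :: 'n cmat))" by simp
 show "cmat.span (range (%(i, j). unit_mat i j :: 'n cmat)) = UNIV"
 proof -
  have "v \<in> cmat.span (range (%(i, j). unit_mat i j))" for v :: "'n cmat"
  proof (subst unit_mat_expand, rule cmat.span_sum)
  fix x :: "'n \<times> 'n"
  have "unit_mat (fst x) (snd x) \<in> range (%(i, j). unit_mat i j :: 'n cmat)"
  by (rule image_eqI[of _ _ x]) (auto simp: case_prod_beta)
  then show "(case x of (i, j) => (v $ i $ j) *\<^sub>C unit_mat i j) \<in> cmat.span (range (%(i, j). unit_mat i j))"
  by (simp add: case_prod_beta cmat.span_scale cmat.span_base)
  qed
  then show ?thesis by blast
 qed
 show "cmat.independent (range (%(i, j). unit_mat i j :: 'n cmat))"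
 proof (rule cmat.independent_if_scalars_zero)
  fix c :: "'n cmat => complex" and x :: "'n cmat"
  assume s: "(\<Sum>x\<in>range (%(i, j). unit_mat i j). c x *\<^sub>C x) = 0"
  and x: "x \<in> range (%(i, j). unit_mat i j)"
  have inj: "inj (%(i, j). unit_mat i j :: 'n cmat)"
  proof (rule injI)
  fix a b :: "'n \<times> 'n"
  assume "(%(i, j). unit_mat i j :: 'n cmat) a = (%(i, j). unit_mat i j) b"
  then have "unit_mat (fst a) (snd a) $ fst a $ snd a = (unit_mat (fst b) (snd b) :: 'n cmat) $ fst a $ snd a"
  by (simp add: case_prod_beta)
  then show "a = b" by (simp add: unit_mat_nth prod_eq_iff split: if_splits)
  qed
  obtain k l :: 'n where kl: "x = unit_mat k l" using x by auto
  have "(\<Sum>x\<in>range (%(i, j). unit_mat i j). c x *\<^sub>C x) $ k $ l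
  = (\<Sum>y\<in>UNIV. c (unit_mat (fst y) (snd y)) * (unit_mat (fst y) (snd y) :: 'n cmat) $ k $ l)"
  unfolding sum_nth2 by (subst sum.reindex[OF inj]) (simp add: case_prod_beta)
  also have "\<dots> = (\<Sum>y\<in>UNIV. if y = (k, l) then c (unit_mat k l) else 0)"
  by (intro sum.cong) (auto simp: unit_mat_nth split: if_splits)
  also have "\<dots> = c x" by (simp add: sum.delta kl)
  finally show "c x = 0" using s by simp
 qed simp
qed

lemma vector_space_complex: "vector_space ((*) :: complex => complex => complex)"
 by unfold_locales (simp_all add: algebra_simps)

global_interpretation cfun: vector_space_pair
 "cscale :: complex => 'n::finite cmat => 'n cmat" "(*) :: complex => complex => complex"
 by unfold_locales (simp_all add: algebra_simps)

global_interpretation cend: finite_dimensional_vector_space_pair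
 "cscale :: complex => 'n::finite cmat => 'n cmat" "range (%(i, j). unit_mat i j)"
 "cscale :: complex => 'n::finite cmat => 'n cmat" "range (%(i, j). unit_mat i j)"
 by unfold_locales

abbreviation clin :: "('n::finite cmat => 'n cmat) => bool" where
 "clin \<equiv> Vector_Spaces.linear cscale cscale"

abbreviation cfunctional :: "('n::finite cmat => complex) => bool" where
 "cfunctional \<equiv> Vector_Spaces.linear cscale (*)"

lemma clin_iff: "clin f \<longleftrightarrow> (ALL x y. f (x + y) = f x + f y) & (ALL c x. f (c *\<^sub>C x) = c *\<^sub>C f x)"
 by (simp add: Vector_Spaces.linear_iff cmat.vector_space_axioms)

lemma cfunctional_iff: "cfunctional f \<longleftrightarrow> (ALL x y. f (x + y) = f x + f y) & (ALL c x. f (c *\<^sub>C x) = c * f x)"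
 by (simp add: Vector_Spaces.linear_iff cmat.vector_space_axioms vector_space_complex)

lemma cfunctional_sum: "cfunctional f ==> f (sum g S) = (\<Sum>i\<in>S. f (g i))"
 by (rule cfun.linear_sum)

lemma cfunctional_pairing: assumes "cfunctional f" shows "f v = pairing (\<chi> i j. f (unit_mat i j)) v"
proof -
 have "f v = (\<Sum>(i, j)\<in>UNIV. v $ i $ j * f (unit_mat i j))"
  using assms by (subst unit_mat_expand) (simp add: cfunctional_sum case_prod_beta cfunctional_iff)
 also have "\<dots> = pairing (\<chi> i j. f (unit_mat i j)) v"
  by (simp add: pairing_def sum.cartesian_product mult.commute)
 finally show ?thesis .
qed

lemma pairing_commute: "pairing a b = pairing b a"
 by (simp add: pairing_def mult.commute)

lemma separate_subspace:
 assumes "cmat.subspace U" "a \<notin> U"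
 obtains f where "cfunctional f" "!!u. u \<in> U ==> f u = 0" "f a = 1"
proof -
 obtain B where B: "B \<subseteq> U" "cmat.independent B" "U \<subseteq> cmat.span B" using cmat.maximal_independent_subset by blast
 have sB: "cmat.span B = U" using B assms(1) by (metis cmat.span_minimal subset_antisym)
 have aB: "a \<notin> B" using B(1) assms(2) by blast
 have "cmat.independent (insert a B)" using B(2) sB assms(2) cmat.independent_insert by metis
 from cfun.linear_independent_extend[OF this, of "%x. if x = a then 1 else 0"]
 obtain f where f: "cfunctional f" "ALL x:insert a B. f x = (if x = a then 1 else 0)" by blast
 have "f u = 0" if "u \<in> cmat.span B" for u
  by (rule cfun.linear_eq_0_on_span[OF f(1) _ that]) (use f(2) aB in auto)
 then show ?thesis using that[OF f(1)] sB f(2) by auto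
qed

lemma double_annihilator:
 assumes U: "cmat.subspace U" and a: "!!v. (!!u. u \<in> U ==> pairing u v = 0) ==> pairing a v = 0"
 shows "a \<in> U"
proof (rule ccontr)
 assume "a \<notin> U"
 then obtain f where f: "cfunctional f" "!!u. u \<in> U ==> f u = 0" "f a = 1" using separate_subspace[OF U] by blast
 have p: "pairing u (\<chi> i j. f (unit_mat i j)) = f u" for u
  using cfunctional_pairing[OF f(1), of u] pairing_commute[of u] by simp
 have "pairing a (\<chi> i j. f (unit_mat i j)) = 0" by (rule a) (simp add: p f(2))
 then show False using p f(3) by simp
qed

text \<open>The coordinate functionals are defined on the whole matrix space, so that they give
  polynomials in the matrix entries.\<close>

lemma dual_basis:
 assumes "V = cmat.span S"
 obtains B \<ll> where "finite B" "B \<subseteq> S" "cmat.independent B" "cmat.span B = V"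
  "!!b. b \<in> B ==> cfunctional (\<ll> b)" "!!b c. b \<in> B ==> c \<in> B ==> \<ll> b c = (if b = c then 1 else 0)"
  "!!v. v \<in> V ==> v = (\<Sum>b\<in>B. \<ll> b v *\<^sub>C b)"
proof -
 obtain B where B: "B \<subseteq> S" "cmat.independent B" "S \<subseteq> cmat.span B" using cmat.maximal_independent_subset by blast
 have fin: "finite B" using fcm.finiteI_independent[OF B(2)] .
 have span: "cmat.span B = V" unfolding assms using B by (metis cmat.span_eq cmat.span_superset subset_trans)
 have "EX f. cfunctional f & (ALL c:B. f c = (if b = c then 1 else 0))" for b
  using cfun.linear_independent_extend[OF B(2), of "%c. if b = c then 1 else 0"] .
 then obtain l where l: "!!b. cfunctional (l b)" "!!b c. c \<in> B ==> l b c = (if b = c then 1 else 0)" by metis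
 have expand: "v = (\<Sum>b\<in>B. l b v *\<^sub>C b)" if v: "v \<in> V" for v
 proof -
  obtain u where u: "v = (\<Sum>c\<in>B. u c *\<^sub>C c)" using v span cmat.span_finite[OF fin] by auto
  have "l b v = u b" if b: "b \<in> B" for b
  proof -
  have "l b v = (\<Sum>c\<in>B. u c * l b c)" unfolding u using l(1)[of b] by (simp add: cfunctional_sum cfunctional_iff)
  also have "\<dots> = (\<Sum>c\<in>B. if b = c then u b else 0)" by (intro sum.cong) (auto simp: l)
  also have "\<dots> = u b" using b fin by simp
  finally show ?thesis .
  qed
  then have "(\<Sum>b\<in>B. l b v *\<^sub>C b) = (\<Sum>b\<in>B. u b *\<^sub>C b)" by (intro sum.cong) auto
  then show ?thesis using u by simp
 qed
 show ?thesis by (rule that[OF fin B(1,2) span l(1) l(2) expand])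
qed

lemma injective_endo_surj:
 assumes V: "cmat.subspace V" and T: "clin T" "!!v. v \<in> V ==> T v \<in> V" "!!v. v \<in> V ==> T v = 0 ==> v = 0"
  and w: "w \<in> V"
 shows "EX v:V. T v = w"
proof -
 have "inj_on T (cmat.span V)"
 proof (rule inj_onI)
  fix x y assume "x \<in> cmat.span V" "y \<in> cmat.span V" and e: "T x = T y"
  then have xy: "x \<in> V" "y \<in> V" using V cmat.span_eq_iff by blast+
  have "T (x - y) = 0" using e cend.linear_diff[OF T(1)] by simp
  then show "x = y" using T(3)[of "x - y"] cmat.subspace_diff[OF V xy] by simp
 qed
 from cend.dim_image_eq[OF T(1) this] have "cmat.dim (T ` V) = cmat.dim V" .
 moreover have "cmat.subspace (T ` V)" by (rule cend.linear_subspace_image[OF T(1) V])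
 ultimately have "T ` V = V" using fcm.subspace_dim_equal[OF _ V, of "T ` V"] T(2) by force
 then show ?thesis using w by (metis imageE)
qed

section \<open>Ideals of germs along vector fields\<close>

definition maxid :: "'n::finite cmat => 'n pol set" where "maxid y = {p. ev p y = 0}"

lemma maxid_iff [simp]: "p \<in> maxid y \<longleftrightarrow> ev p y = 0" by (simp add: maxid_def)

lemma prime_maxid: "prime_in UNIV (maxid y)" and char0_maxid: "char0 (maxid y)"
 by (auto simp: prime_in_def ideal_in_def)

lemma ideal_maxid: "ideal_in UNIV (maxid y)" by (rule prime_in_ideal[OF prime_maxid])

text \<open>The elements vanish at \<open>y\<close> together with all iterated derivatives along
  \<Delta>: formally, along the leaf through \<open>y\<close>. For Hamiltonian fields this is the
  ideal J y of the overview.\<close>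

definition germ :: "('n::finite cmat => 'n cmat) set => 'n cmat => 'n pol set" where
 "germ \<Delta> y = core (vf ` \<Delta>) (maxid y)"

definition linear_part :: "'n::finite pol => 'n cmat => 'n pol" where
 "linear_part p y = (\<Sum>(i, j)\<in>UNIV. Cst (dirD p y (unit_mat i j)) * (Var i j - Cst (y $ i $ j)))"

lemma ev_linear_part: "ev (linear_part p y) x = dirD p y (x - y)"
proof -
 have "dirD p y (x - y) = (\<Sum>(i, j)\<in>UNIV. (x - y) $ i $ j * dirD p y (unit_mat i j))"
  by (subst unit_mat_expand) (simp add: dirD_sum_right case_prod_beta dirD_scale)
 then show ?thesis by (simp add: linear_part_def case_prod_beta mult.commute)
qed

lemma taylor: "mpow (maxid y) 2 (p - Cst (ev p y) - linear_part p y)"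
proof (induction p rule: pol_induct)
 case (Cst c)
 have "Cst c - Cst (ev (Cst c) y) - linear_part (Cst c) y = 0" by (rule pol_eqI) (simp add: ev_linear_part)
 then show ?case using mpow_zero by metis
next
 case (Var i j)
 have "Var i j - Cst (ev (Var i j) y) - linear_part (Var i j) y = 0" by (rule pol_eqI) (simp add: ev_linear_part)
 then show ?case using mpow_zero by metis
next
 case (add p q)
 have "p + q - Cst (ev (p + q) y) - linear_part (p + q) y
  = (p - Cst (ev p y) - linear_part p y) + (q - Cst (ev q y) - linear_part q y)"
  by (rule pol_eqI) (simp add: ev_linear_part)
 then show ?case using mpow_add[OF add] by (simp only:)
next
 case (mult p q)
 have "p * q - Cst (ev (p * q) y) - linear_part (p * q) y
  = (p - Cst (ev p y)) * (q - Cst (ev q y)) + (Cst (ev p y) * (q - Cst (ev q y) - linear_part q y)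
  + Cst (ev q y) * (p - Cst (ev p y) - linear_part p y))"
  by (rule pol_eqI) (simp add: ev_linear_part algebra_simps)
 moreover have "mpow (maxid y) (1 + 1) ((p - Cst (ev p y)) * (q - Cst (ev q y)))"
  using mpow_Suc[OF _ mpow_0[of "maxid y" 1]] by (intro mpow_mult) (simp_all add: maxid_def)
 ultimately show ?case
  using mpow_add[OF _ mpow_add[OF mpow_scale[OF mult(2)] mpow_scale[OF mult(1)]]] by (simp only: one_add_one)
qed

lemma mpow2_I: "ev p y = 0 ==> (!!v. dirD p y v = 0) ==> mpow (maxid y) 2 p"
proof -
 assume "ev p y = 0" "!!v. dirD p y v = 0"
 then have "p - Cst (ev p y) - linear_part p y = p" by (intro pol_eqI) (simp add: ev_linear_part)
 then show ?thesis using taylor[of y p] by (simp only:)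
qed

text \<open>The last assumption says that the Zariski tangent space of \<open>I\<close> at
  \<open>y\<close> is spanned by values of the fields. The locale is used for the group with
  right-invariant fields and for orbit slices with Hamiltonian fields.\<close>

locale germ_setup =
 fixes \<Delta> :: "('n::finite cmat => 'n cmat) set" and I :: "'n pol set" and y :: "'n cmat"
 assumes pm: "!!w. w \<in> \<Delta> ==> pmap w" and I: "ideal_in UNIV I"
  and stable: "!!w p. w \<in> \<Delta> ==> p \<in> I ==> vf w p \<in> I"
  and zero: "!!p. p \<in> I ==> ev p y = 0"
  and tangent: "!!v. (!!p. p \<in> I ==> dirD p y v = 0) ==> v \<in> cmat.span ((%w. w y) ` \<Delta>)"
begin

abbreviation "m \<equiv> maxid y"
abbreviation "J \<equiv> germ \<Delta> y"

lemma prime_germ: "prime_in UNIV J"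
 unfolding germ_def by (intro prime_core prime_maxid char0_maxid) (auto intro: derivation_vf pm)

lemma germ_sub: "J \<subseteq> m" unfolding germ_def by (rule core_sub)

lemma I_germ: "I \<subseteq> J"
 unfolding germ_def by (rule core_greatest) (use zero stable in auto)

lemma germ_stable: "p \<in> J ==> w \<in> \<Delta> ==> vf w p \<in> J"
 unfolding germ_def by (rule core_closed) auto

text \<open>\<open>S k\<close> is the sum of \<open>I\<close> and the k-th power of the maximal
  ideal of \<open>y\<close>; Krull's theorem applies to the intersection of all of them.\<close>

definition S :: "nat => 'n pol set" where "S k = {x. EX c. mpow m k c & x - c \<in> I}"

lemma SI: "mpow m k c ==> x - c \<in> I ==> x \<in> S k" by (auto simp: S_def)

lemma S_mpow: "mpow m k c ==> c \<in> S k" using ideal_in_0[OF I] by (intro SI) auto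

lemma S_I: "x \<in> I ==> x \<in> S k" using mpow_zero by (intro SI[of k 0]) auto

lemma S_add: assumes "x \<in> S k" "z \<in> S k" shows "x + z \<in> S k"
proof -
 obtain c where c: "mpow m k c" "x - c \<in> I" using assms(1) unfolding S_def by blast
 obtain d where d: "mpow m k d" "z - d \<in> I" using assms(2) unfolding S_def by blast
 have e: "x + z - (c + d) = (x - c) + (z - d)" by simp
 have "x + z - (c + d) \<in> I" unfolding e by (rule ideal_in_add[OF I c(2) d(2)])
 then show ?thesis by (rule SI[OF mpow_add[OF c(1) d(1)]])
qed

lemma S_mult: assumes "mpow m j a" "x \<in> S k" shows "a * x \<in> S (j + k)"
proof -
 obtain c where c: "mpow m k c" "x - c \<in> I" using assms(2) unfolding S_def by blast
 have "a * x - a * c \<in> I" using ideal_in_mult[OF I _ c(2), of a] by (simp add: right_diff_distrib)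
 then show ?thesis using mpow_mult[OF assms(1) c(1)] by (intro SI) auto
qed

lemma S_scale: "x \<in> S k ==> a * x \<in> S k" using S_mult[OF mpow_0[of m a], of x k] by simp

lemma S_sum: "(!!i. i \<in> T ==> f i \<in> S k) ==> sum f T \<in> S k"
 by (induction T rule: infinite_finite_induct) (auto intro: S_add S_I ideal_in_0[OF I])

lemma S_minus: "x \<in> S k ==> - x \<in> S k" using S_scale[of x k "-1"] by simp

text \<open>Choose vector fields \<open>w b\<close> whose values at \<open>y\<close> form a basis of the tangent space, with dual
 coordinates \<open>t b\<close>. Then \<open>\<Sum>b. t b * w b\<close> acts on the cotangent space at \<open>y\<close> as the identity.\<close>

lemma cotangent:
 obtains B :: "'n cmat set" and w t where "finite B" "!!b. b \<in> B ==> w b \<in> \<Delta>" "!!b. b \<in> B ==> t b \<in> m"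
  "!!u. u \<in> m ==> u - (\<Sum>b\<in>B. t b * vf (w b) u) \<in> S 2"
proof -
 define V where "V = cmat.span ((%w. w y) ` \<Delta>)"
 obtain B l where B: "finite B" "B \<subseteq> (%w. w y) ` \<Delta>" "cmat.independent B" "cmat.span B = V"
  "!!b. b \<in> B ==> cfunctional (l b)" "!!b c. b \<in> B ==> c \<in> B ==> l b c = (if b = c then 1 else 0)"
  "!!v. v \<in> V ==> v = (\<Sum>b\<in>B. l b v *\<^sub>C b)" by (rule dual_basis[OF V_def]) blast
 have "ALL b:B. EX w:\<Delta>. w y = b" using B(2) by blast
 then obtain w where w: "!!b. b \<in> B ==> w b \<in> \<Delta>" "!!b. b \<in> B ==> w b y = b" by metis
 define t where "t b = (\<Sum>(i, j)\<in>UNIV. Cst (l b (unit_mat i j)) * (Var i j - Cst (y $ i $ j)))" for b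
 have tm: "t b \<in> m" for b by (simp add: t_def case_prod_beta)
 have dt: "dirD (t b) y v = l b v" if "b \<in> B" for b v
 proof -
  have "l b v = (\<Sum>(i, j)\<in>UNIV. v $ i $ j * l b (unit_mat i j))"
  using B(5)[OF that] by (subst unit_mat_expand) (simp add: cfunctional_sum case_prod_beta cfunctional_iff)
  then show ?thesis by (simp add: t_def dirD_sum case_prod_beta mult.commute)
 qed
 have main: "u - (\<Sum>b\<in>B. t b * vf (w b) u) \<in> S 2" if u: "u \<in> m" for u
 proof -
  let ?g = "u - (\<Sum>b\<in>B. t b * vf (w b) u)"
  have et: "ev (t b) y = 0" for b using tm by simp
  have dg: "dirD ?g y v = dirD u y v - (\<Sum>b\<in>B. l b v * dirD u y b)" for v
  using et w by (simp add: dirD_sum dt ev_vf pm cong: sum.cong)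
  have vanish: "dirD ?g y v = 0" if v: "v \<in> V" for v
  proof -
  have "dirD u y v = dirD u y (\<Sum>b\<in>B. l b v *\<^sub>C b)" using B(7)[OF v] by simp
  then show ?thesis unfolding dg by (simp add: dirD_sum_right dirD_scale)
  qed
  define grad where "grad p = (\<chi> i j. dirD p y (unit_mat i j))" for p
  have pg: "pairing (grad p) v = dirD p y v" for p v
  proof -
  have "cfunctional (dirD p y)" by (simp add: cfunctional_iff dirD_add dirD_scale)
  from cfunctional_pairing[OF this, of v] show ?thesis by (simp add: grad_def)
  qed
  have "cmat.subspace (grad ` I)"
  unfolding cmat.subspace_def
  proof (intro conjI ballI allI)
  show "0 \<in> grad ` I" by (rule image_eqI[OF _ ideal_in_0[OF I]]) (simp add: grad_def vec_eq_iff)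
  fix a b assume "a \<in> grad ` I" "b \<in> grad ` I"
  then obtain p q where pq: "p \<in> I" "q \<in> I" "a = grad p" "b = grad q" by blast
  show "a + b \<in> grad ` I"
  by (rule image_eqI[OF _ ideal_in_add[OF I pq(1,2)]]) (simp add: pq grad_def vec_eq_iff)
  next
  fix c a assume "a \<in> grad ` I"
  then obtain p where p: "p \<in> I" "a = grad p" by blast
  show "c *\<^sub>C a \<in> grad ` I"
  by (rule image_eqI[OF _ ideal_in_mult[OF I UNIV_I p(1), of "Cst c"]]) (simp add: p grad_def vec_eq_iff)
  qed
  \<comment> \<open>The differential of \<open>?g\<close> at \<open>y\<close> annihilates the
    tangent space of \<open>I\<close>, so by duality it is the differential of some \<open>p\<close>
    in \<open>I\<close>; subtracting \<open>p\<close> leaves an element of the square of the maximal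
    ideal.\<close>
  then have "grad ?g \<in> grad ` I"
  proof (rule double_annihilator)
  fix v assume a: "!!u. u \<in> grad ` I ==> pairing u v = 0"
  have "dirD p y v = 0" if "p \<in> I" for p using a[of "grad p"] pg[of p v] that by simp
  then have "v \<in> V" unfolding V_def by (rule tangent)
  then show "pairing (grad ?g) v = 0" unfolding pg by (rule vanish)
  qed
  then obtain p where p: "p \<in> I" "grad ?g = grad p" by blast
  have "mpow m 2 (?g - p)"
  proof (rule mpow2_I)
  show "ev (?g - p) y = 0" using u zero[OF p(1)] et by simp
  show "dirD (?g - p) y v = 0" for v using pg[of ?g v] pg[of p v] p(2) by simp
  qed
  then show ?thesis by (rule SI) (use p(1) in simp)
 qed
 have tm': "t b \<in> m" if "b \<in> B" for b by (rule tm)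
 show ?thesis by (rule that[of B w t]; fact)
qed

text \<open>Euler's formula \<open>\<Sum>b. t b * w b (c) = k * c\<close> for homogeneous forms \<open>c\<close> of degree \<open>k\<close> shows
 inductively that an element all of whose iterated derivatives vanish at \<open>y\<close> lies in \<open>I + m\<^sup>k\<close>.\<close>

lemma germ_S: "\<phi> \<in> J ==> \<phi> \<in> S k"
proof -
 obtain B :: "'n cmat set" and w t where B: "finite B" "!!b. b \<in> B ==> w b \<in> \<Delta>" "!!b. b \<in> B ==> t b \<in> m"
  and id: "!!u. u \<in> m ==> u - (\<Sum>b\<in>B. t b * vf (w b) u) \<in> S 2" by (rule cotangent) blast
 have der: "derivation (vf (w b))" if "b \<in> B" for b using derivation_vf pm B(2) that by blast
 have t1: "mpow m 1 (t b)" if "b \<in> B" for b using mpow_Suc[OF B(3)[OF that] mpow_0[of m 1]] by simp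
 have euler: "of_nat k * c - (\<Sum>b\<in>B. t b * vf (w b) c) \<in> S (Suc k)" if "mpow m k c" for k c
  using that
 proof (induction rule: mpow.induct)
  case (mpow_0 a)
  have "t b * vf (w b) a \<in> S 1" if "b \<in> B" for b
  using S_mult[OF t1[OF that] S_mpow[OF mpow.mpow_0], of "vf (w b) a"] by simp
  then have "- (\<Sum>b\<in>B. t b * vf (w b) a) \<in> S 1" by (intro S_minus S_sum)
  then show ?case by simp
 next
  case (mpow_Suc a k c)
  have "(\<Sum>b\<in>B. t b * vf (w b) (a * c)) = (\<Sum>b\<in>B. c * (t b * vf (w b) a) + a * (t b * vf (w b) c))"
  by (intro sum.cong) (auto simp: derivation_mult[OF der] algebra_simps)
  then have "of_nat (Suc k) * (a * c) - (\<Sum>b\<in>B. t b * vf (w b) (a * c))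
  = c * (a - (\<Sum>b\<in>B. t b * vf (w b) a)) + a * (of_nat k * c - (\<Sum>b\<in>B. t b * vf (w b) c))"
  by (simp add: sum.distrib sum_distrib_left algebra_simps)
  moreover have "c * (a - (\<Sum>b\<in>B. t b * vf (w b) a)) \<in> S (k + 2)"
  by (rule S_mult[OF mpow_Suc(2) id[OF mpow_Suc(1)]])
  moreover have "mpow m 1 a" using mpow.mpow_Suc[OF mpow_Suc(1) mpow.mpow_0[of m 1]] by simp
  then have "a * (of_nat k * c - (\<Sum>b\<in>B. t b * vf (w b) c)) \<in> S (1 + Suc k)" by (rule S_mult[OF _ mpow_Suc(3)])
  ultimately show ?case using S_add by simp
 next
  case (mpow_zero k)
  have "of_nat k * 0 - (\<Sum>b\<in>B. t b * vf (w b) 0) = 0" by (simp add: derivation_0[OF der])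
  then show ?case using S_I[OF ideal_in_0[OF I]] by metis
 next
  case (mpow_add k a c)
  have "(\<Sum>b\<in>B. t b * vf (w b) (a + c)) = (\<Sum>b\<in>B. t b * vf (w b) a) + (\<Sum>b\<in>B. t b * vf (w b) c)"
  unfolding sum.distrib[symmetric]
  by (intro sum.cong) (auto simp: derivation_add[OF der] algebra_simps)
  then have "of_nat k * (a + c) - (\<Sum>b\<in>B. t b * vf (w b) (a + c))
  = (of_nat k * a - (\<Sum>b\<in>B. t b * vf (w b) a)) + (of_nat k * c - (\<Sum>b\<in>B. t b * vf (w b) c))"
  by (simp add: algebra_simps)
  then show ?case using S_add[OF mpow_add(3,4)] by simp
 qed
 show "\<phi> \<in> J ==> \<phi> \<in> S k"
 proof (induction k arbitrary: \<phi>)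
  case 0
  show ?case by (rule S_mpow) (rule mpow_0)
 next
  case (Suc k)
  show ?case
  proof (cases "k = 0")
  \<comment> \<open>Euler's formula divides by the degree, so the passage from 0 to 1 is made by
    evaluating at \<open>y\<close> instead.\<close>
  case True
  have "\<phi> \<in> m" using germ_sub Suc.prems by blast
  then have "mpow m 1 \<phi>" using mpow_Suc[OF _ mpow_0[of m 1]] by simp
  then show ?thesis using True S_mpow by simp
  next
  case False
  obtain c where c: "mpow m k c" "\<phi> - c \<in> I" using Suc.IH[OF Suc.prems] unfolding S_def by blast
  \<comment> \<open>As \<open>I\<close> is contained in \<open>J\<close>, the representative
    \<open>c\<close> is in \<open>J\<close> too, and so are its derivatives, to which the induction
    hypothesis applies.\<close>
  have "\<phi> - (\<phi> - c) \<in> J"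
  using ideal_in_diff[OF is_subring_UNIV prime_in_ideal[OF prime_germ] Suc.prems] I_germ c(2) by blast
  then have cJ: "c \<in> J" by simp
  have "t b * vf (w b) c \<in> S (1 + k)" if "b \<in> B" for b
  by (rule S_mult[OF t1[OF that] Suc.IH[OF germ_stable[OF cJ B(2)[OF that]]]])
  then have "(\<Sum>b\<in>B. t b * vf (w b) c) \<in> S (Suc k)" by (intro S_sum) simp
  from S_add[OF euler[OF c(1)] this] have "of_nat k * c \<in> S (Suc k)" by simp
  from S_scale[OF this, of "Cst (1 / of_nat k)"] have "Cst (1 / of_nat k) * (of_nat k * c) \<in> S (Suc k)" .
  moreover have "Cst (1 / of_nat k) * (of_nat k * c) = c" using False by (intro pol_eqI) simp
  ultimately have "c \<in> S (Suc k)" by simp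
  from S_add[OF this S_I[OF c(2)]] show ?thesis by simp
  qed
 qed
qed

text \<open>Krull's theorem turns membership in all \<open>S k\<close> into
  \<open>(1 - a) * \<phi> \<in> I\<close> with \<open>1 - a\<close> nonzero at \<open>y\<close>.
  Since \<open>J\<close> is finitely generated, a product of such factors works for all of
  \<open>J\<close>.\<close>

lemma germ_local: "EX s. ev s y ~= 0 & (ALL p:J. s * p \<in> I)"
proof -
 have one: "EX s. ev s y ~= 0 & s * \<phi> \<in> I" if "\<phi> \<in> J" for \<phi>
 proof -
  have "EX c. mpow m k c & \<phi> - c \<in> I" for k using germ_S[OF that, of k] by (simp add: S_def)
  then obtain a where a: "a \<in> m" "(1 - a) * \<phi> \<in> I"
  using krull_intersection[OF noetherian_pol ideal_maxid I] by blast
  then show ?thesis by (intro exI[of _ "1 - a"]) simp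
 qed
 have JI: "ideal_in UNIV J" by (rule prime_in_ideal[OF prime_germ])
 obtain F where F: "finite F" "F \<subseteq> J" "J = gen UNIV F" using noetherianD[OF noetherian_pol JI] by blast
 have "EX s. ev s y ~= 0 & (ALL p:F. s * p \<in> I)"
  using F(1,2)
 proof (induction F)
  case empty show ?case by (intro exI[of _ 1]) auto
 next
  case (insert p F)
  obtain s where s: "ev s y ~= 0" "ALL p:F. s * p \<in> I" using insert by auto
  obtain s' where s': "ev s' y ~= 0" "s' * p \<in> I" using one insert.prems by auto
  have "s * s' * p \<in> I" using ideal_in_mult[OF I UNIV_I s'(2), of s] by (simp add: mult.assoc)
  moreover have "s * s' * q \<in> I" if "q \<in> F" for q
  using ideal_in_mult[OF I UNIV_I s(2)[rule_format, OF that], of s'] by (simp add: mult.assoc mult.left_commute)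
  ultimately show ?case using s(1) s'(1) by (intro exI[of _ "s * s'"]) auto
 qed
 then obtain s where s: "ev s y ~= 0" "ALL p:F. s * p \<in> I" by blast
 have "s * p \<in> I" if "p \<in> gen UNIV F" for p
  using that
 proof (induction rule: gen.induct)
  case gen_0 then show ?case using ideal_in_0[OF I] by simp
 next
  case (gen_step r x z)
  have "s * (r * x + z) = r * (s * x) + s * z" by (simp add: algebra_simps)
  then show ?case using ideal_in_add[OF I ideal_in_mult[OF I UNIV_I] gen_step(4)] s(2) gen_step(2) by simp
 qed
 then show ?thesis using s(1) F(3) by blast
qed

end

section \<open>Leaves: points of X with the same germ\<close>

locale leaf_setup =
 fixes \<Delta> :: "('n::finite cmat => 'n cmat) set" and I :: "'n pol set" and X :: "'n cmat set"
 assumes pointwise: "!!y. y \<in> X ==> germ_setup \<Delta> I y"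
begin

definition leaf :: "'n cmat => 'n cmat set" where
 "leaf y = {x \<in> X. germ \<Delta> x = germ \<Delta> y}"

text \<open>One inclusion is the maximality of the core. For the other, \<open>s * p\<close> lies in
  \<open>I\<close> and so in the prime germ of \<open>y\<close>, whereas \<open>s\<close> does not,
  being nonzero at \<open>x\<close>.\<close>

lemma germ_eqI:
 assumes "y \<in> X" "x \<in> X" "!!p. p \<in> germ \<Delta> y ==> ev p x = 0"
 shows "germ \<Delta> x = germ \<Delta> y"
proof
 interpret y: germ_setup \<Delta> I y by (rule pointwise[OF assms(1)])
 interpret x: germ_setup \<Delta> I x by (rule pointwise[OF assms(2)])
 show sub: "germ \<Delta> y \<subseteq> germ \<Delta> x"
  unfolding germ_def[of \<Delta> x] by (rule core_greatest) (use assms(3) y.germ_stable in auto)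
 show "germ \<Delta> x \<subseteq> germ \<Delta> y"
 proof
  fix p assume p: "p \<in> germ \<Delta> x"
  obtain s where s: "ev s x ~= 0" "ALL p:germ \<Delta> x. s * p \<in> I" using x.germ_local by blast
  have "s * p \<in> germ \<Delta> y" using s(2) p y.I_germ by blast
  moreover have "s \<notin> germ \<Delta> y" using s(1) assms(3) by blast
  ultimately show "p \<in> germ \<Delta> y" using prime_inD[OF y.prime_germ UNIV_I UNIV_I] by blast
 qed
qed

lemma leaf_alt: "y \<in> X ==> leaf y = {x \<in> X. ALL p:germ \<Delta> y. ev p x = 0}"
proof -
 assume y: "y \<in> X"
 have "ev p x = 0" if "x \<in> X" "germ \<Delta> x = germ \<Delta> y" "p \<in> germ \<Delta> y" for p x
  using germ_setup.germ_sub[OF pointwise[OF that(1)]] that by auto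
 then show ?thesis unfolding leaf_def using germ_eqI[OF y] by blast
qed

text \<open>The products \<open>s * p\<close> are in \<open>I\<close> and vanish on
  \<open>X\<close>; where \<open>s\<close> is nonzero, the whole germ of \<open>y\<close> has to
  vanish.\<close>

lemma leaf_nbhd:
 assumes y: "y \<in> X"
 shows "EX s. ev s y ~= 0 & {x \<in> X. ev s x ~= 0} \<subseteq> leaf y"
proof -
 interpret germ_setup \<Delta> I y by (rule pointwise[OF y])
 obtain s where s: "ev s y ~= 0" "ALL p:germ \<Delta> y. s * p \<in> I" using germ_local by blast
 have "x \<in> leaf y" if "x \<in> X" "ev s x ~= 0" for x
  unfolding leaf_alt[OF y]
 proof (intro CollectI conjI ballI that)
  fix p assume "p \<in> germ \<Delta> y"
  then have "ev (s * p) x = 0" using s(2) germ_setup.zero[OF pointwise[OF that(1)]] by blast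
  then show "ev p x = 0" using that(2) by simp
 qed
 then show ?thesis using s(1) by blast
qed

lemma leaf_self: "y \<in> X ==> y \<in> leaf y" by (simp add: leaf_def)

end

section \<open>Zariski topology\<close>

lemma topspace_zariski [simp]: "topspace (zariski :: 'n::finite cmat topology) = UNIV"
proof -
 have "(UNIV :: 'n cmat set) \<in> {{A. p A ~= 0} | p. p \<in> mat_poly}"
  by (intro CollectI exI[of _ "%_. 1"]) (auto intro: mat_poly.const)
 then show ?thesis unfolding zariski_def topology_generated_by_topspace by blast
qed

lemma openin_zariski_basic: "openin zariski {A. ev p A ~= 0}"
 unfolding zariski_def
 by (rule topology_generated_by_Basis) (auto intro!: exI[of _ "ev p"])

lemma closedin_zariski_zeros: "closedin zariski {A. ALL p:I. ev p A = 0}"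
proof -
 have "openin zariski (\<Union>p\<in>I. {A. ev p A ~= 0})" by (auto intro: openin_zariski_basic)
 moreover have "UNIV - (\<Union>p\<in>I. {A. ev p A ~= 0}) = {A. ALL p:I. ev p A = 0}" by auto
 moreover have "UNIV - {A. ALL p:I. ev p A = 0} = (\<Union>p\<in>I. {A. ev p A ~= 0})" by auto
 ultimately show ?thesis by (simp add: closedin_def)
qed

lemma openin_zariski_nbhd:
 assumes "openin zariski U" "x \<in> U"
 shows "EX p. ev p x ~= 0 & {A. ev p A ~= 0} \<subseteq> U"
proof -
 have "generate_topology_on {{A. p A ~= 0} | p. p \<in> mat_poly} U"
  using assms(1) unfolding zariski_def openin_topology_generated_by_iff .
 then have "ALL x:U. EX p. ev p x ~= 0 & {A. ev p A ~= 0} \<subseteq> U"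
 proof induction
  case (Int a b)
  show ?case
  proof
  fix x assume "x \<in> a \<inter> b"
  then obtain p q where "ev p x ~= 0" "{A. ev p A ~= 0} \<subseteq> a" "ev q x ~= 0" "{A. ev q A ~= 0} \<subseteq> b"
  using Int.IH by (metis IntD1 IntD2)
  then show "EX p. ev p x ~= 0 & {A. ev p A ~= 0} \<subseteq> a \<inter> b" by (intro exI[of _ "p * q"]) auto
  qed
 next
  case (UN K)
  show ?case
  proof
  fix x assume "x \<in> \<Union>K"
  then obtain k where k: "k \<in> K" "x \<in> k" by blast
  then obtain p where "ev p x ~= 0" "{A. ev p A ~= 0} \<subseteq> k" using UN.IH[OF k(1)] by blast
  then show "EX p. ev p x ~= 0 & {A. ev p A ~= 0} \<subseteq> \<Union>K" using k(1) by blast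
  qed
 next
  case (Basis s)
  then obtain p where "s = {A. p A ~= 0}" "p \<in> mat_poly" by blast
  moreover obtain q where "p = ev q" using mat_poly_ev[OF calculation(2)] ..
  ultimately show ?case by blast
 qed auto
 then show ?thesis using assms(2) by blast
qed

lemma closedin_zariski_ideal:
 assumes "closedin zariski C" "x \<notin> C" shows "EX p. ev p x ~= 0 & (ALL A:C. ev p A = 0)"
proof -
 have "openin zariski (UNIV - C)" using assms(1) by (metis closedin_def topspace_zariski)
 from openin_zariski_nbhd[OF this] assms(2) show ?thesis by blast
qed

text \<open>A separation would contain two basic open sets that meet \<open>C\<close> but not both
  at once; the product of their equations would vanish on \<open>C\<close>, though neither factor
  does.\<close>

lemma connectedin_prime:
 assumes "prime_in UNIV {p. ALL x:C. ev p x = 0}" shows "connectedin zariski C"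
 unfolding connectedin
proof (intro conjI notI)
 show "C \<subseteq> topspace zariski" by simp
 assume "EX E1 E2. openin zariski E1 & openin zariski E2 & C \<subseteq> E1 \<union> E2 & E1 \<inter> E2 \<inter> C = {} & E1 \<inter> C ~= {} & E2 \<inter> C ~= {}"
 then obtain E1 E2 x1 x2 where E: "openin zariski E1" "openin zariski E2" "E1 \<inter> E2 \<inter> C = {}"
  "x1 \<in> E1" "x1 \<in> C" "x2 \<in> E2" "x2 \<in> C" by blast
 obtain p where p: "ev p x1 ~= 0" "{A. ev p A ~= 0} \<subseteq> E1" using openin_zariski_nbhd[OF E(1,4)] by blast
 obtain q where q: "ev q x2 ~= 0" "{A. ev q A ~= 0} \<subseteq> E2" using openin_zariski_nbhd[OF E(2,6)] by blast
 have "p * q \<in> {p. ALL x:C. ev p x = 0}" using E(3) p(2) q(2) by auto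
 then show False using prime_inD[OF assms, of p q] p(1) q(1) E(5,7) by blast
qed

lemma (in leaf_setup) leaf_clopen:
 assumes y: "y \<in> X"
 shows "openin (subtopology zariski X) (leaf y)" "closedin (subtopology zariski X) (leaf y)"
proof -
 show "closedin (subtopology zariski X) (leaf y)"
  unfolding closedin_subtopology leaf_alt[OF y]
  by (intro exI[of _ "{A. ALL p:germ \<Delta> y. ev p A = 0}"] conjI closedin_zariski_zeros) auto
 have "EX T. openin (subtopology zariski X) T & x \<in> T & T \<subseteq> leaf y" if "x \<in> leaf y" for x
 proof -
  have x: "x \<in> X" "leaf x = leaf y" using that by (auto simp: leaf_def)
  obtain s where s: "ev s x ~= 0" "{x \<in> X. ev s x ~= 0} \<subseteq> leaf x" using leaf_nbhd[OF x(1)] by blast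
  have "openin (subtopology zariski X) ({A. ev s A ~= 0} \<inter> X)"
  unfolding openin_subtopology using openin_zariski_basic by blast
  then show ?thesis using s x by (intro exI[of _ "{A. ev s A ~= 0} \<inter> X"]) auto
 qed
 then show "openin (subtopology zariski X) (leaf y)" by (intro iffD2[OF openin_subopen] ballI)
qed

section \<open>Inverses, rational functions and the adjoint action\<close>

lemma minv:
 assumes "invertible (A :: 'n::finite cmat)"
 shows minv_right: "A ** matrix_inv A = mat 1" and minv_left: "matrix_inv A ** A = mat 1"
 using someI_ex[of "%B. A ** B = mat 1 & B ** A = mat 1"] assms
 by (auto simp: matrix_inv_def invertible_def)

lemma minv_unique: "invertible (A :: 'n::finite cmat) ==> A ** B = mat 1 ==> B = matrix_inv A"
 by (metis matrix_mul_assoc matrix_mul_lid matrix_mul_rid minv_left)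

lemma invertible_minv: "invertible (A :: 'n::finite cmat) ==> invertible (matrix_inv A)"
 using minv unfolding invertible_def by blast

lemma minv_mult:
 assumes "invertible (A :: 'n::finite cmat)" "invertible (B :: 'n cmat)"
 shows "matrix_inv (A ** B) = matrix_inv B ** matrix_inv A"
proof (rule minv_unique[symmetric])
 show "invertible (A ** B)" using assms by (rule invertible_mult)
 have "A ** B ** (matrix_inv B ** matrix_inv A) = A ** (B ** matrix_inv B) ** matrix_inv A"
  by (simp add: matrix_mul_assoc)
 then show "A ** B ** (matrix_inv B ** matrix_inv A) = mat 1" using assms by (simp add: minv)
qed

lemma cscale_mult_left: "(c *\<^sub>C A) ** B = c *\<^sub>C (A ** B)"
 and cscale_mult_right: "A ** (c *\<^sub>C B) = c *\<^sub>C (A ** (B :: 'n::finite cmat))"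
 by (auto simp: vec_eq_iff matrix_matrix_mult_def sum_distrib_left mult_ac)

lemma matrix_add_mult: "(A + B) ** C = A ** C + B ** (C :: 'n::finite cmat)"
 and matrix_mult_add: "A ** (B + C) = A ** B + A ** (C :: 'n::finite cmat)"
 and matrix_diff_mult: "(A - B) ** C = A ** C - B ** (C :: 'n::finite cmat)"
 and matrix_mult_diff: "A ** (B - C) = A ** B - A ** (C :: 'n::finite cmat)"
 by (auto simp: vec_eq_iff matrix_matrix_mult_def algebra_simps sum.distrib sum_subtractf)

lemma matrix_mult_0 [simp]: "A ** 0 = (0 :: 'n::finite cmat)" "0 ** A = (0 :: 'n::finite cmat)"
 by (auto simp: vec_eq_iff matrix_matrix_mult_def)

lemma br_add_left: "lie_bracket (x + y) z = lie_bracket x z + lie_bracket y z"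
 and br_add_right: "lie_bracket x (y + z) = lie_bracket x y + lie_bracket x z"
 and br_diff_left: "lie_bracket (x - y) z = lie_bracket x z - lie_bracket y z"
 and br_diff_right: "lie_bracket x (y - z) = lie_bracket x y - lie_bracket x z"
 and br_scale_left: "lie_bracket (c *\<^sub>C x) y = c *\<^sub>C lie_bracket x y"
 and br_scale_right: "lie_bracket x (c *\<^sub>C y) = c *\<^sub>C lie_bracket x y"
 by (simp_all add: lie_bracket_def matrix_add_mult matrix_mult_add matrix_diff_mult matrix_mult_diff
  cscale_mult_left cscale_mult_right cmat.scale_right_diff_distrib)

lemma br_self [simp]: "lie_bracket x x = 0"
 and br_0 [simp]: "lie_bracket x 0 = 0" "lie_bracket 0 x = 0"
 by (simp_all add: lie_bracket_def)

lemma br_skew: "lie_bracket x y = - lie_bracket y x"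
 by (simp add: lie_bracket_def)

lemma br_uminus_left: "lie_bracket (- x) y = - lie_bracket x y"
 and br_uminus_right: "lie_bracket x (- y) = - lie_bracket x y"
 using br_diff_left[of 0 x y] br_diff_right[of x 0 y] by simp_all

lemma br_jacobi: "lie_bracket x (lie_bracket y z) = lie_bracket (lie_bracket x y) z + lie_bracket y (lie_bracket x z)"
 by (simp add: lie_bracket_def matrix_diff_mult matrix_mult_diff matrix_mul_assoc)

lemma br_sum_left: "lie_bracket (sum f S) y = (\<Sum>i\<in>S. lie_bracket (f i) y)"
 by (induction S rule: infinite_finite_induct) (auto simp: br_add_left)

lemma br_sum_right: "lie_bracket y (sum f S) = (\<Sum>i\<in>S. lie_bracket y (f i))"
 by (induction S rule: infinite_finite_induct) (auto simp: br_add_right)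

lemma has_dd_mult:
 assumes "has_dd f x v a" "has_dd g x v b"
 shows "has_dd (%x. f x ** g x) x v (a ** g x + f x ** b)"
 unfolding has_dd_def
proof (intro allI)
 fix i j
 have "((%t. \<Sum>k\<in>UNIV. f (x + t *\<^sub>C v) $ i $ k * g (x + t *\<^sub>C v) $ k $ j) has_field_derivative
  (\<Sum>k\<in>UNIV. a $ i $ k * g x $ k $ j + b $ k $ j * f x $ i $ k)) (at 0)"
 proof (rule DERIV_sum)
  fix k
  show "((%t. f (x + t *\<^sub>C v) $ i $ k * g (x + t *\<^sub>C v) $ k $ j) has_field_derivative
  a $ i $ k * g x $ k $ j + b $ k $ j * f x $ i $ k) (at 0)"
  using DERIV_mult[of "%t. f (x + t *\<^sub>C v) $ i $ k" "a $ i $ k" 0 UNIV "%t. g (x + t *\<^sub>C v) $ k $ j" "b $ k $ j"]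
  assms by (simp add: has_dd_def)
 qed
 then show "((%t. (f (x + t *\<^sub>C v) ** g (x + t *\<^sub>C v)) $ i $ j) has_field_derivative
  (a ** g x + f x ** b) $ i $ j) (at 0)"
  by (simp add: matrix_matrix_mult_def sum.distrib mult.commute)
qed

lemma has_dd_const: "has_dd (%x. c) x v 0"
 by (simp add: has_dd_def)

lemma has_dd_cong_ev:
 assumes "has_dd f x v w" "eventually (%t. f (x + t *\<^sub>C v) = g (x + t *\<^sub>C v)) (nhds 0)"
 shows "has_dd g x v w"
 unfolding has_dd_def
proof (intro allI)
 fix i j
 have "eventually (%t. f (x + t *\<^sub>C v) $ i $ j = g (x + t *\<^sub>C v) $ i $ j) (nhds 0)"
  using assms(2) by eventually_elim simp
 from iffD1[OF DERIV_cong_ev[OF refl this refl]] assms(1)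
 show "((%t. g (x + t *\<^sub>C v) $ i $ j) has_field_derivative w $ i $ j) (at 0)"
  unfolding has_dd_def by blast
qed

section \<open>Adjugate, inverse and regular functions on the general linear group\<close>

lemma pfun_det: "pfun (%A :: 'n::finite cmat. det A)"
 unfolding det_def by (intro pfun_sum pfun_intros(4) pfun_prod) auto

definition Det :: "'n::finite pol" where "Det = (SOME p. ev p = det)"

lemma ev_Det [simp]: "ev Det (A :: 'n::finite cmat) = det A"
proof -
 have "\<exists>p :: 'n pol. ev p = det" using pfun_det by (simp add: pfun_def)
 from someI_ex[OF this] show ?thesis by (simp add: Det_def)
qed

text \<open>The adjugate in the form given by Cramer's rule: column \<open>k\<close> is replaced by
  the l-th unit vector. It makes inversion a rational map with denominator
  \<open>det\<close>.\<close>

definition adjm :: "'n::finite cmat => 'n cmat" where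
 "adjm A = (\<chi> k l. det (\<chi> i j. if j = k then if i = l then 1 else 0 else A $ i $ j))"

lemma pmap_adjm: "pmap adjm"
 unfolding pmap_def
proof (intro allI)
 fix k l
 have "pmap (%A. \<chi> i j. if j = k then if i = l then 1 else 0 else A $ i $ j)"
  unfolding pmap_def
 proof (intro allI)
  fix i j
  show "pfun (%A. (\<chi> i j. if j = k then if i = l then 1 else 0 else A $ i $ j) $ i $ j)"
  by (cases "j = k"; cases "i = l") auto
 qed
 from pfun_compose[OF this, of Det] show "pfun (%A. adjm A $ k $ l)" by (simp add: adjm_def)
qed

lemma matrix_inv_adjm:
 assumes "det (A :: 'n::finite cmat) ~= 0" shows "matrix_inv A = (1 / det A) *\<^sub>C adjm A"
proof -
 let ?B = "matrix_inv A"
 have inv: "invertible A" using assms by (simp add: invertible_det_nz)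
 have "?B $ k $ l = adjm A $ k $ l / det A" for k l
 proof -
  have "A *v (\<chi> i. ?B $ i $ l) = (\<chi> i. if i = l then 1 else 0)"
  using minv_right[OF inv] by (simp add: vec_eq_iff matrix_vector_mult_def matrix_matrix_mult_def mat_def)
  then have "(\<chi> i. ?B $ i $ l) = (\<chi> k. det (\<chi> i j. if j = k then (\<chi> i. if i = l then 1 else 0) $ i else A $ i $ j) / det A)"
  using cramer[OF assms] by blast
  from arg_cong[OF this, of "%v. v $ k"] show ?thesis by (simp add: adjm_def cong: if_cong)
 qed
 then show ?thesis by (simp add: vec_eq_iff)
qed

lemma adjm_one: "adjm (mat 1 :: 'n::finite cmat) = mat 1"
proof -
 have "matrix_inv (mat 1 :: 'n cmat) = mat 1"
  using minv_unique[of "mat 1" "mat 1 :: 'n cmat"] by (simp add: invertible_def)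
 then show ?thesis using matrix_inv_adjm[of "mat 1 :: 'n cmat"] by simp
qed

lemma det_line_ev: "eventually (%t. det (mat 1 + t *\<^sub>C b :: 'n::finite cmat) ~= 0) (nhds 0)"
proof -
 have "isCont (%t. ev Det (mat 1 + t *\<^sub>C b :: 'n cmat)) 0"
  using dirD_has DERIV_isCont by blast
 then have "((%t. det (mat 1 + t *\<^sub>C b :: 'n cmat)) \<longlongrightarrow> 1) (at 0)"
  by (simp add: isCont_def)
 then have "eventually (%t. det (mat 1 + t *\<^sub>C b :: 'n cmat) ~= 0) (at 0)"
  by (rule tendsto_imp_eventually_ne) simp
 then show ?thesis by (simp add: eventually_nhds_conv_at)
qed

text \<open>Cramer's rule provides some derivative \<open>u\<close>; its value follows by
  differentiating \<open>A ** matrix_inv A = mat 1\<close> with the product rule.\<close>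

lemma has_dd_matrix_inv: "has_dd matrix_inv (mat 1 :: 'n::finite cmat) b (- b)"
proof -
 obtain w where w: "has_dd adjm (mat 1 :: 'n cmat) b w" using pmap_has_dd[OF pmap_adjm] by blast
 define u where "u = w - dirD Det (mat 1) b *\<^sub>C mat 1"
 have "has_dd (%A. (1 / det A) *\<^sub>C adjm A) (mat 1 :: 'n cmat) b u"
  unfolding has_dd_def
 proof (intro allI)
  fix i j
  have d: "((%t. ev Det (mat 1 + t *\<^sub>C b)) has_field_derivative dirD Det (mat 1) b) (at 0)" by (rule dirD_has)
  have a: "((%t. adjm (mat 1 + t *\<^sub>C b) $ i $ j) has_field_derivative w $ i $ j) (at 0)"
  using w by (simp add: has_dd_def)
  from DERIV_divide[OF a d]
  show "((%t. ((1 / det (mat 1 + t *\<^sub>C b)) *\<^sub>C adjm (mat 1 + t *\<^sub>C b)) $ i $ j) has_field_derivative u $ i $ j) (at 0)"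
  by (simp add: u_def adjm_one mult.commute)
 qed
 moreover have "eventually (%t. (1 / det (mat 1 + t *\<^sub>C b)) *\<^sub>C adjm (mat 1 + t *\<^sub>C b)
  = matrix_inv (mat 1 + t *\<^sub>C b)) (nhds 0)"
  using det_line_ev[of b] by eventually_elim (simp add: matrix_inv_adjm)
 ultimately have u: "has_dd matrix_inv (mat 1 :: 'n cmat) b u" by (rule has_dd_cong_ev)
 have m1: "matrix_inv (mat 1 :: 'n cmat) = mat 1"
  using matrix_inv_adjm[of "mat 1 :: 'n cmat"] by (simp add: adjm_one)
 from has_dd_mult[OF has_dd_id u] have "has_dd (%A. A ** matrix_inv A) (mat 1) b (b + u)" by (simp add: m1)
 moreover have "eventually (%t. (mat 1 + t *\<^sub>C b) ** matrix_inv (mat 1 + t *\<^sub>C b) = mat 1) (nhds 0)"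
  using det_line_ev[of b] by eventually_elim (simp add: minv_right invertible_det_nz)
 ultimately have "has_dd (%A. mat 1) (mat 1 :: 'n cmat) b (b + u)" by (rule has_dd_cong_ev)
 then have "b + u = 0" using has_dd_unique has_dd_const by blast
 then have "u = - b" by (simp add: eq_neg_iff_add_eq_0 add.commute)
 then show ?thesis using u by simp
qed

lemma matrix_inv_one: "matrix_inv (mat 1 :: 'n::finite cmat) = mat 1"
 using matrix_inv_adjm[of "mat 1 :: 'n cmat"] by (simp add: adjm_one)

lemma has_dd_Ad: "has_dd (%A. Ad A x) (mat 1 :: 'n::finite cmat) b (lie_bracket b x)"
proof -
 have "has_dd (%A. A ** x) (mat 1) b (b ** x)"
  using has_dd_mult[OF has_dd_id has_dd_const[of x]] by simp
 from has_dd_mult[OF this has_dd_matrix_inv] show ?thesis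
  by (simp add: Ad_def lie_bracket_def matrix_inv_one matrix_mult_diff[of x 0 b, simplified])
qed

lemma Ad_one [simp]: "Ad (mat 1) x = x"
 by (simp add: Ad_def matrix_inv_one)

lemma Ad_mult: "invertible A ==> invertible B ==> Ad (A ** B) x = Ad A (Ad B x)"
 by (simp add: Ad_def minv_mult matrix_mul_assoc)

lemma Ad_minv: "invertible A ==> Ad (matrix_inv A) (Ad A x) = x"
 by (metis Ad_mult Ad_one invertible_minv minv_left)

lemma Ad_bracket: assumes "invertible A" shows "Ad A (lie_bracket x y) = lie_bracket (Ad A x) (Ad A y)"
proof -
 have "Ad A x ** Ad A y = A ** x ** (matrix_inv A ** A) ** y ** matrix_inv A" for x y
  by (simp add: Ad_def matrix_mul_assoc)
 then show ?thesis using assms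
  by (simp add: lie_bracket_def minv_left) (simp add: Ad_def matrix_diff_mult matrix_mult_diff matrix_mul_assoc)
qed

text \<open>Regular functions on the general linear group: polynomials divided by a power of the
  determinant. Values at singular matrices are left open, since \<open>matrix_inv\<close> is
  arbitrary there.\<close>

definition rfun :: "('n::finite cmat => complex) => bool" where
 "rfun f \<longleftrightarrow> (EX q k. ALL A. det A ~= 0 --> ev q A = det A ^ k * f A)"

lemma rfun_I: "(!!A. det A ~= 0 ==> ev q A = det A ^ k * f A) ==> rfun f"
 unfolding rfun_def by blast

lemma rfun_const [intro]: "rfun (%A. c)" by (rule rfun_I[of "Cst c" 0]) simp

lemma rfun_pol [intro]: "rfun (ev p)" by (rule rfun_I[of p 0]) simp

lemma rfun_add [intro]: assumes "rfun f" "rfun g" shows "rfun (%A. f A + g A)"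
proof -
 obtain p k where p: "ALL A. det A ~= 0 --> ev p A = det A ^ k * f A" using assms(1) rfun_def by blast
 obtain q l where q: "ALL A. det A ~= 0 --> ev q A = det A ^ l * g A" using assms(2) rfun_def by blast
 show ?thesis by (rule rfun_I[of "Det ^ l * p + Det ^ k * q" "k + l"]) (simp add: p q power_add algebra_simps)
qed

lemma rfun_mult [intro]: assumes "rfun f" "rfun g" shows "rfun (%A. f A * g A)"
proof -
 obtain p k where p: "ALL A. det A ~= 0 --> ev p A = det A ^ k * f A" using assms(1) rfun_def by blast
 obtain q l where q: "ALL A. det A ~= 0 --> ev q A = det A ^ l * g A" using assms(2) rfun_def by blast
 show ?thesis by (rule rfun_I[of "p * q" "k + l"]) (simp add: p q power_add algebra_simps)
qed

lemma rfun_sum [intro]: "(!!i. i \<in> S ==> rfun (f i)) ==> rfun (%A. \<Sum>i\<in>S. f i A)"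
 by (induction S rule: infinite_finite_induct) (auto intro: rfun_const rfun_add)

lemma rfun_diff: assumes "rfun f" "rfun g" shows "rfun (%A. f A - g A)"
 using rfun_add[OF assms(1) rfun_mult[OF rfun_const[of "-1"] assms(2)]] by simp

lemma rfun_Ad [intro]: "rfun (%A. Ad A x $ i $ j)"
proof -
 have "pmap (%A. A ** x ** adjm A)" by (intro pmap_mult pmap_id pmap_const pmap_adjm)
 then obtain q where q: "ev q = (%A. (A ** x ** adjm A) $ i $ j)" by (auto simp: pmap_def pfun_def)
 show ?thesis by (rule rfun_I[of q 1]) (simp add: q Ad_def matrix_inv_adjm cscale_mult_right)
qed

lemma rfun_ev_Ad [intro]: "rfun (%A. ev p (Ad A x))"
 by (induction p rule: pol_induct) auto

section \<open>Linear algebraic groups and their Lie algebras\<close>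

locale connected_group =
 fixes G :: "'n::finite cmat set"
 assumes alg: "linear_algebraic_group G" and conn: "connectedin zariski G"
begin

abbreviation "\<gg> \<equiv> Lie G"

definition IG :: "'n pol set" where "IG = {p. ALL A:G. ev p A = 0}"

lemma IG_ideal: "ideal_in UNIV IG" by (auto simp: IG_def ideal_in_def)

lemma G_sub: "subgroup G GL" using alg by (simp add: linear_algebraic_group_def)

lemma G_inv: "A \<in> G ==> invertible A"
 using subgroup.subset[OF G_sub] by (auto simp: GL_def)

lemma G_det: "A \<in> G ==> det A ~= 0" using G_inv invertible_det_nz by blast

lemma G_one: "mat 1 \<in> G" using subgroup.one_closed[OF G_sub] by (simp add: GL_def)

lemma G_mult: "A \<in> G ==> B \<in> G ==> A ** B \<in> G"
 using subgroup.m_closed[OF G_sub] by (simp add: GL_def)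

lemma G_minv: assumes "A \<in> G" shows "matrix_inv A \<in> G"
proof -
 have "m_inv GL A = matrix_inv A"
  unfolding m_inv_def
 proof (rule the_equality)
  show "matrix_inv A \<in> carrier GL & mult GL A (matrix_inv A) = one GL & mult GL (matrix_inv A) A = one GL"
  using G_inv[OF assms] by (simp add: GL_def minv invertible_minv)
  fix B assume "B \<in> carrier GL & mult GL A B = one GL & mult GL B A = one GL"
  then show "B = matrix_inv A" using minv_unique[OF G_inv[OF assms]] by (simp add: GL_def)
 qed
 then show ?thesis using subgroup.m_inv_closed[OF G_sub assms] by simp
qed

lemma G_closed:
 assumes "invertible A" "!!p. p \<in> IG ==> ev p A = 0" shows "A \<in> G"
proof (rule ccontr)
 assume "A \<notin> G"
 have "closedin (subtopology zariski (carrier GL)) G" using alg by (simp add: linear_algebraic_group_def)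
 then obtain C where C: "closedin zariski C" "G = C \<inter> carrier GL" unfolding closedin_subtopology by blast
 have "A \<notin> C" using C(2) \<open>A \<notin> G\<close> assms(1) by (simp add: GL_def)
 obtain p where "ev p A ~= 0" "ALL A:C. ev p A = 0" using \<open>A \<notin> C\<close> closedin_zariski_ideal[OF C(1)] by blast
 moreover have "p \<in> IG" using \<open>ALL A:C. ev p A = 0\<close> C(2) unfolding IG_def by blast
 ultimately show False using assms(2) by blast
qed

lemma Lie_iff: "X \<in> \<gg> \<longleftrightarrow> (ALL p:IG. dirD p (mat 1) X = 0)"
proof -
 have "((%t. ev p (mat 1 + t *\<^sub>C X)) has_field_derivative 0) (at 0) \<longleftrightarrow> dirD p (mat 1) X = 0" for p
  using dirD_eqI dirD_has by metis
 then show ?thesis by (simp add: Lie_def IG_def flip: range_ev)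
qed

lemma Lie_subspace: "cmat.subspace \<gg>"
 by (auto simp: cmat.subspace_def Lie_iff dirD_add dirD_scale)

lemma Lie_translate: assumes "X \<in> \<gg>" "g \<in> G" "p \<in> IG" shows "dirD p g (X ** g) = 0"
proof -
 have pm: "pmap (%A. A ** g)" by (intro pmap_mult pmap_id pmap_const)
 have "pcomp p (%A. A ** g) \<in> IG" using assms G_mult by (simp add: IG_def ev_pcomp[OF pm])
 moreover have "has_dd (%A. A ** g) (mat 1) X (X ** g)" using has_dd_mult[OF has_dd_id has_dd_const[of g]] by simp
 ultimately show ?thesis using dirD_pcomp[OF pm, of "mat 1" X "X ** g" p] assms(1) by (simp add: Lie_iff)
qed

lemma Lie_tangent:
 assumes g: "g \<in> G" and v: "!!p. p \<in> IG ==> dirD p g v = 0" shows "v ** matrix_inv g \<in> \<gg>"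
 unfolding Lie_iff
proof
 fix p assume p: "p \<in> IG"
 let ?i = "matrix_inv g"
 have pm: "pmap (%A. A ** ?i)" by (intro pmap_mult pmap_id pmap_const)
 have "pcomp p (%A. A ** ?i) \<in> IG" using p G_mult G_minv[OF g] by (simp add: IG_def ev_pcomp[OF pm])
 moreover have "has_dd (%A. A ** ?i) g v (v ** ?i)" using has_dd_mult[OF has_dd_id has_dd_const[of ?i]] by simp
 ultimately show "dirD p (mat 1) (v ** ?i) = 0"
  using dirD_pcomp[OF pm, of g v "v ** ?i" p] v minv_right[OF G_inv[OF g]] by simp
qed

definition rinv :: "('n cmat => 'n cmat) set" where "rinv = (%X A. X ** A) ` \<gg>"

lemma pmap_rinv: "pmap (%A. X ** A)" by (intro pmap_mult pmap_id pmap_const)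

lemma vf_IG: "X \<in> \<gg> ==> p \<in> IG ==> vf (%A. X ** A) p \<in> IG"
 using Lie_translate by (simp add: IG_def ev_vf[OF pmap_rinv])

lemma leaf_setup_G: "leaf_setup rinv IG G"
proof (rule leaf_setup.intro)
 fix y assume y: "y \<in> G"
 show "germ_setup rinv IG y"
 proof (rule germ_setup.intro)
  show "pmap w" if "w \<in> rinv" for w using that pmap_rinv by (auto simp: rinv_def)
  show "ideal_in UNIV IG" by (rule IG_ideal)
  show "vf w p \<in> IG" if "w \<in> rinv" "p \<in> IG" for w p using that vf_IG by (auto simp: rinv_def)
  show "ev p y = 0" if "p \<in> IG" for p using that y by (simp add: IG_def)
  fix v assume "!!p. p \<in> IG ==> dirD p y v = 0"
  then have X: "v ** matrix_inv y \<in> \<gg>" using Lie_tangent[OF y] by blast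
  have "v = (v ** matrix_inv y) ** y" using minv_left[OF G_inv[OF y]] by (simp flip: matrix_mul_assoc)
  then have "v \<in> (%w. w y) ` rinv" unfolding rinv_def image_image using X by blast
  then show "v \<in> cmat.span ((%w. w y) ` rinv)" by (rule cmat.span_base)
 qed
qed

text \<open>Connectedness makes \<open>G\<close> a single leaf of the right-invariant vector fields, so that its ideal
 is the ideal of a germ.\<close>

lemma IG_prime: "prime_in UNIV IG"
proof -
 interpret leaf_setup rinv IG G by (rule leaf_setup_G)
 have "leaf (mat 1) = G"
 proof -
  have "connected_space (subtopology zariski G)" using conn by (simp add: connectedin_def)
  then show ?thesis
  using leaf_clopen[OF G_one] leaf_self[OF G_one]
  by (auto simp: connected_space_clopen_in)
 qed
 then have "germ rinv (mat 1) \<subseteq> IG" using leaf_alt[OF G_one] by (auto simp: IG_def)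
 then show ?thesis
  using germ_setup.I_germ[OF pointwise[OF G_one]] germ_setup.prime_germ[OF pointwise[OF G_one]]
  by (metis subset_antisym)
qed

lemma Lie_Ad: assumes "g \<in> G" "X \<in> \<gg>" shows "Ad g X \<in> \<gg>"
 unfolding Lie_iff
proof
 fix p assume p: "p \<in> IG"
 let ?i = "matrix_inv g"
 have pm: "pmap (%A. g ** A ** ?i)" by (intro pmap_mult pmap_id pmap_const)
 have "pcomp p (%A. g ** A ** ?i) \<in> IG" using p G_mult G_minv assms(1) by (simp add: IG_def ev_pcomp[OF pm])
 moreover have "has_dd (%A. g ** A ** ?i) (mat 1) X (g ** X ** ?i)"
  using has_dd_mult[OF has_dd_mult[OF has_dd_const[of g] has_dd_id] has_dd_const[of ?i]] by simp
 ultimately show "dirD p (mat 1) (Ad g X) = 0"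
  using dirD_pcomp[OF pm, of "mat 1" X "g ** X ** ?i" p] assms(2) minv_right[OF G_inv[OF assms(1)]]
  by (simp add: Lie_iff Ad_def)
qed

text \<open>Right-invariant fields reverse the bracket, hence \<open>lie_bracket Y X\<close>. Fields
  that preserve the ideal of G have a commutator that preserves it, and this yields
  \<open>Lie_bracket\<close>.\<close>

lemma vf_commutator:
 "vf (%A. X ** A) (vf (%A. Y ** A) p) - vf (%A. Y ** A) (vf (%A. X ** A) p)
  = vf (%A. lie_bracket Y X ** A) p"
proof (induction p rule: pol_induct)
 case (Cst c)
 have z: "vf (%A. X ** A) (Cst c) = 0" for X by (rule pol_eqI) (simp add: ev_vf[OF pmap_rinv])
 have z0: "vf (%A. X ** A) 0 = 0" for X by (rule derivation_0[OF derivation_vf[OF pmap_rinv]])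
 show ?case by (simp only: z z0 diff_self)
next
 case (Var i j)
 have e: "dirD (vf (%A. X ** A) (Var i j)) A v = (X ** v) $ i $ j" for X A v
 proof -
  have "vf (%A. X ** A) (Var i j) = (\<Sum>k\<in>UNIV. Cst (X $ i $ k) * Var k j)"
  by (rule pol_eqI, simp only: ev_vf[OF pmap_rinv] dirD_simps ev_simps ev_sum)
  (simp add: matrix_matrix_mult_def)
  then show ?thesis by (simp add: dirD_sum matrix_matrix_mult_def)
 qed
 show ?case
  by (rule pol_eqI, simp only: ev_simps ev_vf[OF pmap_rinv] e dirD_simps)
  (simp add: lie_bracket_def matrix_diff_mult matrix_mul_assoc)
next
 case (add p q)
 note d = derivation_add[OF derivation_vf[OF pmap_rinv]]
 show ?case unfolding d add[symmetric] by (simp add: algebra_simps)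
next
 case (mult p q)
 note d = derivation_add[OF derivation_vf[OF pmap_rinv]] derivation_mult[OF derivation_vf[OF pmap_rinv]]
 show ?case unfolding d mult[symmetric] by (simp add: algebra_simps)
qed

lemma Lie_bracket: assumes "X \<in> \<gg>" "Y \<in> \<gg>" shows "lie_bracket X Y \<in> \<gg>"
 unfolding Lie_iff
proof
 fix p assume p: "p \<in> IG"
 have "vf (%A. lie_bracket X Y ** A) p \<in> IG"
  unfolding vf_commutator[symmetric] using assms vf_IG p
  by (intro ideal_in_diff[OF is_subring_UNIV IG_ideal]) auto
 then have "ev (vf (%A. lie_bracket X Y ** A) p) (mat 1) = 0" using G_one by (simp add: IG_def)
 then show "dirD p (mat 1) (lie_bracket X Y) = 0" by (simp add: ev_vf[OF pmap_rinv])
qed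

text \<open>Multiplication by a power of the determinant gives a polynomial in the ideal of G. Since
  \<open>f\<close> vanishes at the identity and the determinant is 1 there, the product rule leaves
  \<open>d\<close>. The lemma turns identities on G into their infinitesimal forms.\<close>

lemma rfun_derivative:
 assumes f: "rfun f" and z: "!!A. A \<in> G ==> f A = 0" and b: "b \<in> \<gg>"
  and d: "((%t. f (mat 1 + t *\<^sub>C b)) has_field_derivative d) (at 0)"
 shows "d = 0"
proof -
 obtain q k where q: "ALL A. det A ~= 0 --> ev q A = det A ^ k * f A" using f rfun_def by blast
 have "q \<in> IG" using q z G_det by (simp add: IG_def)
 then have 0: "dirD q (mat 1) b = 0" using b Lie_iff by blast
 have f1: "f (mat 1) = 0" using z[OF G_one] .
 have "((%t. ev (Det ^ k) (mat 1 + t *\<^sub>C b) * f (mat 1 + t *\<^sub>C b)) has_field_derivative d) (at 0)"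
  using DERIV_mult[OF dirD_has[of "Det ^ k" "mat 1" b] d] f1 by simp
 then have "((%t. ev q (mat 1 + t *\<^sub>C b)) has_field_derivative d) (at 0)"
 proof (rule DERIV_cong_ev[OF refl _ refl, THEN iffD1, rotated])
  show "eventually (%t. ev (Det ^ k) (mat 1 + t *\<^sub>C b) * f (mat 1 + t *\<^sub>C b) = ev q (mat 1 + t *\<^sub>C b)) (nhds 0)"
  using det_line_ev[of b] by eventually_elim (simp add: q)
 qed
 then show ?thesis using dirD_eqI 0 by metis
qed

section \<open>Adjoint orbits and their ideals\<close>

definition IO :: "'n cmat => 'n pol set" where "IO x = {p. ALL z:adjoint_orbit G x. ev p z = 0}"

lemma IO_ideal: "ideal_in UNIV (IO x)" by (auto simp: IO_def ideal_in_def)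

lemma orbit_Ad: "z \<in> adjoint_orbit G x ==> A \<in> G ==> Ad A z \<in> adjoint_orbit G x"
proof -
 assume "z \<in> adjoint_orbit G x" and A: "A \<in> G"
 then obtain B where B: "B \<in> G" "z = Ad B x" by (auto simp: adjoint_orbit_def)
 have "Ad A z = Ad (A ** B) x" using Ad_mult[OF G_inv[OF A] G_inv[OF B(1)]] B(2) by simp
 then show ?thesis unfolding adjoint_orbit_def using G_mult[OF A B(1)] by simp
qed

lemma orbit_self: "x \<in> adjoint_orbit G x"
 unfolding adjoint_orbit_def using G_one Ad_one by (metis image_eqI)

lemma orbit_eq: "z \<in> adjoint_orbit G x ==> adjoint_orbit G z = adjoint_orbit G x"
proof
 assume z: "z \<in> adjoint_orbit G x"
 show "adjoint_orbit G z \<subseteq> adjoint_orbit G x"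
  using orbit_Ad[OF z] by (auto simp: adjoint_orbit_def[of G z])
 obtain A where A: "A \<in> G" "z = Ad A x" using z by (auto simp: adjoint_orbit_def)
 have "x = Ad (matrix_inv A) z" using A(2) Ad_minv[OF G_inv[OF A(1)], of x] by simp
 then have "x \<in> adjoint_orbit G z" using G_minv[OF A(1)] by (auto simp: adjoint_orbit_def)
 from orbit_Ad[OF this] show "adjoint_orbit G x \<subseteq> adjoint_orbit G z" by (auto simp: adjoint_orbit_def[of G x])
qed

lemma IO_derivative: assumes p: "p \<in> IO x" and b: "b \<in> \<gg>" and z: "z \<in> adjoint_orbit G x"
 shows "dirD p z (lie_bracket b z) = 0"
proof (rule rfun_derivative[of "%A. ev p (Ad A z)", OF _ _ b])
 show "ev p (Ad A z) = 0" if "A \<in> G" for A using p orbit_Ad[OF z that] by (simp add: IO_def)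
 show "((%t. ev p (Ad (mat 1 + t *\<^sub>C b) z)) has_field_derivative dirD p z (lie_bracket b z)) (at 0)"
  using dirD_chain[OF has_dd_Ad[of z b], of p] by simp
qed auto

text \<open>Pulling back along the orbit map and clearing the determinant moves the question to the
  prime ideal of G.\<close>

lemma IO_prime: "prime_in UNIV (IO x)"
 unfolding prime_in_def
proof (intro conjI ballI impI)
 show "ideal_in UNIV (IO x)" by (rule IO_ideal)
 show "1 \<notin> IO x" using orbit_self by (auto simp: IO_def)
 fix p q assume pq: "p * q \<in> IO x"
 obtain p' k where p': "ALL A. det A ~= 0 --> ev p' A = det A ^ k * ev p (Ad A x)"
  using rfun_ev_Ad[of p x] unfolding rfun_def by blast
 obtain q' l where q': "ALL A. det A ~= 0 --> ev q' A = det A ^ l * ev q (Ad A x)"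
  using rfun_ev_Ad[of q x] unfolding rfun_def by blast
 have z: "ev p (Ad A x) * ev q (Ad A x) = 0" if "A \<in> G" for A
  using pq that by (auto simp: IO_def adjoint_orbit_def)
 have "ev p' A * ev q' A = 0" if "A \<in> G" for A
  using p' q' z[OF that] G_det[OF that] by auto
 then have "p' * q' \<in> IG" by (simp add: IG_def)
 then have "p' \<in> IG | q' \<in> IG" using prime_inD[OF IG_prime UNIV_I UNIV_I] by blast
 then show "p \<in> IO x | q \<in> IO x"
  using p' q' G_det by (auto simp: IG_def IO_def adjoint_orbit_def)
qed

end

section \<open>Finite-dimensional representations of \<open>sl2\<close>\<close>

locale sl2_rep =
 fixes V :: "'n::finite cmat set" and E H F :: "'n cmat => 'n cmat" and N :: nat
 assumes V: "cmat.subspace V" and lE: "clin E" and lH: "clin H" and lF: "clin F"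
  and VE: "!!v. v \<in> V ==> E v \<in> V" and VH: "!!v. v \<in> V ==> H v \<in> V" and VF: "!!v. v \<in> V ==> F v \<in> V"
  and HE: "!!v. v \<in> V ==> H (E v) = E (H v) + 2 *\<^sub>C E v"
  and HF: "!!v. v \<in> V ==> H (F v) = F (H v) - 2 *\<^sub>C F v"
  and EF: "!!v. v \<in> V ==> E (F v) = F (E v) + H v"
  and nE: "!!v. v \<in> V ==> (E ^^ N) v = 0" and nF: "!!v. v \<in> V ==> (F ^^ N) v = 0"
begin

lemma lin: "E (x + y) = E x + E y" "H (x + y) = H x + H y" "F (x + y) = F x + F y"
 "E (c *\<^sub>C x) = c *\<^sub>C E x" "H (c *\<^sub>C x) = c *\<^sub>C H x" "F (c *\<^sub>C x) = c *\<^sub>C F x"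
 using lE lH lF by (auto simp: clin_iff)

lemma lin0: "E 0 = 0" "H 0 = 0" "F 0 = 0"
 using lin(4)[of 0 0] lin(5)[of 0 0] lin(6)[of 0 0] by auto

lemma lindiff: "E (x - y) = E x - E y" "H (x - y) = H x - H y" "F (x - y) = F x - F y"
 using lE lH lF cend.linear_diff by blast+

text \<open>The product of the operators \<open>H - a\<close> over the list, that is, the polynomial
  in \<open>H\<close> with these roots.\<close>

primrec shifts :: "complex list => 'n cmat => 'n cmat" where
 "shifts [] x = x"
| "shifts (a # as) x = shifts as (H x - a *\<^sub>C x)"

lemma shifts_add: "shifts as (x + y) = shifts as x + shifts as y"
proof (induction as arbitrary: x y)
 case (Cons a as)
 have "H (x + y) - a *\<^sub>C (x + y) = (H x - a *\<^sub>C x) + (H y - a *\<^sub>C y)"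
  by (simp add: lin cmat.scale_right_distrib)
 then show ?case using Cons by (simp only: shifts.simps)
qed simp

lemma shifts_0 [simp]: "shifts as 0 = 0"
 by (induction as) (auto simp: lin0)

lemma shifts_scale: "shifts as (c *\<^sub>C x) = c *\<^sub>C shifts as x"
proof (induction as arbitrary: x)
 case (Cons a as)
 have "H (c *\<^sub>C x) - a *\<^sub>C c *\<^sub>C x = c *\<^sub>C (H x - a *\<^sub>C x)"
  by (simp add: lin cmat.scale_right_diff_distrib mult.commute)
 then show ?case using Cons by simp
qed simp

lemma shifts_H: "shifts as (H x - a *\<^sub>C x) = H (shifts as x) - a *\<^sub>C shifts as x"
proof (induction as arbitrary: x)
 case (Cons b as)
 have "H (H x - a *\<^sub>C x) - b *\<^sub>C (H x - a *\<^sub>C x) = H (H x - b *\<^sub>C x) - a *\<^sub>C (H x - b *\<^sub>C x)"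
  by (simp add: lindiff lin cmat.scale_right_diff_distrib mult.commute algebra_simps)
 then show ?case using Cons by simp
qed simp

lemma shifts_eigen: "H w = a *\<^sub>C w ==> shifts bs w = (\<Prod>b\<leftarrow>bs. a - b) *\<^sub>C w"
proof (induction bs)
 case (Cons b bs)
 have "H w - b *\<^sub>C w = (a - b) *\<^sub>C w" using Cons.prems by (simp add: cmat.scale_left_diff_distrib)
 then show ?case using Cons by (simp add: shifts_scale)
qed simp

lemma shifts_coprime: "shifts as x = 0 ==> shifts bs x = 0 ==> set as \<inter> set bs = {} ==> x = 0"
proof (induction as)
 case (Cons a as)
 define w where "w = shifts as x"
 have "H w - a *\<^sub>C w = 0" using Cons.prems(1) shifts_H[of as x a] by (simp add: w_def)
 then have w: "H w = a *\<^sub>C w" by simp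
 have comm: "shifts as (shifts bs y) = shifts bs (shifts as y)" for y
 proof (induction as arbitrary: y)
  case (Cons c cs) show ?case by (simp only: shifts.simps shifts_H[symmetric] Cons)
 qed simp
 have "shifts bs w = 0" unfolding w_def comm[symmetric] using Cons.prems(2) by simp
 then have "(\<Prod>b\<leftarrow>bs. a - b) *\<^sub>C w = 0" using shifts_eigen[OF w] by simp
 moreover have "(\<Prod>b\<leftarrow>bs. a - b) ~= 0" using Cons.prems(3) by (auto simp: prod_list_zero_iff)
 ultimately have "w = 0" by simp
 then show ?case using Cons by (simp add: w_def)
qed simp

definition eig :: "complex => 'n cmat set" where "eig a = {x \<in> V. H x = a *\<^sub>C x}"

lemma shifts_decompose:
 "shifts as x = 0 ==> x \<in> V ==> distinct as ==> x \<in> cmat.span (\<Union>a\<in>set as. eig a)"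
proof (induction as arbitrary: x)
 case (Cons a as)
 let ?S = "\<Union>b\<in>set as. eig b"
 let ?y = "H x - a *\<^sub>C x"
 have yV: "?y \<in> V" using Cons.prems(2) by (intro cmat.subspace_diff[OF V] cmat.subspace_scale[OF V] VH)
 have y: "?y \<in> cmat.span ?S" using Cons.IH[OF _ yV] Cons.prems by simp
 have "EX z:cmat.span ?S. z \<in> V & H z - a *\<^sub>C z = w" if "w \<in> cmat.span ?S" for w
  using that
 proof (induction rule: cmat.span_induct_alt)
  case base show ?case using cmat.span_zero cmat.subspace_0[OF V] by (intro bexI[of _ 0]) (auto simp: lin0)
 next
  case (step c v w)
  then obtain z where z: "z \<in> cmat.span ?S" "z \<in> V" "H z - a *\<^sub>C z = w" by blast
  obtain b where b: "b \<in> set as" "v \<in> eig b" using step by blast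
  have ab: "b - a ~= 0" using b(1) Cons.prems(3) by auto
  have v: "v \<in> V" "H v = b *\<^sub>C v" using b(2) by (auto simp: eig_def)
  let ?z = "(c / (b - a)) *\<^sub>C v + z"
  have "H ?z - a *\<^sub>C ?z = (c / (b - a)) *\<^sub>C (H v - a *\<^sub>C v) + (H z - a *\<^sub>C z)"
  by (simp add: lin cmat.scale_right_distrib cmat.scale_right_diff_distrib mult.commute algebra_simps)
  also have "H v - a *\<^sub>C v = (b - a) *\<^sub>C v" by (simp add: v cmat.scale_left_diff_distrib)
  also have "(c / (b - a)) *\<^sub>C (b - a) *\<^sub>C v = c *\<^sub>C v" using ab by simp
  finally have "H ?z - a *\<^sub>C ?z = c *\<^sub>C v + w" using z(3) by simp
  moreover have "?z \<in> cmat.span ?S"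
  using b by (intro cmat.span_add cmat.span_scale z) (auto intro: cmat.span_base)
  moreover have "?z \<in> V" by (intro cmat.subspace_add[OF V] cmat.subspace_scale[OF V] v z)
  ultimately show ?case by blast
 qed
 then obtain z where z: "z \<in> cmat.span ?S" "z \<in> V" "H z - a *\<^sub>C z = ?y" using y by blast
 have "H (x - z) - a *\<^sub>C (x - z) = 0"
  using z(3) by (simp add: lindiff cmat.scale_right_diff_distrib algebra_simps)
 then have "x - z \<in> eig a" using cmat.subspace_diff[OF V Cons.prems(2) z(2)] by (simp add: eig_def)
 then have "x - z \<in> cmat.span (\<Union>b\<in>set (a # as). eig b)" by (intro cmat.span_base) auto
 moreover have "z \<in> cmat.span (\<Union>b\<in>set (a # as). eig b)" using z(1) cmat.span_mono[of ?S] by auto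
 ultimately have "(x - z) + z \<in> cmat.span (\<Union>b\<in>set (a # as). eig b)" by (rule cmat.span_add)
 then show ?case by simp
qed (simp add: cmat.span_zero)

lemma funpow_V: "x \<in> V ==> (E ^^ k) x \<in> V" "x \<in> V ==> (F ^^ k) x \<in> V"
 by (induction k) (auto intro: VE VF)

lemma funpow_lin: "(F ^^ k) (c *\<^sub>C x) = c *\<^sub>C (F ^^ k) x" "(F ^^ k) 0 = 0"
 "(E ^^ k) (c *\<^sub>C x) = c *\<^sub>C (E ^^ k) x" "(E ^^ k) 0 = 0" "(E ^^ k) (x + y) = (E ^^ k) x + (E ^^ k) y"
 by (induction k) (auto simp: lin lin0)

text \<open>The highest weight computation works under \<open>F (E z) = 0\<close>, because the only
  term in which \<open>E\<close> acts directly on \<open>z\<close> carries a power of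
  \<open>F\<close> in front.\<close>

lemma E_F_power:
 assumes z: "z \<in> V" "F (E z) = 0"
 shows "E ((F ^^ Suc k) z) = of_nat (Suc k) *\<^sub>C (F ^^ k) (H z - of_nat k *\<^sub>C z)"
proof (induction k)
 case 0 show ?case using EF[OF z(1)] z(2) by simp
next
 case (Suc k)
 have FH: "H ((F ^^ j) z) = (F ^^ j) (H z) - (2 * of_nat j) *\<^sub>C (F ^^ j) z" for j
 proof (induction j)
  case (Suc j)
  have "H ((F ^^ Suc j) z) = F (H ((F ^^ j) z)) - 2 *\<^sub>C (F ^^ Suc j) z" using HF[OF funpow_V(2)[OF z(1)]] by simp
  then show ?case using Suc by (simp add: lindiff lin algebra_simps cmat.scale_left_distrib)
 qed simp
 have fd: "(F ^^ j) (x - y) = (F ^^ j) x - (F ^^ j) y" for j x y by (induction j) (auto simp: lindiff)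
 have "E ((F ^^ Suc (Suc k)) z) = F (E ((F ^^ Suc k) z)) + H ((F ^^ Suc k) z)"
  using EF[OF funpow_V(2)[OF z(1)], of "Suc k"] by simp
 also have "\<dots> = of_nat (Suc k) *\<^sub>C (F ^^ Suc k) (H z - of_nat k *\<^sub>C z) + ((F ^^ Suc k) (H z) - (2 * of_nat (Suc k)) *\<^sub>C (F ^^ Suc k) z)"
  by (simp only: Suc FH) (simp add: lin)
 also have "\<dots> = (of_nat (Suc k) + 1) *\<^sub>C (F ^^ Suc k) (H z) - (of_nat (Suc k) * of_nat k + 2 * of_nat (Suc k)) *\<^sub>C (F ^^ Suc k) z"
  by (simp only: fd funpow_lin cmat.scale_right_diff_distrib cmat.scale_scale cmat.scale_left_distrib cmat.scale_one)
  (simp add: algebra_simps)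
 also have "\<dots> = of_nat (Suc (Suc k)) *\<^sub>C (F ^^ Suc k) (H z - of_nat (Suc k) *\<^sub>C z)"
  by (simp only: fd funpow_lin cmat.scale_right_diff_distrib cmat.scale_scale) (simp add: algebra_simps)
 finally show ?case .
qed

lemma E_power_F_power:
 assumes "z \<in> V" "F (E z) = 0"
 shows "(E ^^ k) ((F ^^ k) z) = fact k *\<^sub>C shifts (map of_nat (rev [0..<k])) z"
 using assms
proof (induction k arbitrary: z)
 case (Suc k)
 let ?y = "H z - of_nat k *\<^sub>C z"
 have y: "?y \<in> V" "F (E ?y) = 0"
 proof -
  show "?y \<in> V" by (intro cmat.subspace_diff[OF V] cmat.subspace_scale[OF V] VH Suc.prems)
  have e: "E (H z) = H (E z) - 2 *\<^sub>C E z" using HE[OF Suc.prems(1)] by simp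
  have "F (H (E z)) = H (F (E z)) + 2 *\<^sub>C F (E z)" using HF[OF VE[OF Suc.prems(1)]] by simp
  then show "F (E ?y) = 0" using Suc.prems(2) by (simp add: lindiff lin e lin0)
 qed
 have "(E ^^ Suc k) ((F ^^ Suc k) z) = (E ^^ k) (E ((F ^^ Suc k) z))" by (simp only: funpow_Suc_right o_def)
 also have "\<dots> = of_nat (Suc k) *\<^sub>C (E ^^ k) ((F ^^ k) ?y)"
  using E_F_power[OF Suc.prems, of k] by (simp only: funpow_lin)
 also have "\<dots> = of_nat (Suc k) *\<^sub>C fact k *\<^sub>C shifts (map of_nat (rev [0..<k])) ?y"
  using Suc.IH[OF y] by simp
 finally show ?case by (simp add: algebra_simps)
qed simp

text \<open>Nilpotency of \<open>F\<close> kills the left-hand side of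
  \<open>E_power_F_power\<close> at \<open>k = N\<close>, so \<open>z\<close> is annihilated by a
  polynomial in \<open>H\<close> with the distinct roots 0, ..., N - 1.\<close>

lemma shifts_FE0:
 assumes "z \<in> V" "F (E z) = 0" shows "shifts (map of_nat (rev [0..<N])) z = 0"
 using E_power_F_power[OF assms, of N] nF[OF assms(1)] by (simp add: funpow_lin)

lemma shifts_E: "z \<in> V ==> E (shifts as z) = shifts (map (%a. a + 2) as) (E z)"
proof (induction as arbitrary: z)
 case (Cons a as)
 have "E (H z - a *\<^sub>C z) = H (E z) - (a + 2) *\<^sub>C E z"
  using HE[OF Cons.prems] by (simp add: lindiff lin cmat.scale_left_distrib algebra_simps)
 moreover have "H z - a *\<^sub>C z \<in> V" by (intro cmat.subspace_diff[OF V] cmat.subspace_scale[OF V] VH Cons.prems)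
 ultimately show ?case using Cons.IH by simp
qed simp

lemma opposite: "sl2_rep V F (%x. - H x) E N"
proof (rule sl2_rep.intro)
 show "clin (%x. - H x)" by (simp add: clin_iff lin)
 show "- H v \<in> V" if "v \<in> V" for v using VH[OF that] cmat.subspace_neg[OF V] by simp
 show "- H (F v) = F (- H v) + 2 *\<^sub>C F v" if "v \<in> V" for v
  using HF[OF that] lin(6)[of "-1" "H v"] by simp
 show "- H (E v) = E (- H v) - 2 *\<^sub>C E v" if "v \<in> V" for v
  using HE[OF that] lin(4)[of "-1" "H v"] by simp
 show "F (E v) = E (F v) + - H v" if "v \<in> V" for v using EF[OF that] by simp
qed (fact V lF lE VE VF nE nF)+

end

context sl2_rep
begin

interpretation op: sl2_rep V F "%x. - H x" E N by (rule opposite)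

lemma op_shifts: "op.shifts as x = (-1) ^ length as *\<^sub>C shifts (map uminus as) x"
proof (induction as arbitrary: x)
 case (Cons a as)
 have "- H x - a *\<^sub>C x = (-1) *\<^sub>C (H x - (- a) *\<^sub>C x)" by (simp add: cmat.scale_right_diff_distrib)
 then show ?case using Cons by (simp only: op.shifts.simps shifts.simps list.map shifts_scale) simp
qed simp

lemma shifts_EF0: assumes "z \<in> V" "E (F z) = 0" shows "shifts (map (%i. - of_nat i) (rev [0..<N])) z = 0"
 using op.shifts_FE0[OF assms] by (simp add: op_shifts o_def)

text \<open>The vector \<open>E z\<close> is killed by a polynomial in \<open>H\<close> with roots
  at least 2, those of \<open>z\<close> raised by \<open>E\<close>, and by the opposite triple also
  by one with roots at most 0.\<close>

lemma kerF_imE: assumes "z \<in> V" "F (E z) = 0" shows "E z = 0"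
proof (rule shifts_coprime)
 show "shifts (map (%a. a + 2) (map of_nat (rev [0..<N]))) (E z) = 0"
  using shifts_E[OF assms(1)] shifts_FE0[OF assms] lin0 by metis
 show "shifts (map (%i. - of_nat i) (rev [0..<N])) (E z) = 0"
  by (rule shifts_EF0) (use assms VE lin0 in auto)
 have "(of_nat i :: complex) + 2 ~= - of_nat j" for i j :: nat
 proof
  assume "(of_nat i :: complex) + 2 = - of_nat j"
  then have "(of_nat i :: complex) + 2 + of_nat j = 0" by simp
  then have "(of_nat (i + 2 + j) :: complex) = 0" by (simp only: of_nat_add of_nat_numeral)
  then show False by (simp only: of_nat_eq_0_iff)
 qed
 then show "set (map (%a. a + 2) (map of_nat (rev [0..<N]))) \<inter> set (map (%i. - of_nat i :: complex) (rev [0..<N])) = {}"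
  by auto
qed

lemma kerE_imF: assumes "z \<in> V" "E (F z) = 0" shows "F z = 0"
 by (rule sl2_rep.kerF_imE[OF opposite assms])

text \<open>By \<open>kerF_imE\<close> and \<open>kerE_imF\<close> the map \<open>F E\<close> is
  injective on the image of \<open>F\<close>, hence onto it by dimension.\<close>

lemma kerF_plus_imE: assumes v: "v \<in> V" shows "EX c:V. EX u:V. F c = 0 & v = c + E u"
proof -
 have "EX w:F ` V. F (E w) = F v"
 proof (rule injective_endo_surj)
  show "cmat.subspace (F ` V)" by (rule cend.linear_subspace_image[OF lF V])
  show "clin (%x. F (E x))" using lE lF by (simp add: clin_iff)
  show "F (E w) \<in> F ` V" if "w \<in> F ` V" for w using that VE VF by blast
  show "F v \<in> F ` V" using v by blast
  show "w = 0" if w: "w \<in> F ` V" "F (E w) = 0" for w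
  proof -
  obtain z where z: "z \<in> V" "w = F z" using w(1) by blast
  have "E w = 0" using kerF_imE[of w] z w(2) VF by blast
  then show ?thesis using kerE_imF[OF z(1)] z(2) by simp
  qed
 qed
 then obtain w where w: "w \<in> V" "F (E w) = F v" using VF by blast
 have "v - E w \<in> V" by (rule cmat.subspace_diff[OF V v VE[OF w(1)]])
 moreover have "F (v - E w) = 0" using w(2) by (simp add: lindiff)
 moreover have "v = (v - E w) + E w" by simp
 ultimately show ?thesis using w(1) by blast
qed

lemma eig_E: "x \<in> eig a ==> E x \<in> eig (a + 2)"
 using HE VE by (auto simp: eig_def lin cmat.scale_left_distrib)

lemma kerF_span: assumes "x \<in> V" "F x = 0" shows "x \<in> cmat.span (\<Union>i\<in>{..0::int}. eig (of_int i))"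
proof -
 have "x \<in> cmat.span (\<Union>a\<in>set (map (%i. - of_nat i) (rev [0..<N])). eig a)"
  by (rule shifts_decompose[OF shifts_EF0]) (use assms lin0 in \<open>auto simp: distinct_map inj_on_def\<close>)
 moreover have "(\<Union>a\<in>set (map (%i. - of_nat i) (rev [0..<N])). eig a) \<subseteq> (\<Union>i\<in>{..0::int}. eig (of_int i))"
 proof
  fix y assume "y \<in> (\<Union>a\<in>set (map (%i. - of_nat i) (rev [0..<N])). eig a)"
  then obtain i where "y \<in> eig (- of_nat i)" by auto
  then have "y \<in> eig (of_int (- int i))" by simp
  then show "y \<in> (\<Union>i\<in>{..0::int}. eig (of_int i))" by (intro UN_I[of "- int i"]) auto
 qed
 ultimately show ?thesis using cmat.span_mono by blast
qed

text \<open>Splitting repeatedly by \<open>kerF_plus_imE\<close> until a power of \<open>E\<close>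
  vanishes writes \<open>v\<close> as a sum of vectors \<open>E^k c\<close> with
  \<open>F c = 0\<close>. Such \<open>c\<close> are sums of integral weight vectors, and
  \<open>E\<close> raises weights by 2. This takes the place of complete reducibility.\<close>

lemma V_span: assumes "v \<in> V" shows "v \<in> cmat.span (\<Union>i::int. eig (of_int i))"
proof -
 let ?U = "cmat.span (\<Union>i::int. eig (of_int i))"
 have EU: "E x \<in> ?U" if "x \<in> ?U" for x
  using that
 proof (induction rule: cmat.span_induct_alt)
  case (step c x y)
  then obtain i :: int where "x \<in> eig (of_int i)" by blast
  from eig_E[OF this] have "E x \<in> eig (of_int (i + 2))" by simp
  then have "E x \<in> ?U" by (intro cmat.span_base) blast
  then show ?case using step by (simp add: lin cmat.span_add cmat.span_scale)
 qed (simp add: lin0 cmat.span_zero)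
 have kF: "c \<in> ?U" if "c \<in> V" "F c = 0" for c
  using kerF_span[OF that] cmat.span_mono[of "\<Union>i\<in>{..0::int}. eig (of_int i)" "\<Union>i::int. eig (of_int i)"] by blast
 have "EX u:V. EX s:?U. v = s + (E ^^ k) u" for k
 proof (induction k)
  case 0 show ?case using assms cmat.span_zero by (intro bexI[of _ v] bexI[of _ 0]) auto
 next
  case (Suc k)
  then obtain u s where us: "u \<in> V" "s \<in> ?U" "v = s + (E ^^ k) u" by blast
  obtain c w where c: "c \<in> V" "w \<in> V" "F c = 0" "u = c + E w" using kerF_plus_imE[OF us(1)] by blast
  have "(E ^^ k) c \<in> ?U" by (induction k) (use kF[OF c(1,3)] EU in auto)
  then have "s + (E ^^ k) c \<in> ?U" using us(2) by (rule cmat.span_add[rotated])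
  moreover have "v = (s + (E ^^ k) c) + (E ^^ Suc k) w"
  using us(3) c(4) by (simp only: funpow_lin funpow_Suc_right o_def add.assoc)
  ultimately show ?case using c(2) by blast
 qed
 from this[of N] show ?thesis using nE by auto
qed

end

section \<open>Points of varieties and of orbits\<close>

lemma hom_is_evaluation:
 assumes "is_hom UNIV P \<psi>" "!!c. \<psi> (Cst c) = c"
 shows "\<psi> p = ev p (\<chi> i j. \<psi> (Var i j))"
proof (induction p rule: pol_induct)
 case (add p q) then show ?case using assms(1) by (simp add: is_hom_def)
next
 case (mult p q) then show ?case using assms(1) by (simp add: is_hom_def)
qed (auto simp: assms(2))

lemma char0_prime:
 assumes "prime_in UNIV (P :: 'n::finite pol set)" shows "char0 P"
proof (intro allI impI notI)
 fix n :: nat assume n: "n > 0" "of_nat n \<in> P"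
 have "Cst (1 / of_nat n) * of_nat n \<in> P" by (rule ideal_in_mult[OF prime_in_ideal[OF assms] UNIV_I n(2)])
 moreover have "Cst (1 / of_nat n) * of_nat n = (1 :: 'n pol)" using n(1) by (intro pol_eqI) simp
 ultimately show False using prime_in_1[OF assms] by simp
qed

lemma Cst_notin_prime:
 assumes "prime_in UNIV (P :: 'n::finite pol set)" "Cst c \<in> P" shows "c = 0"
proof (rule ccontr)
 assume c: "c ~= 0"
 have "Cst (1 / c) * Cst c \<in> P" by (rule ideal_in_mult[OF prime_in_ideal[OF assms(1)] UNIV_I assms(2)])
 moreover have "Cst (1 / c) * Cst c = (1 :: 'n pol)" using c by (intro pol_eqI) simp
 ultimately show False using prime_in_1[OF assms(1)] by simp
qed

text \<open>This is \<open>point_extension\<close> over the constants, whose point sends each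
  constant to itself; constants outside \<open>P\<close> are nonzero. The lifted homomorphism fixes
  constants, so it is evaluation at the matrix of its values on the coordinates.\<close>

theorem countable_nullstellensatz:
 fixes P :: "'n::finite pol set" and b :: "nat => 'n pol"
 assumes P: "prime_in UNIV P" and b: "!!n. b n \<notin> P"
 shows "EX z. (ALL p:P. ev p z = 0) & (ALL n. ev (b n) z ~= 0)"
proof -
 obtain us where us: "adjs (range Cst) us = (UNIV :: 'n pol set)" using finite_generation by blast
 define A :: "'n pol set" where "A = range Cst"
 \<comment> \<open>Evaluation at 0 is an arbitrary way to read off a constant.\<close>
 define \<phi> :: "'n pol => complex" where "\<phi> p = ev p 0" for p
 have "EX a. (\<forall>n::nat. a n \<in> A - P) & (ALL \<phi>. is_hom A P \<phi> --> (ALL n. \<phi> (a n) ~= 0) -->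
  (EX \<psi>. extends_from A (adjs A us) P \<phi> \<psi> & (ALL n. \<psi> (b n) ~= 0)))"
  by (rule point_extension) (use P b us char0_prime[OF P] is_subring_Cst in \<open>auto simp: A_def\<close>)
 then obtain a where "(\<forall>n::nat. a n \<in> A - P) & (ALL \<phi>. is_hom A P \<phi> --> (ALL n. \<phi> (a n) ~= 0) -->
  (EX \<psi>. extends_from A (adjs A us) P \<phi> \<psi> & (ALL n. \<psi> (b n) ~= 0)))" ..
 note a = conjunct1[OF this] and ext = spec[OF conjunct2[OF this], of \<phi>]
 have "is_hom A P \<phi>"
  using Cst_notin_prime[OF P] by (auto simp: is_hom_def \<phi>_def A_def)
 moreover have "\<phi> (a n) ~= 0" for n
 proof -
  obtain c where c: "a n = Cst c" using a by (auto simp: A_def)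
  have "a n \<notin> P" using a by blast
  then have "c ~= 0" using c ideal_in_0[OF prime_in_ideal[OF P]] Cst_simps(3) by metis
  then show ?thesis by (simp add: c \<phi>_def)
 qed
 ultimately have "EX \<psi>. extends_from A (adjs A us) P \<phi> \<psi> & (ALL n. \<psi> (b n) ~= 0)" using ext by simp
 then obtain \<psi> where "extends_from A (adjs A us) P \<phi> \<psi> & (ALL n. \<psi> (b n) ~= 0)" ..
 then have \<psi>: "is_hom UNIV P \<psi>" "!!x. x \<in> A ==> \<psi> x = \<phi> x" "!!n. \<psi> (b n) ~= 0"
  using us by (auto simp: extends_from_def A_def)
 have "\<psi> (Cst c) = c" for c using \<psi>(2)[of "Cst c"] by (simp add: A_def \<phi>_def)
 note e = hom_is_evaluation[OF \<psi>(1) this]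
 define Z :: "'n cmat" where "Z = (\<chi> i j. \<psi> (Var i j))"
 have e': "ev p Z = \<psi> p" for p unfolding Z_def by (rule e[symmetric])
 have "ALL p:P. \<psi> p = 0" using \<psi>(1) by (simp add: is_hom_def)
 then have "(ALL p:P. ev p Z = 0) & (ALL n. ev (b n) Z ~= 0)" using \<psi>(3) by (simp add: e')
 then show ?thesis ..
qed

lemma of_nat_fun_apply: "(of_nat n :: 'a => 'b::comm_ring_1) x = of_nat n"
 by (induction n) auto

context connected_group
begin

text \<open>The functions on \<open>G\<close> are generated over the functions pulled back from the orbit of \<open>x\<close> by the
 matrix entries and the inverse of the determinant. Extending points and tangent vectors from the
 closure of the orbit to \<open>G\<close> shows that generic points of the closure are in the orbit, and that
 generic tangent vectors come from the Lie algebra.\<close>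

lemma orbit_generic:
 "\<exists>a :: nat => 'n pol. (ALL n. a n \<notin> IO x) &
  (ALL z. (ALL p:IO x. ev p z = 0) --> (ALL n. ev (a n) z ~= 0) -->
  z \<in> adjoint_orbit G x &
  (ALL v. (ALL p:IO x. dirD p z v = 0) --> (EX X:\<gg>. v = lie_bracket X z)))"
proof -
 define pb :: "'n pol => 'n cmat => complex" where "pb p = (%A. ev p (Ad A x))" for p
 define C where "C = range pb"
 define crd :: "'n => 'n => 'n cmat => complex" where "crd i j = (%A. A $ i $ j)" for i j
 define idet :: "'n cmat => complex" where "idet = (%A. 1 / det A)"
 obtain cs where cs: "set cs = (%(i, j). crd i j) ` UNIV"
  using finite_list[of "(%(i, j). crd i j) ` (UNIV :: ('n \<times> 'n) set)"] by auto
 define us where "us = idet # cs"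
 have pb: "pb (p + q) = pb p + pb q" "pb (p * q) = pb p * pb q" "pb (- p) = - pb p" "pb 1 = 1" for p q
  by (auto simp: pb_def fun_eq_iff)
 have C: "is_subring C"
  unfolding is_subring_def C_def using pb by (metis (no_types, lifting) imageE rangeI)
 define R where "R = adjs C us"
 have R: "is_subring R" unfolding R_def by (rule adjs_subring[OF C])
 have CR: "f \<in> R" if "f \<in> C" for f unfolding R_def by (rule adjs_base[OF C that])
 have crdR: "crd i j \<in> R" for i j
  unfolding R_def by (rule adjs_self[OF C]) (use cs in \<open>auto simp: us_def intro!: rev_image_eqI[of "(i, j)"]\<close>)
 have idetR: "idet \<in> R" unfolding R_def by (rule adjs_self[OF C]) (simp add: us_def)
 have "rfun (1 :: 'n cmat => complex)" using rfun_const[of 1] by (simp add: one_fun_def)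
 moreover have "rfun (f + g)" "rfun (f * g)" "rfun (- f)" if fg: "rfun f" "rfun g" for f g :: "'n cmat => complex"
  using rfun_add[OF fg] rfun_mult[OF fg] rfun_mult[OF rfun_const[of "-1"] fg(1)]
  by (simp_all add: plus_fun_def times_fun_def fun_Compl_def)
 ultimately have rsub: "is_subring {f :: 'n cmat => complex. rfun f}" by (auto simp: is_subring_def)
 have rR: "rfun f" if "f \<in> R" for f
 proof -
  have "rfun idet" by (rule rfun_I[of 1 1]) (simp add: idet_def)
  moreover have "rfun (crd i j)" for i j proof -
  have "ev (Var i j) = (crd i j :: 'n cmat => complex)" by (rule ext) (simp add: crd_def)
  then show ?thesis using rfun_pol[of "Var i j"] by simp
  qed
  ultimately have "R \<subseteq> {f. rfun f}"
  unfolding R_def using rfun_ev_Ad by (intro adjs_least rsub) (auto simp: C_def pb_def us_def cs)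
  then show ?thesis using that by blast
 qed
 define P where "P = {f \<in> R. ALL A:G. f A = 0}"
 have Pideal: "ideal_in R P"
  using subring_0[OF R] subring_add[OF R] subring_mult[OF R] by (auto simp: ideal_in_def P_def)
 have P: "prime_in R P"
  unfolding prime_in_def
 proof (intro conjI ballI impI)
  show "ideal_in R P" by (rule Pideal)
  show "1 \<notin> P" using G_one by (auto simp: P_def)
  fix f g assume f: "f \<in> R" and g: "g \<in> R" and fg: "f * g \<in> P"
  obtain p k where p: "ALL A. det A ~= 0 --> ev p A = det A ^ k * f A" using rR[OF f] unfolding rfun_def by blast
  obtain q l where q: "ALL A. det A ~= 0 --> ev q A = det A ^ l * g A" using rR[OF g] unfolding rfun_def by blast
  have "f A * g A = 0" if "A \<in> G" for A using fg that by (auto simp: P_def)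
  then have "p * q \<in> IG" using p q G_det by (auto simp: IG_def)
  then have "p \<in> IG | q \<in> IG" using prime_inD[OF IG_prime UNIV_I UNIV_I] by blast
  then show "f \<in> P | g \<in> P" using p q G_det f g by (auto simp: IG_def P_def)
 qed
 have ch: "char0 P" using G_one by (auto simp: P_def of_nat_fun_apply)
 have one: "(1 :: 'n cmat => complex) \<in> adjs C us - P"
  using subring_1[OF R] prime_in_1[OF P] by (simp add: R_def)
 \<comment> \<open>Upstairs there is nothing to keep nonzero, so the family is constantly 1.\<close>
 have "EX a. (\<forall>n::nat. a n \<in> C - P) & (ALL \<phi>. is_hom C P \<phi> --> (ALL n. \<phi> (a n) ~= 0) -->
  (EX \<psi>. extends_from C (adjs C us) P \<phi> \<psi> & (\<forall>n::nat. \<psi> 1 ~= 0)))"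
  by (rule point_extension[where b = "%_. 1"]) (use C P one ch in \<open>simp_all add: R_def\<close>)
 then obtain a where "(\<forall>n::nat. a n \<in> C - P) & (ALL \<phi>. is_hom C P \<phi> --> (ALL n. \<phi> (a n) ~= 0) -->
  (EX \<psi>. extends_from C (adjs C us) P \<phi> \<psi> & (\<forall>n::nat. \<psi> 1 ~= 0)))" ..
 note a = conjunct1[OF this] and ext = conjunct2[OF this]
 have "ALL n. EX p. a n = pb p" using a by (auto simp: C_def)
 then obtain a' where a': "!!n. a n = pb (a' n)" by metis
 have IOpb: "p \<in> IO x \<longleftrightarrow> pb p \<in> P" for p
  using CR[of "pb p"] by (auto simp: C_def IO_def adjoint_orbit_def P_def pb_def)
 have "z \<in> adjoint_orbit G x & (ALL v. (ALL p:IO x. dirD p z v = 0) --> (EX X:\<gg>. v = lie_bracket X z))"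
  if z: "ALL p:IO x. ev p z = 0" and nz: "ALL n. ev (a' n) z ~= 0" for z
 proof -
  define \<phi> where "\<phi> f = ev (SOME p. pb p = f) z" for f
  have \<phi>: "\<phi> (pb p) = ev p z" for p
  proof -
  have "pb (SOME q. pb q = pb p) = pb p" by (rule someI) simp
  then have "pb ((SOME q. pb q = pb p) - p) = 0" by (auto simp: pb_def fun_eq_iff)
  then have "(SOME q. pb q = pb p) - p \<in> IO x"
  unfolding IOpb using ideal_in_0[OF Pideal] by simp
  then show ?thesis using z by (auto simp: \<phi>_def)
  qed
  have hom: "is_hom C P \<phi>"
  unfolding is_hom_def
  proof (intro conjI ballI)
  show "\<phi> 1 = 1" using \<phi>[of 1] by (simp add: pb)
  fix f g assume "f \<in> C" "g \<in> C"
  then obtain p q where "f = pb p" "g = pb q" by (auto simp: C_def)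
  then show "\<phi> (f + g) = \<phi> f + \<phi> g" "\<phi> (f * g) = \<phi> f * \<phi> g"
  using \<phi> by (simp_all flip: pb)
  next
  fix f assume "f \<in> C \<inter> P"
  then obtain p where "f = pb p" "pb p \<in> P" by (auto simp: C_def)
  then show "\<phi> f = 0" using \<phi> z IOpb by simp
  qed
  have "EX \<psi>. extends_from C (adjs C us) P \<phi> \<psi> & (\<forall>n::nat. \<psi> 1 ~= 0)"
  using mp[OF spec[OF ext, of \<phi>] hom] nz by (simp add: a' \<phi>)
  then obtain \<psi> where "extends_from C (adjs C us) P \<phi> \<psi> & (\<forall>n::nat. \<psi> 1 ~= 0)" ..
  then have e: "extends_from C R P \<phi> \<psi>" by (simp add: R_def)
  then have \<psi>: "is_hom R P \<psi>" "!!f. f \<in> C ==> \<psi> f = \<phi> f"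
  and der: "!!d. is_der C P \<phi> d ==> EX d'. is_der R P \<psi> d' & (ALL x:C. d' x = d x)"
  by (auto simp: extends_from_def)
  note P0 = ideal_in_0[OF Pideal]
  note hs = hom_add[OF R P0 \<psi>(1)] hom_mult[OF R P0 \<psi>(1)]
  \<comment> \<open>The lifted point in matrix coordinates. It is invertible, since the inverse
    determinant is among the generators of \<open>R\<close>, and satisfies the equations of G, so it
    belongs to G.\<close>
  define g :: "'n cmat" where "g = (\<chi> i j. \<psi> (crd i j))"
  have pbC: "pb (Cst c) \<in> C" for c by (simp add: C_def)
  have pbc: "pb (Cst c) = (%A. c)" for c by (simp add: pb_def)
  have cR: "(%A. c) \<in> R" for c using CR[OF pbC[of c]] by (simp add: pbc)
  have \<psi>c: "\<psi> (%A. c) = c" for c using \<psi>(2)[OF pbC] \<phi>[of "Cst c"] by (simp add: pbc)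
  have evR: "ev q \<in> R & \<psi> (ev q) = ev q g" for q
  proof (induction q rule: pol_induct)
  case (Cst c)
  have "ev (Cst c) = (%A. c)" by auto
  then show ?case using cR \<psi>c by simp
  next
  case (Var i j)
  have "ev (Var i j) = crd i j" by (auto simp: crd_def)
  moreover have "crd i j g = g $ i $ j" by (simp add: crd_def)
  moreover have "g $ i $ j = \<psi> (crd i j)" by (simp add: g_def)
  ultimately show ?case using crdR by simp
  next
  case (add p q)
  have E: "ev (p + q) = ev p + ev q" by auto
  have "ev p \<in> R" "ev q \<in> R" using add by auto
  note 1 = subring_add[OF R this] hs(1)[OF this]
  have 2: "ev (p + q) g = ev p g + ev q g" by simp
  show ?case unfolding 2 unfolding E 1(2) using 1(1) add by (simp only:)
  next
  case (mult p q)
  have E: "ev (p * q) = ev p * ev q" by auto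
  have "ev p \<in> R" "ev q \<in> R" using mult by auto
  note 1 = subring_mult[OF R this] hs(2)[OF this]
  have 2: "ev (p * q) g = ev p g * ev q g" by simp
  show ?case unfolding 2 unfolding E 1(2) using 1(1) mult by (simp only:)
  qed
  have zeroP: "\<psi> f = 0" if "f \<in> P" for f
  using \<psi>(1) that ideal_in_sub[OF Pideal that] by (auto simp: is_hom_def)
  have IGP: "ev q \<in> P" if "q \<in> IG" for q using that evR by (auto simp: P_def IG_def)
  have "ev Det * idet - 1 \<in> P"
  using G_det subring_diff[OF R subring_mult[OF R] subring_1[OF R]] evR[of Det] idetR
  by (auto simp: P_def idet_def)
  from zeroP[OF this] have "det g * \<psi> idet = 1"
  using hom_diff[OF R P0 \<psi>(1) subring_mult[OF R] subring_1[OF R], of "ev Det" idet] evR[of Det] idetR hs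
  hom_1[OF R P0 \<psi>(1)] by simp
  then have ginv: "invertible g" by (auto simp: invertible_det_nz)
  have gG: "g \<in> G" using ginv zeroP[OF IGP] evR by (intro G_closed) auto
  have AdC: "(%A. Ad A x $ i $ k) \<in> C" for i k
  proof -
  have "(%A. Ad A x $ i $ k) = pb (Var i k)" by (simp add: pb_def)
  then show ?thesis by (simp add: C_def)
  qed
  have AdR: "(%A. Ad A x $ i $ k) \<in> R" for i k by (rule CR[OF AdC])
  have \<phi>Ad: "\<phi> (%A. Ad A x $ i $ k) = z $ i $ k" for i k using \<phi>[of "Var i k"] by (simp add: pb_def)
  \<comment> \<open>The equation \<open>Ad A x ** A = A ** x\<close> avoids the inverse. Applying
    \<psi> to it gives \<open>z ** g = g ** x\<close>, and applying a tangent vector gives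
    \<open>rel2\<close>.\<close>
  have rel: "(\<Sum>k\<in>UNIV. (%A. Ad A x $ i $ k) * crd k j) - (\<Sum>k\<in>UNIV. crd i k * (%A. x $ k $ j)) \<in> P" for i j
  proof -
  let ?f = "(\<Sum>k\<in>UNIV. (%A. Ad A x $ i $ k) * crd k j) - (\<Sum>k\<in>UNIV. crd i k * (%A. x $ k $ j))"
  have "?f \<in> R" by (intro subring_diff[OF R] subring_sum[OF R] subring_mult[OF R] AdR crdR cR)
  moreover have "?f A = 0" if "A \<in> G" for A
  proof -
  have sf: "(\<Sum>k\<in>S. h k) A = (\<Sum>k\<in>S. h k A)" for S and h :: "'n => 'n cmat => complex"
  by (induction S rule: infinite_finite_induct) auto
  have "?f A = (Ad A x ** A) $ i $ j - (A ** x) $ i $ j"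
  by (simp add: sf crd_def matrix_matrix_mult_def)
  moreover have "Ad A x ** A = A ** x ** (matrix_inv A ** A)" by (simp add: Ad_def matrix_mul_assoc)
  then have "Ad A x ** A = A ** x" using minv_left[OF G_inv[OF that]] by simp
  ultimately show ?thesis by simp
  qed
  ultimately show ?thesis by (simp add: P_def)
  qed
  have prodR: "(%A. Ad A x $ i $ k) * crd k j \<in> R" "crd i k * (%A. x $ k $ j) \<in> R" for i j k
  by (intro subring_mult[OF R] AdR crdR cR)+
  have sumR: "(\<Sum>k\<in>UNIV. (%A. Ad A x $ i $ k) * crd k j) \<in> R" "(\<Sum>k\<in>UNIV. crd i k * (%A. x $ k $ j)) \<in> R" for i j
  by (intro subring_sum[OF R] prodR)+
  have zg: "z ** g = g ** x"
  proof -
  have "(z ** g) $ i $ j = (g ** x) $ i $ j" for i j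
  proof -
  have "\<psi> (\<Sum>k\<in>UNIV. (%A. Ad A x $ i $ k) * crd k j) - \<psi> (\<Sum>k\<in>UNIV. crd i k * (%A. x $ k $ j)) = 0"
  using zeroP[OF rel[of i j]] hom_diff[OF R P0 \<psi>(1) sumR(1)[of i j] sumR(2)[of i j]] by simp
  then have "(\<Sum>k\<in>UNIV. \<psi> (%A. Ad A x $ i $ k) * \<psi> (crd k j)) - (\<Sum>k\<in>UNIV. \<psi> (crd i k) * \<psi> (%A. x $ k $ j)) = 0"
  by (simp add: hom_sum[OF R P0 \<psi>(1)] prodR hom_mult[OF R P0 \<psi>(1)] AdR crdR cR)
  then show ?thesis using \<psi>(2)[OF AdC] by (simp add: \<phi>Ad \<psi>c g_def matrix_matrix_mult_def)
  qed
  then show ?thesis by (simp add: vec_eq_iff)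
  qed
  have zAd: "z = Ad g x"
  proof -
  have "z = z ** (g ** matrix_inv g)" using minv_right[OF ginv] by simp
  also have "\<dots> = Ad g x" unfolding Ad_def zg[symmetric] by (simp add: matrix_mul_assoc)
  finally show ?thesis .
  qed
  have "EX X:\<gg>. v = lie_bracket X z" if v: "ALL p:IO x. dirD p z v = 0" for v
  proof -
  define d where "d f = dirD (SOME p. pb p = f) z v" for f
  have d: "d (pb p) = dirD p z v" for p
  proof -
  have "pb (SOME q. pb q = pb p) = pb p" by (rule someI) simp
  then have "pb ((SOME q. pb q = pb p) - p) = 0" by (auto simp: pb_def fun_eq_iff)
  then have "(SOME q. pb q = pb p) - p \<in> IO x"
  unfolding IOpb using ideal_in_0[OF Pideal] by simp
  then show ?thesis using v by (auto simp: d_def)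
  qed
  have "is_der C P \<phi> d"
  unfolding is_der_def
  proof (intro conjI ballI)
  fix f g assume "f \<in> C" "g \<in> C"
  then obtain p q where "f = pb p" "g = pb q" by (auto simp: C_def)
  then show "d (f + g) = d f + d g" "d (f * g) = \<phi> f * d g + d f * \<phi> g"
  using \<phi> d by (simp_all add: algebra_simps flip: pb)
  next
  fix f assume "f \<in> C \<inter> P"
  then obtain p where "f = pb p" "pb p \<in> P" by (auto simp: C_def)
  then show "d f = 0" using d v IOpb by simp
  qed
  from der[OF this] obtain d' where d': "is_der R P \<psi> d'" "!!f. f \<in> C ==> d' f = d f" by blast
  note ds = der_add[OF R P0 \<psi>(1) d'(1)] der_mult[OF R P0 \<psi>(1) d'(1)]
  have d'c: "d' (%A. c) = 0" for c using d'(2)[OF pbC] d[of "Cst c"] by (simp add: pbc)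
  \<comment> \<open>The lifted tangent vector in matrix coordinates. It is tangent to G at
    \<open>g\<close>, so \<open>w ** matrix_inv g\<close> is in the Lie algebra.\<close>
  define w :: "'n cmat" where "w = (\<chi> i j. d' (crd i j))"
  have d'ev: "d' (ev q) = dirD q g w" for q
  proof (induction q rule: pol_induct)
  case (Cst c)
  have "ev (Cst c) = (%A. c)" by auto
  then show ?case using d'c by simp
  next
  case (Var i j)
  have "ev (Var i j) = crd i j" by (auto simp: crd_def)
  then show ?case by (simp add: w_def)
  next
  case (add p q)
  have "ev (p + q) = ev p + ev q" by auto
  moreover have "ev p \<in> R" "ev q \<in> R" "\<psi> (ev p) = ev p g" "\<psi> (ev q) = ev q g" using evR by auto
  note ds(1)[OF this(1,2)] this
  ultimately show ?case using add by (simp only: dirD_simps)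
  next
  case (mult p q)
  have "ev (p * q) = ev p * ev q" by auto
  moreover have "ev p \<in> R" "ev q \<in> R" "\<psi> (ev p) = ev p g" "\<psi> (ev q) = ev q g" using evR by auto
  note ds(2)[OF this(1,2)] this
  ultimately show ?case using mult by (simp only: dirD_simps add.commute)
  qed
  have d'P: "d' f = 0" if "f \<in> P" for f
  using d'(1) that ideal_in_sub[OF Pideal that] by (auto simp: is_der_def)
  define X where "X = w ** matrix_inv g"
  have X: "X \<in> \<gg>" unfolding X_def by (rule Lie_tangent[OF gG]) (use d'P[OF IGP] d'ev in auto)
  have wX: "w = X ** g" using minv_left[OF ginv] by (simp add: X_def flip: matrix_mul_assoc)
  have rel2: "v ** g + z ** w = w ** x"
  proof -
  have "(v ** g) $ i $ j + (z ** w) $ i $ j = (w ** x) $ i $ j" for i j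
  proof -
  have "d' (\<Sum>k\<in>UNIV. (%A. Ad A x $ i $ k) * crd k j) - d' (\<Sum>k\<in>UNIV. crd i k * (%A. x $ k $ j)) = 0"
  using d'P[OF rel[of i j]] der_diff[OF R P0 \<psi>(1) d'(1) sumR(1)[of i j] sumR(2)[of i j]] by simp
  then have "(\<Sum>k\<in>UNIV. \<psi> (%A. Ad A x $ i $ k) * d' (crd k j) + d' (%A. Ad A x $ i $ k) * \<psi> (crd k j))
  - (\<Sum>k\<in>UNIV. \<psi> (crd i k) * d' (%A. x $ k $ j) + d' (crd i k) * \<psi> (%A. x $ k $ j)) = 0"
  by (simp add: der_sum[OF R P0 \<psi>(1) d'(1)] prodR der_mult[OF R P0 \<psi>(1) d'(1)] AdR crdR cR)
  moreover have "d' (%A. Ad A x $ i $ k) = v $ i $ k" for k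
  using d'(2)[OF AdC] d[of "Var i k"] by (simp add: pb_def)
  ultimately show ?thesis using \<psi>(2)[OF AdC]
  by (simp add: \<phi>Ad \<psi>c d'c g_def w_def matrix_matrix_mult_def sum.distrib algebra_simps)
  qed
  then show ?thesis by (simp add: vec_eq_iff)
  qed
  have "v ** g = (X ** z - z ** X) ** g"
  proof -
  have "v ** g = w ** x - z ** w" using rel2 by (simp add: eq_diff_eq)
  also have "w ** x = X ** z ** g" unfolding wX using zg by (simp flip: matrix_mul_assoc)
  finally show ?thesis by (simp add: wX matrix_diff_mult matrix_mul_assoc)
  qed
  then have "v ** g ** matrix_inv g = (X ** z - z ** X) ** g ** matrix_inv g" by simp
  then have "v = lie_bracket X z"
  using minv_right[OF ginv] by (simp add: lie_bracket_def flip: matrix_mul_assoc)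
  then show ?thesis using X by blast
  qed
  then show ?thesis using zAd gG by (auto simp: adjoint_orbit_def)
 qed
 moreover have "a' n \<notin> IO x" for n using a a' IOpb by auto
 ultimately show ?thesis by (intro exI[of _ a']) auto
qed

section \<open>Homogeneity: from generic points to all points of an orbit\<close>

lemma IO_Ad: assumes "p \<in> IO x" "g \<in> G" shows "pcomp p (Ad g) \<in> IO x"
proof -
 have pm: "pmap (Ad g)" unfolding Ad_def by (intro pmap_mult pmap_id pmap_const)
 show ?thesis using assms orbit_Ad by (simp add: IO_def ev_pcomp[OF pm])
qed

lemma dirD_Ad: "dirD (pcomp p (Ad g)) y v = dirD p (Ad g y) (Ad g v)"
proof -
 have pm: "pmap (Ad g)" unfolding Ad_def by (intro pmap_mult pmap_id pmap_const)
 have Adg: "Ad g = (%x. g ** x ** matrix_inv g)" by (rule ext) (simp add: Ad_def)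
 have "has_dd (Ad g) y v (Ad g v)"
  using has_dd_mult[OF has_dd_mult[OF has_dd_const[of g] has_dd_id] has_dd_const[of "matrix_inv g"], of y v]
  unfolding Adg Ad_def by simp
 from dirD_pcomp[OF pm this] show ?thesis .
qed

text \<open>Generic points of the closure exist by \<open>countable_nullstellensatz\<close> and lie
  in the orbit. The group carries \<open>y\<close> to such a point, together with tangent vectors
  and the orbit ideal.\<close>

lemma orbit_tangent:
 assumes y: "y \<in> adjoint_orbit G x" and v: "!!p. p \<in> IO x ==> dirD p y v = 0"
 shows "EX X:\<gg>. v = lie_bracket X y"
proof -
 obtain a :: "nat => 'n pol" where a: "ALL n. a n \<notin> IO x" and
  gen: "ALL z. (ALL p:IO x. ev p z = 0) --> (ALL n. ev (a n) z ~= 0) --> z \<in> adjoint_orbit G x &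
  (ALL v. (ALL p:IO x. dirD p z v = 0) --> (EX X:\<gg>. v = lie_bracket X z))"
  using orbit_generic[of x] by (elim exE conjE)
 obtain z where z: "ALL p:IO x. ev p z = 0" "ALL n. ev (a n) z ~= 0"
  using countable_nullstellensatz[OF IO_prime, of a x] a by blast
 have zO: "z \<in> adjoint_orbit G x" and zt: "!!v. (ALL p:IO x. dirD p z v = 0) ==> (EX X:\<gg>. v = lie_bracket X z)"
  using mp[OF mp[OF spec[OF gen, of z] z(1)] z(2)] by auto
 have "z \<in> adjoint_orbit G y" using zO orbit_eq[OF y] by simp
 then obtain g where g: "g \<in> G" "z = Ad g y" by (auto simp: adjoint_orbit_def)
 have "ALL p:IO x. dirD p z (Ad g v) = 0"
 proof
  fix p assume "p \<in> IO x"
  from v[OF IO_Ad[OF this g(1)]] show "dirD p z (Ad g v) = 0" using dirD_Ad[of p g y v] g(2) by simp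
 qed
 from zt[OF this] obtain X where X: "X \<in> \<gg>" "Ad g v = lie_bracket X z" by blast
 let ?i = "matrix_inv g"
 have "v = Ad ?i (Ad g v)" using Ad_minv[OF G_inv[OF g(1)]] by simp
 also have "\<dots> = lie_bracket (Ad ?i X) (Ad ?i z)"
  unfolding X(2) by (rule Ad_bracket[OF invertible_minv[OF G_inv[OF g(1)]]])
 also have "Ad ?i z = y" using g Ad_minv[OF G_inv[OF g(1)]] by simp
 finally show ?thesis using Lie_Ad[OF G_minv[OF g(1)] X(1)] by blast
qed

text \<open>A countable form of the openness of an orbit in its closure: hypersurfaces avoiding one
  point of the orbit are moved by the group so as to avoid \<open>y\<close>.\<close>

lemma orbit_open:
 assumes y: "y \<in> adjoint_orbit G x"
 shows "\<exists>a :: nat => 'n pol. (ALL n. ev (a n) y ~= 0) &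
  (ALL z. (ALL p:IO x. ev p z = 0) --> (ALL n. ev (a n) z ~= 0) --> z \<in> adjoint_orbit G x)"
proof -
 obtain a :: "nat => 'n pol" where a: "ALL n. a n \<notin> IO x" and
  gen: "ALL z. (ALL p:IO x. ev p z = 0) --> (ALL n. ev (a n) z ~= 0) --> z \<in> adjoint_orbit G x &
  (ALL v. (ALL p:IO x. dirD p z v = 0) --> (EX X:\<gg>. v = lie_bracket X z))"
  using orbit_generic[of x] by (elim exE conjE)
 obtain z where z: "ALL p:IO x. ev p z = 0" "ALL n. ev (a n) z ~= 0"
  using countable_nullstellensatz[OF IO_prime, of a x] a by blast
 have zO: "z \<in> adjoint_orbit G x" using mp[OF mp[OF spec[OF gen, of z] z(1)] z(2)] by auto
 have "z \<in> adjoint_orbit G y" using zO orbit_eq[OF y] by simp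
 then obtain g where g: "g \<in> G" "z = Ad g y" by (auto simp: adjoint_orbit_def)
 have pm: "pmap (Ad g)" unfolding Ad_def by (intro pmap_mult pmap_id pmap_const)
 have "w \<in> adjoint_orbit G x" if w: "ALL p:IO x. ev p w = 0" "ALL n. ev (pcomp (a n) (Ad g)) w ~= 0" for w
 proof -
  have "ALL p:IO x. ev p (Ad g w) = 0" using w(1) IO_Ad[OF _ g(1)] ev_pcomp[OF pm] by metis
  moreover have "ALL n. ev (a n) (Ad g w) ~= 0" using w(2) by (simp add: ev_pcomp[OF pm])
  ultimately have "Ad g w \<in> adjoint_orbit G x" using mp[OF mp[OF spec[OF gen, of "Ad g w"]]] by blast
  from orbit_Ad[OF this G_minv[OF g(1)]] show ?thesis using Ad_minv[OF G_inv[OF g(1)]] by simp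
 qed
 moreover have "ev (pcomp (a n) (Ad g)) y ~= 0" for n using z(2) g(2) by (simp add: ev_pcomp[OF pm])
 ultimately show ?thesis by (intro exI[of _ "%n. pcomp (a n) (Ad g)"]) auto
qed

text \<open>Invariance makes the two ideals equal, so the orbits have the same closure. Each
  contains the points of the closure off countably many hypersurfaces, and both families together
  still leave a point.\<close>

lemma orbit_ideal_eq:
 assumes "!!p. p \<in> IO x ==> ev p y = 0" "!!p. p \<in> IO y ==> ev p x = 0"
 shows "adjoint_orbit G x = adjoint_orbit G y"
proof -
 have mono: "IO u \<subseteq> IO w" if "!!p. p \<in> IO u ==> ev p w = 0" for u w
 proof
  fix p assume p: "p \<in> IO u"
  have pm: "pmap (Ad g)" for g :: "'n cmat" unfolding Ad_def by (intro pmap_mult pmap_id pmap_const)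
  have "ev p (Ad g w) = 0" if "g \<in> G" for g
  using \<open>!!p. p \<in> IO u ==> ev p w = 0\<close>[OF IO_Ad[OF p that]] by (simp add: ev_pcomp[OF pm])
  then show "p \<in> IO w" by (auto simp: IO_def[of w] adjoint_orbit_def)
 qed
 have eq: "IO x = IO y" using mono[OF assms(1)] mono[OF assms(2)] by blast
 obtain a :: "nat => 'n pol" where a: "ALL n. ev (a n) x ~= 0"
  "ALL z. (ALL p:IO x. ev p z = 0) --> (ALL n. ev (a n) z ~= 0) --> z \<in> adjoint_orbit G x"
  using orbit_open[OF orbit_self[of x]] by (elim exE conjE)
 obtain b :: "nat => 'n pol" where b: "ALL n. ev (b n) y ~= 0"
  "ALL z. (ALL p:IO y. ev p z = 0) --> (ALL n. ev (b n) z ~= 0) --> z \<in> adjoint_orbit G y"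
  using orbit_open[OF orbit_self[of y]] by (elim exE conjE)
 have "a n * b n \<notin> IO x" for n
 proof
  assume "a n * b n \<in> IO x"
  then have "a n \<in> IO x | b n \<in> IO y" using prime_inD[OF IO_prime UNIV_I UNIV_I] eq by blast
  then show False using a(1) b(1) orbit_self by (auto simp: IO_def)
 qed
 then obtain z where z: "ALL p:IO x. ev p z = 0" "ALL n. ev (a n * b n) z ~= 0"
  using countable_nullstellensatz[OF IO_prime, of "%n. a n * b n" x] by blast
 have "z \<in> adjoint_orbit G x" using mp[OF mp[OF spec[OF a(2)] z(1)]] z(2) by simp
 moreover have "z \<in> adjoint_orbit G y" using mp[OF mp[OF spec[OF b(2)]], of z] z eq by simp
 ultimately show ?thesis using orbit_eq by metis
qed

end

section \<open>Gradings and transversality\<close>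

lemma (in sl2_rep) span_eig_shifts:
 assumes "w \<in> cmat.span (\<Union>a\<in>A. {x. H x = a *\<^sub>C x})"
 shows "EX as. set as \<subseteq> A & shifts as w = 0"
 using assms
proof (induction rule: cmat.span_induct_alt)
 case base show ?case by (intro exI[of _ "[]"]) auto
next
 case (step c x w)
 then obtain as a where as: "set as \<subseteq> A" "shifts as w = 0" "a \<in> A" "H x = a *\<^sub>C x" by blast
 have "shifts (a # as) w = H (shifts as w) - a *\<^sub>C shifts as w" using shifts_H[of as w a] by simp
 then have w0: "shifts (a # as) w = 0" using as(2) lin0 by simp
 have "shifts (a # as) x = 0" using as(4) by simp
 then have "shifts (a # as) (c *\<^sub>C x + w) = 0" using w0 by (simp only: shifts_add shifts_scale) simp
 then show ?case using as by (intro exI[of _ "a # as"]) auto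
qed

lemma (in sl2_rep) span_eig_unique:
 assumes "w \<in> cmat.span (\<Union>a\<in>A. {x. H x = a *\<^sub>C x})" "H w = b *\<^sub>C w" "b \<notin> A"
 shows "w = 0"
proof -
 obtain as where as: "set as \<subseteq> A" "shifts as w = 0" using span_eig_shifts[OF assms(1)] by blast
 have "(\<Prod>a\<leftarrow>as. b - a) *\<^sub>C w = 0" using shifts_eigen[OF assms(2)] as(2) by simp
 moreover have "(\<Prod>a\<leftarrow>as. b - a) ~= 0" using as(1) assms(3) by (auto simp: prod_list_zero_iff)
 ultimately show ?thesis by simp
qed

section \<open>Matrices of nonzero weight are nilpotent\<close>

lemma clin_ad: "clin (lie_bracket x)"
 by (simp add: clin_iff br_add_right br_scale_right)

definition mpw :: "'n::finite cmat => nat => 'n cmat" where "mpw x k = (((**) x) ^^ k) (mat 1)"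

lemma mpw_simps: "mpw x 0 = mat 1" "mpw x (Suc k) = x ** mpw x k"
 by (auto simp: mpw_def)

lemma mpw_right: "mpw x k ** x = x ** mpw x k"
 by (induction k) (auto simp: mpw_simps matrix_mul_assoc[symmetric])

lemma mpw_weight: "lie_bracket h x = c *\<^sub>C x ==> lie_bracket h (mpw x k) = (of_nat k * c) *\<^sub>C mpw x k"
proof (induction k)
 case 0 show ?case by (simp add: mpw_simps lie_bracket_def)
next
 case (Suc k)
 have "lie_bracket h (x ** y) = lie_bracket h x ** y + x ** lie_bracket h y" for y
  by (simp add: lie_bracket_def matrix_diff_mult matrix_mult_diff matrix_mul_assoc)
 then have "lie_bracket h (mpw x (Suc k)) = c *\<^sub>C (x ** mpw x k) + (of_nat k * c) *\<^sub>C (x ** mpw x k)"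
  using Suc by (simp add: mpw_simps cscale_mult_left cscale_mult_right)
 then show ?case by (simp add: mpw_simps cmat.scale_left_distrib algebra_simps)
qed

text \<open>The powers of \<open>x\<close> have the pairwise different weights \<open>k * c\<close>;
  if none were zero, there would be arbitrarily many linearly independent matrices.\<close>

lemma weight_nilpotent:
 assumes "lie_bracket h x = c *\<^sub>C (x :: 'n::finite cmat)" "c ~= 0" shows "EX k. mpw x k = 0"
proof (rule ccontr)
 assume "\<nexists>k. mpw x k = 0"
 then have nz: "mpw x k ~= 0" for k by blast
 \<comment> \<open>The zero space satisfies the locale trivially; interpreting it there gives access
   to the facts on eigenvectors of \<open>lie_bracket h\<close> in the whole matrix space.\<close>
 interpret triv: sl2_rep "{0}" "lie_bracket h" "lie_bracket h" "lie_bracket h" 0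
  by (rule sl2_rep.intro) (simp_all add: clin_ad cmat.subspace_def)
 have "cmat.independent (mpw x ` {..<n}) & card (mpw x ` {..<n}) = n" for n
 proof (induction n)
  case (Suc n)
  have "mpw x ` {..<n} \<subseteq> (\<Union>a\<in>(%k. of_nat k * c) ` {..<n}. {y. lie_bracket h y = a *\<^sub>C y})"
  using mpw_weight[OF assms(1)] by auto
  note mono = cmat.span_mono[OF this]
  have "mpw x n \<notin> cmat.span (mpw x ` {..<n})"
  proof
  assume "mpw x n \<in> cmat.span (mpw x ` {..<n})"
  from triv.span_eig_unique[OF subsetD[OF mono this] mpw_weight[OF assms(1), of n]] nz[of n]
  have "of_nat n * c \<in> (%k. of_nat k * c) ` {..<n}" by blast
  then show False using assms(2) by auto
  qed
  then show ?case using Suc cmat.span_base[of "mpw x n" "mpw x ` {..<n}"]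
  by (auto simp: lessThan_Suc cmat.independent_insert card_insert_if)
 qed (simp add: cmat.independent_empty)
 then have "n \<le> cmat.dim (UNIV :: 'n cmat set)" for n
  using fcm.independent_card_le_dim[of "mpw x ` {..<n}" UNIV] by (metis subset_UNIV)
 then show False using not_less_eq_eq by blast
qed

text \<open>An n-fold bracket with \<open>x\<close> is a combination of products
  \<open>x^i v x^j\<close> with \<open>i + j = n\<close>; for \<open>n = 2m\<close> one of the
  exponents reaches \<open>m\<close>, where the power of \<open>x\<close> is zero.\<close>

lemma ad_nilpotent:
 assumes "lie_bracket h x = c *\<^sub>C (x :: 'n::finite cmat)" "c ~= 0"
 shows "EX k. ALL v. (lie_bracket x ^^ k) v = 0"
proof -
 obtain m where m: "mpw x m = 0" using weight_nilpotent[OF assms] by blast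
 have big: "mpw x i = 0" if "m \<le> i" for i
  using that by (induction rule: dec_induct) (auto simp: m mpw_simps)
 have span: "(lie_bracket x ^^ n) v \<in> cmat.span {mpw x i ** v ** mpw x j | i j. i + j = n}" for n v
 proof (induction n)
  case 0
  have "mpw x 0 ** v ** mpw x 0 \<in> {mpw x i ** v ** mpw x j | i j. i + j = 0}" by blast
  then show ?case by (auto simp: mpw_simps intro: cmat.span_base)
 next
  case (Suc n)
  let ?S = "{mpw x i ** v ** mpw x j | i j. i + j = Suc n}"
  have "lie_bracket x w \<in> cmat.span ?S" if "w \<in> cmat.span {mpw x i ** v ** mpw x j | i j. i + j = n}" for w
  using that
  proof (induction rule: cmat.span_induct_alt)
  case (step c w w')
  then obtain i j where ij: "i + j = n" "w = mpw x i ** v ** mpw x j" by blast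
  have "lie_bracket x w = mpw x (Suc i) ** v ** mpw x j - mpw x i ** v ** mpw x (Suc j)"
  by (simp add: ij lie_bracket_def mpw_simps mpw_right[symmetric] matrix_mul_assoc)
  moreover have "mpw x (Suc i) ** v ** mpw x j \<in> ?S" "mpw x i ** v ** mpw x (Suc j) \<in> ?S"
  using ij(1) by (metis (mono_tags, lifting) add_Suc mem_Collect_eq, metis (mono_tags, lifting) add_Suc_right mem_Collect_eq)
  ultimately have "lie_bracket x w \<in> cmat.span ?S" by (simp add: cmat.span_diff cmat.span_base)
  then show ?case using step by (simp add: br_add_right br_scale_right cmat.span_add cmat.span_scale)
  qed (simp add: cmat.span_zero)
  then show ?case using Suc by simp
 qed
 have "(lie_bracket x ^^ (m + m)) v = 0" for v
 proof -
  have "{mpw x i ** v ** mpw x j | i j. i + j = m + m} \<subseteq> {0}"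
  proof
  fix w assume "w \<in> {mpw x i ** v ** mpw x j | i j. i + j = m + m}"
  then obtain i j where "i + j = m + m" "w = mpw x i ** v ** mpw x j" by blast
  then show "w \<in> {0}" using big[of i] big[of j] by (cases "m \<le> i") auto
  qed
  then have "cmat.span {mpw x i ** v ** mpw x j | i j. i + j = m + m} \<subseteq> {0}"
  by (intro cmat.span_minimal) (auto simp: cmat.subspace_def)
  then show ?thesis using span[of "m + m" v] by blast
 qed
 then show ?thesis by blast
qed

locale slice_data = connected_group G for G :: "'n::finite cmat set" +
 fixes e h f :: "'n cmat" and \<kappa> :: "'n cmat => 'n cmat => complex" and \<ll> :: "'n cmat set"
 assumes sl2: "sl2_triple (Lie G) e h f" and form: "nondeg_invariant_form G \<kappa>"
  and lag: "lagrangian (Lie G) \<kappa> e h \<ll>"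
begin

lemma efh: "e \<in> \<gg>" "h \<in> \<gg>" "f \<in> \<gg>" "lie_bracket h e = 2 *\<^sub>C e" "lie_bracket h f = (- 2) *\<^sub>C f"
 "lie_bracket e f = h"
 using sl2 by (auto simp: sl2_triple_def)

definition N0 :: nat where
 "N0 = (SOME N. ALL v. (lie_bracket e ^^ N) v = 0 & (lie_bracket f ^^ N) v = 0)"

lemma N0: "(lie_bracket e ^^ N0) v = 0" "(lie_bracket f ^^ N0) v = 0"
proof -
 obtain k where k: "ALL v. (lie_bracket e ^^ k) v = 0" using ad_nilpotent[OF efh(4)] by auto
 obtain l where l: "ALL v. (lie_bracket f ^^ l) v = 0" using ad_nilpotent[OF efh(5)] by auto
 have "(lie_bracket e ^^ (l + k)) v = 0 & (lie_bracket f ^^ (k + l)) v = 0" for v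
 proof -
  have "(lie_bracket x ^^ j) 0 = 0" for x :: "'n cmat" and j by (induction j) auto
  then show ?thesis using k l by (simp only: funpow_add o_def)
 qed
 then have "EX N. ALL v. (lie_bracket e ^^ N) v = 0 & (lie_bracket f ^^ N) v = 0"
  by (intro exI[of _ "k + l"]) (simp add: add.commute)
 from someI_ex[OF this] show "(lie_bracket e ^^ N0) v = 0" "(lie_bracket f ^^ N0) v = 0"
  unfolding N0_def by blast+
qed

sublocale rep: sl2_rep \<gg> "lie_bracket e" "lie_bracket h" "lie_bracket f" N0
proof (rule sl2_rep.intro)
 fix v :: "'n cmat"
 show "lie_bracket h (lie_bracket e v) = lie_bracket e (lie_bracket h v) + 2 *\<^sub>C lie_bracket e v"
  using br_jacobi[of h e v] by (simp add: efh br_scale_left)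
 show "lie_bracket h (lie_bracket f v) = lie_bracket f (lie_bracket h v) - 2 *\<^sub>C lie_bracket f v"
  using br_jacobi[of h f v] by (simp add: efh br_scale_left br_uminus_left)
 show "lie_bracket e (lie_bracket f v) = lie_bracket f (lie_bracket e v) + lie_bracket h v"
  using br_jacobi[of e f v] by (simp add: efh)
qed (simp_all add: Lie_subspace clin_ad Lie_bracket efh N0)

section \<open>Grading, projections and the weight filtration\<close>

abbreviation gr :: "int => 'n cmat set" where "gr i \<equiv> ad_eigenspace \<gg> h i"

lemma gr_eig: "gr i = rep.eig (of_int i)"
 by (auto simp: ad_eigenspace_def rep.eig_def)

lemma gr_sub: "x \<in> gr i ==> x \<in> \<gg>" by (simp add: ad_eigenspace_def)

lemma gr_subspace: "cmat.subspace (gr i)"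
 using cmat.subspace_0[OF Lie_subspace] cmat.subspace_add[OF Lie_subspace] cmat.subspace_scale[OF Lie_subspace]
 by (auto simp: cmat.subspace_def ad_eigenspace_def br_add_right br_scale_right
  cmat.scale_right_distrib mult.commute)

lemma gr_bracket: assumes "x \<in> gr i" "y \<in> gr j" shows "lie_bracket x y \<in> gr (i + j)"
 using assms br_jacobi[of h x y] Lie_bracket
 by (simp add: ad_eigenspace_def br_scale_left br_scale_right cmat.scale_left_distrib)

lemma gr_unique: assumes "x \<in> cmat.span (\<Union>i\<in>I. gr i)" "x \<in> gr j" "j \<notin> I" shows "x = 0"
proof (rule rep.span_eig_unique)
 show "x \<in> cmat.span (\<Union>a\<in>of_int ` I. {x. lie_bracket h x = a *\<^sub>C x})"
  using assms(1) cmat.span_mono[of "\<Union>i\<in>I. gr i" "\<Union>a\<in>of_int ` I. {x. lie_bracket h x = a *\<^sub>C x}"]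
  by (auto simp: ad_eigenspace_def)
 show "lie_bracket h x = of_int j *\<^sub>C x" using assms(2) by (simp add: ad_eigenspace_def)
 show "(of_int j :: complex) \<notin> of_int ` I" using assms(3) by auto
qed

text \<open>The integral weight spaces span the Lie algebra, so it has a basis of weight vectors;
  the i-th projection keeps those of weight \<open>i\<close>. The extended coordinate functionals
  define it on all matrices.\<close>

lemma projections_exist:
 "\<exists>(\<pi> :: int => 'n cmat => 'n cmat) M. (ALL i. clin (\<pi> i)) & (ALL i. ALL v. \<pi> i v \<in> gr i) &
  (ALL i j. ALL v:gr j. \<pi> i v = (if i = j then v else 0)) &
  (ALL v:\<gg>. v = (\<Sum>i\<in>{-M..M}. \<pi> i v)) & (ALL i v. i \<notin> {-M..M} --> \<pi> i v = 0)"
proof -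
 have V: "\<gg> = cmat.span (\<Union>i::int. gr i)"
 proof
  show "\<gg> \<subseteq> cmat.span (\<Union>i::int. gr i)" using rep.V_span by (auto simp: gr_eig)
  show "cmat.span (\<Union>i::int. gr i) \<subseteq> \<gg>" using gr_sub by (intro cmat.span_minimal Lie_subspace) blast
 qed
 obtain B :: "'n cmat set" and l where B: "finite B" "B \<subseteq> (\<Union>i::int. gr i)" "cmat.independent B" "cmat.span B = \<gg>"
  "!!b. b \<in> B ==> cfunctional (l b)" "!!b c. b \<in> B ==> c \<in> B ==> l b c = (if b = c then 1 else 0)"
  "!!v. v \<in> \<gg> ==> v = (\<Sum>b\<in>B. l b v *\<^sub>C b)" by (rule dual_basis[OF V]) blast
 have "ALL b:B. EX i. b \<in> gr i" using B(2) by blast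
 then obtain wt where wt: "!!b. b \<in> B ==> b \<in> gr (wt b)" by metis
 define \<pi> where "\<pi> i v = (\<Sum>b\<in>{b\<in>B. wt b = i}. l b v *\<^sub>C b)" for i v
 have pl: "clin (\<pi> i)" for i
  unfolding clin_iff
 proof (intro conjI allI)
  fix x y c
  have lb: "l b (x + y) = l b x + l b y" "l b (c *\<^sub>C x) = c * l b x" if "b \<in> B" for b
  using B(5)[OF that] by (auto simp: cfunctional_iff)
  show "\<pi> i (x + y) = \<pi> i x + \<pi> i y"
  unfolding \<pi>_def sum.distrib[symmetric] by (intro sum.cong) (auto simp: lb cmat.scale_left_distrib)
  show "\<pi> i (c *\<^sub>C x) = c *\<^sub>C \<pi> i x"
  unfolding \<pi>_def cmat.scale_sum_right by (intro sum.cong) (auto simp: lb)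
 qed
 have pg: "\<pi> i v \<in> gr i" for i v
  unfolding \<pi>_def using wt by (intro cmat.subspace_sum[OF gr_subspace] cmat.subspace_scale[OF gr_subspace]) auto
 \<comment> \<open>A crude bound for the absolute value of every weight in the basis.\<close>
 define M where "M = (\<Sum>b\<in>B. \<bar>wt b\<bar>)"
 have M: "\<bar>wt b\<bar> \<le> M" if "b \<in> B" for b
  unfolding M_def using B(1) that by (intro member_le_sum) auto
 have p0: "\<pi> i v = 0" if "i \<notin> {-M..M}" for i v
 proof -
  have "{b\<in>B. wt b = i} = {}" using M that by force
  then show ?thesis unfolding \<pi>_def by (simp only: sum.empty)
 qed
 have sum: "v = (\<Sum>i\<in>{-M..M}. \<pi> i v)" if "v \<in> \<gg>" for v
 proof -
  have "(\<Sum>i\<in>{-M..M}. \<pi> i v) = (\<Sum>b\<in>B. l b v *\<^sub>C b)"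
  unfolding \<pi>_def by (rule sum.group) (use B(1) M in force)+
  then show ?thesis using B(7)[OF that] by simp
 qed
 have pj: "\<pi> i v = (if i = j then v else 0)" if v: "v \<in> gr j" for i j v
 proof -
  have zero: "v - \<pi> j v = 0"
  proof (rule gr_unique)
  show "v - \<pi> j v \<in> gr j" using v pg by (intro cmat.subspace_diff[OF gr_subspace])
  have "v - \<pi> j v = (\<Sum>i\<in>{-M..M} - {j}. \<pi> i v)"
  proof (cases "j \<in> {-M..M}")
  case True
  have "v = (\<Sum>i\<in>{-M..M}. \<pi> i v)" by (rule sum[OF gr_sub[OF v]])
  also have "\<dots> = \<pi> j v + (\<Sum>i\<in>{-M..M} - {j}. \<pi> i v)" using True by (intro sum.remove) auto
  finally show ?thesis by (simp add: algebra_simps)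
  next
  case False
  then show ?thesis using sum[OF gr_sub[OF v]] p0[OF False] by simp
  qed
  also have "\<dots> \<in> cmat.span (\<Union>i\<in>-{j}. gr i)"
  using pg by (intro cmat.span_sum cmat.span_base) blast
  finally show "v - \<pi> j v \<in> cmat.span (\<Union>i\<in>-{j}. gr i)" .
  qed simp
  show ?thesis
  proof (cases "i = j")
  case True then show ?thesis using zero by simp
  next
  case False
  have "l b v = 0" if b: "b \<in> B" "wt b = i" for b
  proof -
  have "l b v = l b (\<pi> j v)" using zero by simp
  also have "\<dots> = (\<Sum>c\<in>{c\<in>B. wt c = j}. l c v * l b c)"
  unfolding \<pi>_def using B(5)[OF b(1)] by (simp add: cfunctional_sum cfunctional_iff)
  also have "\<dots> = 0" using b False B(6)[OF b(1)] by (intro sum.neutral) auto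
  finally show ?thesis .
  qed
  then have "\<pi> i v = 0" unfolding \<pi>_def by (intro sum.neutral) auto
  then show ?thesis using False by simp
  qed
 qed
 show ?thesis by (rule exI[of _ \<pi>], rule exI[of _ M]) (use pl pg pj sum p0 in blast)
qed

definition is_prj :: "(int => 'n cmat => 'n cmat) => int => bool" where
 "is_prj \<pi> M \<longleftrightarrow> (ALL i. clin (\<pi> i)) & (ALL i. ALL v. \<pi> i v \<in> gr i) &
  (ALL i j. ALL v:gr j. \<pi> i v = (if i = j then v else 0)) &
  (ALL v:\<gg>. v = (\<Sum>i\<in>{-M..M}. \<pi> i v)) & (ALL i v. i \<notin> {-M..M} --> \<pi> i v = 0)"

definition "prj = (SOME \<pi>. EX M. is_prj \<pi> M)"
definition "wmax = (SOME M. is_prj prj M)"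

lemma prj_all: "(ALL i. clin (prj i)) & (ALL i. ALL v. prj i v \<in> gr i) &
  (ALL i j. ALL v:gr j. prj i v = (if i = j then v else 0)) &
  (ALL v:\<gg>. v = (\<Sum>i\<in>{-wmax..wmax}. prj i v)) & (ALL i v. i \<notin> {-wmax..wmax} --> prj i v = 0)"
proof -
 have ex: "EX \<pi> M. is_prj \<pi> M" unfolding is_prj_def by (rule projections_exist)
 have "EX M. is_prj prj M" unfolding prj_def by (rule someI_ex[OF ex])
 then have "is_prj prj wmax" unfolding wmax_def by (rule someI_ex)
 then show ?thesis unfolding is_prj_def .
qed

lemma prj_clin: "clin (prj i)" and prj_gr: "prj i v \<in> gr i"
 and prj_same: "v \<in> gr j ==> prj i v = (if i = j then v else 0)"
 and prj_sum: "v \<in> \<gg> ==> (\<Sum>i\<in>{-wmax..wmax}. prj i v) = v"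
 and prj_outside: "i \<notin> {-wmax..wmax} ==> prj i v = 0"
 using prj_all by (blast, blast, blast, metis, blast)

lemma prj_lin: "prj i (x + y) = prj i x + prj i y" "prj i (c *\<^sub>C x) = c *\<^sub>C prj i x" "prj i 0 = 0"
 "prj i (x - y) = prj i x - prj i y" "prj i (sum g S) = (\<Sum>s\<in>S. prj i (g s))"
 using prj_clin[of i] cend.linear_diff[OF prj_clin] cend.linear_sum[OF prj_clin] cend.linear_0[OF prj_clin]
 by (auto simp: clin_iff)

lemma prj_bracket: assumes x: "x \<in> gr i" and v: "v \<in> \<gg>" shows "prj k (lie_bracket x v) = lie_bracket x (prj (k - i) v)"
proof -
 have "prj k (lie_bracket x v) = prj k (lie_bracket x (\<Sum>j\<in>{-wmax..wmax}. prj j v))" using prj_sum[OF v] by simp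
 also have "\<dots> = (\<Sum>j\<in>{-wmax..wmax}. prj k (lie_bracket x (prj j v)))"
  by (simp add: br_sum_right prj_lin)
 also have "\<dots> = (\<Sum>j\<in>{-wmax..wmax}. if j = k - i then lie_bracket x (prj (k - i) v) else 0)"
  by (intro sum.cong refl) (auto simp: prj_same[OF gr_bracket[OF x prj_gr]])
 also have "\<dots> = lie_bracket x (prj (k - i) v)"
  using prj_outside[of "k - i" v] by (auto simp: sum.delta)
 finally show ?thesis .
qed

text \<open>Vectors of weights at most \<open>k\<close>. The filtration is zero below
  \<open>- wmax\<close>, which ends the successive approximations in
  \<open>slice_transversal\<close> and \<open>nx\<close>.\<close>

definition Fil :: "int => 'n cmat set" where "Fil k = {v \<in> \<gg>. \<forall>i>k. prj i v = 0}"

lemma Fil_sub: "v \<in> Fil k ==> v \<in> \<gg>" by (simp add: Fil_def)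

lemma Fil_subspace: "cmat.subspace (Fil k)"
 using cmat.subspace_0[OF Lie_subspace] cmat.subspace_add[OF Lie_subspace] cmat.subspace_scale[OF Lie_subspace]
 by (auto simp: cmat.subspace_def Fil_def prj_lin)

lemma Fil_mono: "i \<le> j ==> Fil i \<subseteq> Fil j" by (auto simp: Fil_def)

lemma gr_Fil: "x \<in> gr i ==> i \<le> k ==> x \<in> Fil k"
 using gr_sub by (auto simp: Fil_def prj_same)

lemma Fil_bottom: "v \<in> Fil (- wmax - 1) ==> v = 0"
 using prj_sum[of v] by (auto simp: Fil_def intro!: sum.neutral)

lemma Fil_bracket: assumes x: "x \<in> Fil a" and y: "y \<in> Fil b" shows "lie_bracket x y \<in> Fil (a + b)"
proof -
 have xg: "x \<in> \<gg>" and yg: "y \<in> \<gg>" using x y Fil_sub by auto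
 have "prj k (lie_bracket x y) = 0" if k: "k > a + b" for k
 proof -
  have "lie_bracket x y = (\<Sum>i\<in>{-wmax..wmax}. lie_bracket (prj i x) y)"
  by (simp add: prj_sum[OF xg] flip: br_sum_left)
  then have "prj k (lie_bracket x y) = (\<Sum>i\<in>{-wmax..wmax}. lie_bracket (prj i x) (prj (k - i) y))"
  by (simp add: prj_lin prj_bracket[OF prj_gr yg])
  also have "\<dots> = 0"
  proof (intro sum.neutral ballI)
  fix i show "lie_bracket (prj i x) (prj (k - i) y) = 0"
  using x y k by (cases "i > a") (auto simp: Fil_def)
  qed
  finally show ?thesis .
 qed
 then show ?thesis using Lie_bracket[OF xg yg] by (simp add: Fil_def)
qed

section \<open>The invariant form\<close>

lemma \<kappa>_props: "x \<in> \<gg> ==> y \<in> \<gg> ==> \<kappa> x y = \<kappa> y x"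
 "x \<in> \<gg> ==> y \<in> \<gg> ==> z \<in> \<gg> ==> \<kappa> (x + y) z = \<kappa> x z + \<kappa> y z"
 "x \<in> \<gg> ==> y \<in> \<gg> ==> \<kappa> (c *\<^sub>C x) y = c * \<kappa> x y"
 "x \<in> \<gg> ==> (ALL y:\<gg>. \<kappa> x y = 0) ==> x = 0"
 "A \<in> G ==> x \<in> \<gg> ==> y \<in> \<gg> ==> \<kappa> (Ad A x) (Ad A y) = \<kappa> x y"
 using form unfolding nondeg_invariant_form_def by blast+

text \<open>The assumptions on \<kappa> concern only the Lie algebra. A bilinear extension to all
  matrices turns expressions in \<kappa> into polynomial functions.\<close>

lemma extension_exists:
 "\<exists>K :: 'n cmat => 'n cmat => complex. (ALL u. cfunctional (K u)) & (ALL v. cfunctional (%u. K u v)) &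
  (ALL x:\<gg>. ALL y:\<gg>. K x y = \<kappa> x y)"
proof -
 obtain B :: "'n cmat set" and l where B: "finite B" "B \<subseteq> \<gg>" "cmat.independent B" "cmat.span B = \<gg>"
  "!!b. b \<in> B ==> cfunctional (l b)" "!!b c. b \<in> B ==> c \<in> B ==> l b c = (if b = c then 1 else 0)"
  "!!v. v \<in> \<gg> ==> v = (\<Sum>b\<in>B. l b v *\<^sub>C b)"
  by (rule dual_basis[of \<gg> \<gg>]) (use Lie_subspace cmat.span_eq_iff in blast)+
 have lb: "l b (x + y) = l b x + l b y" "l b (c *\<^sub>C x) = c * l b x" if "b \<in> B" for b x y c
  using B(5)[OF that] by (auto simp: cfunctional_iff)
 define K where "K u v = (\<Sum>b\<in>B. \<Sum>c\<in>B. l b u * l c v * \<kappa> b c)" for u v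
 have "cfunctional (K u)" for u
  unfolding cfunctional_iff K_def
  by (auto simp: lb sum_distrib_left algebra_simps sum.distrib intro!: sum.cong)
 moreover have "cfunctional (%u. K u v)" for v
  unfolding cfunctional_iff K_def
  by (auto simp: lb sum_distrib_left algebra_simps sum.distrib intro!: sum.cong)
 moreover have "K x y = \<kappa> x y" if x: "x \<in> \<gg>" and y: "y \<in> \<gg>" for x y
 proof -
  have s1: "\<kappa> (\<Sum>b\<in>S. g b *\<^sub>C b) y = (\<Sum>b\<in>S. g b * \<kappa> b y) & (\<Sum>b\<in>S. g b *\<^sub>C b) \<in> \<gg>"
  if "finite S" "S \<subseteq> B" "y \<in> \<gg>" for S g y
  using that
  proof (induction S)
  case empty
  have "\<kappa> (0 *\<^sub>C y) y = 0" using \<kappa>_props(3)[of y y 0] empty by simp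
  then show ?case using cmat.subspace_0[OF Lie_subspace] by simp
  next
  case (insert b S)
  have b: "b \<in> \<gg>" "g b *\<^sub>C b \<in> \<gg>" using insert B(2) cmat.subspace_scale[OF Lie_subspace] by auto
  show ?case using insert b \<kappa>_props(2)[OF b(2) _ insert.prems(2), of "\<Sum>b\<in>S. g b *\<^sub>C b"] \<kappa>_props(3)[OF b(1) insert.prems(2), of "g b"]
  cmat.subspace_add[OF Lie_subspace b(2)] by auto
  qed
  have "\<kappa> x y = (\<Sum>b\<in>B. l b x * \<kappa> b y)" using s1[OF B(1) subset_refl y, of "%b. l b x"] B(7)[OF x] by simp
  also have "\<dots> = (\<Sum>b\<in>B. l b x * (\<Sum>c\<in>B. l c y * \<kappa> b c))"
  proof (intro sum.cong refl)
  fix b assume "b \<in> B"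
  then have b: "b \<in> \<gg>" using B(2) by blast
  have "\<kappa> b y = \<kappa> y b" using \<kappa>_props(1) b y by blast
  also have "\<dots> = (\<Sum>c\<in>B. l c y * \<kappa> c b)" using s1[OF B(1) subset_refl b, of "%b. l b y"] B(7)[OF y] by simp
  also have "\<dots> = (\<Sum>c\<in>B. l c y * \<kappa> b c)" using \<kappa>_props(1)[OF b] B(2) by (intro sum.cong) auto
  finally show "l b x * \<kappa> b y = l b x * (\<Sum>c\<in>B. l c y * \<kappa> b c)" by simp
  qed
  finally show ?thesis by (simp add: K_def sum_distrib_left mult.assoc)
 qed
 ultimately show ?thesis by (intro exI[of _ K]) blast
qed

definition kap :: "'n cmat => 'n cmat => complex" where
 "kap = (SOME K. (ALL u. cfunctional (K u)) & (ALL v. cfunctional (%u. K u v)) & (ALL x:\<gg>. ALL y:\<gg>. K x y = \<kappa> x y))"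

lemma kap: "cfunctional (kap u)" "cfunctional (%u. kap u v)" "x \<in> \<gg> ==> y \<in> \<gg> ==> kap x y = \<kappa> x y"
 using someI_ex[OF extension_exists] unfolding kap_def by blast+

lemma kap_lin: "kap (x + y) z = kap x z + kap y z" "kap x (y + z) = kap x y + kap x z"
 "kap (c *\<^sub>C x) z = c * kap x z" "kap x (c *\<^sub>C z) = c * kap x z"
 using kap(1,2) by (auto simp: cfunctional_iff)

lemma kap_0 [simp]: "kap 0 x = 0" "kap x 0 = 0"
 using kap_lin(3)[of 0 0 x] kap_lin(4)[of x 0 0] by auto

lemma kap_diff: "kap (x - y) z = kap x z - kap y z" "kap x (y - z) = kap x y - kap x z"
 using kap_lin(1)[of "x - y" y z] kap_lin(2)[of x "y - z" z] by auto

lemma kap_uminus: "kap (- x) z = - kap x z" "kap x (- z) = - kap x z"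
 using kap_diff(1)[of 0 x z] kap_diff(2)[of x 0 z] by auto

lemma kap_sum: "kap (sum g S) z = (\<Sum>i\<in>S. kap (g i) z)" "kap z (sum g S) = (\<Sum>i\<in>S. kap z (g i))"
 by (induction S rule: infinite_finite_induct) (auto simp: kap_lin)

lemma kap_sym: "x \<in> \<gg> ==> y \<in> \<gg> ==> kap x y = kap y x"
 using kap(3) \<kappa>_props(1) by simp

lemma kap_nondeg: "x \<in> \<gg> ==> (!!y. y \<in> \<gg> ==> kap x y = 0) ==> x = 0"
 using kap(3) \<kappa>_props(4) by simp

lemma cfunctional_dd:
 assumes "cfunctional L" "has_dd g x v w" shows "((%t. L (g (x + t *\<^sub>C v))) has_field_derivative L w) (at 0)"
proof -
 define a where "a = (\<chi> i j. L (unit_mat i j))"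
 have "L u = pairing a u" for u unfolding a_def by (rule cfunctional_pairing[OF assms(1)])
 then have La: "L = pairing a" by (rule ext)
 show ?thesis unfolding La pairing_def
  using assms(2) by (intro DERIV_sum DERIV_cmult) (auto simp: has_dd_def)
qed

lemma rfun_functional: "cfunctional L ==> rfun (%A. L (Ad A x))"
 by (subst cfunctional_pairing) (auto simp: pairing_def intro!: rfun_sum rfun_mult)

lemma kap_expand: "kap u v = (\<Sum>(i, j)\<in>UNIV. v $ i $ j * kap u (unit_mat i j))"
 by (subst unit_mat_expand[of v]) (simp add: kap_sum kap_lin case_prod_beta)

text \<open>The infinitesimal form of invariance under \<open>Ad\<close>, from
  \<open>rfun_derivative\<close>. Expansion in matrix units reduces the derivative of the form to
  the product rule.\<close>

lemma kap_invariant: assumes "b \<in> \<gg>" "x \<in> \<gg>" "y \<in> \<gg>" shows "kap (lie_bracket b x) y = - kap x (lie_bracket b y)"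
proof -
 have "kap (lie_bracket b x) y + kap x (lie_bracket b y) = 0"
 proof (rule rfun_derivative[of "%A. kap (Ad A x) (Ad A y) - \<kappa> x y", OF _ _ assms(1)])
  show "rfun (%A. kap (Ad A x) (Ad A y) - \<kappa> x y)"
  by (subst kap_expand) (simp only: case_prod_beta', intro rfun_diff rfun_sum rfun_mult rfun_functional[OF kap(2)] rfun_Ad rfun_const)
  show "kap (Ad A x) (Ad A y) - \<kappa> x y = 0" if "A \<in> G" for A
  using that assms kap(3) Lie_Ad \<kappa>_props(5) by simp
  have "((%t. \<Sum>z\<in>UNIV. Ad (mat 1 + t *\<^sub>C b) y $ fst z $ snd z * kap (Ad (mat 1 + t *\<^sub>C b) x) (unit_mat (fst z) (snd z)))
  has_field_derivative (\<Sum>z\<in>UNIV. lie_bracket b y $ fst z $ snd z * kap x (unit_mat (fst z) (snd z))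
  + kap (lie_bracket b x) (unit_mat (fst z) (snd z)) * y $ fst z $ snd z)) (at 0)"
  proof (rule DERIV_sum)
  fix z :: "'n \<times> 'n"
  have 1: "((%t. Ad (mat 1 + t *\<^sub>C b) y $ fst z $ snd z) has_field_derivative lie_bracket b y $ fst z $ snd z) (at 0)"
  using has_dd_Ad[of y b] by (simp add: has_dd_def)
  have 2: "((%t. kap (Ad (mat 1 + t *\<^sub>C b) x) (unit_mat (fst z) (snd z))) has_field_derivative
  kap (lie_bracket b x) (unit_mat (fst z) (snd z))) (at 0)"
  by (rule cfunctional_dd[OF kap(2) has_dd_Ad])
  from DERIV_mult[OF 1 2] show "((%t. Ad (mat 1 + t *\<^sub>C b) y $ fst z $ snd z * kap (Ad (mat 1 + t *\<^sub>C b) x) (unit_mat (fst z) (snd z)))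
  has_field_derivative (lie_bracket b y $ fst z $ snd z * kap x (unit_mat (fst z) (snd z))
  + kap (lie_bracket b x) (unit_mat (fst z) (snd z)) * y $ fst z $ snd z)) (at 0)" by simp
  qed
  then have "((%t. kap (Ad (mat 1 + t *\<^sub>C b) x) (Ad (mat 1 + t *\<^sub>C b) y)) has_field_derivative
  (kap (lie_bracket b x) y + kap x (lie_bracket b y))) (at 0)"
  by (subst (1 2 3) kap_expand) (simp add: case_prod_beta sum.distrib mult.commute add.commute)
  from DERIV_diff[OF this DERIV_const[of "\<kappa> x y"]]
  show "((%t. kap (Ad (mat 1 + t *\<^sub>C b) x) (Ad (mat 1 + t *\<^sub>C b) y) - \<kappa> x y) has_field_derivative
  kap (lie_bracket b x) y + kap x (lie_bracket b y)) (at 0)" by simp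
 qed
 then show ?thesis by (simp add: eq_neg_iff_add_eq_0)
qed

lemma kap_assoc: "x \<in> \<gg> ==> y \<in> \<gg> ==> z \<in> \<gg> ==> kap (lie_bracket x y) z = kap x (lie_bracket y z)"
 using kap_invariant[of y x z] br_skew[of x y] by (simp add: kap_uminus)

lemma kap_graded: assumes "x \<in> gr i" "y \<in> gr j" "i + j ~= 0" shows "kap x y = 0"
proof -
 have "kap (lie_bracket h x) y = - kap x (lie_bracket h y)"
  using kap_invariant[OF efh(2)] assms gr_sub by blast
 then have "of_int i * kap x y = - (of_int j * kap x y)"
  using assms by (simp add: ad_eigenspace_def kap_lin)
 then have "of_int (i + j) * kap x y = 0" by (simp add: algebra_simps)
 then show ?thesis using assms(3) by (simp only: mult_eq_0_iff of_int_eq_0_iff) simp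
qed

lemma kap_Fil: assumes "x \<in> Fil a" "y \<in> Fil b" "a + b < 0" shows "kap x y = 0"
proof -
 have "kap x y = (\<Sum>i\<in>{-wmax..wmax}. \<Sum>j\<in>{-wmax..wmax}. kap (prj i x) (prj j y))"
  using prj_sum[OF Fil_sub[OF assms(1)]] prj_sum[OF Fil_sub[OF assms(2)]] by (simp flip: kap_sum)
 also have "\<dots> = 0"
 proof (intro sum.neutral ballI)
  fix i j show "kap (prj i x) (prj j y) = 0"
  using assms kap_graded[OF prj_gr prj_gr, of i j x y] by (cases "i > a"; cases "j > b") (auto simp: Fil_def)
 qed
 finally show ?thesis .
qed

lemma riesz: assumes "cfunctional L" shows "EX u:\<gg>. ALL y:\<gg>. kap u y = L y"
proof -
 obtain B :: "'n cmat set" and l where B: "finite B" "B \<subseteq> \<gg>" "cmat.independent B" "cmat.span B = \<gg>"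
  "!!b. b \<in> B ==> cfunctional (l b)" "!!b c. b \<in> B ==> c \<in> B ==> l b c = (if b = c then 1 else 0)"
  "!!v. v \<in> \<gg> ==> v = (\<Sum>b\<in>B. l b v *\<^sub>C b)"
  by (rule dual_basis[of \<gg> \<gg>]) (use Lie_subspace cmat.span_eq_iff in blast)+
 define T where "T v = (\<Sum>b\<in>B. kap v b *\<^sub>C b)" for v
 have lT: "l b (\<Sum>c\<in>B. g c *\<^sub>C c) = g b" if b: "b \<in> B" for b g
 proof -
  have "l b (\<Sum>c\<in>B. g c *\<^sub>C c) = (\<Sum>c\<in>B. g c * l b c)"
  using B(5)[OF b] by (simp add: cfunctional_sum cfunctional_iff)
  also have "\<dots> = (\<Sum>c\<in>B. if b = c then g b else 0)" using B(6)[OF b] by (intro sum.cong) auto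
  finally show ?thesis using b B(1) by simp
 qed
 have "EX u:\<gg>. T u = (\<Sum>b\<in>B. L b *\<^sub>C b)"
 proof (rule injective_endo_surj[OF Lie_subspace])
  show "clin T" unfolding clin_iff T_def
  by (auto simp: kap_lin cmat.scale_left_distrib sum.distrib cmat.scale_sum_right)
  have in_g: "(\<Sum>b\<in>B. g b *\<^sub>C b) \<in> \<gg>" for g
  using B(2) by (intro cmat.subspace_sum[OF Lie_subspace] cmat.subspace_scale[OF Lie_subspace]) auto
  then show "T v \<in> \<gg>" for v by (simp add: T_def)
  show "(\<Sum>b\<in>B. L b *\<^sub>C b) \<in> \<gg>" by (rule in_g)
  show "v = 0" if v: "v \<in> \<gg>" "T v = 0" for v
  proof (rule kap_nondeg[OF v(1)])
  fix y assume y: "y \<in> \<gg>"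
  have "kap v b = 0" if "b \<in> B" for b
  using lT[OF that, of "kap v"] v(2) cfun.linear_0[OF B(5)[OF that]] by (simp add: T_def)
  then have "kap v (\<Sum>b\<in>B. l b y *\<^sub>C b) = 0" by (simp add: kap_sum kap_lin)
  then show "kap v y = 0" using B(7)[OF y] by simp
  qed
 qed
 then obtain u where u: "u \<in> \<gg>" "T u = (\<Sum>b\<in>B. L b *\<^sub>C b)" by blast
 have ub: "kap u b = L b" if "b \<in> B" for b
  using lT[OF that, of "kap u"] lT[OF that, of L] u(2) by (simp add: T_def)
 have "kap u y = L y" if y: "y \<in> \<gg>" for y
 proof -
  have "kap u (\<Sum>b\<in>B. l b y *\<^sub>C b) = L (\<Sum>b\<in>B. l b y *\<^sub>C b)"
  using assms by (simp add: kap_sum kap_lin ub cfunctional_sum cfunctional_iff)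
  then show ?thesis using B(7)[OF y] by simp
 qed
 then show ?thesis using u(1) by blast
qed

lemma perp_perp: assumes "cmat.subspace U" "U \<subseteq> \<gg>" "x \<in> \<gg>"
  "!!v. v \<in> \<gg> ==> (!!u. u \<in> U ==> kap v u = 0) ==> kap x v = 0"
 shows "x \<in> U"
proof (rule ccontr)
 assume "x \<notin> U"
 then obtain L where L: "cfunctional L" "!!u. u \<in> U ==> L u = 0" "L x = 1" using separate_subspace[OF assms(1)] by blast
 obtain v where v: "v \<in> \<gg>" "ALL y:\<gg>. kap v y = L y" using riesz[OF L(1)] by blast
 have "kap x v = 0" by (rule assms(4)[OF v(1)]) (use v L assms(2) in auto)
 then show False using v L(3) assms(3) kap_sym by force
qed

section \<open>The subalgebra \<open>m\<close>\<close>

definition m :: "'n cmat set" where "m = premet \<gg> h \<ll>"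
definition gf :: "'n cmat set" where "gf = {y \<in> \<gg>. lie_bracket f y = 0}"
definition mperp :: "'n cmat set" where "mperp = {v \<in> \<gg>. ALL x:m. kap v x = 0}"

lemma gf_subspace: "cmat.subspace gf"
 using cmat.subspace_0[OF Lie_subspace] cmat.subspace_add[OF Lie_subspace] cmat.subspace_scale[OF Lie_subspace]
 by (auto simp: cmat.subspace_def gf_def br_add_right br_scale_right)

lemma mperp_subspace: "cmat.subspace mperp"
 using cmat.subspace_0[OF Lie_subspace] cmat.subspace_add[OF Lie_subspace] cmat.subspace_scale[OF Lie_subspace]
 by (auto simp: cmat.subspace_def mperp_def kap_lin)

lemma m_subspace: "cmat.subspace m" by (simp add: m_def premet_def)

lemma l_gr: "\<ll> \<subseteq> gr (-1)"
 using lag unfolding lagrangian_def by blast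

lemma m_Fil: "m \<subseteq> Fil (-1)"
 unfolding m_def premet_def
proof (rule cmat.span_minimal[OF _ Fil_subspace])
 show "\<ll> \<union> (\<Union>i\<in>{..- 2}. gr i) \<subseteq> Fil (-1)" using l_gr gr_Fil by force
qed

lemma m_sub: "m \<subseteq> \<gg>" using m_Fil Fil_sub by blast

lemma Fil_m: "Fil (-2) \<subseteq> m"
proof
 fix v assume v: "v \<in> Fil (-2)"
 have "prj i v \<in> m" for i
 proof (cases "i \<le> -2")
  case True
  then show ?thesis unfolding m_def premet_def using prj_gr by (intro cmat.span_base) blast
 next
  case False
  then have "prj i v = 0" using v by (simp add: Fil_def)
  then show ?thesis using cmat.subspace_0[OF m_subspace] by simp
 qed
 then have "(\<Sum>i\<in>{-wmax..wmax}. prj i v) \<in> m" by (intro cmat.subspace_sum[OF m_subspace])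
 then show "v \<in> m" using prj_sum[OF Fil_sub[OF v]] by simp
qed

lemma l_m: "\<ll> \<subseteq> m" unfolding m_def premet_def using cmat.span_superset by blast

lemma m_bracket: "x \<in> m ==> y \<in> m ==> lie_bracket x y \<in> m"
 using Fil_bracket[of x "-1" y "-1"] m_Fil Fil_m by auto

lemma gf_Fil: "gf \<subseteq> Fil 0"
proof
 fix v assume "v \<in> gf"
 then have "v \<in> cmat.span (\<Union>i\<in>{..0::int}. gr i)" using rep.kerF_span by (simp add: gf_def gr_eig)
 moreover have "cmat.span (\<Union>i\<in>{..0::int}. gr i) \<subseteq> Fil 0"
  by (rule cmat.span_minimal[OF _ Fil_subspace]) (use gr_Fil in force)
 ultimately show "v \<in> Fil 0" by blast
qed

lemma Fil0_mperp: "Fil 0 \<subseteq> mperp"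
 using kap_Fil[of _ 0 _ "-1"] m_Fil Fil_sub by (auto simp: mperp_def)

lemma e_gr: "e \<in> gr 2" and f_gr: "f \<in> gr (-2)" and h_gr: "h \<in> gr 0"
 using efh by (auto simp: ad_eigenspace_def)

lemma graded_decomposition:
 assumes v: "v \<in> gr i" shows "EX c:gr i. EX z:gr (i - 2). lie_bracket f c = 0 & v = c + lie_bracket e z"
proof -
 obtain c u where c: "c \<in> \<gg>" "u \<in> \<gg>" "lie_bracket f c = 0" "v = c + lie_bracket e u"
  using rep.kerF_plus_imE[OF gr_sub[OF v]] by blast
 have "v = prj i v" using prj_same[OF v] by simp
 also have "\<dots> = prj i c + lie_bracket e (prj (i - 2) u)"
  unfolding c(4) by (simp add: prj_lin prj_bracket[OF e_gr c(2)])
 finally have "v = prj i c + lie_bracket e (prj (i - 2) u)" .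
 moreover have "lie_bracket f (prj i c) = 0"
  using prj_bracket[OF f_gr c(1), of "i - 2"] c(3) prj_lin(3) by simp
 ultimately show ?thesis using prj_gr by blast
qed

text \<open>By \<open>kerF_imE\<close> the bracket of \<open>e\<close> with \<open>x\<close> is
  zero, and the kernel of \<open>ad e\<close> has only weights at least 0, as the opposite triple
  shows.\<close>

lemma ad_e_injective: assumes "x \<in> Fil (-1)" "lie_bracket e x \<in> gf" shows "x = 0"
proof -
 have xg: "x \<in> \<gg>" using assms(1) Fil_sub by blast
 have "lie_bracket e x = 0" using rep.kerF_imE[OF xg] assms(2) by (simp add: gf_def)
 then have "lie_bracket e (lie_bracket f x) = lie_bracket h x" using rep.EF[OF xg] by simp
 have "lie_bracket e (prj i x) = 0" for i
  using prj_bracket[OF e_gr xg, of "i + 2"] \<open>lie_bracket e x = 0\<close> prj_lin(3) by simp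
 have "prj i x = 0" for i
 proof (cases "i > -1")
  case True then show ?thesis using assms(1) by (simp add: Fil_def)
 next
  case False
  interpret op: sl2_rep \<gg> "lie_bracket f" "%x. - lie_bracket h x" "lie_bracket e" N0 by (rule rep.opposite)
  have "prj i x \<in> cmat.span (\<Union>j\<in>{..0::int}. op.eig (of_int j))"
  by (rule op.kerF_span) (use prj_gr gr_sub \<open>lie_bracket e (prj i x) = 0\<close> in auto)
  moreover have "(\<Union>j\<in>{..0::int}. op.eig (of_int j)) \<subseteq> (\<Union>j\<in>{0::int..}. gr j)"
  proof
  fix y assume "y \<in> (\<Union>j\<in>{..0::int}. op.eig (of_int j))"
  then obtain j :: int where j: "j \<le> 0" "y \<in> \<gg>" "- lie_bracket h y = of_int j *\<^sub>C y" by (auto simp: op.eig_def)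
  have "lie_bracket h y = of_int (- j) *\<^sub>C y" using j(3) by (metis cmat.scale_minus_left minus_minus of_int_minus)
  then have "y \<in> gr (- j)" using j by (simp add: ad_eigenspace_def)
  then show "y \<in> (\<Union>j\<in>{0::int..}. gr j)" using j(1) by (intro UN_I[of "- j"]) auto
  qed
  ultimately have "prj i x \<in> cmat.span (\<Union>j\<in>{0::int..}. gr j)" using cmat.span_mono by blast
  then show ?thesis using gr_unique[OF _ prj_gr] False by auto
 qed
 then show ?thesis using prj_sum[OF xg] by simp
qed

text \<open>Between two elements of \<ll> this is isotropy; in all other pairings the weights do not
  add up to 0.\<close>

lemma e_m_mperp: assumes "x \<in> m" shows "lie_bracket x e \<in> mperp"
proof -
 have "lie_bracket x e \<in> mperp" if "x \<in> \<ll> \<union> (\<Union>i\<in>{..- 2}. gr i)" for x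
  using that
 proof
  assume x: "x \<in> \<ll>"
  then have xg: "x \<in> \<gg>" using l_m m_sub by blast
  have xe: "lie_bracket x e \<in> \<gg>" using Lie_bracket[OF xg efh(1)] .
  have "m \<subseteq> {y \<in> \<gg>. kap (lie_bracket x e) y = 0}"
  unfolding m_def premet_def
  proof (rule cmat.span_minimal)
  show "cmat.subspace {y \<in> \<gg>. kap (lie_bracket x e) y = 0}"
  using cmat.subspace_0[OF Lie_subspace] cmat.subspace_add[OF Lie_subspace] cmat.subspace_scale[OF Lie_subspace]
  by (auto simp: cmat.subspace_def kap_lin)
  show "\<ll> \<union> (\<Union>i\<in>{..- 2}. gr i) \<subseteq> {y \<in> \<gg>. kap (lie_bracket x e) y = 0}"
  proof
  fix y assume "y \<in> \<ll> \<union> (\<Union>i\<in>{..- 2}. gr i)"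
  then show "y \<in> {y \<in> \<gg>. kap (lie_bracket x e) y = 0}"
  proof
  assume y: "y \<in> \<ll>"
  then have yg: "y \<in> \<gg>" using l_m m_sub by blast
  have "\<kappa> e (lie_bracket x y) = 0" using lag x y unfolding lagrangian_def by blast
  then have "kap e (lie_bracket x y) = 0" using kap(3)[OF efh(1) Lie_bracket[OF xg yg]] by simp
  moreover have "kap (lie_bracket x e) y = - kap e (lie_bracket x y)" by (rule kap_invariant[OF xg efh(1) yg])
  ultimately show ?thesis using yg by simp
  next
  assume "y \<in> (\<Union>i\<in>{..- 2}. gr i)"
  then obtain i where i: "i \<le> -2" "y \<in> gr i" by blast
  have "lie_bracket x e \<in> gr (-1 + 2)" using x l_gr by (intro gr_bracket e_gr) auto
  from kap_graded[OF this i(2)] i show ?thesis using gr_sub[OF i(2)] by simp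
  qed
  qed
  qed
  then show ?thesis using xe by (auto simp: mperp_def)
 next
  assume "x \<in> (\<Union>i\<in>{..- 2}. gr i)"
  then obtain i where i: "i \<le> -2" "x \<in> gr i" by blast
  have "lie_bracket x e \<in> Fil 0" using gr_Fil[OF gr_bracket[OF i(2) e_gr]] i(1) by simp
  then show ?thesis using Fil0_mperp by blast
 qed
 then have "m \<subseteq> {x. lie_bracket x e \<in> mperp}"
  unfolding m_def premet_def
  by (intro cmat.span_minimal)
  (auto simp: cmat.subspace_def br_add_left br_scale_left cmat.subspace_0[OF mperp_subspace]
  cmat.subspace_add[OF mperp_subspace] cmat.subspace_scale[OF mperp_subspace])
 then show ?thesis using assms by blast
qed

lemma mperp_Fil: "mperp \<subseteq> Fil 1"
proof
 fix v assume v: "v \<in> mperp"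
 then have vg: "v \<in> \<gg>" by (simp add: mperp_def)
 have "prj i v = 0" if i: "i > 1" for i
 proof (rule kap_nondeg)
  show "prj i v \<in> \<gg>" using prj_gr gr_sub by blast
  fix y assume y: "y \<in> \<gg>"
  have eq: "kap (prj i v) z = kap v z" if "z \<in> gr (- i)" for z
  proof -
  have "kap v z = (\<Sum>j\<in>{-wmax..wmax}. kap (prj j v) z)" using prj_sum[OF vg] by (simp flip: kap_sum)
  also have "\<dots> = (\<Sum>j\<in>{-wmax..wmax}. if j = i then kap (prj i v) z else 0)"
  by (intro sum.cong refl) (use kap_graded[OF prj_gr that] in auto)
  also have "\<dots> = kap (prj i v) z" using prj_outside[of i v] by (auto simp: sum.delta)
  finally show ?thesis by simp
  qed
  have "kap (prj i v) y = (\<Sum>j\<in>{-wmax..wmax}. kap (prj i v) (prj j y))"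
  using prj_sum[OF y] by (simp flip: kap_sum)
  also have "\<dots> = 0"
  proof (intro sum.neutral ballI)
  fix j show "kap (prj i v) (prj j y) = 0"
  proof (cases "j = - i")
  case True
  have "prj j y \<in> m" using gr_Fil[OF prj_gr, of j "-2"] Fil_m i True by auto
  then show ?thesis using eq[of "prj j y"] prj_gr[of j y] True v by (simp add: mperp_def)
  next
  case False then show ?thesis using kap_graded[OF prj_gr prj_gr, of i j] by simp
  qed
  qed
  finally show "kap (prj i v) y = 0" .
 qed
 then show "v \<in> Fil 1" using vg by (simp add: Fil_def)
qed

text \<open>In each weight this is the splitting into the kernel of \<open>ad f\<close> and the
  image of \<open>ad e\<close>; the point is that the preimage lies in \<open>m\<close>. In weights
  at most 0 the degree ensures it. In weight 1 it is the condition that \<ll> equals its own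
  orthogonal space.\<close>

lemma mperp_decomposition:
 assumes v: "v \<in> mperp" "v \<in> Fil k"
 shows "EX x:m. EX c:gf. x \<in> Fil (k - 2) & c \<in> Fil k & v = lie_bracket x e + c"
proof -
 have vg: "v \<in> \<gg>" using v by (simp add: mperp_def)
 have "EX x:m. EX c:gf. x \<in> Fil (k - 2) & c \<in> Fil k & prj i v = lie_bracket x e + c" for i
 proof (cases "i > k | i > 1")
  case True
  then have "prj i v = 0" using v mperp_Fil by (auto simp: Fil_def)
  then show ?thesis
  using cmat.subspace_0[OF m_subspace] cmat.subspace_0[OF gf_subspace] cmat.subspace_0[OF Fil_subspace]
  by (intro bexI[of _ 0]) auto
 next
  case False
  then have i: "i \<le> k" "i \<le> 1" by auto
  obtain c z where c: "c \<in> gr i" "z \<in> gr (i - 2)" "lie_bracket f c = 0" "prj i v = c + lie_bracket e z"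
  using graded_decomposition[OF prj_gr] by blast
  have cgf: "c \<in> gf" using c gr_sub by (simp add: gf_def)
  have zF: "z \<in> Fil (k - 2)" "c \<in> Fil k" using gr_Fil c i by auto
  have "z \<in> m"
  proof (cases "i = 1")
  case False
  then show ?thesis using gr_Fil[OF c(2), of "-2"] Fil_m i by auto
  next
  case True
  have "prj 1 c = 0" using gf_Fil cgf by (auto simp: Fil_def)
  then have c0: "c = 0" using prj_same[OF c(1), of 1] True by simp
  have z1: "z \<in> gr (-1)" using c(2) True by simp
  have "\<kappa> e (lie_bracket z y) = 0" if y: "y \<in> \<ll>" for y
  proof -
  have yg: "y \<in> \<gg>" "y \<in> gr (-1)" "y \<in> m" using y l_gr gr_sub l_m by auto
  have "kap v y = (\<Sum>j\<in>{-wmax..wmax}. kap (prj j v) y)" using prj_sum[OF vg] by (simp flip: kap_sum)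
  also have "\<dots> = (\<Sum>j\<in>{-wmax..wmax}. if j = 1 then kap (prj 1 v) y else 0)"
  by (intro sum.cong refl) (use kap_graded[OF prj_gr yg(2)] in auto)
  also have "\<dots> = kap (prj 1 v) y" using prj_outside[of 1 v] by (auto simp: sum.delta)
  finally have "kap (lie_bracket e z) y = 0" using v(1) yg(3) c(4) c0 True by (simp add: mperp_def)
  then have "kap e (lie_bracket z y) = 0" using kap_assoc[OF efh(1) gr_sub[OF c(2)] yg(1)] by simp
  then show ?thesis using kap(3)[OF efh(1) Lie_bracket[OF gr_sub[OF c(2)] yg(1)]] by simp
  qed
  then have "z \<in> \<ll>" using lag z1 unfolding lagrangian_def by blast
  then show ?thesis using l_m by blast
  qed
  then have "- z \<in> m" "- z \<in> Fil (k - 2)"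
  using cmat.subspace_neg[OF m_subspace] cmat.subspace_neg[OF Fil_subspace] zF by auto
  moreover have "prj i v = lie_bracket (- z) e + c" using c(4) br_skew[of e z] by (simp add: br_uminus_left)
  ultimately show ?thesis using cgf zF by blast
 qed
 then obtain X C where XC: "!!i. X i \<in> m" "!!i. C i \<in> gf" "!!i. X i \<in> Fil (k - 2)" "!!i. C i \<in> Fil k"
  "!!i. prj i v = lie_bracket (X i) e + C i" by metis
 have "v = (\<Sum>i\<in>{-wmax..wmax}. prj i v)" using prj_sum[OF vg] by simp
 also have "\<dots> = lie_bracket (\<Sum>i\<in>{-wmax..wmax}. X i) e + (\<Sum>i\<in>{-wmax..wmax}. C i)"
  unfolding XC(5) sum.distrib by (simp add: br_sum_left)
 finally have "v = lie_bracket (\<Sum>i\<in>{-wmax..wmax}. X i) e + (\<Sum>i\<in>{-wmax..wmax}. C i)" .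
 moreover have "(\<Sum>i\<in>{-wmax..wmax}. X i) \<in> m" "(\<Sum>i\<in>{-wmax..wmax}. X i) \<in> Fil (k - 2)"
  "(\<Sum>i\<in>{-wmax..wmax}. C i) \<in> gf" "(\<Sum>i\<in>{-wmax..wmax}. C i) \<in> Fil k"
  using XC by (auto intro!: cmat.subspace_sum[OF m_subspace] cmat.subspace_sum[OF gf_subspace] cmat.subspace_sum[OF Fil_subspace])
 ultimately show ?thesis by blast
qed

lemma mperp_perp: assumes "x \<in> \<gg>" "!!v. v \<in> mperp ==> kap x v = 0" shows "x \<in> m"
 by (rule perp_perp[OF m_subspace m_sub assms(1)]) (use assms(2) in \<open>auto simp: mperp_def\<close>)

end

section \<open>The Lie--Poisson bracket on polynomials\<close>

definition pol_of :: "('n::finite cmat => complex) => 'n pol" where "pol_of g = (SOME p. ev p = g)"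

lemma ev_pol_of: "pfun g ==> ev (pol_of g) = g"
 unfolding pol_of_def pfun_def by (rule someI_ex)

lemma pfun_functional: assumes "cfunctional L" "pmap g" shows "pfun (%x. L (g x))"
proof -
 have "(%x. L (g x)) = (%x. pairing (\<chi> i j. L (unit_mat i j)) (g x))"
  by (rule ext) (rule cfunctional_pairing[OF assms(1)])
 moreover have "pfun (%x. pairing c (g x))" for c
  unfolding pairing_def using assms(2) by (intro pfun_sum pfun_intros(4) pfun_intros(1)) (simp add: pmap_def)
 ultimately show ?thesis by simp
qed

lemma pmap_clin: assumes "clin L" "pmap g" shows "pmap (%x. L (g x))"
 unfolding pmap_def
proof (intro allI)
 fix i j
 have "cfunctional (%v. L v $ i $ j)" using assms(1) by (simp add: cfunctional_iff clin_iff)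
 from pfun_functional[OF this assms(2)] show "pfun (%x. L (g x) $ i $ j)" .
qed

lemma dirD_functional: assumes "cfunctional L" "ev p = (%x. L (x - a))" shows "dirD p x v = L v"
proof (rule dirD_eqI)
 have L: "L (u + w) = L u + L w" "L (c *\<^sub>C u) = c * L u" for u w c using assms(1) by (auto simp: cfunctional_iff)
 have "ev p (x + t *\<^sub>C v) = L (x - a) + t * L v" for t
  using L(1)[of "x - a" "t *\<^sub>C v"] L(2)[of t v] by (simp add: assms(2) algebra_simps)
 then show "((%t. ev p (x + t *\<^sub>C v)) has_field_derivative L v) (at 0)"
  by (auto intro!: derivative_eq_intros)
qed

lemma derivation_power: "derivation D ==> D (c ^ Suc k) = of_nat (Suc k) * c ^ k * D c"
proof (induction k)
 case (Suc k)
 have "D (c ^ Suc (Suc k)) = D c * c ^ Suc k + c * D (c ^ Suc k)"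
  using derivation_mult[OF Suc.prems, of c "c ^ Suc k"] by simp
 then show ?case using Suc by (simp add: algebra_simps)
qed simp

lemma derivation_nilpotent_mult:
 assumes "derivation D" shows "(D ^^ a) p = 0 ==> (D ^^ b) q = 0 ==> (D ^^ (a + b)) (p * q) = 0"
proof (induction "a + b" arbitrary: a b p q)
 case 0 then show ?case by simp
next
 case (Suc n)
 note D0 = derivation_0[OF assms]
 have z: "(D ^^ j) 0 = 0" for j by (induction j) (auto simp: D0)
 show ?case
 proof (cases "a = 0 | b = 0")
  case True then show ?thesis using Suc.prems z by auto
 next
  case False
  then obtain a' b' where ab: "a = Suc a'" "b = Suc b'" by (metis not0_implies_Suc)
  have 1: "(D ^^ (a' + b)) (D p * q) = 0"
  by (rule Suc.hyps(1)) (use Suc ab in \<open>auto simp: funpow_swap1\<close>)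
  have 2: "(D ^^ (a + b')) (p * D q) = 0"
  by (rule Suc.hyps(1)) (use Suc ab in \<open>auto simp: funpow_swap1\<close>)
  have e: "a + b = Suc (a' + b)" "a' + b = a + b'" using ab by auto
  have "(D ^^ (a + b)) (p * q) = (D ^^ (a' + b)) (D (p * q))" unfolding e(1) by (simp add: funpow_swap1)
  also have "\<dots> = (D ^^ (a' + b)) (D p * q) + (D ^^ (a' + b)) (p * D q)"
  by (simp add: derivation_mult[OF assms] derivation_funpow_add[OF assms])
  finally show ?thesis using 1 2 unfolding e(2) by simp
 qed
qed

context slice_data
begin

section \<open>Gradients and a bracket on polynomials in all matrix entries\<close>

lemma grad_exists: "\<exists>(u :: 'n cmat => 'n cmat) B. B \<subseteq> \<gg> & (ALL b:B. u b \<in> \<gg>) &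
 (ALL y:\<gg>. y = (\<Sum>b\<in>B. kap (u b) y *\<^sub>C b))"
proof -
 obtain B :: "'n cmat set" and l where B: "finite B" "B \<subseteq> \<gg>" "cmat.independent B" "cmat.span B = \<gg>"
  "!!b. b \<in> B ==> cfunctional (l b)" "!!b c. b \<in> B ==> c \<in> B ==> l b c = (if b = c then 1 else 0)"
  "!!v. v \<in> \<gg> ==> v = (\<Sum>b\<in>B. l b v *\<^sub>C b)"
  by (rule dual_basis[of \<gg> \<gg>]) (use Lie_subspace cmat.span_eq_iff in blast)+
 have "ALL b:B. EX u:\<gg>. ALL y:\<gg>. kap u y = l b y" using riesz B(5) by blast
 then obtain u where u: "ALL b:B. u b \<in> \<gg> & (ALL y:\<gg>. kap (u b) y = l b y)" by metis
 have "y = (\<Sum>b\<in>B. kap (u b) y *\<^sub>C b)" if "y \<in> \<gg>" for y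
 proof -
  have "(\<Sum>b\<in>B. kap (u b) y *\<^sub>C b) = (\<Sum>b\<in>B. l b y *\<^sub>C b)" using u that by (intro sum.cong) auto
  then show ?thesis using B(7)[OF that] by simp
 qed
 then show ?thesis using B(2) u by (intro exI[of _ u] exI[of _ B]) auto
qed

text \<open>\<open>gB\<close> is a spanning family of the Lie algebra, and \<open>gU\<close>
  supplies the dual family with respect to the form.\<close>

definition gU :: "'n cmat => 'n cmat" where
 "gU = (SOME u. EX B. B \<subseteq> \<gg> & (ALL b:B. u b \<in> \<gg>) & (ALL y:\<gg>. y = (\<Sum>b\<in>B. kap (u b) y *\<^sub>C b)))"

definition gB :: "'n cmat set" where
 "gB = (SOME B. B \<subseteq> \<gg> & (ALL b:B. gU b \<in> \<gg>) & (ALL y:\<gg>. y = (\<Sum>b\<in>B. kap (gU b) y *\<^sub>C b)))"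

lemma gB: "gB \<subseteq> \<gg>" "b \<in> gB ==> gU b \<in> \<gg>" "y \<in> \<gg> ==> (\<Sum>b\<in>gB. kap (gU b) y *\<^sub>C b) = y"
proof -
 have "EX B. B \<subseteq> \<gg> & (ALL b:B. gU b \<in> \<gg>) & (ALL y:\<gg>. y = (\<Sum>b\<in>B. kap (gU b) y *\<^sub>C b))"
  using someI_ex[OF grad_exists] unfolding gU_def .
 from someI_ex[OF this]
 have *: "gB \<subseteq> \<gg> & (ALL b:gB. gU b \<in> \<gg>) & (ALL y:\<gg>. y = (\<Sum>b\<in>gB. kap (gU b) y *\<^sub>C b))" unfolding gB_def .
 show "gB \<subseteq> \<gg>" by (rule conjunct1[OF *])
 show "b \<in> gB ==> gU b \<in> \<gg>" using conjunct1[OF conjunct2[OF *]] by (rule bspec)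
 show "(\<Sum>b\<in>gB. kap (gU b) y *\<^sub>C b) = y" if "y \<in> \<gg>"
  using bspec[OF conjunct2[OF conjunct2[OF *]] that] by (rule sym)
qed

definition grad :: "'n pol => 'n cmat => 'n cmat" where
 "grad p \<xi> = (\<Sum>b\<in>gB. dirD p \<xi> b *\<^sub>C gU b)"

lemma grad_g: "grad p \<xi> \<in> \<gg>"
 unfolding grad_def by (intro cmat.subspace_sum[OF Lie_subspace] cmat.subspace_scale[OF Lie_subspace] gB)

lemma grad_kap: assumes "y \<in> \<gg>" shows "kap (grad p \<xi>) y = dirD p \<xi> y"
proof -
 have "kap (grad p \<xi>) y = dirD p \<xi> (\<Sum>b\<in>gB. kap (gU b) y *\<^sub>C b)"
  by (simp add: grad_def kap_sum kap_lin dirD_sum_right dirD_scale mult.commute)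
 then show ?thesis by (simp add: gB(3)[OF assms])
qed

lemma grad_unique: assumes "v \<in> \<gg>" "!!y. y \<in> \<gg> ==> kap v y = dirD p \<xi> y" shows "v = grad p \<xi>"
proof -
 have "v - grad p \<xi> = 0"
  by (rule kap_nondeg) (use assms grad_kap in \<open>auto simp: kap_diff intro: cmat.subspace_diff[OF Lie_subspace _ grad_g]\<close>)
 then show ?thesis by simp
qed

lemma grad_simps: "grad (p + q) \<xi> = grad p \<xi> + grad q \<xi>" "grad (Cst c) \<xi> = 0"
 "grad (p * q) \<xi> = ev q \<xi> *\<^sub>C grad p \<xi> + ev p \<xi> *\<^sub>C grad q \<xi>"
 by (simp_all add: grad_def cmat.scale_left_distrib sum.distrib cmat.scale_sum_right mult.commute)

lemma pmap_grad: "pmap (grad p)"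
proof -
 have "pmap (%\<xi>. \<Sum>b\<in>gB. dirD p \<xi> b *\<^sub>C gU b)"
  by (intro pmap_sum pmap_scale pmap_const pfun_dirD)
 then show ?thesis by (simp add: grad_def[abs_def])
qed

lemma pfun_kap: assumes "pmap a" "pmap b" shows "pfun (%\<xi>. kap (a \<xi>) (b \<xi>))"
proof -
 have "pfun (%\<xi>. \<Sum>z\<in>UNIV. b \<xi> $ fst z $ snd z * kap (a \<xi>) (unit_mat (fst z) (snd z)))"
  using assms(2) by (intro pfun_sum pfun_intros(4) pfun_functional[OF kap(2)] assms(1)) (simp add: pmap_def)
 then show ?thesis by (subst kap_expand) (simp add: case_prod_beta)
qed

text \<open>The bracket is defined for polynomials on all matrices; skew symmetry, the Leibniz rule
  and the Jacobi identity hold at every matrix, while \<open>PB_formula\<close> concerns points of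
  the Lie algebra.\<close>

definition PB :: "'n pol => 'n pol => 'n pol" where
 "PB p q = pol_of (%\<xi>. kap \<xi> (lie_bracket (grad p \<xi>) (grad q \<xi>)))"

lemma ev_PB: "ev (PB p q) \<xi> = kap \<xi> (lie_bracket (grad p \<xi>) (grad q \<xi>))"
 unfolding PB_def by (subst ev_pol_of) (auto intro!: pfun_kap pmap_bracket pmap_grad pmap_id)

definition lin :: "'n cmat => 'n pol" where "lin x = pol_of (%\<xi>. kap \<xi> x)"

lemma ev_lin: "ev (lin x) \<xi> = kap \<xi> x"
 unfolding lin_def by (subst ev_pol_of) (auto intro!: pfun_kap)

lemma lin_0: "lin 0 = 0" by (rule pol_eqI) (simp add: ev_lin)

lemma grad_lin: assumes "x \<in> \<gg>" shows "grad (lin x) \<xi> = x"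
proof (rule grad_unique[symmetric, OF assms])
 fix y assume y: "y \<in> \<gg>"
 have "ev (lin x) = (%\<xi>. kap (\<xi> - 0) x)" by (rule ext) (simp add: ev_lin)
 from dirD_functional[OF kap(2) this] show "kap x y = dirD (lin x) \<xi> y" using kap_sym[OF assms y] by simp
qed

lemma PB_skew: "PB q p = - PB p q"
 by (rule pol_eqI) (simp add: ev_PB br_skew[of "grad q _"] kap_uminus)

lemma PB_add: "PB p (q + r) = PB p q + PB p r" and PB_mult: "PB p (q * r) = PB p q * r + q * PB p r"
 and PB_add_left: "PB (q + r) p = PB q p + PB r p" and PB_mult_left: "PB (q * r) p = PB q p * r + q * PB r p"
 and PB_Cst: "PB p (Cst c) = 0" and PB_Cst_left: "PB (Cst c) p = 0"
 by (rule pol_eqI, simp add: ev_PB grad_simps br_add_right br_add_left br_scale_left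
  br_scale_right kap_lin algebra_simps)+

lemma derivation_PB: "derivation (PB p)"
 by (simp add: derivation_def PB_add PB_mult)

definition gv :: "'n => 'n => 'n cmat" where "gv i j = grad (Var i j) 0"

lemma gv: "gv i j \<in> \<gg>" "grad (Var i j) \<xi> = gv i j"
 by (auto simp: gv_def grad_g) (simp add: grad_def)

lemma PB_lin: "x \<in> \<gg> ==> y \<in> \<gg> ==> PB (lin x) (lin y) = lin (lie_bracket x y)"
 by (rule pol_eqI) (simp add: ev_PB ev_lin grad_lin)

lemma PB_Var: "x \<in> \<gg> ==> PB (Var i j) (lin x) = lin (lie_bracket (gv i j) x)"
 "x \<in> \<gg> ==> PB (lin x) (Var i j) = lin (lie_bracket x (gv i j))"
 "PB (Var i j) (Var k l) = lin (lie_bracket (gv i j) (gv k l))"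
 by (rule pol_eqI, simp add: ev_PB ev_lin grad_lin gv)+

section \<open>The Jacobi identity\<close>

definition Jc :: "'n pol => 'n pol => 'n pol => 'n pol" where
 "Jc p q r = PB p (PB q r) + PB q (PB r p) + PB r (PB p q)"

lemma Jc_cyclic: "Jc p q r = Jc q r p" by (simp add: Jc_def add.commute add.left_commute)

lemma Jc_Cst: "Jc (Cst c) q r = 0"
proof -
 have "PB q 0 = 0" for q using PB_Cst[of q 0] by (simp add: Cst_simps)
 then show ?thesis by (simp add: Jc_def PB_Cst PB_Cst_left)
qed

lemma Jc_add: "Jc (p + p') q r = Jc p q r + Jc p' q r"
 by (simp add: Jc_def PB_add PB_add_left algebra_simps)

lemma Jc_mult: "Jc (p * p') q r = Jc p q r * p' + p * Jc p' q r"
proof -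
 have "PB p q = - PB q p" "PB p' q = - PB q p'" by (rule PB_skew)+
 then show ?thesis
  by (simp add: Jc_def PB_add PB_add_left PB_mult PB_mult_left derivation_uminus[OF derivation_PB] derivation_diff[OF derivation_PB] algebra_simps)
qed

lemma Jc_Var: "Jc (Var i j) (Var k l) (Var a b) = 0"
proof (rule pol_eqI)
 fix \<xi>
 have "lie_bracket x (lie_bracket y z) + lie_bracket y (lie_bracket z x) + lie_bracket z (lie_bracket x y) = 0" for x y z :: "'n cmat"
  by (simp add: lie_bracket_def matrix_diff_mult matrix_mult_diff matrix_mul_assoc)
 then have "kap \<xi> (lie_bracket x (lie_bracket y z)) + kap \<xi> (lie_bracket y (lie_bracket z x))
  + kap \<xi> (lie_bracket z (lie_bracket x y)) = 0" for x y z
  by (metis kap_lin(2) kap_0(2))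
 then show "ev (Jc (Var i j) (Var k l) (Var a b)) \<xi> = ev 0 \<xi>"
  by (simp add: Jc_def PB_Var gv(1) Lie_bracket ev_lin)
qed

lemma Jc_induct: assumes "!!i j. Jc (Var i j) q r = 0" shows "Jc p q r = 0"
 by (induction p rule: pol_induct) (simp_all add: assms Jc_Cst Jc_add Jc_mult)

text \<open>The Jacobiator is cyclic and a derivation in its first argument, so it vanishes once it
  does on coordinate functions, whose gradients are constant elements of the Lie algebra.\<close>

lemma PB_jacobi: "PB p (PB q r) + PB q (PB r p) + PB r (PB p q) = 0"
proof -
 have 1: "Jc r (Var i j) (Var k l) = 0" for r i j k l by (rule Jc_induct) (rule Jc_Var)
 have 2: "Jc q r (Var i j) = 0" for q r i j
  by (rule Jc_induct) (use 1 Jc_cyclic in metis)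
 have "Jc p q r = 0" by (rule Jc_induct) (use 2 Jc_cyclic in metis)
 then show ?thesis by (simp add: Jc_def)
qed

lemma PB_jacobi': "PB p (PB q r) = PB (PB p q) r + PB q (PB p r)"
proof -
 have "PB p (PB q r) = - (PB q (PB r p) + PB r (PB p q))"
  using PB_jacobi[of p q r] by (metis add.assoc eq_neg_iff_add_eq_0)
 also have "\<dots> = PB (PB p q) r + PB q (PB p r)"
  using PB_skew[of r p] PB_skew[of r "PB p q"] by (simp add: derivation_uminus[OF derivation_PB])
 finally show ?thesis .
qed

lemma PB_formula: assumes "\<xi> \<in> \<gg>" shows "ev (PB p q) \<xi> = dirD p \<xi> (lie_bracket (grad q \<xi>) \<xi>)"
proof -
 have "kap \<xi> (lie_bracket (grad p \<xi>) (grad q \<xi>)) = kap (grad q \<xi>) (lie_bracket \<xi> (grad p \<xi>))"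
  by (simp add: kap_assoc[symmetric] assms grad_g kap_sym[OF Lie_bracket[OF assms grad_g] grad_g])
 also have "\<dots> = kap (grad p \<xi>) (lie_bracket (grad q \<xi>) \<xi>)"
  by (simp add: kap_assoc[symmetric] assms grad_g kap_sym[OF Lie_bracket[OF grad_g assms] grad_g])
 also have "\<dots> = dirD p \<xi> (lie_bracket (grad q \<xi>) \<xi>)" by (intro grad_kap Lie_bracket grad_g assms)
 finally show ?thesis by (simp add: ev_PB)
qed

lemma PB_lin_formula: "x \<in> \<gg> ==> \<xi> \<in> \<gg> ==> ev (PB (lin x) p) \<xi> = - dirD p \<xi> (lie_bracket x \<xi>)"
 by (subst PB_skew) (simp add: PB_formula grad_lin)

section \<open>The affine space \<open>e + m\<^sup>\<bottom>\<close> and invariant lifts\<close>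

definition van :: "'n pol => bool" where "van p \<longleftrightarrow> (ALL v:mperp. ev p (e + v) = 0)"

lemma mperp_g: "v \<in> mperp ==> v \<in> \<gg>" by (simp add: mperp_def)

lemma Pi_g: "v \<in> mperp ==> e + v \<in> \<gg>"
 using cmat.subspace_add[OF Lie_subspace efh(1) mperp_g] .

lemma van_tangent: assumes "van p" "v \<in> mperp" "w \<in> mperp" shows "dirD p (e + v) w = 0"
proof (rule dirD_eqI)
 have "ev p (e + v + t *\<^sub>C w) = 0" for t
  using assms cmat.subspace_add[OF mperp_subspace assms(2) cmat.subspace_scale[OF mperp_subspace assms(3), of t]]
  by (simp add: van_def add.assoc)
 then show "((%t. ev p (e + v + t *\<^sub>C w)) has_field_derivative 0) (at 0)" by simp
qed

lemma m_mperp: assumes "x \<in> m" "v \<in> mperp" shows "lie_bracket x v \<in> mperp"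
 unfolding mperp_def
proof (intro CollectI conjI ballI)
 have xg: "x \<in> \<gg>" using assms(1) m_sub by blast
 show "lie_bracket x v \<in> \<gg>" by (rule Lie_bracket[OF xg mperp_g[OF assms(2)]])
 fix y assume y: "y \<in> m"
 have "kap (lie_bracket x v) y = - kap v (lie_bracket x y)"
  by (rule kap_invariant[OF xg mperp_g[OF assms(2)]]) (use y m_sub in blast)
 then show "kap (lie_bracket x v) y = 0" using assms(2) m_bracket[OF assms(1) y] by (simp add: mperp_def)
qed

lemma m_Pi: assumes "x \<in> m" "v \<in> mperp" shows "lie_bracket x (e + v) \<in> mperp"
 unfolding br_add_right
 by (rule cmat.subspace_add[OF mperp_subspace e_m_mperp[OF assms(1)] m_mperp[OF assms]])

text \<open>Polynomials annihilated along \<open>e + mperp\<close> by the fields of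
  \<open>m\<close>. By \<open>invariant_lifts_eq\<close> they represent the
  \<open>ad m\<close>-invariants of the quotient.\<close>

definition Linv :: "'n pol => bool" where
 "Linv p \<longleftrightarrow> (ALL x:m. ALL v:mperp. dirD p (e + v) (lie_bracket x (e + v)) = 0)"

lemma LinvD: "Linv p ==> x \<in> m ==> v \<in> mperp ==> dirD p (e + v) (lie_bracket x (e + v)) = 0"
 by (simp add: Linv_def)

lemma Linv_iff: "Linv p \<longleftrightarrow> (ALL x:m. van (PB (lin x) p))"
 using PB_lin_formula[OF _ Pi_g] m_sub by (auto simp: Linv_def van_def subset_iff)

text \<open>Pairing the vector with \<open>x\<close> in \<open>m\<close> gives, up to sign, the
  derivative of \<open>q\<close> along the field of \<open>x\<close>. So Hamiltonian fields of
  invariants are tangent to \<open>e + mperp\<close>.\<close>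

lemma grad_Linv: assumes "Linv q" "v \<in> mperp" shows "lie_bracket (grad q (e + v)) (e + v) \<in> mperp"
 unfolding mperp_def
proof (intro CollectI conjI ballI)
 let ?\<xi> = "e + v"
 note \<xi> = Pi_g[OF assms(2)]
 show "lie_bracket (grad q ?\<xi>) ?\<xi> \<in> \<gg>" by (rule Lie_bracket[OF grad_g \<xi>])
 fix x assume x: "x \<in> m"
 then have xg: "x \<in> \<gg>" using m_sub by blast
 have "kap (lie_bracket (grad q ?\<xi>) ?\<xi>) x = dirD q ?\<xi> (lie_bracket ?\<xi> x)"
  by (simp add: kap_assoc[OF grad_g \<xi> xg] grad_kap[OF Lie_bracket[OF \<xi> xg]])
 also have "\<dots> = - dirD q ?\<xi> (lie_bracket x ?\<xi>)" by (subst br_skew) (simp add: dirD_uminus)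
 finally show "kap (lie_bracket (grad q ?\<xi>) ?\<xi>) x = 0" using LinvD[OF assms(1) x assms(2)] by simp
qed

lemma van_PB: "van r ==> Linv q ==> van (PB r q)"
 unfolding van_def[of "PB r q"] by (auto simp: PB_formula[OF Pi_g] van_tangent grad_Linv)

lemma van_lin: "van r ==> x \<in> m ==> van (PB (lin x) r)"
 unfolding van_def[of "PB _ r"] using m_sub by (auto simp: PB_lin_formula[OF _ Pi_g] van_tangent m_Pi subset_iff)

text \<open>By the Jacobi identity the bracket of \<open>lin x\<close> with \<open>PB p q\<close> is
  a sum of brackets of an invariant with a function vanishing on \<open>e + mperp\<close>, and these
  vanish there by \<open>van_PB\<close>.\<close>

lemma Linv_PB: assumes "Linv p" "Linv q" shows "Linv (PB p q)"
 unfolding Linv_iff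
proof
 fix x assume x: "x \<in> m"
 have "van (PB (PB (lin x) p) q)" using assms x van_PB Linv_iff by blast
 moreover have "van (PB (PB (lin x) q) p)" using assms x van_PB Linv_iff by blast
 then have "van (PB p (PB (lin x) q))" unfolding PB_skew[of p] van_def by simp
 moreover have "PB (lin x) (PB p q) = PB (PB (lin x) p) q + PB p (PB (lin x) q)" by (rule PB_jacobi')
 ultimately show "van (PB (lin x) (PB p q))" by (simp add: van_def)
qed

text \<open>The map \<open>ad f\<close> kills \<open>gf\<close> and, by
  \<open>ad_e_injective\<close>, is injective on the brackets of \<open>m\<close> with
  \<open>e\<close>. A left inverse of the composite on \<open>m\<close> therefore reads off the
  \<open>m\<close>-component in \<open>mperp_decomposition\<close>.\<close>

lemma alpha_exists: "EX \<alpha>. clin \<alpha> & (ALL x:m. \<alpha> (lie_bracket x e) = x) & (ALL c:gf. \<alpha> c = 0)"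
proof -
 define T where "T x = lie_bracket f (lie_bracket x e)" for x
 have T: "clin T"
  by (simp add: clin_iff T_def br_add_left br_add_right br_scale_left br_scale_right)
 have inj: "inj_on T m"
 proof (rule inj_onI)
  fix x y assume xy: "x \<in> m" "y \<in> m" "T x = T y"
  define z where "z = x - y"
  have z: "z \<in> m" unfolding z_def by (rule cmat.subspace_diff[OF m_subspace xy(1,2)])
  then have zg: "z \<in> \<gg>" using m_sub by blast
  have "T z = 0" using cend.linear_diff[OF T, of x y] xy(3) by (simp add: z_def)
  then have "lie_bracket f (lie_bracket e z) = 0"
  using br_skew[of z e] by (simp add: T_def br_uminus_right)
  then have "lie_bracket e z \<in> gf" using Lie_bracket[OF efh(1) zg] by (simp add: gf_def)
  from ad_e_injective[OF _ this] have "z = 0" using z m_Fil by blast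
  then show "x = y" by (simp add: z_def)
 qed
 obtain g where g: "clin g" "ALL v:m. g (T v) = v"
  using cend.linear_exists_left_inverse_on[OF T m_subspace inj] by blast
 have gl: "g (u + w) = g u + g w" "g (c *\<^sub>C u) = c *\<^sub>C g u" for u w c using g(1) by (auto simp: clin_iff)
 have "clin (%v. g (lie_bracket f v))"
  by (simp add: clin_iff gl br_add_right br_scale_right)
 moreover have "g 0 = 0" using gl(2)[of 0 0] by simp
 ultimately show ?thesis
  using g(2) by (intro exI[of _ "%v. g (lie_bracket f v)"]) (auto simp: T_def gf_def)
qed

definition \<alpha> :: "'n cmat => 'n cmat" where
 "\<alpha> = (SOME \<alpha>. clin \<alpha> & (ALL x:m. \<alpha> (lie_bracket x e) = x) & (ALL c:gf. \<alpha> c = 0))"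

lemma \<alpha>: "clin \<alpha>" "x \<in> m ==> \<alpha> (lie_bracket x e) = x" "c \<in> gf ==> \<alpha> c = 0"
 using someI_ex[OF alpha_exists] unfolding \<alpha>_def by blast+

lemma \<alpha>_lin: "\<alpha> (x + y) = \<alpha> x + \<alpha> y" "\<alpha> (c *\<^sub>C x) = c *\<^sub>C \<alpha> x" "\<alpha> 0 = 0"
 using \<alpha>(1) cend.linear_0[OF \<alpha>(1)] by (auto simp: clin_iff)

lemma \<alpha>_Fil: assumes "v \<in> mperp" "v \<in> Fil k"
 shows "\<alpha> v \<in> m" "\<alpha> v \<in> Fil (k - 2)" "v - lie_bracket (\<alpha> v) e \<in> gf"
proof -
 obtain x c where xc: "x \<in> m" "c \<in> gf" "x \<in> Fil (k - 2)" "v = lie_bracket x e + c"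
  using mperp_decomposition[OF assms] by blast
 have "\<alpha> v = x" unfolding xc(4) by (simp add: \<alpha>_lin \<alpha>(2)[OF xc(1)] \<alpha>(3)[OF xc(2)])
 then show "\<alpha> v \<in> m" "\<alpha> v \<in> Fil (k - 2)" "v - lie_bracket (\<alpha> v) e \<in> gf" using xc by simp_all
qed

lemma \<alpha>_m: "v \<in> mperp ==> \<alpha> v \<in> m" using \<alpha>_Fil(1) mperp_Fil by blast

lemma gf_mperp: "gf \<subseteq> mperp" using gf_Fil Fil0_mperp by blast

lemma m_mperp_Fil: assumes "x \<in> m" "x \<in> Fil k" "v \<in> mperp"
 shows "lie_bracket x v \<in> mperp \<inter> Fil (k + 1)"
 using m_mperp[OF assms(1,3)] Fil_bracket[OF assms(2), of v 1] mperp_Fil assms(3) by blast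

text \<open>Transversality at \<open>e\<close> persists at \<open>e + v\<close>: bracketing with
  \<open>v\<close> raises the filtration by at most 1, and \<alpha> lowers it by 2, so
  \<open>x = - \<alpha> (lie_bracket x v)\<close> sinks through every filtration step.\<close>

lemma slice_transversal: assumes x: "x \<in> m" and v: "v \<in> mperp" and c: "lie_bracket x (e + v) \<in> gf" shows "x = 0"
proof -
 have step: "x \<in> Fil (k - 1)" if "x \<in> Fil k" for k
 proof -
  note b = m_mperp_Fil[OF x that v]
  have "\<alpha> (lie_bracket x (e + v)) = x + \<alpha> (lie_bracket x v)"
  by (simp add: br_add_right \<alpha>_lin \<alpha>(2)[OF x])
  then have "x = - \<alpha> (lie_bracket x v)" using \<alpha>(3)[OF c] by (simp add: eq_neg_iff_add_eq_0)
  moreover have "\<alpha> (lie_bracket x v) \<in> Fil (k - 1)" using \<alpha>_Fil(2)[of "lie_bracket x v" "k + 1"] b by simp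
  ultimately show ?thesis using cmat.subspace_neg[OF Fil_subspace] by metis
 qed
 have "x \<in> Fil (-1 - int k)" for k
 proof (induction k)
  case 0 show ?case using x m_Fil by auto
 next
  case (Suc k) then show ?case using step[OF Suc] by (simp add: algebra_simps)
 qed
 from this[of "nat wmax"] have "x \<in> Fil (- wmax - 1)"
  using Fil_mono[of "-1 - int (nat wmax)" "- wmax - 1"] by (cases "0 \<le> wmax") auto
 then show ?thesis by (rule Fil_bottom)
qed

text \<open>The error made by solving for the \<open>m\<close>-component at \<open>e\<close> instead
  of at \<xi>. On \<open>mperp\<close> it lowers the filtration, hence is nilpotent.\<close>

definition nu :: "'n cmat => 'n cmat => 'n cmat" where "nu \<xi> \<eta> = lie_bracket (\<alpha> \<eta>) (\<xi> - e)"

definition nK :: nat where "nK = nat (wmax + 2)"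

text \<open>A finite Neumann series for the inverse of \<open>1 + nu\<close>, hence polynomial in
  \<xi>: it gives the element of \<open>m\<close> whose field accounts for \<eta> up to
  \<open>gf\<close>. With the length \<open>nK\<close> the remainder lies in
  \<open>Fil (- wmax - 1)\<close>, which is zero.\<close>

definition nx :: "'n cmat => 'n cmat => 'n cmat" where
 "nx \<xi> \<eta> = \<alpha> (\<Sum>k<nK. (-1) ^ k *\<^sub>C (nu \<xi> ^^ k) \<eta>)"

lemma nu_Fil: assumes "v \<in> mperp" "\<eta> \<in> mperp" shows "(nu (e + v) ^^ k) \<eta> \<in> mperp \<inter> Fil (1 - int k)"
proof (induction k)
 case 0 then show ?case using assms(2) mperp_Fil by auto
next
 case (Suc k)
 let ?\<eta> = "(nu (e + v) ^^ k) \<eta>"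
 have eq: "nu (e + v) w = lie_bracket (\<alpha> w) v" for w by (simp add: nu_def)
 have "nu (e + v) ?\<eta> \<in> mperp \<inter> Fil (1 - int k - 2 + 1)"
  unfolding eq[of ?\<eta>] using m_mperp_Fil[OF \<alpha>_Fil(1,2)[of ?\<eta> "1 - int k"] assms(1)] Suc by simp
 then show ?case by (simp add: algebra_simps)
qed

lemma nu_lin: "nu \<xi> (a + b) = nu \<xi> a + nu \<xi> b" "nu \<xi> (c *\<^sub>C a) = c *\<^sub>C nu \<xi> a" "nu \<xi> 0 = 0"
 by (simp_all add: nu_def \<alpha>_lin br_add_left br_scale_left)

lemma nu_sum: "nu \<xi> (sum g S) = (\<Sum>i\<in>S. nu \<xi> (g i))"
 by (induction S rule: infinite_finite_induct) (auto simp: nu_lin)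

lemma nx: assumes v: "v \<in> mperp" and \<eta>: "\<eta> \<in> mperp"
 shows "nx (e + v) \<eta> \<in> m" "\<eta> - lie_bracket (nx (e + v) \<eta>) (e + v) \<in> gf"
proof -
 let ?n = "nu (e + v)"
 define s where "s = (\<Sum>k<nK. (-1) ^ k *\<^sub>C (?n ^^ k) \<eta>)"
 have s: "s \<in> mperp" unfolding s_def
  using nu_Fil[OF v \<eta>] by (intro cmat.subspace_sum[OF mperp_subspace] cmat.subspace_scale[OF mperp_subspace]) auto
 have nx: "nx (e + v) \<eta> = \<alpha> s" by (simp add: nx_def s_def)
 show "nx (e + v) \<eta> \<in> m" unfolding nx by (rule \<alpha>_m[OF s])
 have "1 - int nK \<le> - wmax - 1" by (simp add: nK_def)
 then have z: "(?n ^^ nK) \<eta> = 0" using nu_Fil[OF v \<eta>, of nK] Fil_mono Fil_bottom by blast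
 have "s + ?n s = (\<Sum>k<nK. (-1) ^ k *\<^sub>C (?n ^^ k) \<eta> - (-1) ^ Suc k *\<^sub>C (?n ^^ Suc k) \<eta>)"
  unfolding s_def nu_sum sum.distrib[symmetric] by (intro sum.cong refl) (simp add: nu_lin)
 also have "\<dots> = (-1) ^ 0 *\<^sub>C (?n ^^ 0) \<eta> - (-1) ^ nK *\<^sub>C (?n ^^ nK) \<eta>" by (rule sum_lessThan_telescope')
 finally have "s + ?n s = \<eta>" by (simp add: z)
 moreover have "lie_bracket (\<alpha> s) (e + v) = lie_bracket (\<alpha> s) e + ?n s" by (simp add: nu_def br_add_right)
 ultimately have "\<eta> - lie_bracket (nx (e + v) \<eta>) (e + v) = s - lie_bracket (\<alpha> s) e"
  unfolding nx by (simp add: algebra_simps)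
 moreover have "s \<in> Fil 1" using s mperp_Fil by blast
 ultimately show "\<eta> - lie_bracket (nx (e + v) \<eta>) (e + v) \<in> gf" using \<alpha>_Fil(3)[OF s] by simp
qed

lemma pmap_nx: assumes "pmap g" shows "pmap (%\<xi>. nx \<xi> (g \<xi>))"
proof -
 have "pmap (%\<xi>. (nu \<xi> ^^ k) (g \<xi>))" for k
  by (induction k) (auto simp: nu_def intro!: assms pmap_bracket pmap_clin[OF \<alpha>(1)] pmap_diff)
 then show ?thesis unfolding nx_def
  by (intro pmap_clin[OF \<alpha>(1)] pmap_sum pmap_scale pfun_intros(1))
qed

section \<open>Extending functions from the slice to invariants of m\<close>

lemma lin_nilpotent: assumes "x \<in> gr i" "i ~= 0" shows "EX n. (PB (lin x) ^^ n) p = 0"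
proof (induction p rule: pol_induct)
 note xg = gr_sub[OF assms(1)]
 case (Cst c) show ?case by (intro exI[of _ 1]) (simp add: PB_Cst)
next
 note xg = gr_sub[OF assms(1)]
 case (Var a b)
 have hx: "lie_bracket h x = of_int i *\<^sub>C x" "(of_int i :: complex) ~= 0" using assms by (auto simp: ad_eigenspace_def)
 obtain n where n: "ALL v. (lie_bracket x ^^ n) v = 0" using ad_nilpotent[OF hx] by blast
 have adg: "(lie_bracket x ^^ k) y \<in> \<gg>" if "y \<in> \<gg>" for k y
  by (induction k) (auto intro: Lie_bracket xg that)
 have "(PB (lin x) ^^ k) (lin y) = lin ((lie_bracket x ^^ k) y)" if "y \<in> \<gg>" for k y
  by (induction k) (auto simp: PB_lin[OF xg adg[OF that]])
 then have "(PB (lin x) ^^ n) (PB (lin x) (Var a b)) = lin ((lie_bracket x ^^ n) (lie_bracket x (gv a b)))"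
  by (simp add: PB_Var xg Lie_bracket gv(1))
 then have "(PB (lin x) ^^ Suc n) (Var a b) = 0" using n by (simp add: funpow_swap1 lin_0)
 then show ?case ..
next
 case (add p q)
 then obtain a b where ab: "(PB (lin x) ^^ a) p = 0" "(PB (lin x) ^^ b) q = 0" by blast
 have z: "(PB (lin x) ^^ j) 0 = 0" for j by (induction j) (auto simp: derivation_0[OF derivation_PB])
 have "(PB (lin x) ^^ (b + a)) p = 0" "(PB (lin x) ^^ (a + b)) q = 0" using ab z by (simp_all only: funpow_add o_def)
 then show ?case by (intro exI[of _ "a + b"]) (simp add: derivation_funpow_add[OF derivation_PB] add.commute)
next
 case (mult p q)
 then obtain a b where ab: "(PB (lin x) ^^ a) p = 0" "(PB (lin x) ^^ b) q = 0" by blast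
 from derivation_nilpotent_mult[OF derivation_PB this] show ?case ..
qed

text \<open>A homogeneous basis. The last clause makes it triangular: an element of
  \<open>Fil k\<close> has no coordinates along basis vectors of weight above
  \<open>k\<close>.\<close>

lemma m_basis:
 obtains B :: "'n cmat set" and l wt where "finite B" "B \<subseteq> m"
  "!!b. b \<in> B ==> cfunctional (l b)" "!!b c. b \<in> B ==> c \<in> B ==> l b c = (if b = c then 1 else 0)"
  "!!v. v \<in> m ==> v = (\<Sum>b\<in>B. l b v *\<^sub>C b)"
  "!!b. b \<in> B ==> b \<in> gr (wt b) & wt b \<le> -1"
  "!!b y k. b \<in> B ==> y \<in> m ==> y \<in> Fil k ==> k < wt b ==> l b y = 0"
proof -
 have "m = cmat.span (\<ll> \<union> (\<Union>i\<in>{..- 2}. gr i))" by (simp add: m_def premet_def)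
 then obtain B :: "'n cmat set" and l where B: "finite B" "B \<subseteq> \<ll> \<union> (\<Union>i\<in>{..- 2}. gr i)" "cmat.independent B" "cmat.span B = m"
  "!!b. b \<in> B ==> cfunctional (l b)" "!!b c. b \<in> B ==> c \<in> B ==> l b c = (if b = c then 1 else 0)"
  "!!v. v \<in> m ==> v = (\<Sum>b\<in>B. l b v *\<^sub>C b)" by (rule dual_basis) blast
 have Bm: "B \<subseteq> m" using B(4) cmat.span_superset by blast
 have "ALL b:B. EX i. b \<in> gr i & i \<le> -1"
 proof
  fix b assume "b \<in> B"
  then have "b \<in> \<ll> | (\<exists>i\<le>-2. b \<in> gr i)" using B(2) by blast
  then show "EX i. b \<in> gr i & i \<le> -1"
  proof
  assume "b \<in> \<ll>" then show ?thesis using l_gr by (intro exI[of _ "-1"]) auto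
  next
  assume "\<exists>i\<le>-2. b \<in> gr i"
  then obtain i where "i \<le> -2" "b \<in> gr i" by blast
  then show ?thesis by (intro exI[of _ i]) auto
  qed
 qed
 then obtain wt where wt: "ALL b:B. b \<in> gr (wt b) & wt b \<le> -1" by metis
 have high: "l b y = 0" if b: "b \<in> B" and y: "y \<in> m" "y \<in> Fil k" "k < wt b" for b y k
 proof -
  have lb: "l b (u + w) = l b u + l b w" "l b (c *\<^sub>C u) = c * l b u" "l b 0 = 0" for u w c
  using B(5)[OF b] cfun.linear_0[OF B(5)[OF b]] by (auto simp: cfunctional_iff)
  have "prj (wt b) y = (\<Sum>c\<in>B. l c y *\<^sub>C prj (wt b) c)"
  by (subst B(7)[OF y(1)]) (simp add: prj_lin)
  also have "\<dots> = (\<Sum>c\<in>B. if wt c = wt b then l c y *\<^sub>C c else 0)"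
  using wt by (intro sum.cong refl) (auto simp: prj_same[of _ "wt _"])
  finally have "l b (prj (wt b) y) = (\<Sum>c\<in>B. l b (if wt c = wt b then l c y *\<^sub>C c else 0))"
  by (simp add: cfunctional_sum[OF B(5)[OF b]])
  also have "\<dots> = (\<Sum>c\<in>B. if b = c then l b y else 0)"
  by (intro sum.cong refl) (auto simp: lb B(6)[OF b])
  also have "\<dots> = l b y" using b B(1) by simp
  finally show ?thesis using y lb by (simp add: Fil_def)
 qed
 show ?thesis by (rule that[of B l wt]) (use B Bm wt high in blast)+
qed

text \<open>Invariance is achieved for one basis vector of \<open>m\<close> after another, in order
  of increasing weight. Brackets with a new vector have strictly lower weight, so what has been
  achieved persists.\<close>

lemma lift_exists: "EX q. Linv q & (ALL c:gf. ev q (e + c) = ev p (e + c))"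
proof -
 obtain B :: "'n cmat set" and l wt where fB: "finite B" and Bm: "B \<subseteq> m"
  and lf: "!!b. b \<in> B ==> cfunctional (l b)" and lb: "!!b c. b \<in> B ==> c \<in> B ==> l b c = (if b = c then 1 else 0)"
  and le: "!!v. v \<in> m ==> v = (\<Sum>b\<in>B. l b v *\<^sub>C b)"
  and wt: "!!b. b \<in> B ==> b \<in> gr (wt b) & wt b \<le> -1"
  and high: "!!b y k. b \<in> B ==> y \<in> m ==> y \<in> Fil k ==> k < wt b ==> l b y = 0"
  by (rule m_basis) blast
 \<comment> \<open>The second condition closes \<open>T\<close> under lower weights, so that the
   basis vectors occurring in \<open>lie_bracket j b\<close> have already been treated.\<close>
 have main: "EX q. (ALL b:T. van (PB (lin b) q)) & (ALL c:gf. ev q (e + c) = ev p (e + c))"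
  if "T \<subseteq> B" "!!b c. b \<in> T ==> c \<in> B ==> wt c < wt b ==> c \<in> T" for T
  using that
 proof (induction "card T" arbitrary: T)
  case 0
  then have "T = {}" using fB finite_subset by fastforce
  then show ?case by (intro exI[of _ p]) auto
 next
  case (Suc n)
  have fT: "finite T" "T ~= {}" using Suc.hyps(2) Suc.prems(1) fB finite_subset by fastforce+
  obtain b where b: "b \<in> T" "!!c. c \<in> T ==> wt c \<le> wt b"
  using Max_in[of "wt ` T"] Max_ge[of "wt ` T"] fT by fastforce
  define T' where "T' = T - {b}"
  have bB: "b \<in> B" "b \<in> m" using b(1) Suc.prems(1) Bm by auto
  have T': "c \<in> T'" if "c \<in> B" "wt c < wt b" for c
  using Suc.prems(2)[OF b(1) that] that(2) by (auto simp: T'_def)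
  have TB: "T' \<subseteq> B" using Suc.prems(1) by (auto simp: T'_def)
  have "n = card T'" using Suc.hyps(2) b(1) fT by (simp add: T'_def)
  from Suc.hyps(1)[OF this TB] obtain q where q: "ALL j:T'. van (PB (lin j) q)" "ALL c:gf. ev q (e + c) = ev p (e + c)"
  proof -
  have "c \<in> T'" if "a \<in> T'" "c \<in> B" "wt c < wt a" for a c
  using T'[of c] b(2)[of a] that by (auto simp: T'_def)
  then show ?thesis using Suc.hyps(1)[OF \<open>n = card T'\<close> TB] that by blast
  qed
  define D where "D = PB (lin b)"
  have D: "derivation D" unfolding D_def by (rule derivation_PB)
  obtain n0 where n0: "(D ^^ n0) q = 0" using lin_nilpotent[of b "wt b" q] wt[OF bB(1)] by (auto simp: D_def)
  \<comment> \<open>The successor keeps the term \<open>k = 0\<close>, which carries the restriction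
    to the slice, in the sum \<open>F\<close>.\<close>
  define N where "N = Suc n0"
  have N: "(D ^^ N) q = 0" using n0 by (simp add: N_def derivation_0[OF D])
  have DT: "ALL j:T'. van (PB (lin j) ((D ^^ k) q))" for k
  proof (induction k)
  case 0 then show ?case using q by simp
  next
  case (Suc k)
  let ?G = "(D ^^ k) q"
  show ?case
  proof
  fix j assume j: "j \<in> T'"
  then have jB: "j \<in> B" "j \<in> m" using TB Bm by auto
  have jg: "j \<in> \<gg>" "b \<in> \<gg>" using jB bB m_sub by auto
  have jb: "lie_bracket j b \<in> m" by (rule m_bracket[OF jB(2) bB(2)])
  have "PB (lin j) ((D ^^ Suc k) q) = PB (lin (lie_bracket j b)) ?G + D (PB (lin j) ?G)"
  by (simp add: D_def PB_jacobi'[of "lin j"] PB_lin[OF jg])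
  moreover have "van (PB (lin j) ?G)" using Suc j by blast
  from van_lin[OF this bB(2)] have "van (D (PB (lin j) ?G))" by (simp only: D_def)
  moreover have "ev (PB (lin (lie_bracket j b)) ?G) (e + v) = 0" if v: "v \<in> mperp" for v
  proof -
  let ?\<xi> = "e + v"
  have z: "l c (lie_bracket j b) * dirD ?G ?\<xi> (lie_bracket c ?\<xi>) = 0" if c: "c \<in> B" for c
  proof (cases "wt c < wt b")
  case True
  then have "van (PB (lin c) ?G)" using T'[OF c] Suc by blast
  then have "ev (PB (lin c) ?G) ?\<xi> = 0" using v by (simp add: van_def)
  moreover have "c \<in> \<gg>" using c Bm m_sub by blast
  ultimately show ?thesis using PB_lin_formula[OF _ Pi_g[OF v], of c ?G] by simp
  next
  case False
  have "lie_bracket j b \<in> Fil (wt j + wt b)"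
  using gr_Fil[OF gr_bracket] wt[OF jB(1)] wt[OF bB(1)] by blast
  from high[OF c jb this] show ?thesis using False wt[OF jB(1)] by simp
  qed
  have "ev (PB (lin (lie_bracket j b)) ?G) ?\<xi> = - dirD ?G ?\<xi> (lie_bracket (lie_bracket j b) ?\<xi>)"
  by (rule PB_lin_formula[OF Lie_bracket[OF jg] Pi_g[OF v]])
  also have "lie_bracket (lie_bracket j b) ?\<xi> = (\<Sum>c\<in>B. l c (lie_bracket j b) *\<^sub>C lie_bracket c ?\<xi>)"
  by (subst le[OF jb]) (simp add: br_sum_left br_scale_left)
  also have "dirD ?G ?\<xi> \<dots> = 0" unfolding dirD_sum_right dirD_scale using z by (intro sum.neutral) blast
  finally show ?thesis by simp
  qed
  ultimately show "van (PB (lin j) ((D ^^ Suc k) q))" by (simp add: van_def)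
  qed
  qed
  \<comment> \<open>The coordinate dual to \<open>b\<close>: on \<open>e + mperp\<close> its bracket
    with \<open>b\<close> is 1 and with the rest of \<open>T\<close> is 0, and it vanishes on the
    slice. The sign offsets the one in \<open>PB_lin_formula\<close>.\<close>
  define L where "L v = - l b (\<alpha> v)" for v
  have L: "cfunctional L" using lf[OF bB(1)] by (simp add: L_def cfunctional_iff \<alpha>_lin)
  define c where "c = pol_of (%\<xi>. L (\<xi> - e))"
  have evc: "ev c = (%\<xi>. L (\<xi> - e))"
  unfolding c_def by (intro ev_pol_of pfun_functional[OF L] pmap_diff pmap_id pmap_const)
  have Dc: "ev (PB (lin j) c) (e + v) = (if j = b then 1 else 0)" if j: "j \<in> B" "wt j \<le> wt b" and v: "v \<in> mperp" for j v
  proof -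
  have jm: "j \<in> m" "j \<in> \<gg>" using j Bm m_sub by auto
  have jF: "j \<in> Fil (wt j)" using wt[OF j(1)] gr_Fil by blast
  note w = m_mperp_Fil[OF jm(1) jF v]
  have "l b (\<alpha> (lie_bracket j v)) = 0"
  using high[OF bB(1) \<alpha>_Fil(1,2)[of "lie_bracket j v" "wt j + 1"]] w j(2) by simp
  moreover have "l b (u + w) = l b u + l b w" for u w using lf[OF bB(1)] by (simp add: cfunctional_iff)
  ultimately have "l b (\<alpha> (lie_bracket j (e + v))) = l b j"
  by (simp add: br_add_right \<alpha>_lin \<alpha>(2)[OF jm(1)])
  then show ?thesis
  using PB_lin_formula[OF jm(2) Pi_g[OF v], of c] dirD_functional[OF L evc] lb[OF bB(1) j(1)] by (auto simp: L_def)
  qed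
  \<comment> \<open>Formally exp(- c D) applied to \<open>q\<close>, with \<open>c\<close> standing
    to the left of the powers of \<open>D\<close>; the sum is finite since a power of
    \<open>D\<close> kills \<open>q\<close>.\<close>
  define F where "F = (\<Sum>k<N. Cst ((-1) ^ k / fact k) * (c ^ k * (D ^^ k) q))"
  have PBF: "PB r F = (\<Sum>k<N. Cst ((-1) ^ k / fact k) * (PB r (c ^ k) * (D ^^ k) q + c ^ k * PB r ((D ^^ k) q)))" for r
  by (simp add: F_def derivation_sum[OF derivation_PB] PB_mult PB_Cst)
  have pw: "ev (PB r (c ^ k)) \<xi> = (if k = 0 then 0 else of_nat k * ev c \<xi> ^ (k - 1) * ev (PB r c) \<xi>)" for r k \<xi>
  proof (cases k)
  case 0 then show ?thesis using PB_Cst[of r 1] by (simp add: Cst_simps)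
  next
  case (Suc i) then show ?thesis using derivation_power[OF derivation_PB, of r c i] by simp
  qed
  have "van (PB (lin j) F)" if j: "j \<in> T" for j
  unfolding van_def
  proof
  fix v assume v: "v \<in> mperp"
  let ?\<xi> = "e + v"
  show "ev (PB (lin j) F) ?\<xi> = 0"
  proof (cases "j = b")
  case False
  then have j': "j \<in> T'" using j by (simp add: T'_def)
  have "ev (PB (lin j) c) ?\<xi> = 0" using Dc[of j v] False j b(2)[OF j] Suc.prems(1) v by auto
  moreover have "ev (PB (lin j) ((D ^^ k) q)) ?\<xi> = 0" for k using DT j' v by (auto simp: van_def)
  ultimately show ?thesis by (simp add: PBF pw cong: if_cong)
  next
  case True
  define a where "a k = ev ((D ^^ k) q) ?\<xi>" for k
  \<comment> \<open>As \<open>b\<close> has bracket 1 with \<open>c\<close>, the two parts of the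
    product rule telescope.\<close>
  define g where "g k = (if k = 0 then 0 else (-1) ^ k / fact (k - 1) * ev c ?\<xi> ^ (k - 1) * a k)" for k
  have "ev (PB (lin b) c) ?\<xi> = 1" using Dc[OF bB(1) order_refl v] by simp
  then have "ev (PB (lin j) F) ?\<xi> = (\<Sum>k<N. (-1) ^ k / fact k *
  ((if k = 0 then 0 else of_nat k * ev c ?\<xi> ^ (k - 1)) * a k + ev c ?\<xi> ^ k * a (Suc k)))"
  unfolding PBF True by (simp add: pw a_def D_def if_distrib cong: if_cong)
  also have "\<dots> = (\<Sum>k<N. g k - g (Suc k))"
  proof (intro sum.cong refl)
  fix k show "(-1) ^ k / fact k * ((if k = 0 then 0 else of_nat k * ev c ?\<xi> ^ (k - 1)) * a k + ev c ?\<xi> ^ k * a (Suc k)) = g k - g (Suc k)"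
  proof (cases k)
  case 0 then show ?thesis by (simp add: g_def)
  next
  case (Suc i)
  let ?c = "ev c ?\<xi>"
  have key: "of_nat k / (fact k :: complex) = 1 / fact i" using Suc by (simp add: field_simps del: of_nat_Suc)
  have 1: "(-1) ^ k / fact k * (of_nat k * ?c ^ i * a k) = (-1) ^ k * (of_nat k / fact k) * (?c ^ i * a k)" by simp
  have gk: "g k = (-1) ^ k * (1 / fact i) * (?c ^ i * a k)" using Suc by (simp add: g_def)
  have gs: "g (Suc k) = - ((-1) ^ k / fact k * (?c ^ k * a (Suc k)))" by (simp add: g_def)
  have "k ~= 0" "k - 1 = i" using Suc by auto
  then show ?thesis unfolding gk gs using 1 unfolding key by (simp add: distrib_left)
  qed
  qed
  also have "\<dots> = g 0 - g N" by (rule sum_lessThan_telescope')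
  also have "\<dots> = 0" by (simp add: g_def a_def N)
  finally show ?thesis .
  qed
  qed
  moreover have "ev F (e + x) = ev p (e + x)" if x: "x \<in> gf" for x
  proof -
  have "l b 0 = 0" using lf[OF bB(1)] cfun.linear_0 by blast
  then have "ev c (e + x) = 0" using \<alpha>(3)[OF x] by (simp add: evc L_def)
  then have "ev F (e + x) = (\<Sum>k<Suc n0. if k = 0 then ev q (e + x) else 0)"
  unfolding F_def N_def ev_sum by (intro sum.cong refl) (auto simp: power_0_left)
  also have "\<dots> = ev q (e + x)" by simp
  finally show ?thesis using q(2) x by simp
  qed
  ultimately show ?case by blast
 qed
 obtain q where q: "ALL b:B. van (PB (lin b) q)" "ALL c:gf. ev q (e + c) = ev p (e + c)"
  using main[of B] by blast
 have "Linv q"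
  unfolding Linv_def
 proof (intro ballI)
  fix x v assume x: "x \<in> m" and v: "v \<in> mperp"
  have z: "dirD q (e + v) (lie_bracket b (e + v)) = 0" if b: "b \<in> B" for b
  proof -
  have "b \<in> \<gg>" using b Bm m_sub by blast
  then show ?thesis using PB_lin_formula[OF _ Pi_g[OF v], of b q] q(1) b v by (simp add: van_def)
  qed
  have "lie_bracket x (e + v) = (\<Sum>b\<in>B. l b x *\<^sub>C lie_bracket b (e + v))"
  by (subst le[OF x]) (simp add: br_sum_left br_scale_left)
  then show "dirD q (e + v) (lie_bracket x (e + v)) = 0" by (simp add: dirD_sum_right dirD_scale z)
 qed
 then show ?thesis using q(2) by blast
qed

definition lift :: "'n pol => 'n pol" where
 "lift p = (SOME q. Linv q & (ALL c:gf. ev q (e + c) = ev p (e + c)))"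

lemma lift: "Linv (lift p)" "c \<in> gf ==> ev (lift p) (e + c) = ev p (e + c)"
 using someI_ex[OF lift_exists[of p]] unfolding lift_def by blast+

section \<open>Hamiltonian vector fields on the slice\<close>

text \<open>The Hamiltonian vector of an invariant lift, corrected by a field of \<open>m\<close> to
  become tangent to the slice. Invariants are constant along the correction, so brackets are not
  affected.\<close>

definition hv :: "'n pol => 'n cmat => 'n cmat" where
 "hv q \<xi> = lie_bracket (grad (lift q) \<xi> - nx \<xi> (lie_bracket (grad (lift q) \<xi>) \<xi>)) \<xi>"

lemma pmap_hv_gen: "pmap (%\<xi>. grad (lift q) \<xi> - nx \<xi> (lie_bracket (grad (lift q) \<xi>) \<xi>))"
 by (intro pmap_diff pmap_grad pmap_nx pmap_bracket pmap_id)

lemma pmap_hv: "pmap (hv q)"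
proof -
 have "pmap (%\<xi>. lie_bracket (grad (lift q) \<xi> - nx \<xi> (lie_bracket (grad (lift q) \<xi>) \<xi>)) \<xi>)"
  by (intro pmap_bracket pmap_hv_gen pmap_id)
 then show ?thesis by (simp add: hv_def[abs_def])
qed

lemma hv_gf: assumes "c \<in> gf" shows "hv q (e + c) \<in> gf"
 unfolding hv_def br_diff_left
 using nx(2)[OF subsetD[OF gf_mperp assms] grad_Linv[OF lift(1) subsetD[OF gf_mperp assms]]] .

lemma gf_tangent: assumes "!!c. c \<in> gf ==> ev p (e + c) = 0" "c \<in> gf" "w \<in> gf" shows "dirD p (e + c) w = 0"
proof (rule dirD_eqI)
 have "ev p (e + c + t *\<^sub>C w) = 0" for t
  using assms(1)[OF cmat.subspace_add[OF gf_subspace assms(2) cmat.subspace_scale[OF gf_subspace assms(3), of t]]]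
  by (simp add: add.assoc)
 then show "((%t. ev p (e + c + t *\<^sub>C w)) has_field_derivative 0) (at 0)" by simp
qed

lemma gf_tangent_eq: assumes "!!c. c \<in> gf ==> ev p (e + c) = ev q (e + c)" "c \<in> gf" "w \<in> gf"
 shows "dirD p (e + c) w = dirD q (e + c) w"
 using gf_tangent[of "p - q" c w] assms by simp

text \<open>The Hamiltonian vector of \<open>q\<close> differs from a vector tangent to the slice by
  a field of \<open>m\<close>. Both \<open>p\<close> and \<open>p'\<close> are constant along that
  field, and along the slice they agree.\<close>

lemma PB_slice: assumes p: "Linv p" "Linv p'" "!!c. c \<in> gf ==> ev p (e + c) = ev p' (e + c)" and q: "Linv q" and c: "c \<in> gf"
 shows "ev (PB p q) (e + c) = ev (PB p' q) (e + c)"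
proof -
 note cp = subsetD[OF gf_mperp c]
 let ?y = "e + c" and ?\<eta> = "lie_bracket (grad q (e + c)) (e + c)"
 note n = nx[OF cp grad_Linv[OF q cp]]
 have "dirD p ?y (?\<eta> - lie_bracket (nx ?y ?\<eta>) ?y) = dirD p' ?y (?\<eta> - lie_bracket (nx ?y ?\<eta>) ?y)"
  by (rule gf_tangent_eq[OF p(3) c n(2)])
 then show ?thesis using LinvD[OF p(1) n(1) cp] LinvD[OF p(2) n(1) cp]
  by (simp add: PB_formula[OF Pi_g[OF cp]] dirD_diff)
qed

lemma PB_slice2: assumes "Linv p" "Linv p'" "!!c. c \<in> gf ==> ev p (e + c) = ev p' (e + c)"
  "Linv q" "Linv q'" "!!c. c \<in> gf ==> ev q (e + c) = ev q' (e + c)" and c: "c \<in> gf"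
 shows "ev (PB p q) (e + c) = ev (PB p' q') (e + c)"
proof -
 have "ev (PB p q) (e + c) = ev (PB p' q) (e + c)" by (rule PB_slice[OF assms(1-4) c])
 also have "\<dots> = - ev (PB q p') (e + c)" by (subst PB_skew) simp
 also have "\<dots> = - ev (PB q' p') (e + c)" using PB_slice[OF assms(4-6,2) c] by simp
 also have "\<dots> = ev (PB p' q') (e + c)" by (subst PB_skew) simp
 finally show ?thesis .
qed

lemma PB_lift_hv: assumes c: "c \<in> gf" shows "ev (PB (lift p) (lift q)) (e + c) = dirD p (e + c) (hv q (e + c))"
proof -
 note cp = subsetD[OF gf_mperp c]
 let ?y = "e + c" and ?\<eta> = "lie_bracket (grad (lift q) (e + c)) (e + c)"
 note n = nx[OF cp grad_Linv[OF lift(1) cp]]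
 have "dirD p ?y (hv q ?y) = dirD (lift p) ?y (hv q ?y)"
  by (rule gf_tangent_eq[OF lift(2)[symmetric] c hv_gf[OF c]])
 also have "\<dots> = dirD (lift p) ?y ?\<eta>"
  using LinvD[OF lift(1) n(1) cp] by (simp add: hv_def br_diff_left dirD_diff)
 finally show ?thesis by (simp add: PB_formula[OF Pi_g[OF cp]])
qed

text \<open>Let \<open>q\<close> be the linear function of \<open>x\<close>. The gradient of its
  lift differs from \<open>x\<close> by an element of \<open>m\<close>, because both pair equally
  with the directions of \<open>m\<close> and of the slice, which span \<open>mperp\<close>.
  Transversality then identifies the corrected generator with \<open>x\<close>.\<close>

lemma hv_surj: assumes c: "c \<in> gf" and x: "x \<in> \<gg>" "lie_bracket x (e + c) \<in> gf"
 shows "EX q. hv q (e + c) = lie_bracket x (e + c)"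
proof -
 note cp = subsetD[OF gf_mperp c]
 let ?y = "e + c"
 note y = Pi_g[OF cp]
 define L where "L v = kap x v" for v
 have L: "cfunctional L" unfolding L_def by (rule kap(1))
 define q where "q = pol_of (%\<xi>. L (\<xi> - 0))"
 have evq: "ev q = (%\<xi>. L (\<xi> - 0))"
  unfolding q_def by (intro ev_pol_of pfun_functional[OF L] pmap_diff pmap_id pmap_const)
 let ?g = "grad (lift q) ?y"
 have xm: "?g - x \<in> m"
 proof (rule mperp_perp)
  show "?g - x \<in> \<gg>" by (rule cmat.subspace_diff[OF Lie_subspace grad_g x(1)])
  fix v assume v: "v \<in> mperp"
  note n = nx[OF cp v]
  let ?n = "nx ?y v" and ?w = "v - lie_bracket (nx ?y v) ?y"
  have ng: "?n \<in> \<gg>" using n(1) m_sub by blast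
  have wg: "?w \<in> \<gg>" using n(2) by (simp add: gf_def)
  have "kap (?g - x) (lie_bracket ?n ?y) = - kap x (lie_bracket ?n ?y)"
  using grad_kap[OF Lie_bracket[OF ng y], of "lift q" ?y] LinvD[OF lift(1) n(1) cp] by (simp add: kap_diff)
  also have "kap x (lie_bracket ?n ?y) = - kap x (lie_bracket ?y ?n)"
  by (subst br_skew) (simp add: kap_uminus)
  also have "kap x (lie_bracket ?y ?n) = kap (lie_bracket x ?y) ?n" by (simp add: kap_assoc[OF x(1) y ng])
  also have "\<dots> = 0" using x(2) gf_mperp n(1) by (auto simp: mperp_def)
  finally have 1: "kap (?g - x) (lie_bracket ?n ?y) = 0" by simp
  have "kap ?g ?w = dirD q ?y ?w"
  unfolding grad_kap[OF wg] by (rule gf_tangent_eq[OF lift(2) c n(2)])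
  also have "\<dots> = kap x ?w" using dirD_functional[OF L evq] by (simp add: L_def)
  finally have "kap (?g - x) ?w = 0" by (simp add: kap_diff algebra_simps)
  then show "kap (?g - x) v = 0" using 1 by (simp add: kap_diff)
 qed
 let ?n = "nx ?y (lie_bracket ?g ?y)"
 note n = nx[OF cp grad_Linv[OF lift(1)[of q] cp]]
 have "lie_bracket (?g - x - ?n) ?y = hv q ?y - lie_bracket x ?y"
  by (simp add: hv_def br_diff_left)
 then have "lie_bracket (?g - x - ?n) ?y \<in> gf"
  using cmat.subspace_diff[OF gf_subspace hv_gf[OF c] x(2)] by simp
 from slice_transversal[OF cmat.subspace_diff[OF m_subspace xm n(1)] cp this]
 have "?g - ?n = x" by (simp add: algebra_simps)
 then show ?thesis by (intro exI[of _ q]) (simp add: hv_def)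
qed

lemma hv_generator: assumes "c \<in> gf"
 shows "grad (lift q) (e + c) - nx (e + c) (lie_bracket (grad (lift q) (e + c)) (e + c)) \<in> \<gg>"
 using nx(1)[OF subsetD[OF gf_mperp assms] grad_Linv[OF lift(1) subsetD[OF gf_mperp assms]]] m_sub
 by (intro cmat.subspace_diff[OF Lie_subspace grad_g]) blast

end

section \<open>Rational stable primes are germs\<close>

text \<open>Monomials, enumerated through the countability of lists of index pairs.\<close>

lemma pol_span: "\<exists>g :: nat => 'n::finite pol. ALL p. EX n x. p = (\<Sum>k<n. Cst (x k) * g k)"
proof -
 define mon :: "('n \<times> 'n) list => 'n pol" where "mon xs = (\<Prod>(i, j)\<leftarrow>xs. Var i j)" for xs
 define g where "g n = mon (from_nat n)" for n
 define V where "V = {p. EX n x. p = (\<Sum>k<n. Cst (x k) * g k)}"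
 have pad: "EX y. p = (\<Sum>k<N. Cst (y k) * g k)" if p: "p = (\<Sum>k<n. Cst (x k) * g k)" and "n \<le> N" for p n N and x :: "nat => complex"
 proof -
  have "(\<Sum>k<N. Cst (if k < n then x k else 0) * g k) = (\<Sum>k<n. Cst (if k < n then x k else 0) * g k)"
  using \<open>n \<le> N\<close> by (intro sum.mono_neutral_right) (auto simp: Cst_simps)
  also have "\<dots> = p" unfolding p by (intro sum.cong) auto
  finally show ?thesis by (intro exI[of _ "%k. if k < n then x k else 0"]) simp
 qed
 have Vadd: "p + q \<in> V" if pq: "p \<in> V" "q \<in> V" for p q
 proof -
  obtain n x where p: "p = (\<Sum>k<n. Cst (x k) * g k)" using pq(1) unfolding V_def by blast
  obtain l y where q: "q = (\<Sum>k<l. Cst (y k) * g k)" using pq(2) unfolding V_def by blast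
  obtain x' where x': "p = (\<Sum>k<max n l. Cst (x' k) * g k)" using pad[OF p] max.cobounded1 by blast
  obtain y' where y': "q = (\<Sum>k<max n l. Cst (y' k) * g k)" using pad[OF q] max.cobounded2 by blast
  have "p + q = (\<Sum>k<max n l. Cst (x' k + y' k) * g k)"
  by (simp add: x' y' Cst_simps sum.distrib ring_distribs)
  then show ?thesis unfolding V_def by (intro CollectI exI[of _ "max n l"] exI[of _ "%k. x' k + y' k"])
 qed
 have Vscale: "Cst c * p \<in> V" if p: "p \<in> V" for c p
 proof -
  obtain n x where "p = (\<Sum>k<n. Cst (x k) * g k)" using p unfolding V_def by blast
  then have "Cst c * p = (\<Sum>k<n. Cst (c * x k) * g k)" by (simp add: sum_distrib_left Cst_simps mult.assoc)
  then show ?thesis unfolding V_def by (intro CollectI exI[of _ n] exI[of _ "%k. c * x k"])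
 qed
 have Vmon: "mon xs \<in> V" for xs
 proof -
  have "mon xs = g (to_nat xs)" by (simp add: g_def)
  also have "\<dots> = (\<Sum>k<Suc (to_nat xs). if k = to_nat xs then g k else 0)" by simp
  also have "\<dots> = (\<Sum>k<Suc (to_nat xs). Cst (if k = to_nat xs then 1 else 0) * g k)"
  by (intro sum.cong refl) (auto simp: Cst_simps)
  finally show ?thesis unfolding V_def
  by (intro CollectI exI[of _ "Suc (to_nat xs)"] exI[of _ "%k. if k = to_nat xs then 1 else 0"])
 qed
 have V0: "0 \<in> V" using Vscale[OF Vmon[of "[]"], of 0] by (simp add: Cst_simps)
 have Vsum: "sum F A \<in> V" if "!!a. a \<in> A ==> F a \<in> V" for F :: "nat => 'n pol" and A
  using that by (induction A rule: infinite_finite_induct) (auto intro: V0 Vadd)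
 have Vmult: "p * q \<in> V" if pq: "p \<in> V" "q \<in> V" for p q
 proof -
  have mm: "mon xs * mon ys = mon (xs @ ys)" for xs ys by (simp add: mon_def)
  obtain n x where p: "p = (\<Sum>k<n. Cst (x k) * g k)" using pq(1) unfolding V_def by blast
  obtain l y where q: "q = (\<Sum>k<l. Cst (y k) * g k)" using pq(2) unfolding V_def by blast
  have "p * q = (\<Sum>i<n. \<Sum>j<l. Cst (x i) * (Cst (y j) * (g i * g j)))"
  unfolding p q sum_product by (intro sum.cong refl) (simp add: algebra_simps)
  also have "\<dots> \<in> V" unfolding g_def mm by (intro Vsum Vscale Vmon)
  finally show ?thesis .
 qed
 have "p \<in> V" for p
 proof (induction p rule: pol_induct)
  case (Cst c) show ?case using Vscale[OF Vmon[of "[]"], of c] by (simp add: mon_def)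
 next
  case (Var i j) show ?case using Vmon[of "[(i, j)]"] by (simp add: mon_def)
 qed (auto intro: Vadd Vmult)
 then show ?thesis unfolding V_def by (intro exI[of _ g]) blast
qed

text \<open>The condition \<open>rational\<close> says that the constants in the fraction field
  modulo \<open>P\<close> are the complex numbers.\<close>

locale stable_prime =
 fixes D :: "('n::finite pol => 'n pol) set" and P :: "'n pol set"
 assumes der: "!!\<delta>. \<delta> \<in> D ==> derivation \<delta>" and prime: "prime_in UNIV P"
  and stable: "!!\<delta> p. \<delta> \<in> D ==> p \<in> P ==> \<delta> p \<in> P"
  and rational: "!!a b. b \<notin> P ==> (!!\<delta>. \<delta> \<in> D ==> b * \<delta> a - a * \<delta> b \<in> P) ==> EX c. a - Cst c * b \<in> P"
begin

lemma P: "ideal_in UNIV P" by (rule prime_in_ideal[OF prime])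

lemmas Pi = ideal_in_0[OF P] ideal_in_add[OF P] ideal_in_mult[OF P UNIV_I] ideal_in_mult2[OF P UNIV_I]
 ideal_in_diff[OF is_subring_UNIV P] ideal_in_uminus[OF is_subring_UNIV P] ideal_in_sum[OF P]

definition cg :: "'n pol => 'n pol => bool" (infix "\<doteq>" 50) where "a \<doteq> b \<longleftrightarrow> a - b \<in> P"

lemma cg_refl [simp]: "a \<doteq> a" by (simp add: cg_def Pi)

lemma cg_sym: "a \<doteq> b ==> b \<doteq> a" using Pi(6)[of "a - b"] by (simp add: cg_def)

lemma cg_trans [trans]: "a \<doteq> b ==> b \<doteq> c ==> a \<doteq> c" using Pi(2)[of "a - b" "b - c"] by (simp add: cg_def)

lemma cg_add: "a \<doteq> b ==> c \<doteq> d ==> a + c \<doteq> b + d"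
 using Pi(2)[of "a - b" "c - d"] by (simp add: cg_def algebra_simps)

lemma cg_diff: "a \<doteq> b ==> c \<doteq> d ==> a - c \<doteq> b - d"
 using Pi(5)[of "a - b" "c - d"] by (simp add: cg_def algebra_simps)

lemma cg_mult: "a \<doteq> b ==> c * a \<doteq> c * b" using Pi(3)[of "a - b" c] by (simp add: cg_def algebra_simps)

lemma cg_mult2: "a \<doteq> b ==> a * c \<doteq> b * c" using cg_mult[of a b c] by (simp only: mult.commute)

lemma cg_sum: "(!!i. i \<in> S ==> u i \<doteq> v i) ==> sum u S \<doteq> sum v S"
 by (induction S rule: infinite_finite_induct) (auto intro: cg_add)

lemma cg_der: "\<delta> \<in> D ==> a \<doteq> b ==> \<delta> a \<doteq> \<delta> b"
 using stable[of \<delta> "a - b"] by (simp add: cg_def derivation_diff[OF der])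

lemma cg_0: "a \<doteq> 0 \<longleftrightarrow> a \<in> P" by (simp add: cg_def)

lemma cg_cancel: "a * b \<doteq> a * c ==> a \<notin> P ==> b \<doteq> c"
 using prime_inD[OF prime UNIV_I UNIV_I, of a "b - c"] by (simp add: cg_def right_diff_distrib)

text \<open>The differential operators generated by \<open>D\<close> and by multiplications. They
  preserve \<open>P\<close> and the cores of maximal ideals.\<close>

inductive_set Op :: "('n pol => 'n pol) set" where
 Op_id: "(%x. x) \<in> Op"
| Op_der: "U \<in> Op ==> \<delta> \<in> D ==> (%x. \<delta> (U x)) \<in> Op"
| Op_mult: "U \<in> Op ==> (%x. a * U x) \<in> Op"
| Op_add: "U \<in> Op ==> V \<in> Op ==> (%x. U x + V x) \<in> Op"

lemma Op_0: "(%x. 0) \<in> Op" using Op_mult[OF Op_id, of 0] by simp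

lemma Op_diff: "U \<in> Op ==> V \<in> Op ==> (%x. U x - V x) \<in> Op"
 using Op_add[OF _ Op_mult[of V "-1"], of U] by simp

lemma Op_sum: "(!!i. i \<in> S ==> U i \<in> Op) ==> (%x. \<Sum>i\<in>S. U i x) \<in> Op"
 by (induction S rule: infinite_finite_induct) (auto intro: Op_0 Op_add)

lemma Op_additive: "U \<in> Op ==> U (x + y) = U x + U y"
 by (induction rule: Op.induct) (auto simp: derivation_add[OF der] algebra_simps)

lemma Op_P: "U \<in> Op ==> x \<in> P ==> U x \<in> P"
 by (induction rule: Op.induct) (auto intro: stable Pi)

lemma Op_core: "U \<in> Op ==> ideal_in UNIV Q ==> ideal_in UNIV (core D Q) ==> x \<in> core D Q ==> U x \<in> core D Q"
 by (induction rule: Op.induct) (auto intro: core_closed ideal_in_add ideal_in_mult)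

lemma Op_Cst: assumes "!!\<delta> c. \<delta> \<in> D ==> \<delta> (Cst c) = 0" shows "U \<in> Op ==> U (Cst c * x) = Cst c * U x"
 by (induction rule: Op.induct) (auto simp: derivation_mult[OF der] assms algebra_simps)

text \<open>\<open>sep N F T d\<close>: the operators \<open>T j\<close> separate the elements \<open>F i\<close> modulo \<open>P\<close>, with common value \<open>d\<close>.\<close>

definition sep :: "nat => (nat => 'n pol) => (nat => 'n pol => 'n pol) => 'n pol => bool" where
 "sep N F T d \<longleftrightarrow> d \<notin> P & (\<forall>j<N. T j \<in> Op) & (\<forall>i<N. \<forall>j<N. T j (F i) \<doteq> (if i = j then d else 0))"

lemma sep_step:
 assumes "sep N F T d" and indep: "!!x. ~ g \<doteq> (\<Sum>i<N. Cst (x i) * F i)"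
 shows "EX T' d'. sep (Suc N) (F(N := g)) T' d'"
proof -
 have dP: "d \<notin> P" and TO: "!!j. j < N ==> T j \<in> Op"
  and TF: "!!i j. i < N ==> j < N ==> T j (F i) \<doteq> (if i = j then d else 0)"
  using assms(1) by (auto simp: sep_def)
 define H where "H j = T j g" for j
 \<comment> \<open>\<open>K U\<close> is \<open>d * U\<close> with its components along the
   \<open>T j\<close> removed, so it kills all \<open>F i\<close> modulo \<open>P\<close>.\<close>
 define K where "K U x = d * U x - (\<Sum>j<N. U (F j) * T j x)" for U x
 have KO: "K U \<in> Op" if "U \<in> Op" for U
  unfolding K_def[abs_def] by (intro Op_diff Op_mult Op_sum that TO) auto
 have KF: "K U (F i) \<doteq> 0" if U: "U \<in> Op" and i: "i < N" for U i
 proof -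
  have "(\<Sum>j<N. U (F j) * T j (F i)) \<doteq> (\<Sum>j<N. U (F j) * (if i = j then d else 0))"
  using i by (intro cg_sum cg_mult TF) auto
  also have "(\<Sum>j<N. U (F j) * (if i = j then d else 0)) = (\<Sum>j<N. if i = j then U (F j) * d else 0)"
  by (intro sum.cong) auto
  also have "\<dots> = U (F i) * d" using i by simp
  finally have "d * U (F i) - (\<Sum>j<N. U (F j) * T j (F i)) \<doteq> d * U (F i) - U (F i) * d"
  by (intro cg_diff cg_refl)
  then show ?thesis by (simp add: K_def mult.commute)
 qed
 have "EX U:Op. ~ K U g \<doteq> 0"
 proof (rule ccontr)
  assume "~ (EX U:Op. ~ K U g \<doteq> 0)"
  \<comment> \<open>If all \<open>K U g\<close> vanish, the fractions \<open>H j / d\<close> express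
    \<open>g\<close> through the \<open>F j\<close> compatibly with every operator. Comparing the
    \<delta>-derivative of this relation with the relation for \<delta> after \<open>U\<close> shows
    that these fractions are constants, hence complex numbers, against \<open>indep\<close>.\<close>
  then have K0: "d * U g \<doteq> (\<Sum>j<N. U (F j) * H j)" if "U \<in> Op" for U
  using that by (auto simp: K_def H_def cg_def)
  have const: "d * \<delta> (H i) - H i * \<delta> d \<in> P" if \<delta>: "\<delta> \<in> D" and i: "i < N" for \<delta> i
  proof -
  define W where "W U = (\<Sum>j<N. U (F j) * (d * \<delta> (H j) - H j * \<delta> d))" for U
  have W: "W U \<doteq> 0" if U: "U \<in> Op" for U
  proof -
  have "\<delta> (d * U g) \<doteq> \<delta> (\<Sum>j<N. U (F j) * H j)" by (rule cg_der[OF \<delta> K0[OF U]])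
  then have "\<delta> d * U g + d * \<delta> (U g) \<doteq> (\<Sum>j<N. \<delta> (U (F j)) * H j) + (\<Sum>j<N. U (F j) * \<delta> (H j))"
  by (simp add: derivation_mult[OF der[OF \<delta>]] derivation_sum[OF der[OF \<delta>]] sum.distrib)
  from cg_diff[OF this K0[OF Op_der[OF U \<delta>]]] have "\<delta> d * U g \<doteq> (\<Sum>j<N. U (F j) * \<delta> (H j))" by simp
  from cg_mult[OF this, of d] have 1: "\<delta> d * (d * U g) \<doteq> d * (\<Sum>j<N. U (F j) * \<delta> (H j))"
  by (simp only: mult.left_commute)
  have "d * (\<Sum>j<N. U (F j) * \<delta> (H j)) - \<delta> d * (\<Sum>j<N. U (F j) * H j) \<doteq> \<delta> d * (d * U g) - \<delta> d * (d * U g)"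
  by (rule cg_diff[OF cg_sym[OF 1] cg_mult[OF cg_sym[OF K0[OF U]]]])
  moreover have "W U = d * (\<Sum>j<N. U (F j) * \<delta> (H j)) - \<delta> d * (\<Sum>j<N. U (F j) * H j)"
  unfolding W_def sum_distrib_left sum_subtractf[symmetric] by (intro sum.cong refl) (simp add: algebra_simps)
  ultimately show ?thesis by simp
  qed
  have "W (T i) \<doteq> (\<Sum>j<N. (if j = i then d else 0) * (d * \<delta> (H j) - H j * \<delta> d))"
  unfolding W_def using i by (intro cg_sum cg_mult2 TF) auto
  also have "(\<Sum>j<N. (if j = i then d else 0) * (d * \<delta> (H j) - H j * \<delta> d)) = (\<Sum>j<N. if j = i then d * (d * \<delta> (H j) - H j * \<delta> d) else 0)"
  by (intro sum.cong) auto
  also have "\<dots> = d * (d * \<delta> (H i) - H i * \<delta> d)" using i by simp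
  finally have "d * (d * \<delta> (H i) - H i * \<delta> d) \<doteq> 0" using W[OF TO[OF i]] cg_sym cg_trans by blast
  then show ?thesis using prime_inD[OF prime UNIV_I UNIV_I] dP by (auto simp: cg_0)
  qed
  have "\<forall>i<N. EX c. H i - Cst c * d \<in> P" using rational[OF dP const] by blast
  then obtain x where x: "!!i. i < N ==> H i \<doteq> Cst (x i) * d" unfolding cg_def by metis
  have "d * g \<doteq> (\<Sum>j<N. F j * H j)" using K0[OF Op_id] .
  also have "\<dots> \<doteq> (\<Sum>j<N. F j * (Cst (x j) * d))" by (intro cg_sum cg_mult x) auto
  also have "\<dots> = d * (\<Sum>j<N. Cst (x j) * F j)" by (simp add: sum_distrib_left algebra_simps)
  finally show False using cg_cancel[OF _ dP] indep[of x] by blast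
 qed
 then obtain U where U: "U \<in> Op" "~ K U g \<doteq> 0" by blast
 define s where "s = K U g"
 \<comment> \<open>Cross-multiplication: \<open>K U\<close> becomes the operator for
   \<open>g\<close>, and \<open>g\<close> is cleared from the old operators, with common value
   \<open>d * s\<close>.\<close>
 define T' where "T' j = (if j = N then (%x. d * K U x) else (%x. s * T j x - H j * K U x))" for j
 have "sep (Suc N) (F(N := g)) T' (d * s)"
  unfolding sep_def
 proof (intro conjI allI impI)
  show "d * s \<notin> P" using prime_inD[OF prime UNIV_I UNIV_I, of d s] dP U(2) by (auto simp: s_def cg_0)
  fix j assume j: "j < Suc N"
  show "T' j \<in> Op" using j by (auto simp: T'_def intro!: Op_mult KO U Op_diff TO)
  fix i assume i: "i < Suc N"
  show "T' j ((F(N := g)) i) \<doteq> (if i = j then d * s else 0)"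
  proof (cases "j = N")
  case True
  then show ?thesis using i cg_mult[OF KF[OF U(1), of i], of d] by (auto simp: T'_def s_def)
  next
  case False
  then have jN: "j < N" using j by simp
  show ?thesis
  proof (cases "i = N")
  case True
  then show ?thesis using jN by (simp add: T'_def s_def H_def mult.commute)
  next
  case False
  then have iN: "i < N" using i by simp
  have "s * T j (F i) - H j * K U (F i) \<doteq> s * (if i = j then d else 0) - H j * 0"
  by (intro cg_diff cg_mult TF iN jN KF U)
  then show ?thesis using jN iN by (auto simp: T'_def mult.commute)
  qed
  qed
 qed
 then show ?thesis by blast
qed

text \<open>The \<open>F i\<close> are those \<open>g k\<close> that are linearly independent modulo
  \<open>P\<close> of the ones chosen before; only these call for \<open>sep_step\<close>.\<close>

lemma sep_exists: fixes n :: nat and g :: "nat => 'n pol"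
 shows "EX N F T d. sep N F T d & (\<forall>k<n. EX x. g k \<doteq> (\<Sum>i<N. Cst (x i) * F i))"
proof (induction n)
 case 0
 have "sep 0 F T 1" for F T using prime_in_1[OF prime] by (simp add: sep_def)
 then have "sep 0 (%_. 0) (%_ x. x) 1 & (\<forall>k<0. EX x. g k \<doteq> (\<Sum>i<0. Cst (x i) * (%_. 0) i))" by simp
 then show ?case by (intro exI)
next
 case (Suc n)
 then obtain N F T d where s: "sep N F T d" and x: "\<forall>k<n. EX x. g k \<doteq> (\<Sum>i<N. Cst (x i) * F i)" by (elim exE conjE)
 show ?case
 proof (cases "EX x. g n \<doteq> (\<Sum>i<N. Cst (x i) * F i)")
  case True
  then have "\<forall>k<Suc n. EX x. g k \<doteq> (\<Sum>i<N. Cst (x i) * F i)" using x by (auto simp: less_Suc_eq)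
  with s have "sep N F T d & (\<forall>k<Suc n. EX x. g k \<doteq> (\<Sum>i<N. Cst (x i) * F i))" by (rule conjI)
  then show ?thesis by (intro exI)
 next
  case False
  then have no: "~ g n \<doteq> (\<Sum>i<N. Cst (x i) * F i)" for x using exI[of "%x. g n \<doteq> (\<Sum>i<N. Cst (x i) * F i)" x] by (rule contrapos_nn)
  from sep_step[OF s no] obtain T' d' where T': "sep (Suc N) (F(N := g n)) T' d'" by (elim exE)
  have "EX x. g k \<doteq> (\<Sum>i<Suc N. Cst (x i) * (F(N := g n)) i)" if "k < Suc n" for k
  proof (cases "k = n")
  case True
  have "(\<Sum>i<Suc N. Cst (if i = N then 1 else 0) * (F(N := g n)) i) = g n"
  by (simp add: Cst_simps)
  then show ?thesis using True by (intro exI[of _ "%i. if i = N then 1 else 0"]) simp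
  next
  case False
  then have "k < n" using \<open>k < Suc n\<close> by simp
  then have "EX y. g k \<doteq> (\<Sum>i<N. Cst (y i) * F i)" using x by simp
  then obtain y where "g k \<doteq> (\<Sum>i<N. Cst (y i) * F i)" ..
  moreover have "(\<Sum>i<Suc N. Cst ((y(N := 0)) i) * (F(N := g n)) i) = (\<Sum>i<N. Cst (y i) * F i)"
  by (simp add: Cst_simps)
  ultimately show ?thesis by (intro exI[of _ "y(N := 0)"]) simp
  qed
  with T' have "sep (Suc N) (F(N := g n)) T' d' & (\<forall>k<Suc n. EX x. g k \<doteq> (\<Sum>i<Suc N. Cst (x i) * (F(N := g n)) i))" by simp
  then show ?thesis by (intro exI)
 qed
qed

text \<open>Let \<open>y\<close> be a zero of \<open>P\<close> at which no \<open>d n\<close>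
  vanishes. An element of the core outside \<open>P\<close> has a nonzero coefficient along some
  \<open>F j\<close>; the separating operator maps it to a nonzero multiple of \<open>d n\<close>
  modulo \<open>P\<close>, yet keeps it in the core, so \<open>d n\<close> would vanish at
  \<open>y\<close>.\<close>

theorem rational_point:
 assumes DC: "!!\<delta> c. \<delta> \<in> D ==> \<delta> (Cst c) = 0"
 shows "EX y. (ALL p:P. ev p y = 0) & core D (maxid y) = P"
proof -
 obtain g :: "nat => 'n pol" where g: "ALL p. EX n x. p = (\<Sum>k<n. Cst (x k) * g k)" using pol_span by blast
 have "ALL n. EX d. EX N F T. sep N F T d & (\<forall>k<n. EX x. g k \<doteq> (\<Sum>i<N. Cst (x i) * F i))"
 proof
  fix n
  obtain N F T d where "sep N F T d & (\<forall>k<n. EX x. g k \<doteq> (\<Sum>i<N. Cst (x i) * F i))"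
  using sep_exists[of n g] by (elim exE)
  then show "EX d. EX N F T. sep N F T d & (\<forall>k<n. EX x. g k \<doteq> (\<Sum>i<N. Cst (x i) * F i))" by (intro exI)
 qed
 from choice[OF this] obtain d where d': "ALL n. EX N F T. sep N F T (d n) & (\<forall>k<n. EX x. g k \<doteq> (\<Sum>i<N. Cst (x i) * F i))" ..
 note d = spec[OF d']
 have "d n \<notin> P" for n using d[of n] by (auto simp: sep_def)
 then obtain y where y: "ALL p:P. ev p y = 0" "ALL n. ev (d n) y ~= 0"
  using countable_nullstellensatz[OF prime, of d] by blast
 have C: "ideal_in UNIV (core D (maxid y))"
  by (intro prime_in_ideal prime_core prime_maxid char0_maxid ballI der)
 have PC: "P \<subseteq> core D (maxid y)" by (rule core_greatest) (use y(1) stable in auto)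
 moreover have "core D (maxid y) \<subseteq> P"
 proof
  fix p assume p: "p \<in> core D (maxid y)"
  show "p \<in> P"
  proof (rule ccontr)
  assume pP: "p \<notin> P"
  obtain n x where px: "p = (\<Sum>k<n. Cst (x k) * g k)" using g by blast
  obtain N F T where s: "sep N F T (d n)" and z: "\<forall>k<n. EX x. g k \<doteq> (\<Sum>i<N. Cst (x i) * F i)"
  using d[of n] by (elim exE conjE)
  have "ALL k. EX x. k < n --> g k \<doteq> (\<Sum>i<N. Cst (x i) * F i)" using z by simp
  from choice[OF this] obtain z' where "ALL k. k < n --> g k \<doteq> (\<Sum>i<N. Cst (z' k i) * F i)" ..
  then have z': "g k \<doteq> (\<Sum>i<N. Cst (z' k i) * F i)" if "k < n" for k using that by simp
  define w where "w i = (\<Sum>k<n. x k * z' k i)" for i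
  have Cs: "Cst (sum u A) = (\<Sum>i\<in>A. Cst (u i) :: 'n pol)" for u and A :: "nat set"
  by (rule pol_eqI) simp
  have "p \<doteq> (\<Sum>k<n. Cst (x k) * (\<Sum>i<N. Cst (z' k i) * F i))"
  unfolding px by (intro cg_sum cg_mult z') auto
  also have "\<dots> = (\<Sum>i<N. Cst (w i) * F i)"
  unfolding w_def Cs sum_distrib_left sum_distrib_right
  by (subst sum.swap) (simp add: Cst_simps mult.assoc)
  finally have pw: "p \<doteq> (\<Sum>i<N. Cst (w i) * F i)" .
  have "\<exists>j<N. w j ~= 0"
  proof (rule ccontr)
  assume "~ (\<exists>j<N. w j ~= 0)"
  then have "(\<Sum>i<N. Cst (w i) * F i) = 0" by (intro sum.neutral) (auto simp: Cst_simps)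
  then show False using pw pP by (simp add: cg_0)
  qed
  then obtain j where j: "j < N" "w j ~= 0" by blast
  have TO: "T j \<in> Op" using s j by (simp add: sep_def)
  have Tsum: "T j (sum u A) = (\<Sum>i\<in>A. T j (u i))" for u and A :: "nat set"
  proof (induction A rule: infinite_finite_induct)
  case (infinite A) then show ?case using Op_additive[OF TO, of 0 0] by simp
  next
  case empty then show ?case using Op_additive[OF TO, of 0 0] by simp
  qed (simp add: Op_additive[OF TO])
  have OpC: "T j (Cst c * x) = Cst c * T j x" for c x by (rule Op_Cst[OF _ TO]) (rule DC)
  have Tdiff: "T j (a - b) = T j a - T j b" for a b
  using Op_additive[OF TO, of "a - b" b] by simp
  have "T j p \<doteq> T j (\<Sum>i<N. Cst (w i) * F i)"
  using Op_P[OF TO pw[unfolded cg_def]] by (simp add: cg_def Tdiff)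
  also have "\<dots> = (\<Sum>i<N. Cst (w i) * T j (F i))" by (simp add: Tsum OpC)
  also have "\<dots> \<doteq> (\<Sum>i<N. Cst (w i) * (if i = j then d n else 0))"
  using s j by (intro cg_sum cg_mult) (auto simp: sep_def)
  also have "\<dots> = (\<Sum>i<N. if i = j then Cst (w j) * d n else 0)" by (intro sum.cong) auto
  also have "\<dots> = Cst (w j) * d n" using j by simp
  finally have "Cst (w j) * d n - T j p \<in> P" using cg_sym by (auto simp: cg_def)
  then have "Cst (w j) * d n - T j p \<in> core D (maxid y)" using PC by blast
  moreover have "T j p \<in> core D (maxid y)" by (rule Op_core[OF TO ideal_maxid C p])
  ultimately have "Cst (w j) * d n \<in> core D (maxid y)" using ideal_in_add[OF C] by fastforce
  then have "Cst (w j) * d n \<in> maxid y" by (rule subsetD[OF core_sub])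
  then show False using y(2) j by simp
  qed
 qed
 ultimately show ?thesis using y(1) by blast
qed

end

section \<open>Coordinate algebras of Poisson varieties\<close>

definition rs :: "'n::finite cmat set => 'n pol => ('n cmat => complex)" where "rs X p = restrict (ev p) X"

lemma rs_eq_iff: "rs X p = rs X q \<longleftrightarrow> (ALL x:X. ev p x = ev q x)"
 by (metis rs_def restrict_apply' restrict_ext)

lemma rs_apply [simp]: "x \<in> X ==> rs X p x = ev p x" by (simp add: rs_def)

lemma coord_simps:
 "carrier (coord_algebra X br) = range (rs X)" "mult (coord_algebra X br) (rs X p) (rs X q) = rs X (p * q)"
 "one (coord_algebra X br) = rs X 1" "zero (coord_algebra X br) = rs X 0"
 "add (coord_algebra X br) (rs X p) (rs X q) = rs X (p + q)" "scalar (coord_algebra X br) c = rs X (Cst c)"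
 "pbracket (coord_algebra X br) = br"
proof -
 have "range (rs X) = (%p. restrict p X) ` range ev" by (auto simp: rs_def)
 then show "carrier (coord_algebra X br) = range (rs X)" by (simp add: coord_algebra_def range_ev)
qed (auto simp: coord_algebra_def rs_def restrict_def)

lemma coord_cring: "cring (coord_algebra X br)"
proof (rule cringI)
 show "abelian_group (coord_algebra X br)"
 proof (rule abelian_groupI)
  fix x assume "x \<in> carrier (coord_algebra X br)"
  then obtain p where "x = rs X p" by (auto simp: coord_simps)
  then show "EX y:carrier (coord_algebra X br). y \<oplus>\<^bsub>coord_algebra X br\<^esub> x = \<zero>\<^bsub>coord_algebra X br\<^esub>"
  by (intro bexI[of _ "rs X (- p)"]) (auto simp: coord_simps)
 qed (auto simp: coord_simps algebra_simps)
 show "comm_monoid (coord_algebra X br)"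
  by (rule comm_monoidI) (auto simp: coord_simps algebra_simps)
qed (auto simp: coord_simps algebra_simps)

lemma coord_uminus: "a_inv (coord_algebra X br) (rs X p) = rs X (- p)"
 by (rule abelian_group.minus_equality[OF cring.axioms(1)[OF coord_cring, THEN ring.axioms(1)]])
  (auto simp: coord_simps)

lemma mpow_dec: "mpow m (Suc k) a ==> mpow m k a"
 by (induction "Suc k" a arbitrary: rule: mpow.induct) (auto intro: mpow.intros mpow_scale)

lemma mpow_le: "k \<le> l ==> mpow m l a ==> mpow m k a"
 by (induction rule: inc_induct) (auto intro: mpow_dec)

lemma mpow_derivation:
 assumes d: "derivation d" shows "mpow m k a ==> mpow m (k - 1) (d a)"
proof (induction rule: mpow.induct)
 case (mpow_Suc a k b)
 have "mpow m k (a * d b)"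
 proof (cases k)
  case 0 then show ?thesis by (simp add: mpow.intros)
 next
  case (Suc j) then show ?thesis using mpow.mpow_Suc[OF mpow_Suc(1), of j "d b"] mpow_Suc by simp
 qed
 moreover have "mpow m k (d a * b)" by (rule mpow_scale[OF mpow_Suc(2)])
 ultimately show ?case using mpow.mpow_add by (auto simp: derivation_mult[OF d])
qed (auto simp: derivation_0[OF d] derivation_add[OF d] intro: mpow.intros)

text \<open>Real numbers are coded by sets of natural numbers, and a sequence of complex numbers by
  one such set; even and odd first components keep real and imaginary parts apart.\<close>

lemma function_injection: "\<exists>g :: (nat => complex) => complex. inj g"
proof -
 have e: "(UNIV :: nat set set) \<approx> (UNIV :: real set)" by (rule nat_sets_eqpoll_reals)
 obtain s :: "nat set => real" where s: "inj s" using e by (auto simp: eqpoll_def bij_betw_def)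
 obtain r :: "real => nat set" where r: "inj r" using eqpoll_sym[OF e] by (auto simp: eqpoll_def bij_betw_def)
 define code where "code c = {prod_encode (2 * n, k) | n k. k \<in> r (Re (c n))} \<union> {prod_encode (2 * n + 1, k) | n k. k \<in> r (Im (c n))}"
  for c :: "nat => complex"
 have "inj code"
 proof (rule injI)
  fix c d assume cd: "code c = code d"
  have *: "k \<in> r (Re (c n)) \<longleftrightarrow> prod_encode (2 * n, k) \<in> code c" "k \<in> r (Im (c n)) \<longleftrightarrow> prod_encode (2 * n + 1, k) \<in> code c"
  for c n k unfolding code_def by (auto; presburger)+
  have "r (Re (c n)) = r (Re (d n))" "r (Im (c n)) = r (Im (d n))" for n using *[of _ c n] *[of _ d n] cd by auto
  then have "c n = d n" for n using r by (simp add: inj_eq complex_eq_iff)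
  then show "c = d" by auto
 qed
 then have "inj (%c. complex_of_real (s (code c)))" using s by (auto simp: inj_def)
 then show ?thesis by blast
qed

text \<open>Functions on \<open>S\<close> are represented by polynomials on the matrix space, and
  \<open>hv q\<close> is an ambient polynomial field that is Hamiltonian for \<open>q\<close> along
  \<open>S\<close>. The Poisson identities are required on \<open>S\<close> only.\<close>

locale poisson_variety =
 fixes S :: "'n::finite cmat set" and hv :: "'n pol => 'n cmat => 'n cmat"
  and br :: "('n cmat => complex) => ('n cmat => complex) => ('n cmat => complex)"
 assumes pmh: "pmap (hv q)"
  and tangent: "(!!z. z \<in> S ==> ev p z = 0) ==> y \<in> S ==> dirD p y (hv q y) = 0"
  and skew: "y \<in> S ==> dirD p y (hv q y) = - dirD q y (hv p y)"
  and jacobi: "y \<in> S ==> ev (vf (hv (vf (hv r) q)) p) y = ev (vf (hv r) (vf (hv q) p)) y - ev (vf (hv q) (vf (hv r) p)) y"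
  and br: "br (rs S p) (rs S q) = rs S (vf (hv q) p)"
  and closed: "z \<notin> S ==> EX p. (ALL y:S. ev p y = 0) & ev p z ~= 0"
begin

abbreviation "Z \<equiv> coord_algebra S br"

text \<open>\<open>dl q p\<close> represents the bracket of \<open>p\<close> with \<open>q\<close>,
  in this order.\<close>

definition dl :: "'n pol => 'n pol => 'n pol" where "dl q = vf (hv q)"

definition J :: "'n cmat => 'n pol set" where "J y = germ (range hv) y"

lemma J_core: "J y = core (range dl) (maxid y)"
 by (simp add: J_def germ_def dl_def[abs_def] image_image)

lemma ev_dl: "ev (dl q p) y = dirD p y (hv q y)" by (simp add: dl_def ev_vf pmh)

lemma derivation_dl: "derivation (dl q)" unfolding dl_def by (rule derivation_vf[OF pmh])

lemma dl_skew: "y \<in> S ==> ev (dl q p) y = - ev (dl p q) y" unfolding ev_dl by (rule skew)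

lemma dl_van: "(!!z. z \<in> S ==> ev p z = 0) ==> y \<in> S ==> ev (dl q p) y = 0" using tangent by (simp add: ev_dl)

lemma dl_cong: "(!!z. z \<in> S ==> ev p z = ev p' z) ==> y \<in> S ==> ev (dl q p) y = ev (dl q p') y"
 using dl_van[of "p - p'" y q] by (simp add: derivation_diff[OF derivation_dl])

lemma dl_cong_left: "(!!z. z \<in> S ==> ev p z = ev p' z) ==> y \<in> S ==> ev (dl p q) y = ev (dl p' q) y"
 using dl_skew[of y p q] dl_skew[of y p' q] dl_cong[of p p' y q] by simp

lemma dl_skew2: assumes "y \<in> S" shows "ev (dl r (dl q p)) y = - ev (dl r (dl p q)) y"
proof -
 have "ev (dl r (dl q p)) y = ev (dl r (- dl p q)) y"
 proof (rule dl_cong[OF _ assms])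
  fix z assume "z \<in> S"
  from dl_skew[OF this, of q p] show "ev (dl q p) z = ev (- dl p q) z" by simp
 qed
 then show ?thesis by (simp add: derivation_uminus[OF derivation_dl])
qed

lemma dl_jacobi: "y \<in> S ==> ev (dl (dl r q) p) y = ev (dl r (dl q p)) y - ev (dl q (dl r p)) y"
 unfolding dl_def by (rule jacobi)

lemma dl_Cst: "dl q (Cst c) = 0" by (rule pol_eqI) (simp add: ev_dl)

lemma pb: "pbracket Z (rs S p) (rs S q) = rs S (dl q p)" by (simp add: coord_simps br dl_def)

lemma poisson_Z: "poisson_algebra Z"
proof (rule poisson_algebra.intro[OF coord_cring], rule poisson_algebra_axioms.intro)
 fix x y z assume "x \<in> carrier Z" "y \<in> carrier Z" "z \<in> carrier Z"
 then obtain p q r where e: "x = rs S p" "y = rs S q" "z = rs S r" by (auto simp: coord_simps)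
 show "pbracket Z x (y \<oplus>\<^bsub>Z\<^esub> z) = pbracket Z x y \<oplus>\<^bsub>Z\<^esub> pbracket Z x z"
  unfolding e coord_simps(5) pb rs_eq_iff by (simp add: dl_skew[of _ _ p] derivation_add[OF derivation_dl])
 show "pbracket Z x (pbracket Z y z) \<oplus>\<^bsub>Z\<^esub> pbracket Z y (pbracket Z z x) \<oplus>\<^bsub>Z\<^esub> pbracket Z z (pbracket Z x y) = \<zero>\<^bsub>Z\<^esub>"
  unfolding e coord_simps(4,5) pb rs_eq_iff
 proof
  fix y assume y: "y \<in> S"
  show "ev (dl (dl r q) p + dl (dl p r) q + dl (dl q p) r) y = ev 0 y"
  using dl_jacobi[OF y, of r q p] dl_skew[OF y, of "dl p r" q] dl_skew[OF y, of "dl q p" r] dl_skew2[OF y, of q p r] by simp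
 qed
 show "pbracket Z x (y \<otimes>\<^bsub>Z\<^esub> z) = pbracket Z x y \<otimes>\<^bsub>Z\<^esub> z \<oplus>\<^bsub>Z\<^esub> y \<otimes>\<^bsub>Z\<^esub> pbracket Z x z"
  unfolding e coord_simps(2,5) pb rs_eq_iff by (simp add: dl_skew[of _ _ p] derivation_mult[OF derivation_dl])
next
 fix x y c assume "x \<in> carrier Z" "y \<in> carrier Z"
 then obtain p q where e: "x = rs S p" "y = rs S q" by (auto simp: coord_simps)
 show "pbracket Z x y \<in> carrier Z" by (simp add: e pb coord_simps(1))
 show "pbracket Z y x = \<ominus>\<^bsub>Z\<^esub> pbracket Z x y"
  unfolding e pb coord_uminus rs_eq_iff
 proof
  fix z assume "z \<in> S"
  from dl_skew[OF this, of p q] show "ev (dl p q) z = ev (- dl q p) z" by simp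
 qed
 show "pbracket Z x (scalar Z c \<otimes>\<^bsub>Z\<^esub> y) = scalar Z c \<otimes>\<^bsub>Z\<^esub> pbracket Z x y"
  unfolding e coord_simps(2,6) pb rs_eq_iff
  by (simp add: dl_skew[of _ _ p] derivation_mult[OF derivation_dl] dl_Cst)
qed (auto simp: coord_simps Cst_simps)

lemma prime_J: "prime_in UNIV (J y)"
 unfolding J_core by (intro prime_core prime_maxid char0_maxid) (auto intro: derivation_dl)

lemma J_ideal: "ideal_in UNIV (J y)" by (rule prime_in_ideal[OF prime_J])

lemma J_sub: "p \<in> J y ==> ev p y = 0" using core_sub[of "range dl" "maxid y"] by (auto simp: J_core)

lemma J_stable: "p \<in> J y ==> dl q p \<in> J y" unfolding J_core by (rule core_closed) auto

lemma J_van: "y \<in> S ==> (!!z. z \<in> S ==> ev p z = 0) ==> p \<in> J y"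
proof -
 assume y: "y \<in> S" and p: "!!z. z \<in> S ==> ev p z = 0"
 have "{p. ALL z:S. ev p z = 0} \<subseteq> J y"
  unfolding J_core by (rule core_greatest) (use y dl_van in auto)
 then show "p \<in> J y" using p by blast
qed

subsection \<open>Modules of distributions at a point\<close>

text \<open>Distributions supported at \<open>y\<close>: the functionals obtained from the
  evaluation by transposed multiplications and transposed Hamiltonian derivations.\<close>

inductive_set NY :: "'n cmat => ('n pol => complex) set" for y where
 NY_pt: "(%w. ev w y) \<in> NY y"
| NY_mult: "u \<in> NY y ==> (%w. u (z * w)) \<in> NY y"
| NY_der: "u \<in> NY y ==> (%w. u (dl x w)) \<in> NY y"
| NY_add: "u \<in> NY y ==> v \<in> NY y ==> (%w. u w + v w) \<in> NY y"

lemma NY_lin: "u \<in> NY y ==> u (a + b) = u a + u b" "u \<in> NY y ==> u (Cst c * a) = c * u a"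
proof (induction arbitrary: a b rule: NY.induct)
 case (NY_mult u z)
 { case 1 show ?case by (simp add: ring_distribs NY_mult) }
 { case 2 show ?case using NY_mult(3)[of "z * a"] by (simp only: mult.left_commute) }
next
 case (NY_der u x)
 { case 1 show ?case by (simp add: derivation_add[OF derivation_dl] NY_der) }
 { case 2 show ?case by (simp add: derivation_mult[OF derivation_dl] dl_Cst NY_der) }
qed (simp_all add: algebra_simps)

lemma NY_0: "u \<in> NY y ==> u 0 = 0" using NY_lin(1)[of u y 0 0] by simp

lemma NY_diff: "u \<in> NY y ==> u (a - b) = u a - u b" using NY_lin(1)[of u y "a - b" b] by simp

lemma NY_zero: "(%w. 0) \<in> NY y" using NY_mult[OF NY_pt, where z = 0] by simp

lemma NY_scale: "u \<in> NY y ==> (%w. c * u w) \<in> NY y" using NY_mult[of u y "Cst c"] by (simp add: NY_lin)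

lemma NY_J: "u \<in> NY y ==> p \<in> J y ==> u p = 0"
 by (induction arbitrary: p rule: NY.induct) (auto simp: J_sub J_stable ideal_in_mult[OF J_ideal])

lemma NY_cong: "y \<in> S ==> u \<in> NY y ==> (!!z. z \<in> S ==> ev a z = ev b z) ==> u a = u b"
 using NY_J[of u y "a - b"] J_van[of y "a - b"] NY_diff[of u y a b] by simp

lemma NY_finite: "u \<in> NY y ==> EX k. ALL w. mpow (maxid y) k w --> u w = 0"
proof (induction rule: NY.induct)
 case NY_pt
 have "mpow (maxid y) (Suc 0) w ==> w \<in> maxid y" for w by (rule mpow_Suc_ideal[OF ideal_maxid])
 then show ?case by (intro exI[of _ "Suc 0"]) auto
next
 case (NY_mult u z) then show ?case using mpow_scale by blast
next
 case (NY_der u x)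
 then obtain k where k: "ALL w. mpow (maxid y) k w --> u w = 0" by blast
 have "mpow (maxid y) (Suc k) w ==> mpow (maxid y) k (dl x w)" for w
  using mpow_derivation[OF derivation_dl, of "maxid y" "Suc k"] by simp
 then show ?case using k by blast
next
 case (NY_add u v)
 then obtain k l where "ALL w. mpow (maxid y) k w --> u w = 0" "ALL w. mpow (maxid y) l w --> v w = 0" by blast
 moreover have "mpow (maxid y) k w" "mpow (maxid y) l w" if "mpow (maxid y) (k + l) w" for w
  using mpow_le[OF _ that, of k] mpow_le[OF _ that, of l] by simp_all
 ultimately have "u w + v w = 0" if "mpow (maxid y) (k + l) w" for w using that by simp
 then show ?case by (intro exI[of _ "k + l"]) simp
qed

text \<open>Take in \<open>T\<close> a nonzero functional killed by the least possible power of the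
  maximal ideal. Multiplying it by an element of that ideal lowers the power and so gives zero.
  Hence it is a multiple of the evaluation, which generates everything.\<close>

lemma NY_simple:
 assumes T: "T \<subseteq> NY y" "!!u z. u \<in> T ==> (%w. u (z * w)) \<in> T" "!!u x. u \<in> T ==> (%w. u (dl x w)) \<in> T"
  "!!u v. u \<in> T ==> v \<in> T ==> (%w. u w + v w) \<in> T" and u: "u \<in> T" "u ~= (%w. 0)"
 shows "T = NY y"
proof -
 define Q where "Q k \<longleftrightarrow> (EX u:T. u ~= (%w. 0) & (ALL w. mpow (maxid y) k w --> u w = 0))" for k
 have "EX k. Q k" using NY_finite[of u y] u T(1) unfolding Q_def by blast
 define k where "k = (LEAST k. Q k)"
 have Qk: "Q k" and min: "!!j. j < k ==> ~ Q j"
  unfolding k_def using LeastI_ex[OF \<open>EX k. Q k\<close>] not_less_Least by auto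
 obtain v where v: "v \<in> T" "v ~= (%w. 0)" "ALL w. mpow (maxid y) k w --> v w = 0" using Qk unfolding Q_def by blast
 have vN: "v \<in> NY y" using v T by blast
 have "k ~= 0" using v mpow.mpow_0[of "maxid y"] by auto
 then obtain j where j: "k = Suc j" using not0_implies_Suc by blast
 have vz: "v z = 0" if z: "ev z y = 0" for z
 proof (rule ccontr)
  assume "v z ~= 0"
  then have "(%w. v (z * w)) ~= (%w. 0)" by (metis mult.right_neutral)
  moreover have "ALL w. mpow (maxid y) j w --> v (z * w) = 0"
  using v(3) mpow.mpow_Suc[of z "maxid y" j] z by (auto simp: j)
  ultimately have "Q j" unfolding Q_def using T(2)[OF v(1)] by blast
  then show False using min j by blast
 qed
 have vw: "v w = ev w y * v 1" for w
 proof -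
  have "v (w - Cst (ev w y) * 1) = 0" by (rule vz) simp
  then show ?thesis using NY_diff[OF vN] NY_lin(2)[OF vN, of "ev w y" 1] by simp
 qed
 have v1: "v 1 ~= 0"
 proof
  assume 0: "v 1 = 0"
  have "v w = 0" for w using vw[of w] unfolding 0 by simp
  then show False using v(2) by blast
 qed
 have "(%w. ev w y) = (%w. v (Cst (1 / v 1) * w))"
 proof
  fix w
  have "v (Cst (1 / v 1) * w) = 1 / v 1 * (ev w y * v 1)"
  unfolding NY_lin(2)[OF vN, of "1 / v 1" w] by (subst vw) (rule refl)
  then show "ev w y = v (Cst (1 / v 1) * w)" using v1 by simp
 qed
 then have pt: "(%w. ev w y) \<in> T" using T(2)[OF v(1)] by metis
 have "t \<in> NY y ==> t \<in> T" for t by (induction rule: NY.induct) (auto intro: pt T)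
 then show ?thesis using T(1) by blast
qed

text \<open>A functional is determined by its values on a countable spanning set, and
  \<open>function_injection\<close> codes this sequence by one complex number.\<close>

lemma NY_injection: assumes "inj (\<iota> :: complex => 'm)" shows "\<exists>\<theta> :: ('n pol => complex) => 'm. inj_on \<theta> (NY y)"
proof -
 obtain g :: "nat => 'n pol" where g: "ALL p. EX n x. p = (\<Sum>k<n. Cst (x k) * g k)" using pol_span by blast
 obtain s :: "(nat => complex) => complex" where s: "inj s" using function_injection by blast
 have sum: "u (sum F A) = (\<Sum>k\<in>A. u (F k))" if "u \<in> NY y" for u F and A :: "nat set"
  by (induction A rule: infinite_finite_induct) (auto simp: NY_0[OF that] NY_lin(1)[OF that])
 have "inj_on (%u. \<iota> (s (%k. u (g k)))) (NY y)"
 proof (rule inj_onI)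
  fix u v assume uv: "u \<in> NY y" "v \<in> NY y" "\<iota> (s (%k. u (g k))) = \<iota> (s (%k. v (g k)))"
  then have "(%k. u (g k)) = (%k. v (g k))" using assms s by (simp add: inj_eq)
  then have e: "u (g k) = v (g k)" for k by metis
  have "u p = v p" for p
  proof -
  obtain n x where p: "p = (\<Sum>k<n. Cst (x k) * g k)" using g by blast
  show ?thesis unfolding p by (simp add: sum uv(1,2) NY_lin(2)[OF uv(1)] NY_lin(2)[OF uv(2)] e)
  qed
  then show "u = v" by blast
 qed
 then show ?thesis by blast
qed

theorem point_module:
 assumes y: "y \<in> S" and "inj (\<iota>' :: complex => 'm)"
 shows "\<exists>(M :: ('n cmat => complex, 'm) module) nabla. simple_poisson_module Z M nabla & annihilator Z M = rs S ` J y"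
proof -
 obtain \<iota> :: "('n pol => complex) => 'm" where \<iota>: "inj_on \<iota> (NY y)" using NY_injection[OF assms(2)] by blast
 \<comment> \<open>A polynomial representing a function on \<open>S\<close>; by
   \<open>NY_cong\<close> the functionals do not depend on the choice.\<close>
 define rp where "rp \<phi> = (SOME p. rs S p = \<phi>)" for \<phi> :: "'n cmat => complex"
 have rp: "ev (rp (rs S p)) z = ev p z" if "z \<in> S" for p z
 proof -
  have "rs S (rp (rs S p)) = rs S p" unfolding rp_def by (rule someI[of _ p]) simp
  then show ?thesis using that rs_eq_iff by blast
 qed
 define io where "io a = inv_into (NY y) \<iota> a" for a
 have io: "io (\<iota> u) = u" if "u \<in> NY y" for u using inv_into_f_f[OF \<iota> that] by (simp add: io_def)
 define M :: "('n cmat => complex, 'm) module" where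
  "M = \<lparr>carrier = \<iota> ` NY y, mult = (%a b. a), one = \<iota> (%w. 0), zero = \<iota> (%w. 0),
  add = (%a b. \<iota> (%w. io a w + io b w)), smult = (%\<phi> a. \<iota> (%w. io a (rp \<phi> * w)))\<rparr>"
 \<comment> \<open>Transposition reverses the order of operators, and \<open>dl\<close> brackets
   from the right. The two sign changes cancel, so the transpose of \<open>dl\<close> satisfies the
   axioms without a further sign.\<close>
 define nb where "nb \<phi> a = \<iota> (%w. io a (dl (rp \<phi>) w))" for \<phi> a
 have cM: "carrier M = \<iota> ` NY y" and zM: "zero M = \<iota> (%w. 0)" by (simp_all add: M_def)
 have aM: "add M (\<iota> u) (\<iota> v) = \<iota> (%w. u w + v w)" if "u \<in> NY y" "v \<in> NY y" for u v
  using that by (simp add: M_def io)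
 have sM: "smult M (rs S p) (\<iota> u) = \<iota> (%w. u (p * w))" if "u \<in> NY y" for u p
 proof -
  have "u (rp (rs S p) * w) = u (p * w)" for w by (rule NY_cong[OF y that]) (simp add: rp)
  then show ?thesis using that by (simp add: M_def io)
 qed
 have nM: "nb (rs S p) (\<iota> u) = \<iota> (%w. u (dl p w))" if "u \<in> NY y" for u p
 proof -
  have "u (dl (rp (rs S p)) w) = u (dl p w)" for w
  by (rule NY_cong[OF y that]) (rule dl_cong_left, simp_all add: rp)
  then show ?thesis using that by (simp add: nb_def io)
 qed
 note N = NY_mult NY_der NY_add NY_zero
 have ab: "abelian_group M"
 proof (rule abelian_groupI)
  fix x assume "x \<in> carrier M"
  then obtain u where u: "x = \<iota> u" "u \<in> NY y" by (auto simp: cM)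
  have "(%w. - 1 * u w) \<in> NY y" by (rule NY_scale[OF u(2)])
  then show "EX z:carrier M. z \<oplus>\<^bsub>M\<^esub> x = \<zero>\<^bsub>M\<^esub>"
  using u by (intro bexI[of _ "\<iota> (%w. - 1 * u w)"]) (auto simp: cM zM aM)
 qed (auto simp: cM zM aM N ac_simps)
 have mi: "a_minus M (\<iota> u) (\<iota> v) = \<iota> (%w. u w - v w)" if uv: "u \<in> NY y" "v \<in> NY y" for u v
 proof -
  have v: "(%w. - 1 * v w) \<in> NY y" by (rule NY_scale[OF uv(2)])
  have "a_inv M (\<iota> v) = \<iota> (%w. - 1 * v w)"
  by (rule abelian_group.minus_equality[OF ab]) (use uv v in \<open>auto simp: cM zM aM\<close>)
  then show ?thesis using aM[OF uv(1) v] by (simp add: a_minus_def)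
 qed
 have mod: "Module.module Z M"
 proof (rule moduleI[OF coord_cring ab])
  fix a b x assume "a \<in> carrier Z" "b \<in> carrier Z" "x \<in> carrier M"
  then obtain p q u where e: "a = rs S p" "b = rs S q" "x = \<iota> u" "u \<in> NY y" by (auto simp: cM coord_simps)
  note Nu = NY_mult[OF e(4)]
  show "(a \<oplus>\<^bsub>Z\<^esub> b) \<odot>\<^bsub>M\<^esub> x = a \<odot>\<^bsub>M\<^esub> x \<oplus>\<^bsub>M\<^esub> b \<odot>\<^bsub>M\<^esub> x"
  unfolding e(1-3) coord_simps(5) sM[OF e(4)] aM[OF Nu Nu] by (simp add: ring_distribs NY_lin(1)[OF e(4)])
  show "(a \<otimes>\<^bsub>Z\<^esub> b) \<odot>\<^bsub>M\<^esub> x = a \<odot>\<^bsub>M\<^esub> (b \<odot>\<^bsub>M\<^esub> x)"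
  unfolding e(1-3) coord_simps(2) sM[OF e(4)] sM[OF Nu] by (simp add: mult.assoc mult.left_commute)
 next
  fix a x z assume "a \<in> carrier Z" "x \<in> carrier M" "z \<in> carrier M"
  then obtain p u v where e: "a = rs S p" "x = \<iota> u" "u \<in> NY y" "z = \<iota> v" "v \<in> NY y" by (auto simp: cM coord_simps)
  show "a \<odot>\<^bsub>M\<^esub> (x \<oplus>\<^bsub>M\<^esub> z) = a \<odot>\<^bsub>M\<^esub> x \<oplus>\<^bsub>M\<^esub> a \<odot>\<^bsub>M\<^esub> z"
  unfolding e(1,2,4) aM[OF e(3,5)] sM[OF e(3)] sM[OF e(5)] sM[OF NY_add[OF e(3,5)]] aM[OF NY_mult[OF e(3)] NY_mult[OF e(5)]] ..
 next
  fix a x assume "a \<in> carrier Z" "x \<in> carrier M"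
  then obtain p u where e: "a = rs S p" "x = \<iota> u" "u \<in> NY y" by (auto simp: cM coord_simps)
  show "a \<odot>\<^bsub>M\<^esub> x \<in> carrier M" unfolding e(1,2) sM[OF e(3)] cM using NY_mult[OF e(3)] by blast
 next
  fix x assume "x \<in> carrier M"
  then obtain u where e: "x = \<iota> u" "u \<in> NY y" by (auto simp: cM)
  show "\<one>\<^bsub>Z\<^esub> \<odot>\<^bsub>M\<^esub> x = x" unfolding e(1) coord_simps(3) sM[OF e(2)] by simp
 qed
 have pmod: "poisson_module Z M nb"
 proof (rule poisson_module.intro[OF poisson_Z mod], rule poisson_module_axioms.intro)
  fix a b x assume "a \<in> carrier Z" "b \<in> carrier Z" "x \<in> carrier M"
  then obtain p q u where e: "a = rs S p" "b = rs S q" "x = \<iota> u" and u: "u \<in> NY y" by (auto simp: cM coord_simps)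
  note Nm = NY_mult[OF u] and Nd = NY_der[OF u]
  show "nb (a \<oplus>\<^bsub>Z\<^esub> b) x = nb a x \<oplus>\<^bsub>M\<^esub> nb b x"
  proof -
  have "u (dl (p + q) w) = u (dl p w) + u (dl q w)" for w
  proof -
  have "u (dl (p + q) w) = u (dl p w + dl q w)"
  by (rule NY_cong[OF y u]) (simp add: dl_skew[of _ _ w] derivation_add[OF derivation_dl])
  then show ?thesis by (simp add: NY_lin(1)[OF u])
  qed
  then show ?thesis unfolding e coord_simps(5) nM[OF u] aM[OF Nd Nd] by simp
  qed
  show "nb (a \<otimes>\<^bsub>Z\<^esub> b) x = a \<odot>\<^bsub>M\<^esub> nb b x \<oplus>\<^bsub>M\<^esub> b \<odot>\<^bsub>M\<^esub> nb a x"
  proof -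
  have "u (dl (p * q) w) = u (dl q (p * w)) + u (dl p (q * w))" for w
  proof -
  have "u (dl (p * q) w) = u (dl q (p * w) + dl p (q * w))"
  proof (rule NY_cong[OF y u])
  fix z assume z: "z \<in> S"
  have "ev (dl (p * q) w) z = - (ev (dl w p) z * ev q z + ev p z * ev (dl w q) z)"
  by (simp add: dl_skew[OF z, of _ w] derivation_mult[OF derivation_dl])
  then show "ev (dl (p * q) w) z = ev (dl q (p * w) + dl p (q * w)) z"
  using dl_skew[OF z, of q p] dl_skew[OF z, of p w] dl_skew[OF z, of q w]
  by (simp add: derivation_mult[OF derivation_dl] algebra_simps)
  qed
  then show ?thesis by (simp add: NY_lin(1)[OF u])
  qed
  then show ?thesis
  unfolding e coord_simps(2) nM[OF u] sM[OF Nd] aM[OF NY_mult[OF Nd] NY_mult[OF Nd]] by simp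
  qed
  show "pbracket Z a b \<odot>\<^bsub>M\<^esub> x = nb a (b \<odot>\<^bsub>M\<^esub> x) \<ominus>\<^bsub>M\<^esub> b \<odot>\<^bsub>M\<^esub> nb a x"
  proof -
  have "u (dl q p * w) = u (q * dl p w) - u (dl p (q * w))" for w
  proof -
  have "u (dl q p * w) = u (q * dl p w - dl p (q * w))"
  by (rule NY_cong[OF y u]) (simp add: dl_skew[of _ q p] derivation_mult[OF derivation_dl])
  then show ?thesis by (simp add: NY_diff[OF u])
  qed
  then show ?thesis
  unfolding e pb sM[OF u] nM[OF Nm] nM[OF u] sM[OF Nd] mi[OF NY_der[OF Nm] NY_mult[OF Nd]] by simp
  qed
  show "nb (pbracket Z a b) x = nb a (nb b x) \<ominus>\<^bsub>M\<^esub> nb b (nb a x)"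
  proof -
  have "u (dl (dl q p) w) = u (dl q (dl p w)) - u (dl p (dl q w))" for w
  proof -
  have "u (dl (dl q p) w) = u (dl q (dl p w) - dl p (dl q w))"
  by (rule NY_cong[OF y u]) (simp add: dl_jacobi)
  then show ?thesis by (simp add: NY_diff[OF u])
  qed
  then show ?thesis
  unfolding e pb nM[OF u] nM[OF Nd] mi[OF NY_der[OF Nd] NY_der[OF Nd]] by simp
  qed
 next
  fix a x z assume "a \<in> carrier Z" "x \<in> carrier M" "z \<in> carrier M"
  then obtain p u v where e: "a = rs S p" "x = \<iota> u" "z = \<iota> v" and u: "u \<in> NY y" and v: "v \<in> NY y" by (auto simp: cM coord_simps)
  show "nb a (x \<oplus>\<^bsub>M\<^esub> z) = nb a x \<oplus>\<^bsub>M\<^esub> nb a z"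
  unfolding e aM[OF u v] nM[OF u] nM[OF v] nM[OF NY_add[OF u v]] aM[OF NY_der[OF u] NY_der[OF v]] ..
 next
  fix a x c assume "a \<in> carrier Z" "x \<in> carrier M"
  then obtain p u where e: "a = rs S p" "x = \<iota> u" and u: "u \<in> NY y" by (auto simp: cM coord_simps)
  show "nb a x \<in> carrier M" unfolding e nM[OF u] cM using NY_der[OF u] by blast
  show "nb a (scalar Z c \<odot>\<^bsub>M\<^esub> x) = scalar Z c \<odot>\<^bsub>M\<^esub> nb a x"
  unfolding e coord_simps(6) sM[OF u] nM[OF u] nM[OF NY_mult[OF u]] sM[OF NY_der[OF u]]
  by (simp add: derivation_mult[OF derivation_dl] dl_Cst)
  show "nb (scalar Z c \<otimes>\<^bsub>Z\<^esub> a) x = scalar Z c \<odot>\<^bsub>M\<^esub> nb a x"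
  proof -
  have "u (dl (Cst c * p) w) = u (dl p (Cst c * w))" for w
  proof (rule NY_cong[OF y u])
  fix z assume z: "z \<in> S"
  show "ev (dl (Cst c * p) w) z = ev (dl p (Cst c * w)) z"
  using dl_skew[OF z, of "Cst c * p" w] dl_skew[OF z, of p w] by (simp add: derivation_mult[OF derivation_dl] dl_Cst)
  qed
  then show ?thesis unfolding e coord_simps(2,6) nM[OF u] sM[OF NY_der[OF u]] by simp
  qed
 qed
 have "simple_poisson_module Z M nb"
 proof (rule simple_poisson_module.intro[OF pmod], rule simple_poisson_module_axioms.intro)
  have "(%w. ev w y) ~= (%w. 0)"
  proof
  assume "(%w. ev w y) = (%w. 0)"
  then have "ev 1 y = 0" by metis
  then show False by simp
  qed
  then have "\<iota> (%w. ev w y) ~= \<iota> (%w. 0)" using inj_on_eq_iff[OF \<iota> NY_pt NY_zero] by simp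
  then show "carrier M ~= {\<zero>\<^bsub>M\<^esub>}" using NY_pt[of y] unfolding cM zM by blast
  fix N assume sub: "submodule N Z M" and nb: "!!x m. x \<in> carrier Z ==> m \<in> N ==> nb x m \<in> N"
  have NM: "N \<subseteq> carrier M" "\<zero>\<^bsub>M\<^esub> \<in> N" "!!x z. x \<in> N ==> z \<in> N ==> x \<oplus>\<^bsub>M\<^esub> z \<in> N"
  using subgroup.subset[OF submodule.axioms(1)[OF sub]] subgroup.one_closed[OF submodule.axioms(1)[OF sub]]
  subgroup.m_closed[OF submodule.axioms(1)[OF sub]] by auto
  have Ns: "!!a x. a \<in> carrier Z ==> x \<in> N ==> a \<odot>\<^bsub>M\<^esub> x \<in> N" by (rule submodule.smult_closed[OF sub])
  define T where "T = {u \<in> NY y. \<iota> u \<in> N}"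
  show "N = {\<zero>\<^bsub>M\<^esub>} | N = carrier M"
  proof (cases "T \<subseteq> {%w. 0}")
  case True
  then have "N \<subseteq> {\<zero>\<^bsub>M\<^esub>}" using NM(1) by (auto simp: T_def cM zM)
  then show ?thesis using NM(2) by blast
  next
  case False
  then obtain u where u: "u \<in> T" "u ~= (%w. 0)" by blast
  have rc: "rs S p \<in> carrier Z" for p by (simp add: coord_simps)
  have "T = NY y"
  proof (rule NY_simple[OF _ _ _ _ u])
  show "T \<subseteq> NY y" by (auto simp: T_def)
  show "(%w. v (z * w)) \<in> T" if "v \<in> T" for v z
  using that Ns[OF rc, of "\<iota> v" z] by (simp add: T_def sM NY_mult)
  show "(%w. v (dl z w)) \<in> T" if "v \<in> T" for v z
  using that nb[OF rc, of "\<iota> v" z] by (simp add: T_def nM NY_der)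
  show "(%w. v w + v' w) \<in> T" if "v \<in> T" "v' \<in> T" for v v'
  using that NM(3)[of "\<iota> v" "\<iota> v'"] by (simp add: T_def aM NY_add)
  qed
  then have "carrier M \<subseteq> N" by (auto simp: T_def cM)
  then show ?thesis using NM(1) by blast
  qed
 qed
 moreover have "annihilator Z M = rs S ` J y"
 proof -
  have *: "(ALL m:carrier M. rs S p \<odot>\<^bsub>M\<^esub> m = \<zero>\<^bsub>M\<^esub>) \<longleftrightarrow> (ALL u:NY y. ALL w. u (p * w) = 0)" for p
  proof -
  have "rs S p \<odot>\<^bsub>M\<^esub> \<iota> u = \<zero>\<^bsub>M\<^esub> \<longleftrightarrow> (ALL w. u (p * w) = 0)" if "u \<in> NY y" for u
  unfolding sM[OF that] zM using inj_on_eq_iff[OF \<iota> NY_mult[OF that] NY_zero] by (auto simp: fun_eq_iff)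
  then show ?thesis by (auto simp: cM)
  qed
  have "(ALL u:NY y. ALL w. u (p * w) = 0) \<longleftrightarrow> p \<in> J y" for p
  proof
  assume p: "ALL u:NY y. ALL w. u (p * w) = 0"
  \<comment> \<open>The annihilating polynomials form a set stable under \<open>dl\<close> inside
    the maximal ideal of \<open>y\<close>, so the maximality of the core applies.\<close>
  have "{p. ALL u:NY y. ALL w. u (p * w) = 0} \<subseteq> core (range dl) (maxid y)"
  proof (rule core_greatest)
  show "{p. ALL u:NY y. ALL w. u (p * w) = 0} \<subseteq> maxid y"
  using NY_pt[of y] by (force dest: bspec spec[of _ 1])
  fix d a assume "d \<in> range dl" and a: "a \<in> {p. ALL u:NY y. ALL w. u (p * w) = 0}"
  then obtain x where d: "d = dl x" by blast
  have "u (dl x a * w) = 0" if u: "u \<in> NY y" for u w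
  proof -
  have A: "v (a * w) = 0" if "v \<in> NY y" for v w using a that by simp
  have "u (dl x (a * w)) = 0" by (rule A[OF NY_der[OF u]])
  moreover have "u (a * dl x w) = 0" by (rule A[OF u])
  ultimately show ?thesis by (simp add: derivation_mult[OF derivation_dl] NY_lin(1)[OF u])
  qed
  then show "d a \<in> {p. ALL u:NY y. ALL w. u (p * w) = 0}" by (simp add: d)
  qed
  then show "p \<in> J y" using p by (auto simp: J_core)
  next
  assume "p \<in> J y"
  then show "ALL u:NY y. ALL w. u (p * w) = 0" using NY_J ideal_in_mult2[OF J_ideal] by blast
  qed
  with * have **: "(ALL m:carrier M. rs S p \<odot>\<^bsub>M\<^esub> m = \<zero>\<^bsub>M\<^esub>) \<longleftrightarrow> p \<in> J y" for p by (rule trans)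
  have "annihilator Z M = rs S ` {p. ALL m:carrier M. rs S p \<odot>\<^bsub>M\<^esub> m = \<zero>\<^bsub>M\<^esub>}"
  unfolding annihilator_def coord_simps(1) by blast
  then show ?thesis by (simp only: ** Collect_mem_eq)
 qed
 ultimately show ?thesis by blast
qed

end

section \<open>Annihilators of simple Poisson modules\<close>

lemma dependent_vectors:
 fixes X :: "'i => nat => complex"
 assumes "finite I" "card I > n"
 shows "EX l. (EX i:I. l i ~= 0) & (\<forall>k<n. (\<Sum>i\<in>I. l i * X i k) = 0)"
 using assms
proof (induction n arbitrary: I X)
 case 0
 then have "I ~= {}" by auto
 then show ?case by (intro exI[of _ "%_. 1"]) auto
next
 case (Suc n)
 show ?case
 proof (cases "ALL i:I. X i n = 0")
  case True
  obtain l where l: "EX i:I. l i ~= 0" "\<forall>k<n. (\<Sum>i\<in>I. l i * X i k) = 0"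
  using Suc.IH[OF Suc.prems(1), of X] Suc.prems(2) by auto
  have "(\<Sum>i\<in>I. l i * X i n) = 0" using True by (intro sum.neutral) auto
  then show ?thesis using l less_Suc_eq by metis
 next
  case False
  then obtain j where j: "j \<in> I" "X j n ~= 0" by blast
  have "card (I - {j}) > n" using Suc.prems j by simp
  with Suc.IH[of "I - {j}" "%i k. X i k - X i n / X j n * X j k"] Suc.prems(1)
  obtain l where l: "EX i:I - {j}. l i ~= 0" "\<forall>k<n. (\<Sum>i\<in>I - {j}. l i * (X i k - X i n / X j n * X j k)) = 0" by auto
  define s where "s = (\<Sum>i\<in>I - {j}. l i * X i n) / X j n"
  define l' where "l' = l(j := - s)"
  have sum: "(\<Sum>i\<in>I. l' i * X i k) = (\<Sum>i\<in>I - {j}. l i * (X i k - X i n / X j n * X j k))" for k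
  proof -
  have "(\<Sum>i\<in>I. l' i * X i k) = l' j * X j k + (\<Sum>i\<in>I - {j}. l' i * X i k)"
  by (rule sum.remove[OF Suc.prems(1) j(1)])
  also have "(\<Sum>i\<in>I - {j}. l' i * X i k) = (\<Sum>i\<in>I - {j}. l i * X i k)" by (intro sum.cong) (auto simp: l'_def)
  also have "l' j * X j k = - (\<Sum>i\<in>I - {j}. l i * (X i n / X j n * X j k))"
  by (simp add: l'_def s_def sum_distrib_right sum_divide_distrib mult.assoc)
  finally show ?thesis by (simp add: right_diff_distrib sum_subtractf)
  qed
  have "(\<Sum>i\<in>I. l' i * X i n) = 0" unfolding sum using j(2) by simp
  then have "\<forall>k<Suc n. (\<Sum>i\<in>I. l' i * X i k) = 0" using l(2) sum less_Suc_eq by metis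
  moreover have "EX i:I. l' i ~= 0" using l(1) by (auto simp: l'_def)
  ultimately show ?thesis by blast
 qed
qed

locale simple_over = poisson_variety S hv br + M: simple_poisson_module "coord_algebra S br" M nabla
 for S :: "'n::finite cmat set" and hv and br and M :: "('n cmat => complex, 'm, 'c) module_scheme" and nabla
begin

definition "C = carrier M"
definition act :: "'n pol => 'm => 'm" where "act p x = smult M (rs S p) x"
definition nab :: "'n pol => 'm => 'm" where "nab p x = nabla (rs S p) x"
abbreviation plus (infixl "\<boxplus>" 65) where "x \<boxplus> y \<equiv> x \<oplus>\<^bsub>M\<^esub> y"
abbreviation zero ("\<zero>M") where "\<zero>M \<equiv> \<zero>\<^bsub>M\<^esub>"

lemma mod: "Module.module Z M" by (rule M.module_axioms)

lemma ab: "abelian_group M" by (rule module.axioms(2)[OF mod])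

lemma abm: "abelian_monoid M" by (rule abelian_group.axioms(1)[OF ab])

lemma rsZ: "rs S p \<in> carrier Z" by (simp add: coord_simps)

lemma grp: "x \<in> C ==> y \<in> C ==> x \<boxplus> y \<in> C" "\<zero>M \<in> C" "x \<in> C ==> x \<boxplus> \<zero>M = x" "x \<in> C ==> \<zero>M \<boxplus> x = x"
 "x \<in> C ==> y \<in> C ==> x \<boxplus> y = y \<boxplus> x"
 "x \<in> C ==> y \<in> C ==> z \<in> C ==> x \<boxplus> y \<boxplus> z = x \<boxplus> (y \<boxplus> z)"
 unfolding C_def
 by (auto simp: abelian_monoid.a_closed[OF abm] abelian_monoid.zero_closed[OF abm] abelian_monoid.l_zero[OF abm]
  abelian_monoid.r_zero[OF abm] abelian_monoid.a_assoc[OF abm] intro: abelian_monoid.a_comm[OF abm])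

lemma act_closed: "x \<in> C ==> act p x \<in> C"
 unfolding C_def act_def by (rule module.smult_closed[OF mod rsZ])

lemma act_add: "x \<in> C ==> act (p + q) x = act p x \<boxplus> act q x"
 using module.smult_l_distr[OF mod rsZ rsZ, of x p q] by (simp add: C_def act_def coord_simps)

lemma act_mult: "x \<in> C ==> act (p * q) x = act p (act q x)"
 using module.smult_assoc1[OF mod rsZ rsZ, of x p q] by (simp add: C_def act_def coord_simps)

lemma act_addr: "x \<in> C ==> y \<in> C ==> act p (x \<boxplus> y) = act p x \<boxplus> act p y"
 using module.smult_r_distr[OF mod rsZ, of x y p] by (simp add: C_def act_def)

lemma act_1: "x \<in> C ==> act 1 x = x"
 using module.smult_one[OF mod, of x] by (simp add: C_def act_def coord_simps)

lemma act_0: "x \<in> C ==> act 0 x = \<zero>M"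
 using module.smult_l_null[OF mod, of x] by (simp add: C_def act_def coord_simps)

lemma act_zero: "act p \<zero>M = \<zero>M"
 using module.smult_r_null[OF mod rsZ] by (simp add: act_def)

lemma act_cong: "(!!y. y \<in> S ==> ev p y = ev q y) ==> act p x = act q x"
 using rs_eq_iff[of S p q] by (simp add: act_def)

lemma act_commute: "x \<in> C ==> act p (act q x) = act q (act p x)"
 using act_mult[of x p q] act_mult[of x q p] by (simp add: mult.commute)

lemma neg: "x \<in> C ==> act (-1) x \<boxplus> x = \<zero>M" "x \<in> C ==> x \<boxplus> act (-1) x = \<zero>M"
 using act_add[of x "-1" 1] act_add[of x 1 "-1"] act_1[of x] act_0[of x] by simp_all

lemma a_inv: "x \<in> C ==> \<ominus>\<^bsub>M\<^esub> x = act (-1) x"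
 using abelian_group.minus_equality[OF ab neg(1)] act_closed unfolding C_def by blast

lemma diff_0: "x \<in> C ==> y \<in> C ==> x \<boxplus> act (-1) y = \<zero>M ==> x = y"
 by (metis act_closed grp(3,4,6) neg(1))

lemma nab_closed: "x \<in> C ==> nab p x \<in> C"
 unfolding C_def nab_def by (rule M.nabla_closed[OF rsZ])

lemma nab_addr: "x \<in> C ==> y \<in> C ==> nab p (x \<boxplus> y) = nab p x \<boxplus> nab p y"
 unfolding C_def nab_def by (rule M.nabla_add_right[OF rsZ])

lemma nab_scaler: "x \<in> C ==> nab p (act (Cst c) x) = act (Cst c) (nab p x)"
 using M.nabla_scalar_right[OF rsZ, of x p c] by (simp add: C_def act_def nab_def coord_simps)

lemma nab_add: "x \<in> C ==> nab (p + q) x = nab p x \<boxplus> nab q x"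
 using M.nabla_add_left[OF rsZ rsZ, of x p q] by (simp add: C_def nab_def coord_simps)

lemma nab_scale: "x \<in> C ==> nab (Cst c * p) x = act (Cst c) (nab p x)"
 using M.nabla_scalar_left[OF rsZ, of x c p] by (simp add: C_def act_def nab_def coord_simps)

lemma nab_mult: "x \<in> C ==> nab (p * q) x = act p (nab q x) \<boxplus> act q (nab p x)"
 using M.nabla_mult[OF rsZ rsZ, of x p q] by (simp add: C_def act_def nab_def coord_simps)

lemma nab_zero: "nab p \<zero>M = \<zero>M"
 using nab_scaler[OF grp(2), of p 0] act_0[OF nab_closed[OF grp(2)]] act_0[OF grp(2)] by (simp add: Cst_simps)

lemma weyl: assumes x: "x \<in> C" shows "act (dl a p) x \<boxplus> act a (nab p x) = nab p (act a x)"
proof -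
 have c: "act a (nab p x) \<in> C" "nab p (act a x) \<in> C" using x by (simp_all add: act_closed nab_closed)
 have e: "act (dl a p) x = nab p (act a x) \<boxplus> act (-1) (act a (nab p x))"
  using M.nabla_smult[OF rsZ rsZ, of x p a] x a_inv[OF act_closed[OF nab_closed[OF x]]]
  by (simp add: C_def act_def nab_def pb a_minus_def)
 show ?thesis unfolding e grp(6)[OF c(2) act_closed[OF c(1)] c(1)] neg(1)[OF c(1)] by (rule grp(3)[OF c(2)])
qed

lemma dl_act: "x \<in> C ==> act (dl a p) x = act (- dl p a) x"
 by (rule act_cong) (simp add: dl_skew[of _ a])

lemma sub_cases:
 assumes "N \<subseteq> C" "\<zero>M \<in> N" "!!x y. x \<in> N ==> y \<in> N ==> x \<boxplus> y \<in> N" "!!p x. x \<in> N ==> act p x \<in> N"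
  "!!p x. x \<in> N ==> nab p x \<in> N"
 shows "N = {\<zero>M} | N = C"
proof -
 have NC: "x \<in> N ==> x \<in> C" for x using assms(1) by blast
 have "submodule N Z M"
 proof (rule module.submoduleI[OF mod])
  show "N \<subseteq> carrier M" using assms(1) by (simp add: C_def)
  show "\<ominus>\<^bsub>M\<^esub> a \<in> N" if "a \<in> N" for a using a_inv[OF NC[OF that]] assms(4)[OF that] by simp
  show "a \<odot>\<^bsub>M\<^esub> x \<in> N" if "a \<in> carrier Z" "x \<in> N" for a x
  using that assms(4)[OF that(2)] by (auto simp: coord_simps act_def)
 qed (use assms(2,3) in auto)
 moreover have "nabla x n \<in> N" if "x \<in> carrier Z" "n \<in> N" for x n
  using that assms(5)[OF that(2)] by (auto simp: coord_simps nab_def)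
 ultimately show ?thesis using M.simple[of N] by (simp add: C_def)
qed

lemma C_nz: "EX x:C. x ~= \<zero>M" using M.nonzero grp(2) unfolding C_def by blast

section \<open>Elements acting locally nilpotently, and the annihilator\<close>

definition Tors where "Tors a = {x \<in> C. \<exists>k::nat. act (a ^ k) x = \<zero>M}"

lemma power_kill: "x \<in> C ==> act (a ^ k) x = \<zero>M ==> act (a ^ (l + k)) x = \<zero>M"
 by (simp add: power_add act_mult act_zero)

text \<open>Torsion is stable under \<nabla> because a derivative of \<open>a ^ Suc k\<close> still
  contains the factor \<open>a ^ k\<close>.\<close>

lemma Tors_cases: "Tors a = {\<zero>M} | Tors a = C"
proof (rule sub_cases)
 show "Tors a \<subseteq> C" by (auto simp: Tors_def)
 show "\<zero>M \<in> Tors a" using grp(2) act_zero by (auto simp: Tors_def)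
next
 fix x y assume "x \<in> Tors a" "y \<in> Tors a"
 then obtain k l where kl: "x \<in> C" "y \<in> C" "act (a ^ k) x = \<zero>M" "act (a ^ l) y = \<zero>M" by (auto simp: Tors_def)
 have "act (a ^ (l + k)) (x \<boxplus> y) = \<zero>M"
  using power_kill[OF kl(1,3), of l] power_kill[OF kl(2,4), of k] kl(1,2) by (simp add: act_addr grp add.commute)
 then show "x \<boxplus> y \<in> Tors a" using kl grp(1) by (auto simp: Tors_def)
next
 fix p x assume "x \<in> Tors a"
 then obtain k where k: "x \<in> C" "act (a ^ k) x = \<zero>M" by (auto simp: Tors_def)
 have "act (a ^ k) (act p x) = \<zero>M" using k act_commute[of x "a ^ k" p] by (simp add: act_zero)
 then show "act p x \<in> Tors a" using k act_closed by (auto simp: Tors_def)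
 have "dl p (a ^ Suc k) = (of_nat (Suc k) * dl p a) * a ^ k"
 proof -
  have "dl p (a ^ Suc j) = of_nat (Suc j) * dl p a * a ^ j" for j
  by (induction j) (simp_all add: derivation_mult[OF derivation_dl] algebra_simps)
  then show ?thesis .
 qed
 then have "act (dl (a ^ Suc k) p) x = act (- (of_nat (Suc k) * dl p a) * a ^ k) x" using dl_act[OF k(1)] by simp
 also have "\<dots> = \<zero>M" unfolding act_mult[OF k(1)] k(2) by (rule act_zero)
 finally have "act (dl (a ^ Suc k) p) x = \<zero>M" .
 moreover have "act (a ^ Suc k) x = \<zero>M" using power_kill[OF k, of 1] by simp
 ultimately have "act (a ^ Suc k) (nab p x) = \<zero>M"
  using weyl[OF k(1), of "a ^ Suc k" p] nab_zero grp(4)[OF act_closed[OF nab_closed[OF k(1)]]] by metis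
 then show "nab p x \<in> Tors a" using nab_closed[OF k(1)] unfolding Tors_def by blast
qed

text \<open>By \<open>Tors_cases\<close> an element acts either injectively or locally nilpotently;
  these are the latter.\<close>

definition Q where "Q = {a. Tors a = C}"

lemma Q_iff: "a \<in> Q \<longleftrightarrow> (ALL x:C. EX k. act (a ^ k) x = \<zero>M)" by (auto simp: Q_def Tors_def)

lemma Q_I: assumes "x \<in> C" "x ~= \<zero>M" "act a x = \<zero>M" shows "a \<in> Q"
proof -
 have "x \<in> Tors a" using assms by (auto simp: Tors_def intro!: exI[of _ 1])
 then show ?thesis using Tors_cases[of a] assms(2) by (auto simp: Q_def)
qed

lemma Q_kill: assumes a: "a \<in> Q" and x: "x \<in> C" "x ~= \<zero>M"
 shows "EX k. act (a ^ k) x ~= \<zero>M & act a (act (a ^ k) x) = \<zero>M"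
proof -
 have ex: "EX k. act (a ^ k) x = \<zero>M" using a x by (simp add: Q_iff)
 define n where "n = (LEAST k. act (a ^ k) x = \<zero>M)"
 have n: "act (a ^ n) x = \<zero>M" unfolding n_def by (rule LeastI_ex[OF ex])
 have "n ~= 0" using n x act_1 by (metis power_0)
 then obtain k where k: "n = Suc k" using not0_implies_Suc by blast
 have "act (a ^ k) x ~= \<zero>M" using not_less_Least[of k "%k. act (a ^ k) x = \<zero>M"] k n_def by simp
 moreover have "act a (act (a ^ k) x) = \<zero>M" using n x(1) by (simp add: k act_mult)
 ultimately show ?thesis by blast
qed

lemma Q_kill_all: "finite F ==> F \<subseteq> Q ==> EX x:C. x ~= \<zero>M & (ALL a:F. act a x = \<zero>M)"
proof (induction F rule: finite_induct)
 case empty then show ?case using C_nz by simp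
next
 case (insert a F)
 then obtain x where x: "x \<in> C" "x ~= \<zero>M" "ALL b:F. act b x = \<zero>M" by blast
 have "a \<in> Q" using insert.prems by simp
 then obtain k where k: "act (a ^ k) x ~= \<zero>M" "act a (act (a ^ k) x) = \<zero>M" using Q_kill[OF _ x(1,2)] by blast
 have "act b (act (a ^ k) x) = \<zero>M" if "b \<in> F" for b
  using act_commute[OF x(1), of b "a ^ k"] x(3) that by (simp add: act_zero)
 then show ?case using k act_closed[OF x(1)] by blast
qed

text \<open>Finitely many elements of \<open>Q\<close> have a common nonzero null vector, and a
  single nonzero null vector already puts an element into \<open>Q\<close>.\<close>

lemma Q_prime: "prime_in UNIV Q"
proof -
 have "0 \<in> Q" using C_nz Q_I act_0 by blast
 moreover have "a + b \<in> Q" if ab: "a \<in> Q" "b \<in> Q" for a b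
 proof -
  obtain x where x: "x \<in> C" "x ~= \<zero>M" "act a x = \<zero>M" "act b x = \<zero>M" using Q_kill_all[of "{a, b}"] ab by auto
  then have "act (a + b) x = \<zero>M" by (simp add: act_add grp)
  then show ?thesis using Q_I x by blast
 qed
 moreover have "r * a \<in> Q" if a: "a \<in> Q" for a r
 proof -
  obtain x where x: "x \<in> C" "x ~= \<zero>M" "act a x = \<zero>M" using Q_kill_all[of "{a}"] a by auto
  then have "act (r * a) x = \<zero>M" by (simp add: act_mult act_zero)
  then show ?thesis using Q_I x by blast
 qed
 moreover have "1 \<notin> Q"
 proof
  assume "1 \<in> Q"
  then obtain x where x: "x \<in> C" "x ~= \<zero>M" "act 1 x = \<zero>M" using Q_kill_all[of "{1}"] by auto
  then show False using act_1 by simp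
 qed
 moreover have "a \<in> Q | b \<in> Q" if ab: "a * b \<in> Q" for a b
 proof -
  obtain x where x: "x \<in> C" "x ~= \<zero>M" "act (a * b) x = \<zero>M" using Q_kill_all[of "{a * b}"] ab by auto
  then have "act a (act b x) = \<zero>M" by (simp add: act_mult)
  then show ?thesis using Q_I[OF x(1,2)] Q_I[OF act_closed[OF x(1)]] by blast
 qed
 ultimately show ?thesis by (auto simp: prime_in_def ideal_in_def)
qed

definition P where "P = {p. ALL x:C. act p x = \<zero>M}"

lemma P_act: "p \<in> P ==> x \<in> C ==> act p x = \<zero>M" by (simp add: P_def)

lemma P_eq: assumes "p - q \<in> P" "x \<in> C" shows "act p x = act q x"
 using act_add[OF assms(2), of "p - q" q] P_act[OF assms] grp(4)[OF act_closed[OF assms(2)]] by simp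

lemma P_stable: assumes "p \<in> P" shows "dl q p \<in> P"
proof -
 have "act (dl q p) x = \<zero>M" if x: "x \<in> C" for x
 proof -
  have "act (dl p q) x = \<zero>M"
  using weyl[OF x, of p q] P_act[OF assms x] P_act[OF assms nab_closed[OF x]] nab_zero grp(3)[OF act_closed[OF x]] by metis
  moreover have "act (dl q p) x = act (-1 * dl p q) x" using dl_act[OF x, of q p] by simp
  ultimately show ?thesis by (simp only: act_mult[OF x] act_zero)
 qed
 then show ?thesis by (simp add: P_def)
qed

lemma annihilated: assumes "!!p q. p \<in> K ==> dl q p \<in> K"
  shows "{x \<in> C. ALL p:K. act p x = \<zero>M} = {\<zero>M} | {x \<in> C. ALL p:K. act p x = \<zero>M} = C"
proof (rule sub_cases)
 fix q x assume x: "x \<in> {x \<in> C. ALL p:K. act p x = \<zero>M}"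
 then have xC: "x \<in> C" by blast
 show "act q x \<in> {x \<in> C. ALL p:K. act p x = \<zero>M}"
  using x act_commute[OF xC, of _ q] act_closed by (simp add: act_zero)
 have "act p (nab q x) = \<zero>M" if p: "p \<in> K" for p
 proof -
  have "act (dl p q) x = act (-1 * dl q p) x" using dl_act[OF xC, of p q] by simp
  also have "\<dots> = \<zero>M" using x assms[OF p, of q] by (simp only: act_mult[OF xC]) (simp add: act_zero)
  finally show ?thesis
  using weyl[OF xC, of p q] x p nab_zero[of q] grp(4)[OF act_closed[OF nab_closed[OF xC]], of p q] by auto
 qed
 then show "nab q x \<in> {x \<in> C. ALL p:K. act p x = \<zero>M}" using nab_closed[OF xC] by blast
qed (auto simp: act_zero grp act_addr)

text \<open>The core of \<open>Q\<close> is finitely generated, so some nonzero vector is killed by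
  all of it. The vectors killed by a stable ideal form a Poisson submodule, which is then the whole
  module. Thus the annihilator inherits primality from \<open>Q\<close>.\<close>

lemma P_core: "P = core (range dl) Q"
proof
 show "P \<subseteq> core (range dl) Q"
 proof (rule core_greatest)
  show "P \<subseteq> Q" using C_nz Q_I P_act by blast
 qed (use P_stable in auto)
 have K: "prime_in UNIV (core (range dl) Q)"
  by (intro prime_core Q_prime char0_prime) (auto intro: derivation_dl)
 obtain F where F: "finite F" "F \<subseteq> core (range dl) Q" "core (range dl) Q = gen UNIV F"
  using noetherianD[OF noetherian_pol prime_in_ideal[OF K]] by blast
 obtain x where x: "x \<in> C" "x ~= \<zero>M" "ALL a:F. act a x = \<zero>M"
  using Q_kill_all[OF F(1)] F(2) core_sub[of "range dl" Q] by blast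
 have "ideal_in UNIV {a. act a x = \<zero>M}"
  using x(1) by (auto simp: ideal_in_def act_0 act_add act_mult act_zero grp)
 then have "gen UNIV F \<subseteq> {a. act a x = \<zero>M}" using x(3) by (intro gen_sub) auto
 then have xK: "x \<in> {x \<in> C. ALL p:core (range dl) Q. act p x = \<zero>M}" using x(1) F(3) by blast
 have "{x \<in> C. ALL p:core (range dl) Q. act p x = \<zero>M} = {\<zero>M} | {x \<in> C. ALL p:core (range dl) Q. act p x = \<zero>M} = C"
  by (rule annihilated) (rule core_closed, auto)
 then have "{x \<in> C. ALL p:core (range dl) Q. act p x = \<zero>M} = C" using xK x(2) by blast
 then show "core (range dl) Q \<subseteq> P" unfolding P_def by blast
qed

lemma P_prime: "prime_in UNIV P"
 unfolding P_core by (intro prime_core Q_prime char0_prime) (auto intro: derivation_dl)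

lemma Pid: "ideal_in UNIV P" by (rule prime_in_ideal[OF P_prime])

lemmas PI = ideal_in_0[OF Pid] ideal_in_add[OF Pid] ideal_in_mult[OF Pid UNIV_I] ideal_in_diff[OF is_subring_UNIV Pid]
 ideal_in_uminus[OF is_subring_UNIV Pid]

subsection \<open>Constants of the fraction field act by endomorphisms\<close>

text \<open>The fraction a/b is a constant for the derivations of the fraction field modulo
  \<open>P\<close>.\<close>

definition const_pair where "const_pair a b \<longleftrightarrow> b \<notin> P & (ALL x. b * dl x a - a * dl x b \<in> P)"

text \<open>The graph of multiplication by a/b, tested on all pairs with w/z = a/b. These pairs are
  stable under derivations by \<open>pair_stable\<close>, which makes the relation stable under
  \<nabla>.\<close>

definition Gr where "Gr a b u v \<longleftrightarrow> u \<in> C & v \<in> C & (ALL z w. w * b - z * a \<in> P --> act z v = act w u)"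

lemma GrD: "Gr a b u v ==> w * b - z * a \<in> P ==> act z v = act w u" by (simp add: Gr_def)

lemma GrC: "Gr a b u v ==> u \<in> C" "Gr a b u v ==> v \<in> C" by (simp_all add: Gr_def)

lemma pair_stable: assumes ab: "const_pair a b" and zw: "w * b - z * a \<in> P"
 shows "dl x w * b - dl x z * a \<in> P"
proof -
 have "b * dl x (w * b - z * a) \<in> P" by (rule PI(3)[OF P_stable[OF zw]])
 moreover have "(w * b - z * a) * dl x b \<in> P" using PI(3)[OF zw, of "dl x b"] by (simp only: mult.commute)
 moreover have "z * (b * dl x a - a * dl x b) \<in> P" using ab PI(3) by (simp add: const_pair_def)
 ultimately have "b * dl x (w * b - z * a) - (w * b - z * a) * dl x b + z * (b * dl x a - a * dl x b) \<in> P"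
  using PI(2,4) by blast
 moreover have "b * dl x (w * b - z * a) - (w * b - z * a) * dl x b + z * (b * dl x a - a * dl x b) = b * (dl x w * b - dl x z * a)"
  by (simp add: derivation_diff[OF derivation_dl] derivation_mult[OF derivation_dl] algebra_simps)
 ultimately have "b * (dl x w * b - dl x z * a) \<in> P" by metis
 then show ?thesis using prime_inD[OF P_prime UNIV_I UNIV_I] ab by (auto simp: const_pair_def)
qed

lemma Gr_add: "Gr a b u v ==> Gr a b u' v' ==> Gr a b (u \<boxplus> u') (v \<boxplus> v')"
 by (simp add: Gr_def grp act_addr)

lemma Gr_act: assumes "Gr a b u v" shows "Gr a b (act p u) (act p v)"
 unfolding Gr_def
proof (intro conjI allI impI)
 fix z w assume zw: "w * b - z * a \<in> P"
 show "act z (act p v) = act w (act p u)"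
  using GrD[OF assms zw] act_commute[OF GrC(2)[OF assms], of z p] act_commute[OF GrC(1)[OF assms], of w p] by simp
qed (use GrC[OF assms] act_closed in auto)

lemma Gr_nab: assumes ab: "const_pair a b" and uv: "Gr a b u v" shows "Gr a b (nab x u) (nab x v)"
 unfolding Gr_def
proof (intro conjI allI impI)
 note uC = GrC(1)[OF uv] and vC = GrC(2)[OF uv]
 show "nab x u \<in> C" "nab x v \<in> C" using uC vC nab_closed by auto
 fix z w assume zw: "w * b - z * a \<in> P"
 have "act (dl x z) v = act (dl x w) u" by (rule GrD[OF uv pair_stable[OF ab zw]])
 then have "act (-1) (act (dl x z) v) = act (-1) (act (dl x w) u)" by simp
 then have e: "act (dl z x) v = act (dl w x) u"
  using dl_act[OF vC, of z x] dl_act[OF uC, of w x] by (simp flip: act_mult[OF vC] act_mult[OF uC])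
 have "act (dl z x) v \<boxplus> act z (nab x v) = act (dl w x) u \<boxplus> act w (nab x u)"
  unfolding weyl[OF uC] weyl[OF vC] GrD[OF uv zw] ..
 then have "act (-1) (act (dl w x) u) \<boxplus> (act (dl w x) u \<boxplus> act z (nab x v)) = act (-1) (act (dl w x) u) \<boxplus> (act (dl w x) u \<boxplus> act w (nab x u))"
  using e by simp
 then show "act z (nab x v) = act w (nab x u)"
  using uC vC by (simp add: act_closed nab_closed neg grp flip: grp(6))
qed

lemma Gr_0: "Gr a b \<zero>M \<zero>M" by (simp add: Gr_def grp act_zero)

lemma Gr_sym: assumes "Gr a b u v" shows "Gr b a v u"
 unfolding Gr_def
proof (intro conjI allI impI)
 fix z w assume "w * a - z * b \<in> P"
 from PI(5)[OF this] have "z * b - w * a \<in> P" by simp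
 from GrD[OF assms this] show "act z u = act w v" by simp
qed (use GrC[OF assms] in auto)

text \<open>The denominators of a/b form a set stable under derivations and containing
  \<open>b\<close>, which does not annihilate the module; so no nonzero vector is killed by all of
  them.\<close>

lemma Gr_unique0: assumes ab: "const_pair a b" and v: "Gr a b \<zero>M v" shows "v = \<zero>M"
proof -
 define K where "K = {z. EX w. w * b - z * a \<in> P}"
 have "dl q p \<in> K" if "p \<in> K" for p q using that pair_stable[OF ab] unfolding K_def by blast
 from annihilated[of K, OF this] have "{x \<in> C. ALL p:K. act p x = \<zero>M} = {\<zero>M} | {x \<in> C. ALL p:K. act p x = \<zero>M} = C" .
 moreover have "{x \<in> C. ALL p:K. act p x = \<zero>M} ~= C"
 proof
  assume e: "{x \<in> C. ALL p:K. act p x = \<zero>M} = C"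
  have "a * b - b * a \<in> P" using PI(1) by (simp add: mult.commute)
  then have "b \<in> K" unfolding K_def by blast
  then have "b \<in> P" using e unfolding P_def by blast
  then show False using ab by (simp add: const_pair_def)
 qed
 moreover have "v \<in> {x \<in> C. ALL p:K. act p x = \<zero>M}"
  using GrC(2)[OF v] GrD[OF v] unfolding K_def by (auto simp: act_zero)
 ultimately show ?thesis by blast
qed

lemma Gr_unique: assumes ab: "const_pair a b" and "Gr a b u v" "Gr a b u v'" shows "v = v'"
proof -
 have "Gr a b (u \<boxplus> act (-1) u) (v \<boxplus> act (-1) v')" by (rule Gr_add[OF assms(2) Gr_act[OF assms(3)]])
 then have "v \<boxplus> act (-1) v' = \<zero>M" using Gr_unique0[OF ab] neg(2)[OF GrC(1)[OF assms(2)]] by simp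
 then show ?thesis using diff_0 GrC(2) assms by blast
qed

lemma Gr_base: assumes u: "u \<in> C" shows "Gr a b (act b u) (act a u)"
 unfolding Gr_def
proof (intro conjI allI impI)
 fix z w assume "w * b - z * a \<in> P"
 from P_eq[OF this u] show "act z (act a u) = act w (act b u)" by (simp add: act_mult[OF u])
qed (use act_closed[OF u] in auto)

text \<open>The domain of the relation is a Poisson submodule that contains all vectors
  \<open>act b u\<close>, and these are not all zero.\<close>

lemma Gr_total: assumes ab: "const_pair a b" and u: "u \<in> C" shows "EX v. Gr a b u v"
proof -
 have "{u. EX v. Gr a b u v} = {\<zero>M} | {u. EX v. Gr a b u v} = C"
 proof (rule sub_cases)
  show "{u. EX v. Gr a b u v} \<subseteq> C" using GrC(1) by blast
  show "\<zero>M \<in> {u. EX v. Gr a b u v}" using Gr_0 by blast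
 qed (use Gr_add Gr_act Gr_nab[OF ab] in blast)+
 moreover have "EX u:C. act b u ~= \<zero>M" using ab unfolding const_pair_def P_def by blast
 ultimately show ?thesis using Gr_base u by blast
qed

subsection \<open>Countable dimension and Schur's lemma\<close>

primrec comb :: "(nat => 'm) => nat => (nat => complex) => 'm" where
 "comb g 0 x = \<zero>M"
| "comb g (Suc n) x = comb g n x \<boxplus> act (Cst (x n)) (g n)"

lemma comb_set_I: "comb g n x \<in> range (case_prod (comb g))"
 by (rule range_eqI[of _ _ "(n, x)"]) simp

context
 fixes g :: "nat => 'm" assumes g: "!!k. g k \<in> C"
begin

lemma comb_C: "comb g n x \<in> C" by (induction n) (auto simp: grp act_closed g)

lemma comb_add: "comb g n (%k. x k + y k) = comb g n x \<boxplus> comb g n y"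
proof (induction n)
 case (Suc n)
 have "(a \<boxplus> b) \<boxplus> (c \<boxplus> d) = (a \<boxplus> c) \<boxplus> (b \<boxplus> d)" if "a \<in> C" "b \<in> C" "c \<in> C" "d \<in> C" for a b c d
  using that by (metis grp(1,5,6))
 then show ?case using Suc by (simp add: Cst_simps act_add g comb_C act_closed)
qed (simp add: grp)

lemma comb_scale: "comb g n (%k. c * x k) = act (Cst c) (comb g n x)"
 by (induction n) (simp_all add: act_zero Cst_simps act_mult g comb_C act_closed act_addr)

lemma comb_cong: "(!!k. k < n ==> x k = y k) ==> comb g n x = comb g n y"
 by (induction n) auto

lemma comb_pad: "n \<le> N ==> comb g n x = comb g N (%k. if k < n then x k else 0)"
proof (induction N rule: dec_induct)
 case base show ?case by (rule comb_cong) simp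
next
 case (step N)
 then show ?case by (simp add: Cst_simps act_0 g grp comb_C)
qed

lemma comb_set_add: "u \<in> range (case_prod (comb g)) ==> v \<in> range (case_prod (comb g)) ==> u \<boxplus> v \<in> range (case_prod (comb g))"
proof -
 assume "u \<in> range (case_prod (comb g))" "v \<in> range (case_prod (comb g))"
 then obtain n x l y where u: "u = comb g n x" and v: "v = comb g l y" by auto
 have "u \<boxplus> v = comb g (max n l) (%k. (if k < n then x k else 0) + (if k < l then y k else 0))"
  unfolding u v comb_add using comb_pad[of n "max n l" x] comb_pad[of l "max n l" y] by simp
 then show ?thesis by (simp only: comb_set_I)
qed

lemma comb_set_map:
 assumes "!!k. F (g k) \<in> range (case_prod (comb g))" "F \<zero>M = \<zero>M" "!!u v. u \<in> C ==> v \<in> C ==> F (u \<boxplus> v) = F u \<boxplus> F v"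
  "!!c u. u \<in> C ==> F (act (Cst c) u) = act (Cst c) (F u)"
 shows "u \<in> range (case_prod (comb g)) ==> F u \<in> range (case_prod (comb g))"
proof -
 have scale: "act (Cst c) u \<in> range (case_prod (comb g))" if u: "u \<in> range (case_prod (comb g))" for c u
 proof -
  obtain n x where "u = comb g n x" using u by auto
  then have "act (Cst c) u = case_prod (comb g) (n, %k. c * x k)" by (simp add: comb_scale)
  then show ?thesis by (metis rangeI)
 qed
 have z: "\<zero>M \<in> range (case_prod (comb g))"
 proof -
  have "\<zero>M = case_prod (comb g) (0, %_. 0)" by simp
  then show ?thesis by (metis rangeI)
 qed
 assume "u \<in> range (case_prod (comb g))"
 then obtain n x where u: "u = comb g n x" by auto
 have "F (comb g n x) \<in> range (case_prod (comb g))"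
 proof (induction n)
  case (Suc n)
  then show ?case by (simp add: assms(3,4) comb_C act_closed g comb_set_add scale assms(1))
 qed (simp add: assms(2) z)
 then show ?thesis by (simp add: u)
qed

end

text \<open>By the Leibniz rules, the words in the finitely many operators
  \<open>act (Var i j)\<close> and \<open>nab (Var i j)\<close>, applied to one nonzero vector, span
  a Poisson submodule.\<close>

lemma countable_dimension: "EX g. (ALL k. g k \<in> C) & (ALL x:C. EX n y. x = comb g n y)"
proof -
 obtain m0 where m0: "m0 \<in> C" "m0 ~= \<zero>M" using C_nz by blast
 define opr :: "bool \<times> 'n \<times> 'n => 'm => 'm" where
  "opr = (%(b, i, j). if b then act (Var i j) else nab (Var i j))"
 define W where "W ws = foldr opr ws m0" for ws
 define g where "g k = W (from_nat k)" for k
 have WC: "W ws \<in> C" for ws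
  by (induction ws) (auto simp: W_def opr_def m0 act_closed nab_closed)
 then have g: "g k \<in> C" for k by (simp add: g_def)
 define N where "N = range (case_prod (comb g))"
 have W: "W ws \<in> N" for ws
 proof -
  define k where "k = to_nat ws"
  have "comb g k (%i. if i = k then 1 else 0) = comb g k (%i. 0 * 0)" by (rule comb_cong[OF g]) simp
  also have "\<dots> = \<zero>M" unfolding comb_scale[OF g] by (simp add: Cst_simps act_0 comb_C[OF g])
  finally have "comb g (Suc k) (%i. if i = k then 1 else 0) = W ws"
  by (simp add: Cst_simps act_1 g grp) (simp add: g_def k_def)
  then have "W ws = case_prod (comb g) (Suc k, %i. if i = k then 1 else 0)" by simp
  then show ?thesis unfolding N_def by (metis rangeI)
 qed
 have NC: "N \<subseteq> C" using comb_C[OF g] by (auto simp: N_def)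
 have Nadd: "u \<boxplus> v \<in> N" if "u \<in> N" "v \<in> N" for u v using that unfolding N_def by (rule comb_set_add[OF g])
 have vara: "act (Var i j) u \<in> N" if "u \<in> N" for u i j
  unfolding N_def
 proof (rule comb_set_map[OF g, where F = "act (Var i j)"])
  show "act (Var i j) (g k) \<in> range (case_prod (comb g))" for k
  using W[of "(True, i, j) # from_nat k"] by (simp add: W_def opr_def g_def N_def)
 qed (use that act_zero act_addr act_commute in \<open>auto simp: N_def\<close>)
 have varn: "nab (Var i j) u \<in> N" if "u \<in> N" for u i j
  unfolding N_def
 proof (rule comb_set_map[OF g, where F = "nab (Var i j)"])
  show "nab (Var i j) (g k) \<in> range (case_prod (comb g))" for k
  using W[of "(False, i, j) # from_nat k"] by (simp add: W_def opr_def g_def N_def)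
 qed (use that nab_zero nab_addr nab_scaler in \<open>auto simp: N_def\<close>)
 have Cst: "act (Cst c) u \<in> N" if "u \<in> N" for u c
 proof -
  obtain n x where "u = comb g n x" using \<open>u \<in> N\<close> by (auto simp: N_def)
  then have "act (Cst c) u = case_prod (comb g) (n, %k. c * x k)" by (simp add: comb_scale[OF g])
  then show ?thesis unfolding N_def by (metis rangeI)
 qed
 have Nact: "u \<in> N ==> act p u \<in> N" for p u
 proof (induction p arbitrary: u rule: pol_induct)
  case (add p q)
  have "u \<in> C" using NC add.prems by blast
  then show ?case using Nadd[OF add.IH(1)[OF add.prems] add.IH(2)[OF add.prems]] by (simp only: act_add)
 next
  case (mult p q)
  have "u \<in> C" using NC mult.prems by blast
  then show ?case using mult.IH(1)[OF mult.IH(2)[OF mult.prems]] by (simp only: act_mult)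
 qed (auto intro: vara Cst)
 have N0: "\<zero>M \<in> N"
 proof -
  have "\<zero>M = act (Cst 0) (W [])" by (simp add: Cst_simps act_0 WC)
  then show ?thesis using Cst[OF W] by metis
 qed
 have n1: "nab 1 u = \<zero>M" if u: "u \<in> C" for u
 proof -
  have "nab 1 u = nab 1 u \<boxplus> nab 1 u" using nab_mult[OF u, of 1 1] by (simp add: act_1 nab_closed u)
  then have "act (-1) (nab 1 u) \<boxplus> nab 1 u = act (-1) (nab 1 u) \<boxplus> nab 1 u \<boxplus> nab 1 u"
  using grp(6) act_closed nab_closed u by metis
  then show ?thesis by (simp add: neg nab_closed u grp)
 qed
 have Nnab: "u \<in> N ==> nab p u \<in> N" for p u
 proof (induction p arbitrary: u rule: pol_induct)
  case (Cst c)
  then have "u \<in> C" using NC by blast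
  then have "nab (Cst c) u = \<zero>M" using nab_scale[of u c 1] n1 by (simp add: act_zero)
  then show ?case using N0 by simp
 next
  case (add p q)
  have "u \<in> C" using NC add.prems by blast
  then show ?case using Nadd[OF add.IH(1)[OF add.prems] add.IH(2)[OF add.prems]] by (simp only: nab_add)
 next
  case (mult p q)
  have "u \<in> C" using NC mult.prems by blast
  then show ?case using Nadd[OF Nact[OF mult.IH(2)[OF mult.prems], of p] Nact[OF mult.IH(1)[OF mult.prems], of q]]
  by (simp only: nab_mult)
 qed (auto intro: varn)
 have "N = {\<zero>M} | N = C" by (rule sub_cases[OF NC N0 Nadd Nact Nnab])
 moreover have "m0 \<in> N" using W[of "[]"] by (simp add: W_def)
 ultimately have "N = C" using m0(2) by blast
 have "ALL x:C. EX n y. x = comb g n y"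
 proof
  fix x assume "x \<in> C"
  then have "x \<in> range (case_prod (comb g))" using \<open>N = C\<close> by (simp only: N_def)
  then obtain z where "x = case_prod (comb g) z" by (rule rangeE)
  then show "EX n y. x = comb g n y" by (cases z) auto
 qed
 then show ?thesis using g by blast
qed

text \<open>Multiplication by a/b is an endomorphism \<theta>. If a/b is no complex number, every
  \<theta> - c is bijective, so nonzero polynomials in \<theta> act injectively, and the uncountably
  many vectors (\<theta> - r)^(-1) m0 would be linearly independent in countable dimension.\<close>

lemma constants:
 assumes b: "b \<notin> P" and ab: "!!x. b * dl x a - a * dl x b \<in> P"
 shows "EX c. a - Cst c * b \<in> P"
proof (rule ccontr)
 assume no: "\<nexists>c. a - Cst c * b \<in> P"
 define a' where "a' c = a - Cst c * b" for c
 have a'P: "a' c \<notin> P" for c using no by (auto simp: a'_def)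
 have cp: "const_pair (a' c) b" and pc: "const_pair b (a' c)" for c
 proof -
  have e: "b * dl x (a' c) - a' c * dl x b = b * dl x a - a * dl x b" for x
  by (simp add: a'_def derivation_diff[OF derivation_dl] derivation_mult[OF derivation_dl] dl_Cst algebra_simps)
  then show "const_pair (a' c) b" using b ab by (simp add: const_pair_def)
  have "a' c * dl x b - b * dl x (a' c) \<in> P" for x using PI(5)[OF ab[of x]] e[of x] by (metis minus_diff_eq)
  then show "const_pair b (a' c)" using a'P by (simp add: const_pair_def)
 qed
 have cab: "const_pair a b" using b ab by (simp add: const_pair_def)
 define \<theta> where "\<theta> u = (SOME v. Gr a b u v)" for u
 have \<theta>: "Gr a b u (\<theta> u)" if "u \<in> C" for u
  unfolding \<theta>_def by (rule someI_ex[OF Gr_total[OF cab that]])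
 have \<theta>C: "\<theta> u \<in> C" if "u \<in> C" for u using GrC(2)[OF \<theta>[OF that]] .
 have \<theta>add: "\<theta> (u \<boxplus> v) = \<theta> u \<boxplus> \<theta> v" if "u \<in> C" "v \<in> C" for u v
  using Gr_unique[OF cab \<theta>[OF grp(1)[OF that]] Gr_add[OF \<theta>[OF that(1)] \<theta>[OF that(2)]]] .
 have \<theta>act: "\<theta> (act p u) = act p (\<theta> u)" if "u \<in> C" for u p
  using Gr_unique[OF cab \<theta>[OF act_closed[OF that]] Gr_act[OF \<theta>[OF that]]] .
 have \<theta>0: "\<theta> \<zero>M = \<zero>M" using Gr_unique[OF cab \<theta>[OF grp(2)] Gr_0] .
 define T where "T c u = \<theta> u \<boxplus> act (Cst (- c)) u" for c u
 have TC: "T c u \<in> C" if "u \<in> C" for c u using that by (simp add: T_def grp \<theta>C act_closed)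
 have TG: "Gr (a' c) b u (T c u)" if u: "u \<in> C" for c u
  unfolding Gr_def
 proof (intro conjI allI impI)
  fix z w assume "w * b - z * a' c \<in> P"
  then have "(w + z * Cst c) * b - z * a \<in> P" by (simp add: a'_def algebra_simps)
  from GrD[OF \<theta>[OF u] this] have "act z (\<theta> u) = act (w + z * Cst c) u" .
  then have "act z (T c u) = act (w + z * Cst c) u \<boxplus> act (z * Cst (- c)) u"
  by (simp add: T_def act_addr \<theta>C u act_closed act_mult)
  also have "\<dots> = act w u" by (simp add: Cst_simps flip: act_add[OF u])
  finally show "act z (T c u) = act w u" .
 qed (use u TC in auto)
 have Tinj: "u = \<zero>M" if u: "u \<in> C" "T c u = \<zero>M" for c u
  using Gr_unique0[OF pc[of c]] Gr_sym[OF TG[OF u(1), of c]] u(2) by simp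
 have Tsurj: "EX u:C. T c u = v" if v: "v \<in> C" for c v
 proof -
  obtain u where u: "Gr b (a' c) v u" using Gr_total[OF pc v] by blast
  have uC: "u \<in> C" by (rule GrC(2)[OF u])
  show ?thesis using Gr_unique[OF cp TG[OF uC] Gr_sym[OF u]] uC by blast
 qed
 \<comment> \<open>\<open>\<rho> u p\<close> is p(\<theta>) u, evaluated by Horner's scheme.\<close>
 define \<rho> where "\<rho> u p = fold_coeffs (%a x. act (Cst a) u \<boxplus> \<theta> x) p \<zero>M" for u p
 have \<rho>0: "\<rho> u 0 = \<zero>M" for u by (simp add: \<rho>_def)
 have \<rho>s: "\<rho> u (pCons c p) = act (Cst c) u \<boxplus> \<theta> (\<rho> u p)" if u: "u \<in> C" for u c p
 proof (cases "c = 0 & p = 0")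
  case True then show ?thesis using u by (simp add: \<rho>_def \<theta>0 Cst_simps act_0 grp)
 next
  case False
  then show ?thesis by (cases "c = 0") (simp_all add: \<rho>_def)
 qed
 have \<rho>C: "\<rho> u p \<in> C" if u: "u \<in> C" for u p
  by (induction p) (auto simp: \<rho>0 \<rho>s[OF u] grp act_closed \<theta>C u)
 have \<rho>add: "\<rho> u (p + q) = \<rho> u p \<boxplus> \<rho> u q" if u: "u \<in> C" for u p q
 proof (induction p q rule: poly_induct2)
  case (pCons c p d q)
  have "(w \<boxplus> x) \<boxplus> (y \<boxplus> z) = (w \<boxplus> y) \<boxplus> (x \<boxplus> z)" if "w \<in> C" "x \<in> C" "y \<in> C" "z \<in> C" for w x y z
  using that by (metis grp(1,5,6))
  then show ?case using pCons u by (simp add: \<rho>s Cst_simps act_add \<theta>add \<rho>C act_closed \<theta>C)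
 qed (simp add: \<rho>0 grp)
 have \<rho>scale: "\<rho> u (Polynomial.smult c p) = act (Cst c) (\<rho> u p)" if u: "u \<in> C" for u c p
  by (induction p) (simp_all add: \<rho>0 act_zero \<rho>s u Cst_simps act_mult act_addr act_closed \<theta>C \<rho>C \<theta>act)
 have \<rho>lin: "\<rho> u ([:- c, 1:] * p) = T c (\<rho> u p)" if u: "u \<in> C" for u c p
 proof -
  have "[:- c, 1:] * p = pCons 0 p + Polynomial.smult (- c) p" by (simp add: mult_pCons_left)
  then show ?thesis using u by (simp only: \<rho>add \<rho>s \<rho>scale) (simp add: T_def Cst_simps act_0 grp \<theta>C \<rho>C)
 qed
 have \<rho>nz: "p ~= 0 ==> \<rho> u p ~= \<zero>M" if u: "u \<in> C" "u ~= \<zero>M" for u p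
 proof (induction "degree p" arbitrary: p rule: less_induct)
  case less
  show ?case
  proof (cases "degree p = 0")
  case True
  then obtain c where p: "p = [:c:]" by (metis degree_eq_zeroE)
  have c: "c ~= 0" using less.prems p by simp
  have e: "\<rho> u p = act (Cst c) u" using u by (simp add: p \<rho>s \<rho>0 \<theta>0 grp act_closed)
  have "act (Cst (1 / c)) (act (Cst c) u) = u"
  using c u by (simp add: act_1 Cst_simps(4) flip: act_mult Cst_simps(2))
  then show ?thesis using u(2) e act_zero by metis
  next
  case False
  then have "~ constant (poly p)" by (simp add: constant_degree)
  then obtain c where "poly p c = 0" using fundamental_theorem_of_algebra by blast
  then obtain q where q: "p = [:- c, 1:] * q" by (metis poly_eq_0_iff_dvd dvdE)
  then have "q ~= 0" using less.prems by auto
  moreover from this have "degree q < degree p" unfolding q by (subst degree_mult_eq) auto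
  ultimately have "\<rho> u q ~= \<zero>M" using less.hyps by blast
  then show ?thesis unfolding q \<rho>lin[OF u(1)] using Tinj \<rho>C[OF u(1)] by blast
  qed
 qed
 obtain g where g: "!!k. g k \<in> C" "!!x. x \<in> C ==> EX n y. x = comb g n y" using countable_dimension by blast
 obtain m0 where m0: "m0 \<in> C" "m0 ~= \<zero>M" using C_nz by blast
 \<comment> \<open>The vectors (\<theta> - r)^(-1) m0 for real \<open>r\<close>. Some
   \<open>comb g n\<close> captures infinitely many of them, and \<open>Suc n\<close> of these
   satisfy a linear relation.\<close>
 have "\<forall>r::real. EX v:C. T (of_real r) v = m0" using Tsurj[OF m0(1)] by blast
 then obtain v where v: "!!r::real. v r \<in> C" "!!r. T (of_real r) (v r) = m0" by metis
 have "EX n. infinite {r. EX y. v r = comb g n y}"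
 proof (rule ccontr)
  assume "~ (EX n. infinite {r. EX y. v r = comb g n y})"
  then have fin: "finite {r. EX y. v r = comb g n y}" for n by blast
  have "countable (\<Union>n. {r. EX y. v r = comb g n y})" by (intro countable_UN countableI_type countable_finite fin)
  moreover have "(\<Union>n. {r. EX y. v r = comb g n y}) = UNIV" using g(2) v(1) by fastforce
  ultimately show False using uncountable_UNIV_real by simp
 qed
 then obtain n where "infinite {r. EX y. v r = comb g n y}" by blast
 then obtain I where I: "I \<subseteq> {r. EX y. v r = comb g n y}" "finite I" "card I = Suc n"
  using infinite_arbitrarily_large by blast
 have "ALL r:I. EX y. v r = comb g n y" using I(1) by blast
 then obtain X where X: "!!r. r \<in> I ==> v r = comb g n (X r)" by metis
 obtain l where l: "EX r:I. l r ~= 0" "\<forall>k<n. (\<Sum>r\<in>I. l r * X r k) = 0"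
  using dependent_vectors[OF I(2), of n X] I(3) by auto
 \<comment> \<open>Common denominators: \<open>u\<close> below is m0 divided by the whole product,
   so omitting the factor of \<open>r\<close> returns \<open>v r\<close>, and the linear relation
   becomes p(\<theta>) u = 0.\<close>
 define pr where "pr A = (\<Prod>r\<in>A. [:- of_real r, 1:] :: complex poly)" for A :: "real set"
 have surj: "finite A ==> x \<in> C ==> EX u:C. \<rho> u (pr A) = x" for A x
 proof (induction A arbitrary: x rule: finite_induct)
  case empty
  have "\<rho> x (pr {}) = x" using empty by (simp add: pr_def one_pCons \<rho>s \<rho>0 \<theta>0 Cst_simps act_1 grp)
  then show ?case using empty by blast
 next
  case (insert r A)
  obtain x' where x': "x' \<in> C" "T (of_real r) x' = x" using Tsurj[OF insert.prems] by blast
  obtain u where u: "u \<in> C" "\<rho> u (pr A) = x'" using insert.IH[OF x'(1)] by blast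
  have "pr (insert r A) = [:- of_real r, 1:] * pr A" unfolding pr_def by (rule prod.insert[OF insert.hyps])
  then show ?case using \<rho>lin[OF u(1)] u x' by (intro bexI[of _ u]) simp_all
 qed
 obtain u where u: "u \<in> C" "\<rho> u (pr I) = m0" using surj[OF I(2) m0(1)] by blast
 have unz: "u ~= \<zero>M"
 proof
  assume u0: "u = \<zero>M"
  have "\<rho> \<zero>M p = \<zero>M" for p by (induction p) (simp_all add: \<rho>0 \<rho>s grp act_zero \<theta>0)
  then show False using u u0 m0(2) by simp
 qed
 have pc: "\<rho> u (pr (I - {r})) = v r" if r: "r \<in> I" for r
 proof -
  let ?x = "\<rho> u (pr (I - {r}))"
  have xC: "?x \<in> C" by (rule \<rho>C[OF u(1)])
  have "pr I = [:- of_real r, 1:] * pr (I - {r})" unfolding pr_def by (rule prod.remove[OF I(2) r])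
  then have "T (of_real r) ?x = m0" using \<rho>lin[OF u(1)] u(2) by metis
  then have e: "T (of_real r) ?x = T (of_real r) (v r)" using v(2) by simp
  note G1 = Gr_sym[OF TG[OF xC, of "of_real r"]] and G2 = Gr_sym[OF TG[OF v(1)[of r], of "of_real r"]]
  show ?thesis by (rule Gr_unique[OF pc G1]) (use G2 e in simp)
 qed
 define p where "p = (\<Sum>r\<in>I. Polynomial.smult (l r) (pr (I - {r})))"
 have "finite A ==> A \<subseteq> I ==> \<rho> u (\<Sum>r\<in>A. Polynomial.smult (l r) (pr (I - {r}))) = comb g n (%k. \<Sum>r\<in>A. l r * X r k)" for A
 proof (induction A rule: finite_induct)
  case empty
  have "comb g n (%k. 0 * 0) = \<zero>M" unfolding comb_scale[OF g(1)] by (simp add: Cst_simps act_0 comb_C[OF g(1)])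
  then show ?case by (simp add: \<rho>0)
 next
  case (insert r A)
  then have "\<rho> u (Polynomial.smult (l r) (pr (I - {r}))) = comb g n (%k. l r * X r k)"
  using X by (simp add: \<rho>scale[OF u(1)] pc comb_scale[OF g(1)])
  then show ?case using insert by (simp add: \<rho>add[OF u(1)] comb_add[OF g(1)])
 qed
 from this[OF I(2) subset_refl] have "\<rho> u p = comb g n (%k. \<Sum>r\<in>I. l r * X r k)" by (simp add: p_def)
 also have "\<dots> = comb g n (%k. 0 * 0)" by (rule comb_cong[OF g(1)]) (use l(2) in simp)
 also have "\<dots> = \<zero>M" unfolding comb_scale[OF g(1)] by (simp add: Cst_simps act_0 comb_C[OF g(1)])
 finally have p0: "p = 0" using \<rho>nz[OF u(1) unz] by blast
 obtain r where r: "r \<in> I" "l r ~= 0" using l(1) by blast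
 \<comment> \<open>At a point of \<open>I\<close> a single summand of \<open>p\<close> survives, as
   in Lagrange interpolation.\<close>
 have pev: "poly (pr (I - {s})) (of_real r) = (if s = r then (\<Prod>t\<in>I - {r}. of_real r - of_real t) else 0)" if "s \<in> I" for s
  using r(1) I(2) by (auto simp: pr_def poly_prod intro!: prod_zero)
 have "poly p (of_real r) = (\<Sum>s\<in>I. if s = r then l r * (\<Prod>t\<in>I - {r}. of_real r - of_real t) else 0)"
  unfolding p_def poly_sum by (intro sum.cong refl) (auto simp: pev)
 also have "\<dots> = l r * (\<Prod>t\<in>I - {r}. of_real r - of_real t)" using r I(2) by simp
 finally have "l r * (\<Prod>t\<in>I - {r}. of_real r - of_real t) = 0" using p0 by simp
 then show False using r(2) I(2) by (auto simp: prod_zero_iff)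
qed

text \<open>By \<open>constants\<close> the annihilator satisfies the assumptions of
  \<open>rational_point\<close>. The point found lies in \<open>S\<close>, because polynomials
  vanishing on \<open>S\<close> act by zero.\<close>

theorem annihilator_germ: "EX y:S. annihilator Z M = rs S ` J y"
proof -
 interpret stable_prime "range dl" P
 proof (rule stable_prime.intro)
  show "EX c. a - Cst c * b \<in> P" if "b \<notin> P" "!!\<delta>. \<delta> \<in> range dl ==> b * \<delta> a - a * \<delta> b \<in> P" for a b
  by (rule constants[OF that(1)]) (rule that(2), simp)
 qed (auto intro: derivation_dl P_prime P_stable)
 have "EX y. (ALL p:P. ev p y = 0) & core (range dl) (maxid y) = P"
  by (rule rational_point) (auto simp: dl_Cst)
 then obtain y where y: "ALL p:P. ev p y = 0" "core (range dl) (maxid y) = P" by blast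
 have "y \<in> S"
 proof (rule ccontr)
  assume "y \<notin> S"
  then obtain p where p: "ALL z:S. ev p z = 0" "ev p y ~= 0" using closed by blast
  have "act p x = act 0 x" for x by (rule act_cong) (simp add: p)
  then have "p \<in> P" by (simp add: P_def act_0)
  then show False using y(1) p(2) by blast
 qed
 moreover have "annihilator Z M = rs S ` P"
  by (auto simp: annihilator_def coord_simps(1) P_def act_def C_def)
 ultimately show ?thesis using y(2) unfolding J_core by (intro bexI[of _ y]) simp_all
qed

end

section \<open>The Poisson algebra of the slice\<close>

context slice_data
begin

lemma gradient_rs: assumes \<xi>: "\<xi> \<in> \<gg>" shows "gradient \<gg> \<kappa> (rs \<gg> p) \<xi> = grad p \<xi>"
proof -
 have D: "((%t. rs \<gg> p (\<xi> + t *\<^sub>C y)) has_field_derivative d) (at 0) \<longleftrightarrow> d = dirD p \<xi> y" if y: "y \<in> \<gg>" for y d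
 proof -
  have "\<xi> + t *\<^sub>C y \<in> \<gg>" for t
  by (intro cmat.subspace_add[OF Lie_subspace \<xi>] cmat.subspace_scale[OF Lie_subspace y])
  then have e: "(%t. rs \<gg> p (\<xi> + t *\<^sub>C y)) = (%t. ev p (\<xi> + t *\<^sub>C y))" by (intro ext) simp
  show ?thesis unfolding e using dirD_has dirD_eqI by metis
 qed
 show ?thesis
  unfolding gradient_def
 proof (rule the_equality)
  show "grad p \<xi> \<in> \<gg> & (ALL y:\<gg>. ((%t. rs \<gg> p (\<xi> + t *\<^sub>C y)) has_field_derivative \<kappa> (grad p \<xi>) y) (at 0))"
  using D grad_g grad_kap kap(3)[OF grad_g] by simp
 next
  fix v assume v: "v \<in> \<gg> & (ALL y:\<gg>. ((%t. rs \<gg> p (\<xi> + t *\<^sub>C y)) has_field_derivative \<kappa> v y) (at 0))"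
  show "v = grad p \<xi>"
  proof (rule grad_unique)
  show "v \<in> \<gg>" using v by blast
  fix y assume y: "y \<in> \<gg>"
  then have "\<kappa> v y = dirD p \<xi> y" using v D[OF y] by blast
  then show "kap v y = dirD p \<xi> y" using kap(3) v y by simp
  qed
 qed
qed

abbreviation "lpa \<equiv> lie_poisson_algebra \<gg> \<kappa>"

lemma lpa: "EX br. lpa = coord_algebra \<gg> br" by (auto simp: lie_poisson_algebra_def)

lemma lpa_simps: "carrier lpa = range (rs \<gg>)" "mult lpa (rs \<gg> p) (rs \<gg> q) = rs \<gg> (p * q)"
 "zero lpa = rs \<gg> 0" "add lpa (rs \<gg> p) (rs \<gg> q) = rs \<gg> (p + q)" "a_inv lpa (rs \<gg> p) = rs \<gg> (- p)"
 "cring lpa"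
 by (simp_all add: lie_poisson_algebra_def coord_simps coord_uminus coord_cring)

lemma lpa_bracket: "pbracket lpa (rs \<gg> p) (rs \<gg> q) = rs \<gg> (PB p q)"
 unfolding lie_poisson_algebra_def coord_simps(7) rs_def[of _ "PB p q"]
proof (rule restrict_ext)
 fix \<xi> assume \<xi>: "\<xi> \<in> \<gg>"
 show "\<kappa> \<xi> (lie_bracket (gradient \<gg> \<kappa> (rs \<gg> p) \<xi>) (gradient \<gg> \<kappa> (rs \<gg> q) \<xi>)) = ev (PB p q) \<xi>"
  using kap(3)[OF \<xi> Lie_bracket[OF grad_g grad_g]] by (simp add: gradient_rs \<xi> ev_PB)
qed

lemma linear_fun_lin: "x \<in> \<gg> ==> linear_fun \<gg> \<kappa> x = rs \<gg> (lin x)"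
 unfolding linear_fun_def rs_def by (rule restrict_ext) (simp add: ev_lin kap(3) \<kappa>_props(1)[of x])

lemma van_rs: "rs \<gg> p \<in> rs \<gg> ` {p. van p} \<longleftrightarrow> van p"
proof
 assume "rs \<gg> p \<in> rs \<gg> ` {p. van p}"
 then obtain q where q: "rs \<gg> p = rs \<gg> q" "van q" by blast
 then show "van p" using Pi_g unfolding rs_eq_iff van_def by auto
qed blast

lemma shift_generators: "{restrict (%\<xi>. linear_fun \<gg> \<kappa> x \<xi> - \<kappa> e x) \<gg> | x. x \<in> m} = (%x. rs \<gg> (lin x - Cst (kap e x))) ` m"
proof -
 have "restrict (%\<xi>. linear_fun \<gg> \<kappa> x \<xi> - \<kappa> e x) \<gg> = rs \<gg> (lin x - Cst (kap e x))" if "x \<in> m" for x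
 proof -
  have xg: "x \<in> \<gg>" using that m_sub by blast
  show ?thesis unfolding rs_def[of _ "_ - _"]
  by (rule restrict_ext) (simp add: linear_fun_lin[OF xg] kap(3)[OF efh(1) xg])
 qed
 then show ?thesis unfolding Setcompr_eq_image by (rule image_cong[OF refl])
qed

text \<open>The generators are the affine equations of \<open>e + mperp\<close>. The projection
  \<open>pr\<close> onto this space moves each coordinate by a combination of the equations, so
  \<open>q - pcomp q pr\<close> is in the ideal for every \<open>q\<close>, and
  \<open>pcomp q pr\<close> is zero on the Lie algebra if \<open>q\<close> vanishes on the affine
  space.\<close>

lemma shift_ideal_eq: "shift_ideal \<gg> \<kappa> e m = rs \<gg> ` {p. van p}"
proof
 have "ideal (rs \<gg> ` {p. van p}) lpa"
 proof (rule idealI)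
  show "ring lpa" by (rule cring.axioms(1)[OF lpa_simps(6)])
  show "subgroup (rs \<gg> ` {p. van p}) (add_monoid lpa)"
  proof (rule subgroup.intro)
  show "rs \<gg> ` {p. van p} \<subseteq> carrier (add_monoid lpa)" by (auto simp: lpa_simps)
  show "x \<otimes>\<^bsub>add_monoid lpa\<^esub> y \<in> rs \<gg> ` {p. van p}" if "x \<in> rs \<gg> ` {p. van p}" "y \<in> rs \<gg> ` {p. van p}" for x y
  proof -
  obtain p q where "x = rs \<gg> p" "y = rs \<gg> q" "van p" "van q" using \<open>x \<in> _\<close> \<open>y \<in> _\<close> by blast
  then show ?thesis by (simp add: lpa_simps van_rs) (simp add: van_def)
  qed
  show "\<one>\<^bsub>add_monoid lpa\<^esub> \<in> rs \<gg> ` {p. van p}" by (simp add: lpa_simps van_rs) (simp add: van_def)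
  show "inv\<^bsub>add_monoid lpa\<^esub> x \<in> rs \<gg> ` {p. van p}" if x: "x \<in> rs \<gg> ` {p. van p}" for x
  proof -
  obtain p where p: "x = rs \<gg> p" "van p" using x by blast
  have "inv\<^bsub>add_monoid lpa\<^esub> x = rs \<gg> (- p)" using lpa_simps(5)[of p] by (simp add: a_inv_def p)
  then show ?thesis using p by (simp add: van_rs) (simp add: van_def)
  qed
  qed
 next
  fix a x assume "a \<in> rs \<gg> ` {p. van p}" "x \<in> carrier lpa"
  then obtain p q where "a = rs \<gg> p" "van p" "x = rs \<gg> q" by (auto simp: lpa_simps)
  then show "x \<otimes>\<^bsub>lpa\<^esub> a \<in> rs \<gg> ` {p. van p}" "a \<otimes>\<^bsub>lpa\<^esub> x \<in> rs \<gg> ` {p. van p}"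
  by (simp_all add: lpa_simps van_rs) (simp_all add: van_def)
 qed
 moreover have "(%x. rs \<gg> (lin x - Cst (kap e x))) ` m \<subseteq> rs \<gg> ` {p. van p}"
 proof
  fix F assume "F \<in> (%x. rs \<gg> (lin x - Cst (kap e x))) ` m"
  then obtain x where x: "x \<in> m" "F = rs \<gg> (lin x - Cst (kap e x))" by blast
  have "van (lin x - Cst (kap e x))" using x(1) by (simp add: van_def ev_lin kap_lin mperp_def)
  then show "F \<in> rs \<gg> ` {p. van p}" unfolding x(2) by blast
 qed
 ultimately show "shift_ideal \<gg> \<kappa> e m \<subseteq> rs \<gg> ` {p. van p}"
  unfolding shift_ideal_def shift_generators genideal_def by (intro Inter_lower CollectI conjI)
next
 obtain B :: "'n cmat set" and l where B: "finite B" "B \<subseteq> m" "cmat.independent B" "cmat.span B = m"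
  "!!b. b \<in> B ==> cfunctional (l b)" "!!b c. b \<in> B ==> c \<in> B ==> l b c = (if b = c then 1 else 0)"
  "!!v. v \<in> m ==> v = (\<Sum>b\<in>B. l b v *\<^sub>C b)"
  by (rule dual_basis[of m m]) (use m_subspace cmat.span_eq_iff in blast)+
 have "ALL b:B. EX u:\<gg>. ALL y:\<gg>. kap u y = l b y" using riesz B(5) by blast
 then obtain u where u: "!!b. b \<in> B ==> u b \<in> \<gg>" "!!b y. b \<in> B ==> y \<in> \<gg> ==> kap (u b) y = l b y" by metis
 \<comment> \<open>The \<open>u b\<close> are dual to the basis of \<open>m\<close>; the subtraction
   makes the pairings with \<open>m\<close> equal to those of \<open>e\<close>.\<close>
 define pr where "pr \<xi> = \<xi> - (\<Sum>b\<in>B. kap (\<xi> - e) b *\<^sub>C u b)" for \<xi>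
 have pmap_pr: "pmap pr"
 proof -
  have "pmap (%\<xi>. \<xi> - (\<Sum>b\<in>B. kap (\<xi> - e) b *\<^sub>C u b))"
  by (intro pmap_diff pmap_id pmap_sum pmap_scale pfun_kap pmap_const)
  then show ?thesis by (simp add: pr_def[abs_def])
 qed
 have pr: "EX v:mperp. pr \<xi> = e + v" if \<xi>: "\<xi> \<in> \<gg>" for \<xi>
 proof -
  have "pr \<xi> - e \<in> mperp"
  unfolding mperp_def
  proof (intro CollectI conjI ballI)
  have "(\<Sum>b\<in>B. kap (\<xi> - e) b *\<^sub>C u b) \<in> \<gg>"
  by (intro cmat.subspace_sum[OF Lie_subspace] cmat.subspace_scale[OF Lie_subspace] u)
  then show "pr \<xi> - e \<in> \<gg>" unfolding pr_def
  by (intro cmat.subspace_diff[OF Lie_subspace] \<xi> efh(1))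
  fix x assume x: "x \<in> m"
  have c: "kap (pr \<xi> - e) c = 0" if c: "c \<in> B" for c
  proof -
  have cg: "c \<in> \<gg>" using c B(2) m_sub by blast
  have "kap (pr \<xi> - e) c = kap (\<xi> - e) c - (\<Sum>b\<in>B. kap (\<xi> - e) b * kap (u b) c)"
  by (simp add: pr_def kap_diff kap_sum kap_lin)
  also have "(\<Sum>b\<in>B. kap (\<xi> - e) b * kap (u b) c) = (\<Sum>b\<in>B. if b = c then kap (\<xi> - e) c else 0)"
  by (intro sum.cong refl) (simp add: u(2) cg B(6) c)
  also have "\<dots> = kap (\<xi> - e) c" using B(1) c by simp
  finally show ?thesis by simp
  qed
  have "kap (pr \<xi> - e) (\<Sum>b\<in>B. l b x *\<^sub>C b) = 0" by (simp add: kap_sum kap_lin c)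
  then show "kap (pr \<xi> - e) x = 0" using B(7)[OF x] by simp
  qed
  then show ?thesis by (intro bexI[of _ "pr \<xi> - e"]) auto
 qed
 have "rs \<gg> p \<in> I" if I: "ideal I lpa" and gI: "(%x. rs \<gg> (lin x - Cst (kap e x))) ` m \<subseteq> I" and p: "van p" for I p
 proof -
  have Iadd: "rs \<gg> (a + b) \<in> I" if "rs \<gg> a \<in> I" "rs \<gg> b \<in> I" for a b
  using additive_subgroup.a_closed[OF ideal.axioms(1)[OF I] that] by (simp add: lpa_simps)
  have Imult: "rs \<gg> (a * b) \<in> I" if "rs \<gg> b \<in> I" for a b
  using ideal.I_l_closed[OF I that, of "rs \<gg> a"] by (simp add: lpa_simps)
  have I0: "rs \<gg> 0 \<in> I"
  using additive_subgroup.zero_closed[OF ideal.axioms(1)[OF I]] by (simp add: lpa_simps)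
  have Isum: "rs \<gg> (sum F A) \<in> I" if "!!b. b \<in> A ==> rs \<gg> (F b) \<in> I" for F and A :: "'n cmat set"
  using that by (induction A rule: infinite_finite_induct) (auto intro: I0 Iadd)
  have "rs \<gg> (q - pcomp q pr) \<in> I" for q
  proof (induction q rule: pol_induct)
  case (Cst c)
  have "Cst c - pcomp (Cst c) pr = 0" by (rule pol_eqI) (simp add: ev_pcomp[OF pmap_pr])
  then show ?case using I0 by simp
  next
  case (Var i j)
  have "Var i j - pcomp (Var i j) pr = (\<Sum>b\<in>B. Cst (u b $ i $ j) * (lin b - Cst (kap e b)))"
  by (rule pol_eqI) (simp add: ev_pcomp[OF pmap_pr] pr_def sum_nth2 ev_lin kap_diff mult.commute)
  moreover have "rs \<gg> (lin b - Cst (kap e b)) \<in> I" if "b \<in> B" for b using gI that B(2) by blast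
  ultimately show ?case by (simp add: Isum Imult)
  next
  case (add p q)
  have E: "p + q - pcomp (p + q) pr = (p - pcomp p pr) + (q - pcomp q pr)"
  by (rule pol_eqI) (simp add: ev_pcomp[OF pmap_pr])
  show ?case unfolding E by (rule Iadd[OF add])
  next
  case (mult p q)
  have "p * q - pcomp (p * q) pr = p * (q - pcomp q pr) + pcomp q pr * (p - pcomp p pr)"
  by (rule pol_eqI) (simp add: ev_pcomp[OF pmap_pr] algebra_simps)
  then show ?case using Iadd[OF Imult[OF mult(2)] Imult[OF mult(1)]] by simp
  qed
  moreover have "rs \<gg> (p - pcomp p pr) = rs \<gg> p"
  unfolding rs_eq_iff
  proof
  fix \<xi> assume "\<xi> \<in> \<gg>"
  then obtain v where "v \<in> mperp" "pr \<xi> = e + v" using pr by blast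
  then show "ev (p - pcomp p pr) \<xi> = ev p \<xi>" using p by (simp add: ev_pcomp[OF pmap_pr] van_def)
  qed
  ultimately show ?thesis by metis
 qed
 then show "rs \<gg> ` {p. van p} \<subseteq> shift_ideal \<gg> \<kappa> e m"
  unfolding shift_ideal_def shift_generators genideal_def by (intro Inter_greatest image_subsetI) simp
qed

lemma invariant_lifts_eq: "invariant_lifts \<gg> \<kappa> e m = rs \<gg> ` {p. Linv p}"
proof -
 have "(ALL x:m. pbracket lpa (linear_fun \<gg> \<kappa> x) (rs \<gg> p) \<in> shift_ideal \<gg> \<kappa> e m) \<longleftrightarrow> Linv p" for p
  unfolding Linv_iff shift_ideal_eq using m_sub by (auto simp: linear_fun_lin lpa_bracket van_rs subset_iff)
 then show ?thesis unfolding invariant_lifts_def lpa_simps by auto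
qed

definition Sl where "Sl = slodowy_slice \<gg> e f"

lemma Sl: "Sl = (%c. e + c) ` gf" by (simp add: Sl_def slodowy_slice_def gf_def)

lemma Sl_E: assumes "y \<in> Sl" obtains c where "c \<in> gf" "y = e + c" using assms by (auto simp: Sl)

lemma Sl_I: "c \<in> gf ==> e + c \<in> Sl" by (auto simp: Sl)

lemma Sl_g: "Sl \<subseteq> \<gg>" using Pi_g gf_mperp by (auto simp: Sl)

definition sbr where "sbr \<phi> \<psi> = (THE \<theta>. EX F:invariant_lifts \<gg> \<kappa> e m. EX H:invariant_lifts \<gg> \<kappa> e m.
 restrict F Sl = \<phi> & restrict H Sl = \<psi> & \<theta> = restrict (pbracket lpa F H) Sl)"

lemma slice_algebra_eq: "slice_algebra \<gg> \<kappa> e h f \<ll> = coord_algebra Sl sbr"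
 by (simp add: slice_algebra_def sbr_def[abs_def] Sl_def m_def Let_def)

lemma restrict_rs: "restrict (rs \<gg> p) Sl = rs Sl p"
 unfolding rs_def[of Sl] by (rule restrict_ext) (use Sl_g in auto)

lemma sbr: "sbr (rs Sl p) (rs Sl q) = rs Sl (vf (hv q) p)"
 unfolding sbr_def
proof (rule the_equality)
 have l: "rs Sl (lift p) = rs Sl p" for p unfolding rs_eq_iff using lift(2) by (auto simp: Sl)
 have "rs Sl (PB (lift p) (lift q)) = rs Sl (vf (hv q) p)"
  unfolding rs_eq_iff using PB_lift_hv by (auto simp: Sl ev_vf[OF pmap_hv])
 then show "EX F:invariant_lifts \<gg> \<kappa> e m. EX H:invariant_lifts \<gg> \<kappa> e m. restrict F Sl = rs Sl p &
  restrict H Sl = rs Sl q & rs Sl (vf (hv q) p) = restrict (pbracket lpa F H) Sl"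
  unfolding invariant_lifts_eq using lift(1) l
  by (intro bexI[of _ "rs \<gg> (lift p)"] bexI[of _ "rs \<gg> (lift q)"]) (auto simp: restrict_rs lpa_bracket)
next
 fix \<theta> assume "EX F:invariant_lifts \<gg> \<kappa> e m. EX H:invariant_lifts \<gg> \<kappa> e m. restrict F Sl = rs Sl p &
  restrict H Sl = rs Sl q & \<theta> = restrict (pbracket lpa F H) Sl"
 then obtain P Q where PQ: "Linv P" "Linv Q" "rs Sl P = rs Sl p" "rs Sl Q = rs Sl q" "\<theta> = rs Sl (PB P Q)"
  unfolding invariant_lifts_eq by (auto simp: restrict_rs lpa_bracket)
 have "ev (PB P Q) y = ev (vf (hv q) p) y" if y: "y \<in> Sl" for y
 proof -
  obtain c where c: "c \<in> gf" "y = e + c" using y by (rule Sl_E)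
  have P: "ev P (e + c) = ev (lift p) (e + c)" "ev Q (e + c) = ev (lift q) (e + c)" if "c \<in> gf" for c
  using PQ(3,4) lift(2)[OF that] Sl_I[OF that] unfolding rs_eq_iff by auto
  have "ev (PB P Q) (e + c) = ev (PB (lift p) (lift q)) (e + c)"
  by (rule PB_slice2[OF PQ(1) lift(1) P(1) PQ(2) lift(1) P(2) c(1)])
  then show ?thesis using PB_lift_hv[OF c(1)] by (simp add: c(2) ev_vf[OF pmap_hv])
 qed
 then show "\<theta> = rs Sl (vf (hv q) p)" unfolding PQ(5) rs_eq_iff by blast
qed

lemma gf_polynomial: assumes "v \<notin> gf"
 shows "EX p. (ALL y:Sl. ev p y = 0) & ev p (e + v) = 1 & (ALL y. dirD p y v = 1)"
proof -
 obtain L where L: "cfunctional L" "!!u. u \<in> gf ==> L u = 0" "L v = 1" using separate_subspace[OF gf_subspace assms] by blast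
 define p where "p = pol_of (%\<xi>. L (\<xi> - e))"
 have evp: "ev p = (%\<xi>. L (\<xi> - e))"
  unfolding p_def by (intro ev_pol_of pfun_functional[OF L(1)] pmap_diff pmap_id pmap_const)
 show ?thesis
  by (intro exI[of _ p]) (auto simp: evp Sl L dirD_functional[OF L(1) evp])
qed

lemma ev_vf_hv: assumes "y \<in> Sl" shows "ev (vf (hv q) p) y = ev (PB (lift p) (lift q)) y"
 using assms PB_lift_hv by (auto simp: Sl ev_vf[OF pmap_hv])

lemma ev_lift: "y \<in> Sl ==> ev (lift p) y = ev p y" using lift(2) by (auto simp: Sl)

lemma PB_cong: assumes "Linv p" "Linv p'" "!!y. y \<in> Sl ==> ev p y = ev p' y" "Linv q" "Linv q'"
  "!!y. y \<in> Sl ==> ev q y = ev q' y" "y \<in> Sl"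
 shows "ev (PB p q) y = ev (PB p' q') y"
proof -
 obtain c where c: "c \<in> gf" "y = e + c" using assms(7) by (rule Sl_E)
 show ?thesis unfolding c(2) by (rule PB_slice2) (use assms Sl_I c(1) in auto)
qed

sublocale poisson_variety Sl hv sbr
proof (rule poisson_variety.intro)
 show "pmap (hv q)" for q by (rule pmap_hv)
 show "dirD p y (hv q y) = 0" if p: "!!z. z \<in> Sl ==> ev p z = 0" and y: "y \<in> Sl" for p y q
 proof -
  obtain c where c: "c \<in> gf" "y = e + c" using y by (rule Sl_E)
  show ?thesis unfolding c(2) by (rule gf_tangent[OF p[OF Sl_I] c(1) hv_gf[OF c(1)]])
 qed
 show "dirD p y (hv q y) = - dirD q y (hv p y)" if y: "y \<in> Sl" for p q y
  using ev_vf_hv[OF y, of q p] ev_vf_hv[OF y, of p q] PB_skew[of "lift p" "lift q"] by (simp add: ev_vf[OF pmap_hv])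
 \<comment> \<open>Brackets of lifts are again invariant, so they may replace the lifts of brackets;
   what remains is the Jacobi identity for \<open>PB\<close>.\<close>
 show "ev (vf (hv (vf (hv r) q)) p) y = ev (vf (hv r) (vf (hv q) p)) y - ev (vf (hv q) (vf (hv r) p)) y"
  if y: "y \<in> Sl" for p q r y
 proof -
  have l: "ev (lift (vf (hv b) a)) z = ev (PB (lift a) (lift b)) z" if "z \<in> Sl" for a b z
  using ev_lift[OF that] ev_vf_hv[OF that] by simp
  have 1: "ev (vf (hv (vf (hv r) q)) p) y = ev (PB (lift p) (PB (lift q) (lift r))) y"
  unfolding ev_vf_hv[OF y] by (rule PB_cong[OF lift(1) lift(1) refl lift(1) Linv_PB[OF lift(1) lift(1)] l y])
  have 2: "ev (vf (hv a) (vf (hv b) p)) y = ev (PB (PB (lift p) (lift b)) (lift a)) y" for a b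
  unfolding ev_vf_hv[OF y] by (rule PB_cong[OF lift(1) Linv_PB[OF lift(1) lift(1)] l lift(1) lift(1) refl y])
  have "PB (lift p) (PB (lift q) (lift r)) = PB (PB (lift p) (lift q)) (lift r) + PB (lift q) (PB (lift p) (lift r))"
  by (rule PB_jacobi')
  moreover have "PB (lift q) (PB (lift p) (lift r)) = - PB (PB (lift p) (lift r)) (lift q)" by (rule PB_skew)
  ultimately show ?thesis unfolding 1 2 by simp
 qed
 show "sbr (rs Sl p) (rs Sl q) = rs Sl (vf (hv q) p)" for p q by (rule sbr)
 show "EX p. (ALL y:Sl. ev p y = 0) & ev p z ~= 0" if z: "z \<notin> Sl" for z
 proof -
  have "z - e \<notin> gf" using z Sl_I[of "z - e"] by auto
  from gf_polynomial[OF this] obtain p where "ALL y:Sl. ev p y = 0" "ev p (e + (z - e)) = 1" by blast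
  then show ?thesis by (intro exI[of _ p]) simp
 qed
qed

section \<open>Leaves of orbit slices\<close>

text \<open>The sum of the ideal of the orbit and the ideal of the slice; near each point of the
  orbit slice it agrees with a prime germ.\<close>

definition IX where "IX x = {p. EX q:IO x. ALL y:Sl. ev p y = ev q y}"

lemma IX_IO: "IO x \<subseteq> IX x" by (auto simp: IX_def)

lemma IX_van: assumes "!!y. y \<in> Sl ==> ev p y = 0" shows "p \<in> IX x"
 unfolding IX_def using assms by (intro CollectI bexI[of _ 0] ideal_in_0[OF IO_ideal]) simp

text \<open>Along the slice the field is \<open>lie_bracket (U y) y\<close> with \<open>U\<close>
  polynomial, so it is a combination with polynomial coefficients of fields
  \<open>lie_bracket b\<close> for fixed \<open>b\<close>, which preserve the orbit ideal.\<close>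

lemma IX_stable: assumes "p \<in> IX x" shows "vf (hv r) p \<in> IX x"
proof -
 obtain q where q: "q \<in> IO x" "ALL y:Sl. ev p y = ev q y" using assms by (auto simp: IX_def)
 define U where "U \<xi> = grad (lift r) \<xi> - nx \<xi> (lie_bracket (grad (lift r) \<xi>) \<xi>)" for \<xi>
 have U: "pmap U" using pmap_hv_gen[of r] by (simp add: U_def[abs_def])
 define k where "k b = pol_of (%\<xi>. kap (gU b) (U \<xi>))" for b
 have k: "ev (k b) \<xi> = kap (gU b) (U \<xi>)" for b \<xi>
  unfolding k_def by (subst ev_pol_of) (auto intro!: pfun_kap U)
 define q' where "q' = (\<Sum>b\<in>gB. k b * vf (lie_bracket b) q)"
 have pb: "pmap (lie_bracket b)" for b :: "'n cmat"
 proof -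
  have "pmap (%\<xi>. lie_bracket b \<xi>)" by (intro pmap_bracket pmap_id pmap_const)
  then show ?thesis .
 qed
 have "vf (lie_bracket b) q \<in> IO x" if "b \<in> gB" for b
 proof -
  have "b \<in> \<gg>" using that gB(1) by blast
  then show ?thesis using IO_derivative[OF q(1)] by (simp add: IO_def ev_vf[OF pb])
 qed
 then have "q' \<in> IO x" unfolding q'_def by (intro ideal_in_sum[OF IO_ideal] ideal_in_mult[OF IO_ideal UNIV_I])
 moreover have "ev (vf (hv r) p) y = ev q' y" if y: "y \<in> Sl" for y
 proof -
  obtain c where c: "c \<in> gf" "y = e + c" using y by (rule Sl_E)
  have Ug: "U y \<in> \<gg>" using hv_generator[OF c(1), of r] by (simp add: U_def c(2))
  have "ev (vf (hv r) p) y = dirD q y (hv r y)"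
  unfolding ev_vf[OF pmap_hv] c(2) by (rule gf_tangent_eq[OF _ c(1) hv_gf[OF c(1)]]) (use q(2) Sl_I in blast)
  also have "hv r y = lie_bracket (U y) y" by (simp add: hv_def U_def)
  also have "\<dots> = lie_bracket (\<Sum>b\<in>gB. kap (gU b) (U y) *\<^sub>C b) y" by (simp only: gB(3)[OF Ug])
  also have "dirD q y \<dots> = ev q' y"
  by (simp add: br_sum_left br_scale_left dirD_sum_right dirD_scale q'_def k ev_vf[OF pb])
  finally show ?thesis .
 qed
 ultimately show ?thesis unfolding IX_def by blast
qed

text \<open>A vector tangent to both the slice and the orbit lies in \<open>gf\<close> and has the
  form \<open>lie_bracket X y\<close>; \<open>hv_surj\<close> makes it a Hamiltonian vector.\<close>

lemma leaf_setup_orbit: "leaf_setup (range hv) (IX x) (adjoint_orbit G x \<inter> Sl)"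
proof (rule leaf_setup.intro)
 fix y assume y: "y \<in> adjoint_orbit G x \<inter> Sl"
 then obtain c where c: "c \<in> gf" "y = e + c" by (auto elim: Sl_E)
 show "germ_setup (range hv) (IX x) y"
 proof (rule germ_setup.intro)
  show "pmap w" if "w \<in> range hv" for w using that pmap_hv by blast
  show "ideal_in UNIV (IX x)"
  unfolding ideal_in_def
  proof (intro conjI ballI)
  show "IX x \<subseteq> UNIV" by simp
  show "0 \<in> IX x" by (rule IX_van) simp
  fix p q assume "p \<in> IX x" "q \<in> IX x"
  then obtain p' q' where "p' \<in> IO x" "ALL y:Sl. ev p y = ev p' y" "q' \<in> IO x" "ALL y:Sl. ev q y = ev q' y"
  by (auto simp: IX_def)
  then show "p + q \<in> IX x" unfolding IX_def
  by (intro CollectI bexI[of _ "p' + q'"] ideal_in_add[OF IO_ideal]) auto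
  next
  fix r p assume "p \<in> IX x"
  then obtain p' where "p' \<in> IO x" "ALL y:Sl. ev p y = ev p' y" by (auto simp: IX_def)
  then show "r * p \<in> IX x" unfolding IX_def
  by (intro CollectI bexI[of _ "r * p'"] ideal_in_mult[OF IO_ideal]) auto
  qed
  show "vf w p \<in> IX x" if "w \<in> range hv" "p \<in> IX x" for w p using that IX_stable by blast
  show "ev p y = 0" if "p \<in> IX x" for p using that y by (auto simp: IX_def IO_def)
  fix v assume v: "!!p. p \<in> IX x ==> dirD p y v = 0"
  have "v \<in> gf"
  proof (rule ccontr)
  assume "v \<notin> gf"
  then obtain p where p: "ALL y:Sl. ev p y = 0" "ALL y. dirD p y v = 1" using gf_polynomial by blast
  have "p \<in> IX x" by (rule IX_van) (use p(1) in blast)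
  then show False using v p(2) by force
  qed
  obtain X where X: "X \<in> \<gg>" "v = lie_bracket X y" using orbit_tangent[of y x v] y v IX_IO by blast
  have "EX q. hv q (e + c) = lie_bracket X (e + c)"
  by (rule hv_surj[OF c(1) X(1)]) (use X(2) c(2) \<open>v \<in> gf\<close> in simp)
  then obtain q where "hv q y = v" using X(2) c(2) by auto
  then show "v \<in> cmat.span ((%w. w y) ` range hv)" by (intro cmat.span_base) auto
 qed
qed

definition lf where "lf y = leaf_setup.leaf (range hv) (adjoint_orbit G y \<inter> Sl) y"

text \<open>Zeros of J y may lie outside the orbit, so a point where \<open>p\<close> is nonzero has
  to be found inside it. The countably many inequations of \<open>orbit_open\<close> ensure this;
  they hold at \<open>y\<close>, so their polynomials are outside J y.\<close>

lemma germ_vanishing: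
 assumes y: "y \<in> adjoint_orbit G x \<inter> Sl"
 shows "{p. ALL z:leaf_setup.leaf (range hv) (adjoint_orbit G x \<inter> Sl) y. ev p z = 0} = J y"
proof -
 interpret leaf_setup "range hv" "IX x" "adjoint_orbit G x \<inter> Sl" by (rule leaf_setup_orbit)
 interpret gy: germ_setup "range hv" "IX x" y by (rule pointwise[OF y])
 have "EX z:leaf y. ev p z ~= 0" if p: "p \<notin> J y" for p
 proof -
  obtain a :: "nat => 'n pol" where a: "ALL n. ev (a n) y ~= 0"
  "ALL z. (ALL p:IO x. ev p z = 0) --> (ALL n. ev (a n) z ~= 0) --> z \<in> adjoint_orbit G x"
  using orbit_open[of y x] y by (elim IntE) (blast elim: exE conjE)
  define b where "b n = (case n of 0 => p | Suc k => a k)" for n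
  have "b n \<notin> J y" for n using p a(1) J_sub[of _ y] by (auto simp: b_def split: nat.splits)
  then obtain z where z: "ALL p:J y. ev p z = 0" "ALL n. ev (b n) z ~= 0"
  using countable_nullstellensatz[OF prime_J, of b y] by blast
  have "ALL p:IO x. ev p z = 0" using z(1) gy.I_germ IX_IO unfolding J_def by blast
  moreover have "ev (a n) z ~= 0" for n using z(2)[rule_format, of "Suc n"] by (simp add: b_def)
  ultimately have zO: "z \<in> adjoint_orbit G x" using a(2) by blast
  have zS: "z \<in> Sl"
  proof (rule ccontr)
  assume "z \<notin> Sl"
  then obtain q where q: "ALL y:Sl. ev q y = 0" "ev q z ~= 0" using closed by blast
  have "q \<in> J y" by (rule J_van) (use y q(1) in auto)
  then show False using z(1) q(2) by blast
  qed
  have "z \<in> leaf y" unfolding leaf_alt[OF y] using z(1) zO zS by (auto simp: J_def)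
  moreover have "ev p z ~= 0" using z(2)[rule_format, of 0] by (simp add: b_def)
  ultimately show ?thesis by blast
 qed
 moreover have "ev p z = 0" if "p \<in> J y" "z \<in> leaf y" for p z
  using that unfolding leaf_alt[OF y] J_def by blast
 ultimately show ?thesis by blast
qed

lemma components:
 "connected_components_of (subtopology zariski (adjoint_orbit G x \<inter> Sl)) = lf ` (adjoint_orbit G x \<inter> Sl)"
proof -
 interpret leaf_setup "range hv" "IX x" "adjoint_orbit G x \<inter> Sl" by (rule leaf_setup_orbit)
 let ?X = "adjoint_orbit G x \<inter> Sl"
 have "connected_component_of_set (subtopology zariski ?X) y = lf y" if y: "y \<in> ?X" for y
 proof -
  have "adjoint_orbit G y = adjoint_orbit G x" using orbit_eq y by blast
  then have lf: "lf y = leaf y" by (simp add: lf_def)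
  have "connectedin zariski (leaf y)"
  by (rule connectedin_prime) (simp only: germ_vanishing[OF y] prime_J)
  moreover have lX: "leaf y \<subseteq> ?X" by (auto simp: leaf_def)
  ultimately have c: "connectedin (subtopology zariski ?X) (leaf y)" by (simp add: connectedin_subtopology)
  have 1: "leaf y \<subseteq> connected_component_of_set (subtopology zariski ?X) y"
  by (rule connected_component_of_maximal[OF c leaf_self[OF y]])
  have "connected_component_of_set (subtopology zariski ?X) y \<subseteq> leaf y | disjnt (connected_component_of_set (subtopology zariski ?X) y) (leaf y)"
  by (rule connectedin_clopen_cases[OF connectedin_connected_component_of leaf_clopen(2)[OF y] leaf_clopen(1)[OF y]])
  moreover have "~ disjnt (connected_component_of_set (subtopology zariski ?X) y) (leaf y)"
  using 1 leaf_self[OF y] by (auto simp: disjnt_def)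
  ultimately show ?thesis using 1 lf by blast
 qed
 then show ?thesis by (auto simp: connected_components_of_def)
qed

lemma all_components:
 "(\<Union>x\<in>Sl. connected_components_of (subtopology zariski (adjoint_orbit G x \<inter> Sl))) = lf ` Sl"
 unfolding components using orbit_self by blast

lemma vanishing_lf: assumes "y \<in> Sl" shows "vanishing_ideal Z (lf y) = rs Sl ` J y"
proof -
 interpret leaf_setup "range hv" "IX y" "adjoint_orbit G y \<inter> Sl" by (rule leaf_setup_orbit)
 have "y \<in> adjoint_orbit G y \<inter> Sl" using assms orbit_self by blast
 note g = germ_vanishing[OF this]
 have sub: "lf y \<subseteq> Sl" by (auto simp: lf_def leaf_def)
 have "(ALL z:lf y. rs Sl p z = 0) \<longleftrightarrow> p \<in> J y" for p
 proof -
  have "rs Sl p z = ev p z" if "z \<in> lf y" for z using sub that by (intro rs_apply) blast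
  then have "(ALL z:lf y. rs Sl p z = 0) \<longleftrightarrow> (ALL z:lf y. ev p z = 0)" by simp
  also have "\<dots> \<longleftrightarrow> p \<in> J y" unfolding g[symmetric] lf_def[symmetric] by simp
  finally show ?thesis .
 qed
 then show ?thesis by (auto simp: vanishing_ideal_def coord_simps(1))
qed

lemma rs_J: "y \<in> Sl ==> rs Sl p \<in> rs Sl ` J y \<longleftrightarrow> p \<in> J y"
proof
 assume y: "y \<in> Sl" and "rs Sl p \<in> rs Sl ` J y"
 then obtain q where q: "q \<in> J y" "rs Sl p = rs Sl q" by blast
 have "p - q \<in> J y" by (rule J_van[OF y]) (use q(2) rs_eq_iff in auto)
 then show "p \<in> J y" using ideal_in_add[OF J_ideal _ q(1), of "p - q"] by simp
qed blast

text \<open>The common germ contains both orbit ideals, so each point is a zero of the orbit ideal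
  of the other, and \<open>orbit_ideal_eq\<close> identifies the orbits.\<close>

lemma lf_inj: assumes y: "y \<in> Sl" "y' \<in> Sl" and e: "rs Sl ` J y = rs Sl ` J y'" shows "lf y = lf y'"
proof -
 have JJ: "J y = J y'" using rs_J[OF y(1)] rs_J[OF y(2)] e by blast
 have sub: "IO z \<subseteq> J z" if "z \<in> Sl" for z
 proof -
  have "z \<in> adjoint_orbit G z \<inter> Sl" using that orbit_self by blast
  then have "germ_setup (range hv) (IX z) z" by (rule leaf_setup.pointwise[OF leaf_setup_orbit])
  from germ_setup.I_germ[OF this] show ?thesis using IX_IO unfolding J_def by blast
 qed
 have O: "adjoint_orbit G y = adjoint_orbit G y'"
  by (rule orbit_ideal_eq) (use sub[OF y(1)] sub[OF y(2)] JJ J_sub in blast)+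
 interpret leaf_setup "range hv" "IX y" "adjoint_orbit G y \<inter> Sl" by (rule leaf_setup_orbit)
 show ?thesis using JJ by (simp add: lf_def flip: O) (simp add: leaf_def J_def)
qed

end

theorem mainTheorem5:
  fixes G :: "'n::finite cmat set"
    and e h f :: "'n cmat"
    and \<kappa> :: "'n cmat \<Rightarrow> 'n cmat \<Rightarrow> complex"
    and \<ll> :: "'n cmat set"
  assumes "reductive_group G"
    and "connectedin zariski G"
    and "nilpotent_mat e"
    and "sl2_triple (Lie G) e h f"
    and "nondeg_invariant_form G \<kappa>"
    and "lagrangian (Lie G) \<kappa> e h \<ll>"
    and "\<exists>\<iota> :: complex \<Rightarrow> 'm. inj \<iota>"
  shows "bij_betw
    (vanishing_ideal (slice_algebra (Lie G) \<kappa> e h f \<ll>))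
    (\<Union>x\<in>slodowy_slice (Lie G) e f.
       connected_components_of
         (subtopology zariski (adjoint_orbit G x \<inter> slodowy_slice (Lie G) e f)))
    (simple_poisson_annihilators TYPE('m) (slice_algebra (Lie G) \<kappa> e h f \<ll>))"
proof -
 have "slice_data G e h f \<kappa> \<ll>"
  using assms by (intro slice_data.intro connected_group.intro slice_data_axioms.intro) (auto simp: reductive_group_def)
 then interpret slice_data G e h f \<kappa> \<ll> .
 obtain \<iota> :: "complex => 'm" where \<iota>: "inj \<iota>" using assms(7) by blast
 have "inj_on (vanishing_ideal Z) (lf ` Sl)"
 proof (rule inj_onI)
  fix A B assume "A \<in> lf ` Sl" "B \<in> lf ` Sl" and eq: "vanishing_ideal Z A = vanishing_ideal Z B"
  then obtain y y' where y: "y \<in> Sl" "y' \<in> Sl" "A = lf y" "B = lf y'" by blast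
  have "rs Sl ` J y = rs Sl ` J y'" using eq unfolding y(3,4) vanishing_lf[OF y(1)] vanishing_lf[OF y(2)] .
  then show "A = B" unfolding y(3,4) by (rule lf_inj[OF y(1,2)])
 qed
 moreover have "vanishing_ideal Z ` lf ` Sl = simple_poisson_annihilators TYPE('m) Z"
 proof
  show "vanishing_ideal Z ` lf ` Sl \<subseteq> simple_poisson_annihilators TYPE('m) Z"
  proof
  fix A assume "A \<in> vanishing_ideal Z ` lf ` Sl"
  then obtain y where y: "y \<in> Sl" "A = vanishing_ideal Z (lf y)" by blast
  obtain M :: "('n cmat => complex, 'm) module" and nabla where
  M: "simple_poisson_module Z M nabla" "annihilator Z M = rs Sl ` J y" using point_module[OF y(1) \<iota>] by blast
  have "A = annihilator Z M" using y(2) vanishing_lf[OF y(1)] M(2) by simp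
  then show "A \<in> simple_poisson_annihilators TYPE('m) Z" using M(1) unfolding simple_poisson_annihilators_def by blast
  qed
  show "simple_poisson_annihilators TYPE('m) Z \<subseteq> vanishing_ideal Z ` lf ` Sl"
  proof
  fix A assume "A \<in> simple_poisson_annihilators TYPE('m) Z"
  then obtain M :: "('n cmat => complex, 'm) module" and nabla where
  M: "A = annihilator Z M" "simple_poisson_module Z M nabla" unfolding simple_poisson_annihilators_def by blast
  interpret simple_over Sl hv sbr M nabla
  by (rule simple_over.intro[OF poisson_variety_axioms M(2)])
  obtain y where "y \<in> Sl" "annihilator Z M = rs Sl ` J y" using annihilator_germ by blast
  then show "A \<in> vanishing_ideal Z ` lf ` Sl" using M(1) vanishing_lf by blast
  qed
 qed
 ultimately have "bij_betw (vanishing_ideal Z) (lf ` Sl) (simple_poisson_annihilators TYPE('m) Z)"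
  by (simp add: bij_betw_def)
 then show ?thesis unfolding slice_algebra_eq Sl_def[symmetric] all_components .
qed

end
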